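(* For every integer $r\ge 4$ there exist constants $N_0$ and $c=c(r)>0$ such that for all integers $n\ge N_0$ and all integers $t\in[0,cn]$ we have \[ \mathrm{EX}\left(n,(t+1)H^{M_2^r}_{2r}\right)=\{K_t^r\bowtie S_r(n-t)\}. \]
   Context: $M_2^r$ is the $r$-graph consisting of two vertex-disjoint edges (on $2r$ vertices). For an $r$-graph $F$ on $\ell+1$ vertices, its expansion $H^F_{\ell+1}$ is obtained from $F$ by adding, for every pair $\{u,v\}\subseteq V(F)$ not contained in any edge of $F$, an edge $\{u,v\}\cup B_{uv}$ where $B_{uv}$ is a set of $r-2$ new vertices, these sets pairwise disjoint. An $r$-graph is semibipartite if its vertex set can be partitioned into $V_1,V_2$ such that every edge contains exactly one vertex of $V_1$; $S_r(n)$ is the semibipartite $r$-graph on $n$ vertices with the maximum number of edges. $K_t^r$ is the complete $r$-graph on $t$ vertices; $\mathcal{G}\bowtie\mathcal{H}$ (disjoint vertex sets) consists of the edges of both plus all $r$-subsets meeting both vertex sets. $\mathrm{EX}(n,(t+1)F)$ is the set (up to isomorphism) of $n$-vertex $r$-graphs not containing $t+1$ pairwise vertex-disjoint copies of $F$ with the maximum number of edges among such.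
   Formalization: The maximum semibipartite r-graph S_r(n-t) is not unique when n-t is congruent to -1 mod r (two part sizes tie), so the right-hand side is read as the set of K_t^r ⋈ S over all semibipartite r-graphs S on n-t vertices with the maximum number of edges. *)

theory Defs
  imports Complex_Main "HOL-Library.Disjoint_Sets"
begin

datatype 'a hgraph = HGraph (verts: "'a set") (edges: "'a set set")

definition rgraph :: "nat \<Rightarrow> 'a hgraph \<Rightarrow> bool" where
  "rgraph r G \<longleftrightarrow> finite (verts G) \<and> (\<forall>e \<in> edges G. e \<subseteq> verts G \<and> card e = r)"

definition hiso :: "'a hgraph \<Rightarrow> 'b hgraph \<Rightarrow> bool" where
  "hiso G H \<longleftrightarrow> (\<exists>f. bij_betw f (verts G) (verts H) \<and> edges H = (\<lambda>e. f ` e) ` edges G)"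

text \<open>Every finite hypergraph has an isomorphic copy with natural-number vertices, so an
  isomorphism type is represented by the set of all its copies over \<open>nat\<close>.\<close>

definition iso_class :: "'a hgraph \<Rightarrow> nat hgraph set" where
  "iso_class G = {H. hiso G H}"

definition subhgraph :: "'a hgraph \<Rightarrow> 'a hgraph \<Rightarrow> bool" where
  "subhgraph H G \<longleftrightarrow> verts H \<subseteq> verts G \<and> edges H \<subseteq> edges G"

definition has_disjoint_copies :: "nat \<Rightarrow> 'b hgraph \<Rightarrow> 'a hgraph \<Rightarrow> bool" where
  "has_disjoint_copies k F G \<longleftrightarrow>
     (\<exists>C. (\<forall>i<k. subhgraph (C i) G \<and> hiso F (C i)) \<and>
          disjoint_family_on (\<lambda>i. verts (C i)) {..<k})"

text \<open>\<open>extremal_classes r n k F\<close> is \<open>EX(n, kF)\<close>, as a set of isomorphism types of \<open>r\<close>-graphs.\<close>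

definition extremal_classes :: "nat \<Rightarrow> nat \<Rightarrow> nat \<Rightarrow> 'b hgraph \<Rightarrow> nat hgraph set set" where
  "extremal_classes r n k F =
     {iso_class G | G :: nat hgraph.
        is_arg_max (\<lambda>G. card (edges G))
          (\<lambda>G. rgraph r G \<and> card (verts G) = n \<and> \<not> has_disjoint_copies k F G) G}"

definition matching2 :: "nat \<Rightarrow> nat hgraph" where
  "matching2 r = HGraph {0..<2 * r} {{0..<r}, {r..<2 * r}}"

definition uncovered_pairs :: "'a hgraph \<Rightarrow> 'a set set" where
  "uncovered_pairs F = {p. p \<subseteq> verts F \<and> card p = 2 \<and> \<not> (\<exists>e \<in> edges F. p \<subseteq> e)}"

text \<open>In the expansion, \<open>Inl v\<close> is an original vertex, and the new vertices attached to the
  uncovered pair \<open>p\<close> are \<open>Inr (p, i)\<close> with \<open>i < r - 2\<close>.\<close>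

definition new_verts :: "nat \<Rightarrow> 'a set \<Rightarrow> ('a + 'a set \<times> nat) set" where
  "new_verts r p = {Inr (p, i) | i. i < r - 2}"

definition expansion :: "nat \<Rightarrow> 'a hgraph \<Rightarrow> ('a + 'a set \<times> nat) hgraph" where
  "expansion r F = HGraph
     (Inl ` verts F \<union> (\<Union>p \<in> uncovered_pairs F. new_verts r p))
     ((\<lambda>e. Inl ` e) ` edges F \<union> {Inl ` p \<union> new_verts r p | p. p \<in> uncovered_pairs F})"

definition semibipartite :: "'a hgraph \<Rightarrow> bool" where
  "semibipartite G \<longleftrightarrow>
     (\<exists>V1 V2. V1 \<union> V2 = verts G \<and> V1 \<inter> V2 = {} \<and> (\<forall>e \<in> edges G. card (e \<inter> V1) = 1))"

text \<open>The hypergraphs denoted \<open>S_r(n)\<close>. Up to isomorphism the maximiser is unique unless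
  \<open>n\<close> is congruent to \<open>-1\<close> modulo \<open>r\<close>; in that case two sizes of the first part can tie, and
  both maximisers are admitted.\<close>

definition max_semibipartite :: "nat \<Rightarrow> nat \<Rightarrow> nat hgraph \<Rightarrow> bool" where
  "max_semibipartite r n S \<longleftrightarrow>
     is_arg_max (\<lambda>S. card (edges S))
       (\<lambda>S. rgraph r S \<and> card (verts S) = n \<and> semibipartite S) S"

definition complete_hgraph :: "nat \<Rightarrow> nat \<Rightarrow> nat hgraph" where
  "complete_hgraph r t = HGraph {0..<t} {e. e \<subseteq> {0..<t} \<and> card e = r}"

text \<open>The sum type makes the two vertex sets disjoint.\<close>

definition hjoin :: "nat \<Rightarrow> 'a hgraph \<Rightarrow> 'b hgraph \<Rightarrow> ('a + 'b) hgraph" where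
  "hjoin r G H =
     (let A = Inl ` verts G; B = Inr ` verts H in
      HGraph (A \<union> B)
        ((\<lambda>e. Inl ` e) ` edges G \<union> (\<lambda>e. Inr ` e) ` edges H \<union>
         {e. e \<subseteq> A \<union> B \<and> card e = r \<and> e \<inter> A \<noteq> {} \<and> e \<inter> B \<noteq> {}}))"

end

theory Submission
  imports Defs "HOL-Analysis.Analysis"
begin

text \<open>Call a family pair-free if any two disjoint edges leave some cross pair uncovered. Deleting few
  edges makes a hypergraph with few disjoint copies of the expansion pair-free: once all cross
  pairs of two disjoint edges have large codegree, the new vertices can be chosen greedily.
  Symmetrization moves any weighting of a pair-free family onto a set on which every pair is covered;
  there the family is intersecting, so its Lagrangian is at most that of a star (compression, a ballot
  argument of Frankl, and a bound for cross-intersecting families), with a definite loss unless one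
  vertex carries weight almost \<open>1 / r\<close>. Hence a nearly extremal hypergraph has a vertex with
  about \<open>n / r\<close> non-neighbours, and these form the first part of an almost semibipartite
  structure.

  In an extremal hypergraph take the part \<open>V\<^sub>1\<close> minimising the number of bad edges. Every
  vertex of large bad degree lies outside any prescribed small set together with a copy avoiding that set,
  so there are \<open>l \<le> t\<close> of them; every other bad edge on typical vertices also yields
  a copy. Comparison with the hypergraph whose dominating set consists of these \<open>l\<close> vertices and
  \<open>t - l\<close> further ones then leaves no missing sets, no other bad edges, and \<open>l = t\<close>.\<close>

section \<open>Weighted set systems\<close>

text \<open>Let \<open>x 0 \<ge> x 1 \<ge> x 2\<close> be the largest weights at a compressed
  maximiser of density \<open>M\<close>. Every link at a vertex of positive weight then has density
  exactly \<open>M\<close>, and the ballot argument yields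
  \<open>M \<le> r * (x 0 + x 2) * M\<close>, so \<open>x 0 + x 1\<close> is at least
  \<open>1 / r\<close>. The links at 0 and 1 consist of a common part and a cross-intersecting pair;
  hence \<open>2 * M\<close> is at most a decreasing function of \<open>x 0 + x 1\<close> whose
  value at \<open>1 / r\<close> is twice the star density. The bound for cross-intersecting
  \<open>j\<close>-uniform families, used with \<open>j = r - 1\<close>, is false for
  \<open>j = 2\<close>: take both families equal to a triangle. This is where
  \<open>r \<ge> 4\<close> enters, and it forces a separate treatment of triples, whose links are
  graphs. The gap comes from a single term: products containing the square of \<open>x 2\<close> are
  absent from the common part, and if \<open>x 0\<close> stays below \<open>1 / r\<close> then the
  ballot inequality keeps \<open>x 2\<close> away from zero. In the exact part the obstacle is a
  cross pair inside the first part, where a semibipartite graph has no edges at all; there the bad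
  edge itself is used as the connecting edge.\<close>

definition ksets :: "'a set \<Rightarrow> nat \<Rightarrow> 'a set set" where
  "ksets V k = {e. e \<subseteq> V \<and> card e = k}"

text \<open>The edge polynomial of the family. For weights of sum 1 the quantity
  \<open>fact k * wt x E\<close> is a density, and all later bounds are normalised this way.\<close>

definition wt :: "('a \<Rightarrow> real) \<Rightarrow> 'a set set \<Rightarrow> real" where
  "wt x E = (\<Sum>e\<in>E. \<Prod>v\<in>e. x v)"

text \<open>The condition \<open>v \<notin> A\<close> makes \<open>insert v\<close> injective on the
  link, so \<open>wt\<close> splits at \<open>v\<close> without correction;
  \<open>wt x (link v E)\<close> is the partial derivative of the edge polynomial at
  \<open>v\<close>.\<close>

definition link :: "'a \<Rightarrow> 'a set set \<Rightarrow> 'a set set" where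
  "link v E = {A. v \<notin> A \<and> insert v A \<in> E}"

lemma finite_ksets: "finite V \<Longrightarrow> finite (ksets V k)"
  unfolding ksets_def by (rule finite_subset[of _ "Pow V"]) auto

lemma card_ksets: "finite V \<Longrightarrow> card (ksets V k) = card V choose k"
  unfolding ksets_def by (rule n_subsets)

lemma ksets_mono: "U \<subseteq> V \<Longrightarrow> ksets U k \<subseteq> ksets V k"
  unfolding ksets_def by auto

lemma finite_fam: "finite V \<Longrightarrow> E \<subseteq> ksets V k \<Longrightarrow> finite E"
  by (rule finite_subset[OF _ finite_ksets])

lemma finite_edge: "finite V \<Longrightarrow> E \<subseteq> ksets V k \<Longrightarrow> e \<in> E \<Longrightarrow> finite e"
  by (rule finite_subset[of e V]) (auto simp: ksets_def)

lemma ksets_finite: "finite V \<Longrightarrow> e \<in> ksets V k \<Longrightarrow> finite e"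
  by (rule finite_subset[of e V]) (simp_all add: ksets_def)

lemma ksets_0: "finite V \<Longrightarrow> ksets V 0 = {{}}"
proof -
  assume V: "finite V"
  have "e = {}" if "e \<in> ksets V 0" for e
    using that ksets_finite[OF V that] by (simp add: ksets_def)
  then show ?thesis by (auto simp: ksets_def)
qed

lemma ksets_empty:
  assumes "finite V" "card V < k"
  shows "ksets V k = {}"
proof (rule equals0I)
  fix e assume "e \<in> ksets V k"
  then have "e \<subseteq> V" "card e = k" by (auto simp: ksets_def)
  then show False using card_mono[OF assms(1), of e] assms(2) by simp
qed

lemma link_subset: assumes "finite V" "E \<subseteq> ksets V (Suc k)" shows "link v E \<subseteq> ksets (V - {v}) k"
proof
  fix A assume A: "A \<in> link v E"
  then have *: "insert v A \<in> ksets V (Suc k)" "v \<notin> A" using assms unfolding link_def by auto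
  have "finite A" using ksets_finite[OF assms(1) *(1)] by simp
  then show "A \<in> ksets (V - {v}) k" using * unfolding ksets_def by auto
qed

lemma wt_nonneg:
  assumes "E \<subseteq> ksets V k" "\<And>v. v \<in> V \<Longrightarrow> 0 \<le> x v"
  shows "0 \<le> wt x E"
  unfolding wt_def using assms(1) by (intro sum_nonneg prod_nonneg assms(2)) (auto simp: ksets_def)

lemma wt_mono:
  assumes "finite V" "E \<subseteq> F" "F \<subseteq> ksets V k" "\<And>v. v \<in> V \<Longrightarrow> 0 \<le> x v"
  shows "wt x E \<le> wt x F"
  unfolding wt_def using assms(1-3) finite_fam[of V F k]
  by (intro sum_mono2 prod_nonneg assms(4)) (auto simp: ksets_def)

lemma wt_cong: "(\<And>e v. e \<in> E \<Longrightarrow> v \<in> e \<Longrightarrow> x v = y v) \<Longrightarrow> wt x E = wt y E"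
  unfolding wt_def by (intro sum.cong prod.cong refl) auto

lemma wt_empty: "wt x {} = 0"
  unfolding wt_def by simp

lemma wt_Un: "finite E \<Longrightarrow> finite F \<Longrightarrow> E \<inter> F = {} \<Longrightarrow> wt x (E \<union> F) = wt x E + wt x F"
  unfolding wt_def by (rule sum.union_disjoint)

lemma wt_Un_le:
  assumes "finite V" "E \<subseteq> ksets V k" "F \<subseteq> ksets V k" "\<And>v. v \<in> V \<Longrightarrow> 0 \<le> x v"
  shows "wt x (E \<union> F) \<le> wt x E + wt x F"
proof -
  have fE: "finite E" and fF: "finite F" using finite_fam[OF assms(1,2)] finite_fam[OF assms(1,3)] by auto
  have "E \<union> F = E \<union> (F - E)" by auto
  then have "wt x (E \<union> F) = wt x E + wt x (F - E)"
    using wt_Un[of E "F - E" x] fE fF by auto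
  also have "wt x (F - E) \<le> wt x F" by (rule wt_mono[of V _ _ k]) (use assms in auto)
  finally show ?thesis by simp
qed

lemma wt_insert_image:
  assumes "finite V" "F \<subseteq> ksets V k" "v \<notin> V"
  shows "wt x (insert v ` F) = x v * wt x F"
proof -
  have "v \<notin> e" if "e \<in> F" for e using that assms by (auto simp: ksets_def)
  then have inj: "inj_on (insert v) F" by (intro inj_onI) (metis insert_ident)
  have "wt x (insert v ` F) = (\<Sum>e\<in>F. \<Prod>w\<in>insert v e. x w)"
    unfolding wt_def by (simp add: sum.reindex[OF inj])
  also have "\<dots> = (\<Sum>e\<in>F. x v * (\<Prod>w\<in>e. x w))"
  proof (rule sum.cong[OF refl])
    fix e assume "e \<in> F"
    then have "finite e" "v \<notin> e" using assms finite_edge[OF assms(1,2)] by (auto simp: ksets_def)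
    then show "(\<Prod>w\<in>insert v e. x w) = x v * (\<Prod>w\<in>e. x w)" by simp
  qed
  finally show ?thesis unfolding wt_def by (simp add: sum_distrib_left)
qed

lemma link_image: "insert v ` link v E = {e \<in> E. v \<in> e}"
proof -
  have "e \<in> insert v ` link v E" if "e \<in> E" "v \<in> e" for e
  proof -
    have "insert v (e - {v}) = e" using that by auto
    then show ?thesis using that unfolding link_def by (intro image_eqI[of _ _ "e - {v}"]) auto
  qed
  then show ?thesis unfolding link_def by auto
qed

lemma wt_containing:
  assumes "finite V" "E \<subseteq> ksets V (Suc k)"
  shows "wt x {e \<in> E. v \<in> e} = x v * wt x (link v E)"
  using wt_insert_image[of "V - {v}" "link v E" k v x] link_subset[OF assms, of v] assms(1) link_image[of v E] by auto

lemma wt_split: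
  assumes "finite V" "E \<subseteq> ksets V (Suc k)"
  shows "wt x E = wt x {e \<in> E. v \<notin> e} + x v * wt x (link v E)"
proof -
  have "E = {e \<in> E. v \<notin> e} \<union> {e \<in> E. v \<in> e}" by auto
  then have "wt x E = wt x {e \<in> E. v \<notin> e} + wt x {e \<in> E. v \<in> e}"
    using wt_Un[of "{e \<in> E. v \<notin> e}" "{e \<in> E. v \<in> e}" x] finite_fam[OF assms] by auto
  then show ?thesis using wt_containing[OF assms] by simp
qed

lemma link_ksets:
  assumes "finite V" "v \<notin> V"
  shows "link v (ksets (insert v V) (Suc k)) = ksets V k"
proof
  show "link v (ksets (insert v V) (Suc k)) \<subseteq> ksets V k"
    using link_subset[of "insert v V" "ksets (insert v V) (Suc k)" k v] assms by simp
  show "ksets V k \<subseteq> link v (ksets (insert v V) (Suc k))"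
  proof
    fix A assume A: "A \<in> ksets V k"
    then have "finite A" "A \<subseteq> V" "card A = k" using ksets_finite[OF assms(1) A] by (auto simp: ksets_def)
    moreover then have "v \<notin> A" using assms by auto
    ultimately show "A \<in> link v (ksets (insert v V) (Suc k))" unfolding link_def ksets_def by auto
  qed
qed

lemma wt_ksets_insert:
  assumes "finite V" "v \<notin> V"
  shows "wt x (ksets (insert v V) (Suc k)) = wt x (ksets V (Suc k)) + x v * wt x (ksets V k)"
proof -
  have "{e \<in> ksets (insert v V) (Suc k). v \<notin> e} = ksets V (Suc k)"
    using assms unfolding ksets_def by auto
  then show ?thesis
    using wt_split[of "insert v V" "ksets (insert v V) (Suc k)" k x v] link_ksets[OF assms, of k] assms by auto
qed

lemma wt_ksets_0 [simp]: "finite V \<Longrightarrow> wt x (ksets V 0) = 1"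
  unfolding wt_def by (simp add: ksets_0)

section \<open>Elementary symmetric polynomials\<close>

lemma pow_add_ge:
  fixes a b :: real assumes "0 \<le> a" "0 \<le> b"
  shows "a ^ Suc n + real (Suc n) * b * a ^ n \<le> (a + b) ^ Suc n"
proof (induction n)
  case 0 then show ?case by simp
next
  case (Suc n)
  have "(a + b) ^ Suc (Suc n) = (a + b) * (a + b) ^ Suc n" by simp
  also have "\<dots> \<ge> (a + b) * (a ^ Suc n + real (Suc n) * b * a ^ n)"
    using Suc assms by (intro mult_left_mono) auto
  moreover have "(a + b) * (a ^ Suc n + real (Suc n) * b * a ^ n)
      = a ^ Suc (Suc n) + real (Suc (Suc n)) * b * a ^ Suc n + real (Suc n) * b * b * a ^ n"
    by (simp add: algebra_simps)
  moreover have "0 \<le> real (Suc n) * b * b * a ^ n" using assms by simp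
  ultimately show ?case by linarith
qed

text \<open>Adding a vertex \<open>v\<close> leaves the sets avoiding it and \<open>x v\<close>
  times the sets one smaller; the two inductive bounds are the first two terms of the binomial
  expansion of the new power. The same scheme carries the induction for cross-intersecting
  families.\<close>

lemma wt_ksets_le:
  assumes "finite V" "\<And>v. v \<in> V \<Longrightarrow> 0 \<le> x v"
  shows "fact k * wt x (ksets V k) \<le> (sum x V) ^ k"
  using assms
proof (induction V arbitrary: k rule: finite_induct)
  case empty
  then show ?case by (cases k) (simp_all add: ksets_empty wt_empty)
next
  case (insert v V)
  show ?case
  proof (cases k)
    case 0 then show ?thesis using insert by simp
  next
    case (Suc l)
    have nn: "0 \<le> sum x V" "0 \<le> x v" using insert by (auto intro: sum_nonneg)
    have "fact k * wt x (ksets (insert v V) k)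
       = fact (Suc l) * wt x (ksets V (Suc l)) + real (Suc l) * x v * (fact l * wt x (ksets V l))"
      using insert.hyps Suc by (simp add: wt_ksets_insert algebra_simps)
    also have "\<dots> \<le> (sum x V) ^ Suc l + real (Suc l) * x v * (sum x V) ^ l"
      using insert.IH[of "Suc l"] insert.IH[of l] insert.prems nn
      by (intro add_mono mult_left_mono) auto
    also have "\<dots> \<le> (sum x V + x v) ^ Suc l" using nn by (rule pow_add_ge)
    finally show ?thesis using Suc insert.hyps by (simp add: add.commute)
  qed
qed

lemma wt_le:
  assumes "finite V" "E \<subseteq> ksets V k" "\<And>v. v \<in> V \<Longrightarrow> 0 \<le> x v"
  shows "fact k * wt x E \<le> (sum x V) ^ k"
proof -
  have "wt x E \<le> wt x (ksets V k)"
    using wt_mono[of V E "ksets V k" k x] assms by auto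
  then have "fact k * wt x E \<le> fact k * wt x (ksets V k)" by (intro mult_left_mono) auto
  then show ?thesis using wt_ksets_le[of V x k, OF assms(1,3)] by linarith
qed

text \<open>Expanding the power also produces words that use \<open>u\<close> twice, which no set of
  distinct vertices accounts for; the words beginning with \<open>u\<close>, \<open>u\<close>
  already have weight \<open>(x u)\<^sup>2 * (sum x V) ^ k\<close>. This loss is the source of the
  gap in the Lagrangian.\<close>

lemma wt_ksets_le_gap:
  assumes "finite V" "\<And>v. v \<in> V \<Longrightarrow> 0 \<le> x v" "u \<in> V"
  shows "fact (k + 2) * wt x (ksets V (k + 2)) \<le> (sum x V) ^ (k + 2) - (x u)\<^sup>2 * (sum x V) ^ k"
proof -
  define U where "U = V - {u}"
  define s where "s = sum x U"
  have U: "finite U" "u \<notin> U" "V = insert u U" using assms U_def by auto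
  have nn: "0 \<le> s" "0 \<le> x u" using assms U s_def by (auto intro: sum_nonneg)
  have S: "sum x V = s + x u" using U s_def by simp
  have "fact (k + 2) * wt x (ksets V (k + 2))
     = fact (k+2) * wt x (ksets U (k + 2)) + real (k + 2) * x u * (fact (k+1) * wt x (ksets U (k+1)))"
    using U wt_ksets_insert[of U u x "Suc k"] by (simp add: algebra_simps)
  also have "\<dots> \<le> s ^ (k+2) + real (k+2) * x u * s ^ (k+1)"
    using wt_ksets_le[of U x "k+2"] wt_ksets_le[of U x "k+1"] assms U nn
    unfolding s_def by (intro add_mono mult_left_mono) auto
  \<comment> \<open>The second factor is \<open>(s + x u)\<^sup>2 - (x u)\<^sup>2\<close>, so the
    subtracted square appears without any further estimate.\<close>
  also have "\<dots> \<le> (s + x u) ^ k * (s\<^sup>2 + 2 * x u * s)"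
  proof (cases k)
    case 0 then show ?thesis by (simp add: power2_eq_square algebra_simps)
  next
    case (Suc l)
    have "s ^ (k+2) + real (k+2) * x u * s ^ (k+1) \<le> (s ^ Suc l + real (Suc l) * x u * s ^ l) * (s\<^sup>2 + 2 * x u * s)"
    proof -
      have "(s ^ Suc l + real (Suc l) * x u * s ^ l) * (s\<^sup>2 + 2 * x u * s)
         = s ^ (k+2) + real (k+2) * x u * s ^ (k+1) + 2 * real (Suc l) * (x u)\<^sup>2 * s ^ Suc l"
        using Suc by (simp add: power2_eq_square algebra_simps)
      moreover have "0 \<le> 2 * real (Suc l) * (x u)\<^sup>2 * s ^ Suc l" using nn by simp
      ultimately show ?thesis by linarith
    qed
    also have "\<dots> \<le> (s + x u) ^ k * (s\<^sup>2 + 2 * x u * s)"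
      using pow_add_ge[of s "x u" l] nn Suc by (intro mult_right_mono) auto
    finally show ?thesis .
  qed
  also have "\<dots> = (s + x u) ^ (k + 2) - (x u)\<^sup>2 * (s + x u) ^ k"
    by (simp add: power2_eq_square algebra_simps)
  finally show ?thesis using S by simp
qed

text \<open>The arithmetic-geometric mean inequality for \<open>n\<close> copies of \<open>s\<close>
  and one \<open>c\<close>, obtained from Bernoulli's inequality after division by
  \<open>s\<close>.\<close>

lemma power_mean_bernoulli:
  fixes s c :: real assumes "0 \<le> s" "0 \<le> c"
  shows "s ^ n * c \<le> ((real n * s + c) / real (Suc n)) ^ Suc n"
proof (cases "s = 0")
  case True then show ?thesis using assms by (cases n) auto
next
  case False
  then have s: "0 < s" using assms by simp
  define t where "t = c / s"
  have t0: "0 \<le> t" and c: "c = s * t" using s assms unfolding t_def by auto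
  define y where "y = (t - 1) / real (Suc n)"
  have y: "real (Suc n) * y = t - 1" unfolding y_def by simp
  have "real (Suc n) * (1 + y) = real n + t" using y by (simp add: algebra_simps)
  then have y1: "1 + y = (real n + t) / real (Suc n)"
    by (metis nonzero_mult_div_cancel_left of_nat_eq_0_iff nat.distinct(1))
  have "0 \<le> 1 + y" unfolding y1 using t0 by simp
  then have "-1 \<le> y" by simp
  then have "1 + real (Suc n) * y \<le> (1 + y) ^ Suc n" by (rule Bernoulli_inequality)
  then have "t \<le> (1 + y) ^ Suc n" using y by simp
  then have "s ^ Suc n * t \<le> s ^ Suc n * (1 + y) ^ Suc n" using s by (intro mult_left_mono) auto
  also have "\<dots> = (s * (1 + y)) ^ Suc n" by (simp only: power_mult_distrib)
  also have "s * (1 + y) = (real n * s + c) / real (Suc n)" unfolding y1 c by (simp add: algebra_simps)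
  finally show ?thesis unfolding c by (simp add: algebra_simps)
qed

text \<open>Maclaurin's inequality, by adding one vertex. With the old weights replaced by their
  mean \<open>s\<close>, the two terms combine to a binomial coefficient times
  \<open>s ^ l * c\<close>, and \<open>c\<close> is such that \<open>l\<close> copies of
  \<open>s\<close> and one \<open>c\<close> average to the new mean.\<close>

lemma maclaurin:
  assumes "finite V" "\<And>v. v \<in> V \<Longrightarrow> 0 \<le> x v"
  shows "real (card V) ^ k * wt x (ksets V k) \<le> real (card V choose k) * (sum x V) ^ k"
  using assms
proof (induction V arbitrary: k rule: finite_induct)
  case empty
  then show ?case by (cases k) (simp_all add: ksets_empty wt_empty)
next
  case (insert v V)
  show ?case
  proof (cases k)
    case 0 then show ?thesis using insert by simp
  next
    case (Suc l)
    define m where "m = card V"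
    have nn: "0 \<le> sum x V" "0 \<le> x v" using insert by (auto intro: sum_nonneg)
    have cV: "card (insert v V) = Suc m" using insert m_def by simp
    show ?thesis
    proof (cases "m = 0")
      case True
      then have V: "V = {}" using insert m_def by simp
      show ?thesis
      proof (cases l)
        case 0
        have "ksets {v} (Suc 0) = {{v}}" unfolding ksets_def by (auto simp: card_Suc_eq)
        then show ?thesis using V Suc 0 by (simp add: wt_def)
      next
        case (Suc l')
        then show ?thesis using V \<open>k = Suc l\<close> by (simp add: ksets_empty wt_empty)
      qed
    next
      case False
      then have m0: "0 < m" by simp
      define s where "s = sum x V / real m"
      have s0: "0 \<le> s" using nn s_def by simp
      have e1: "wt x (ksets V (Suc l)) \<le> real (m choose Suc l) * s ^ Suc l"
      proof -
        have "real m ^ Suc l * wt x (ksets V (Suc l)) \<le> real (m choose Suc l) * (sum x V) ^ Suc l"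
          using insert.IH[of "Suc l"] insert.prems m_def by simp
        then have "wt x (ksets V (Suc l)) \<le> (real (m choose Suc l) * (sum x V) ^ Suc l) / real m ^ Suc l" using m0
          by (simp add: pos_le_divide_eq mult.commute del: power_Suc)
        then show ?thesis unfolding s_def power_divide by simp
      qed
      have e2: "wt x (ksets V l) \<le> real (m choose l) * s ^ l"
      proof -
        have "real m ^ l * wt x (ksets V l) \<le> real (m choose l) * (sum x V) ^ l"
          using insert.IH[of l] insert.prems m_def by simp
        then have "wt x (ksets V l) \<le> (real (m choose l) * (sum x V) ^ l) / real m ^ l" using m0
          by (simp add: pos_le_divide_eq mult.commute)
        then show ?thesis unfolding s_def power_divide by simp
      qed
      have ch1: "real (Suc m) * real (m choose l) = real (Suc m choose Suc l) * real (Suc l)"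
        using Suc_times_binomial_eq[of m l] by (metis of_nat_mult mult.commute)
      have ch2: "real (Suc m) * real (m choose Suc l) = real (Suc m choose Suc l) * (real m - real l)"
      proof -
        have "real (Suc m choose Suc l) = real (m choose l) + real (m choose Suc l)" by simp
        then have "real (Suc m) * real (m choose Suc l) = real (Suc m) * real (Suc m choose Suc l) - real (Suc m) * real (m choose l)"
          by (simp add: algebra_simps)
        also have "\<dots> = real (Suc m choose Suc l) * (real (Suc m) - real (Suc l))"
          using ch1 by (simp add: algebra_simps)
        finally show ?thesis by simp
      qed
      define c where "c = ((real m - real l) * s + real (Suc l) * x v) / real (Suc m)"
      define W where "W = sum x V + x v"
      have W: "W = real m * s + x v" unfolding W_def s_def using m0 by simp
      show ?thesis
      proof (cases "l \<le> m")
        case False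
        then have "ksets (insert v V) k = {}" using ksets_empty[of "insert v V" k] cV Suc insert by simp
        moreover have "0 \<le> sum x (insert v V)" using insert by (intro sum_nonneg) auto
          ultimately show ?thesis by (simp add: wt_empty)
      next
        case True
        have c0: "0 \<le> c" unfolding c_def using True s0 nn by (intro divide_nonneg_nonneg add_nonneg_nonneg mult_nonneg_nonneg) auto
        have "wt x (ksets (insert v V) k) = wt x (ksets V (Suc l)) + x v * wt x (ksets V l)"
          using insert.hyps Suc wt_ksets_insert by simp
        also have "\<dots> \<le> real (m choose Suc l) * s ^ Suc l + x v * (real (m choose l) * s ^ l)"
          using e1 e2 nn by (intro add_mono mult_left_mono)
        also have "\<dots> = real (Suc m choose Suc l) * (s ^ l * c)"
        proof -
          have "real (Suc m) * (real (m choose Suc l) * s ^ Suc l + x v * (real (m choose l) * s ^ l))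
             = (real (Suc m) * real (m choose Suc l)) * s * s ^ l + (real (Suc m) * real (m choose l)) * x v * s ^ l"
            by (simp add: algebra_simps)
          also have "\<dots> = real (Suc m choose Suc l) * (s ^ l * ((real m - real l) * s + real (Suc l) * x v))"
            unfolding ch1 ch2 by (simp add: algebra_simps)
          also have "\<dots> = real (Suc m) * (real (Suc m choose Suc l) * (s ^ l * c))"
            unfolding c_def by simp
          finally have "real (Suc m) * (real (m choose Suc l) * s ^ Suc l + x v * (real (m choose l) * s ^ l))
            = real (Suc m) * (real (Suc m choose Suc l) * (s ^ l * c))" .
          then show ?thesis by (metis mult_cancel_left of_nat_eq_0_iff nat.distinct(1))
        qed
        also have "\<dots> \<le> real (Suc m choose Suc l) * ((real l * s + c) / real (Suc l)) ^ Suc l"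
          using power_mean_bernoulli[OF s0 c0] by (intro mult_left_mono) auto
        also have "(real l * s + c) / real (Suc l) = W / real (Suc m)"
        proof -
          have "real (Suc m) * (real l * s + c) = real (Suc l) * W"
            unfolding c_def W by (simp add: field_simps)
          then show ?thesis by (simp add: field_simps del: of_nat_Suc)
        qed
        finally have "wt x (ksets (insert v V) k) \<le> real (Suc m choose Suc l) * (W / real (Suc m)) ^ Suc l" .
        then have "wt x (ksets (insert v V) k) \<le> (real (Suc m choose Suc l) * W ^ Suc l) / real (Suc m) ^ Suc l"
          unfolding power_divide by simp
        moreover have "0 < real (Suc m) ^ Suc l" by (rule zero_less_power) simp
        ultimately have "real (Suc m) ^ Suc l * wt x (ksets (insert v V) k) \<le> real (Suc m choose Suc l) * W ^ Suc l"
          by (metis pos_le_divide_eq mult.commute)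
        moreover have "sum x (insert v V) = W" unfolding W_def using insert.hyps by simp
        ultimately show ?thesis by (simp only: cV Suc)
      qed
    qed
  qed
qed

section \<open>Cross-intersecting families\<close>

text \<open>Left-compressed families. The ground set is a parameter because links and subfamilies
  avoiding a vertex live on \<open>V - {v}\<close>. Small labels will carry the large
  weights.\<close>

definition compressed :: "nat set \<Rightarrow> nat set set \<Rightarrow> bool" where
  "compressed V E \<longleftrightarrow> (\<forall>A\<in>E. \<forall>b\<in>A. \<forall>a\<in>V. a < b \<longrightarrow> a \<notin> A \<longrightarrow> insert a (A - {b}) \<in> E)"

definition cross_intersecting :: "'a set set \<Rightarrow> 'a set set \<Rightarrow> bool" where
  "cross_intersecting \<A> \<B> \<longleftrightarrow> (\<forall>A\<in>\<A>. \<forall>B\<in>\<B>. A \<inter> B \<noteq> {})"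

lemma compressedD: "compressed V E \<Longrightarrow> A \<in> E \<Longrightarrow> b \<in> A \<Longrightarrow> a \<in> V \<Longrightarrow> a < b \<Longrightarrow> a \<notin> A \<Longrightarrow> insert a (A - {b}) \<in> E"
  unfolding compressed_def by blast

lemma cross_sym: "cross_intersecting \<A> \<B> \<Longrightarrow> cross_intersecting \<B> \<A>"
  unfolding cross_intersecting_def by blast

lemma compressed_link:
  assumes "compressed V E" shows "compressed (V - {v}) (link v E)"
  unfolding compressed_def
proof (intro ballI impI)
  fix A b a assume *: "A \<in> link v E" "b \<in> A" "a \<in> V - {v}" "a < b" "a \<notin> A"
  then have "insert v A \<in> E" "v \<notin> A" by (auto simp: link_def)
  moreover then have "b \<noteq> v" using * by auto
  moreover have "insert a (insert v A - {b}) \<in> E"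
    by (rule compressedD[OF assms]) (use * calculation in auto)
  moreover have "insert a (insert v A - {b}) = insert v (insert a (A - {b}))" using calculation by auto
  ultimately show "insert a (A - {b}) \<in> link v E" using * by (auto simp: link_def)
qed

lemma compressed_avoid:
  assumes "compressed V E" shows "compressed (V - {v}) {A \<in> E. v \<notin> A}"
  unfolding compressed_def
proof (intro ballI impI)
  fix A b a assume *: "A \<in> {A \<in> E. v \<notin> A}" "b \<in> A" "a \<in> V - {v}" "a < b" "a \<notin> A"
  then show "insert a (A - {b}) \<in> {A \<in> E. v \<notin> A}"
    using compressedD[OF assms, of A b a] by auto
qed

text \<open>Two disjoint members of the links use, together with \<open>n\<close>, at most
  \<open>2 * k + 1\<close> vertices. A further vertex \<open>i\<close> exists, and shifting
  \<open>n\<close> to \<open>i\<close> in the first member gives two disjoint members of the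
  original families.\<close>

lemma cross_link:
  assumes "finite V" "\<A> \<subseteq> ksets V (Suc k)" "\<B> \<subseteq> ksets V (Suc k)" "compressed V \<A>"
    "cross_intersecting \<A> \<B>" "n \<in> V" "\<And>v. v \<in> V \<Longrightarrow> v \<le> n" "2 * Suc k \<le> card V"
  shows "cross_intersecting (link n \<A>) (link n \<B>)"
  unfolding cross_intersecting_def
proof (intro ballI notI)
  fix A B assume A: "A \<in> link n \<A>" and B: "B \<in> link n \<B>" and d: "A \<inter> B = {}"
  have A': "A \<in> ksets (V - {n}) k" and B': "B \<in> ksets (V - {n}) k"
    using link_subset[OF assms(1,2), of n] link_subset[OF assms(1,3), of n] A B by auto
  have fin: "finite A" "finite B" using ksets_finite[of "V - {n}"] A' B' assms(1) by auto
  have "card (A \<union> B) \<le> 2 * k" using card_Un_le[of A B] A' B' by (simp add: ksets_def)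
  then have "card (insert n (A \<union> B)) \<le> 2 * k + 1" using fin card_insert_le_m1[of "2*k+1" "A \<union> B" n] by simp
  then have "card (insert n (A \<union> B)) < card V" using assms(8) by simp
  then have "\<not> V \<subseteq> insert n (A \<union> B)" using card_mono[of "insert n (A \<union> B)" V] fin by auto
  then obtain i where i: "i \<in> V" "i \<noteq> n" "i \<notin> A" "i \<notin> B" by auto
  have "insert n A \<in> \<A>" "n \<notin> A" using A by (auto simp: link_def)
  then have "insert i (insert n A - {n}) \<in> \<A>"
    using compressedD[OF assms(4), of "insert n A" n i] i assms(7)[of i] by auto
  moreover have "insert i (insert n A - {n}) = insert i A" using \<open>n \<notin> A\<close> by auto
  ultimately have iA: "insert i A \<in> \<A>" by simp
  have nB: "insert n B \<in> \<B>" using B by (auto simp: link_def)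
  have "insert i A \<inter> insert n B \<noteq> {}" using assms(5) iA nB unfolding cross_intersecting_def by blast
  moreover have "insert i A \<inter> insert n B = {}" using i d \<open>n \<notin> A\<close> by auto
  ultimately show False by simp
qed

text \<open>Only the two smallest factors \<open>n - j + 1\<close> and \<open>n - j + 2\<close> of
  the falling factorial are examined; their product is at most half of \<open>n * n\<close>. For
  \<open>j = 2\<close> and \<open>n = 3\<close> the inequality fails.\<close>

lemma falling_half:
  assumes "3 \<le> j" "j \<le> n" "n \<le> 2 * j - 1"
  shows "2 * (fact j * (n choose j)) \<le> n ^ j"
proof -
  define i where "i = j - 2"
  have i: "j = Suc (Suc i)" using assms unfolding i_def by simp
  have "i + 2 \<le> n" using assms i by simp
  then obtain d where d: "n = i + 2 + d" using le_Suc_ex by blast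
  have step: "Suc k * (n choose Suc k) = (n - k) * (n choose k)" for k
    using binomial_absorption[of k n] binomial_absorb_comp[of n k] by simp
  have "fact j * (n choose j) = fact (Suc i) * (Suc (Suc i) * (n choose Suc (Suc i)))"
    unfolding i by (simp only: fact_Suc of_nat_id mult_ac)
  also have "\<dots> = (n - Suc i) * (fact i * (Suc i * (n choose Suc i)))"
    unfolding step[of "Suc i"] by (simp only: fact_Suc of_nat_id mult_ac)
  also have "\<dots> = ((n - Suc i) * (n - i)) * ((n choose i) * fact i)"
    unfolding step[of i] by (simp only: mult_ac)
  also have "\<dots> \<le> ((n - Suc i) * (n - i)) * n ^ i" by (intro mult_left_mono binomial_fact_pow) auto
  finally have "2 * (fact j * (n choose j)) \<le> (2 * ((n - Suc i) * (n - i))) * n ^ i" by simp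
  also have "2 * ((n - Suc i) * (n - i)) \<le> n * n"
  proof -
    have "n - Suc i = d + 1" "n - i = d + 2" using d by auto
    moreover have di: "d \<le> i + 1" "1 \<le> i" using assms i d by auto
    moreover have "2 * ((d + 1) * (d + 2)) \<le> (i + 2 + d) * (i + 2 + d)"
    proof -
      \<comment> \<open>Here \<open>i + 2 + d\<close> is at least \<open>2 * d + 1\<close>, whose
        square suffices as soon as \<open>d\<close> is at least 2; the two smaller values use
        \<open>1 \<le> i\<close>.\<close>
      consider "d = 0" | "d = 1" | "2 \<le> d" by linarith
      then show ?thesis
      proof cases
        case 1
        have "2 * 2 \<le> (i + 2 + d) * (i + 2 + d)" by (intro mult_le_mono) auto
        then show ?thesis using 1 by simp
      next
        case 2
        have "4 * 4 \<le> (i + 2 + d) * (i + 2 + d)" using 2 di by (intro mult_le_mono) auto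
        then show ?thesis using 2 by simp
      next
        case 3
        define f where "f = d - 2"
        have f: "d = f + 2" using 3 unfolding f_def by simp
        have "(2 * d + 1) * (2 * d + 1) \<le> (i + 2 + d) * (i + 2 + d)" using di by (intro mult_le_mono) auto
        moreover have "2 * ((d + 1) * (d + 2)) \<le> (2 * d + 1) * (2 * d + 1)" unfolding f by (simp add: algebra_simps)
        ultimately show ?thesis by simp
      qed
    qed
    ultimately show ?thesis using d by simp
  qed
  finally show ?thesis unfolding i by (simp add: mult_ac)
qed

text \<open>With fewer than \<open>2 * j\<close> vertices each family is bounded by all
  \<open>j\<close>-sets, and by Maclaurin's inequality these contribute at most half of the
  power.\<close>

lemma cross_small:
  assumes "finite V" "\<And>v. v \<in> V \<Longrightarrow> 0 \<le> x v" "3 \<le> j" "card V \<le> 2 * j - 1"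
    "\<A> \<subseteq> ksets V j" "\<B> \<subseteq> ksets V j"
  shows "fact j * (wt x \<A> + wt x \<B>) \<le> (sum x V) ^ j"
proof -
  have S0: "0 \<le> sum x V" using assms(2) by (rule sum_nonneg)
  have wA: "wt x \<A> \<le> wt x (ksets V j)" "wt x \<B> \<le> wt x (ksets V j)"
    using wt_mono[of V _ "ksets V j" j x] assms by auto
  have le: "fact j * (wt x \<A> + wt x \<B>) \<le> 2 * fact j * wt x (ksets V j)"
    using mult_left_mono[OF add_mono[OF wA], of "fact j"] by (simp add: algebra_simps)
  show ?thesis
  proof (cases "card V < j")
    case True
    then have "ksets V j = {}" using ksets_empty assms(1) by blast
    then have "fact j * (wt x \<A> + wt x \<B>) \<le> 0" using le by (simp add: wt_empty)
    then show ?thesis using zero_le_power[OF S0, of j] by linarith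
  next
    case False
    define n where "n = card V"
    have n: "0 < real n" using False assms(3) n_def by simp
    have M: "real n ^ j * wt x (ksets V j) \<le> real (n choose j) * (sum x V) ^ j"
      unfolding n_def by (rule maclaurin) (use assms in auto)
    have "2 * (fact j * (n choose j)) \<le> n ^ j" using falling_half[of j n] assms False n_def by simp
    then have "real (2 * (fact j * (n choose j))) \<le> real (n ^ j)" by (rule of_nat_mono)
    then have F: "2 * (fact j * real (n choose j)) \<le> real n ^ j" by simp
    have "real n ^ j * (2 * fact j * wt x (ksets V j)) \<le> 2 * fact j * (real (n choose j) * (sum x V) ^ j)"
      using mult_left_mono[OF M, of "2 * fact j"] by (simp add: algebra_simps)
    also have "\<dots> = (2 * (fact j * real (n choose j))) * (sum x V) ^ j" by simp
    also have "\<dots> \<le> real n ^ j * (sum x V) ^ j" using F S0 by (intro mult_right_mono) auto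
    finally have "2 * fact j * wt x (ksets V j) \<le> (sum x V) ^ j" using n by simp
    then show ?thesis using le by linarith
  qed
qed

section \<open>Cross-intersecting graphs and triples\<close>

lemma compressed_pair:
  assumes "compressed V G" "{a, b} \<in> G" "a < b" "c \<in> V" "d \<in> V" "c < d" "c \<le> a" "d \<le> b"
  shows "{c, d} \<in> G"
proof -
  have 1: "{c, b} \<in> G"
  proof (cases "c = a")
    case False
    then have "insert c ({a, b} - {a}) \<in> G" using compressedD[OF assms(1,2), of a c] assms by auto
    moreover have "insert c ({a, b} - {a}) = {c, b}" using assms by auto
    ultimately show ?thesis by simp
  qed (use assms in simp)
  show ?thesis
  proof (cases "d = b")
    case False
    then have "insert d ({c, b} - {b}) \<in> G" using compressedD[OF assms(1) 1, of b d] assms by auto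
    moreover have "insert d ({c, b} - {b}) = {c, d}" using assms by auto
    ultimately show ?thesis by simp
  qed (use 1 in simp)
qed

lemma pair_of_ksets:
  fixes V :: "nat set" assumes "e \<in> ksets V 2" obtains a b where "e = {a, b}" "a < b" "a \<in> V" "b \<in> V"
proof -
  obtain a b where ab: "e = {a, b}" "a \<noteq> b" using assms by (auto simp: ksets_def card_2_iff)
  then have "a \<in> V" "b \<in> V" using assms by (auto simp: ksets_def)
  then show ?thesis using that[of a b] that[of b a] ab by (cases "a < b") auto
qed

lemma wt_ksets_1: "finite V \<Longrightarrow> wt x (ksets V 1) = sum x V"
proof (induction V rule: finite_induct)
  case empty then show ?case by (simp add: ksets_empty wt_empty)
next
  case (insert v V) then show ?case using wt_ksets_insert[of V v x 0] by simp
qed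

lemma wt_ksets_2_le:
  assumes "finite V" "\<And>v. v \<in> V \<Longrightarrow> 0 \<le> x v"
  shows "2 * wt x (ksets V 2) \<le> (sum x V)\<^sup>2"
  using wt_ksets_le[of V x 2] assms by simp

lemma insert_image_ksets:
  assumes "finite V" "v \<notin> V" "F \<subseteq> ksets V k"
  shows "insert v ` F \<subseteq> ksets (insert v V) (Suc k)"
proof
  fix e assume "e \<in> insert v ` F"
  then obtain A where A: "A \<in> ksets V k" "e = insert v A" using assms by auto
  then have "finite A" "A \<subseteq> V" "card A = k" using ksets_finite[OF assms(1) A(1)] by (auto simp: ksets_def)
  moreover then have "v \<notin> A" using assms(2) by auto
  ultimately show "e \<in> ksets (insert v V) (Suc k)" using A(2) unfolding ksets_def by auto
qed

text \<open>Any edge of \<open>H\<close> other than \<open>{v1, v2}\<close> could be shifted down to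
  \<open>{v1, v3}\<close>. So \<open>H\<close> is that single edge, every edge of \<open>G\<close>
  meets it, and the resulting quadratic form differs from the square by
  \<open>(x v1 - x v2)\<^sup>2\<close> and the square of the remaining weight.\<close>

lemma cross_graphs_aux:
  assumes V: "finite V" "\<And>v. v \<in> V \<Longrightarrow> 0 \<le> (x::nat \<Rightarrow> real) v"
    and G: "G \<subseteq> ksets V 2" and H: "H \<subseteq> ksets V 2" "H \<noteq> {}" "compressed V H" and X: "cross_intersecting G H"
    and v: "v1 \<in> V" "v2 \<in> V" "v3 \<in> V" "v1 < v2" "v2 < v3" "\<And>u. u \<in> V \<Longrightarrow> u = v1 \<or> u = v2 \<or> v3 \<le> u"
    and no: "{v1, v3} \<notin> H"
  shows "2 * (wt x G + wt x H) \<le> (sum x V)\<^sup>2"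
proof -
  have Heq: "e = {v1, v2}" if "e \<in> H" for e
  proof -
    have "e \<in> ksets V 2" using H that by auto
    then obtain a b where ab: "e = {a, b}" "a < b" "a \<in> V" "b \<in> V" by (rule pair_of_ksets)
    have "\<not> v3 \<le> b"
    proof
      assume "v3 \<le> b"
      moreover have "v1 \<le> a" using v(4,5) v(6)[OF ab(3)] by auto
      ultimately have "{v1, v3} \<in> H" using compressed_pair[OF H(3), of a b v1 v3] that ab v(1-5) by auto
      then show False using no by simp
    qed
    then have "b = v1 \<or> b = v2" "a = v1 \<or> a = v2 \<or> v3 \<le> a" using v(6)[OF ab(4)] v(6)[OF ab(3)] by auto
    then show ?thesis using ab v(4,5) by auto
  qed
  then have Hs: "H = {{v1, v2}}" using H(2) by auto
  define V1 where "V1 = V - {v1}"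
  define V2 where "V2 = V1 - {v2}"
  define R where "R = sum x V2"
  have VV: "V1 = insert v2 V2" "V = insert v1 V1" "v2 \<notin> V2" "v1 \<notin> V1" "finite V1" "finite V2"
    unfolding V1_def V2_def using v(1-5) V(1) by auto
  have nn: "0 \<le> x v1" "0 \<le> x v2" "0 \<le> R" unfolding R_def V2_def V1_def using V v(1-5) by (auto intro: sum_nonneg)
  have S1: "sum x V1 = x v2 + R" "sum x V = x v1 + x v2 + R" using VV R_def by auto
  have "G \<subseteq> insert v1 ` ksets V1 1 \<union> insert v2 ` ksets V2 1"
  proof
    fix e assume e: "e \<in> G"
    then have "e \<in> ksets V 2" using G by auto
    then obtain a b where ab: "e = {a, b}" "a < b" "a \<in> V" "b \<in> V" by (rule pair_of_ksets)
    have "e \<inter> {v1, v2} \<noteq> {}" using X e Hs unfolding cross_intersecting_def by auto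
    then consider "v1 \<in> e" | "v1 \<notin> e" "v2 \<in> e" by auto
    then show "e \<in> insert v1 ` ksets V1 1 \<union> insert v2 ` ksets V2 1"
    proof cases
      case 1
      then have "e = insert v1 (e - {v1})" by auto
      moreover have "e - {v1} \<in> ksets V1 1" unfolding ksets_def V1_def using 1 ab by (auto simp: card_insert_if)
      ultimately show ?thesis by blast
    next
      case 2
      then have "e = insert v2 (e - {v2})" by auto
      moreover have "e - {v2} \<in> ksets V2 1" unfolding ksets_def V2_def V1_def using 2 ab by (auto simp: card_insert_if)
      ultimately show ?thesis by blast
    qed
  qed
  moreover have "insert v1 ` ksets V1 1 \<subseteq> ksets V 2" "insert v2 ` ksets V2 1 \<subseteq> ksets V 2"
  proof -
    show "insert v1 ` ksets V1 1 \<subseteq> ksets V 2"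
      using insert_image_ksets[OF VV(5,4), of "ksets V1 1" 1] VV(2) by (simp add: numeral_2_eq_2)
    have "insert v2 ` ksets V2 1 \<subseteq> ksets V1 2"
      using insert_image_ksets[OF VV(6,3), of "ksets V2 1" 1] VV(1) by (simp add: numeral_2_eq_2)
    moreover have "ksets V1 2 \<subseteq> ksets V 2" by (rule ksets_mono) (use VV(2) in auto)
    ultimately show "insert v2 ` ksets V2 1 \<subseteq> ksets V 2" by (rule subset_trans)
  qed
  ultimately have "wt x G \<le> wt x (insert v1 ` ksets V1 1) + wt x (insert v2 ` ksets V2 1)"
    using wt_mono[of V G "insert v1 ` ksets V1 1 \<union> insert v2 ` ksets V2 1" 2 x]
      wt_Un_le[of V "insert v1 ` ksets V1 1" 2 "insert v2 ` ksets V2 1" x] V by simp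
  also have "\<dots> = x v1 * (x v2 + R) + x v2 * R"
    using wt_insert_image[of V1 "ksets V1 1" 1 v1 x] wt_insert_image[of V2 "ksets V2 1" 1 v2 x]
      VV S1 R_def by (simp add: wt_ksets_1[simplified])
  finally have "wt x G \<le> x v1 * (x v2 + R) + x v2 * R" .
  moreover have "wt x H = x v1 * x v2" unfolding Hs wt_def using v(4) by simp
  ultimately have "2 * (wt x G + wt x H) \<le> 2 * (x v1 * (x v2 + R) + x v2 * R + x v1 * x v2)" by simp
  also have "\<dots> = (x v1 + x v2 + R)\<^sup>2 - ((x v1 - x v2)\<^sup>2 + R\<^sup>2)" by (simp add: power2_eq_square algebra_simps)
  also have "\<dots> \<le> (x v1 + x v2 + R)\<^sup>2" by simp
  finally show ?thesis using S1 by simp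
qed

lemma star_graph_le:
  assumes V: "finite V" "\<And>v. v \<in> V \<Longrightarrow> 0 \<le> (x::nat \<Rightarrow> real) v" "v \<in> V"
    and G: "G \<subseteq> ksets V 2" "\<And>e. e \<in> G \<Longrightarrow> v \<in> e"
  shows "4 * wt x G \<le> (sum x V)\<^sup>2"
proof -
  define U where "U = V - {v}"
  define R where "R = sum x U"
  have U: "V = insert v U" "v \<notin> U" "finite U" unfolding U_def using V by auto
  have nn: "0 \<le> x v" "0 \<le> R" unfolding R_def U_def using V by (auto intro: sum_nonneg)
  have "link v G \<subseteq> ksets U 1" using link_subset[of V G 1 v] V G U_def by (simp add: numeral_2_eq_2)
  then have "wt x (link v G) \<le> R"
    using wt_mono[of U "link v G" "ksets U 1" 1 x] wt_ksets_1[of U x] V U R_def by auto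
  moreover have "G = {e \<in> G. v \<in> e}" using G by auto
  then have "wt x G = x v * wt x (link v G)" using wt_containing[of V G 1 x v] V G by (simp add: numeral_2_eq_2)
  ultimately have "wt x G \<le> x v * R" using nn by (simp add: mult_left_mono)
  then have "4 * wt x G \<le> 4 * (x v * R)" by simp
  also have "\<dots> = (x v + R)\<^sup>2 - (x v - R)\<^sup>2" by (simp add: power2_eq_square algebra_simps)
  also have "\<dots> \<le> (x v + R)\<^sup>2" by simp
  finally show ?thesis using U R_def by simp
qed

text \<open>For graphs the bound can fail, but only in a configuration that the last two
  alternatives pin down. An edge missing \<open>v1\<close> shifts down to \<open>{v2, v3}\<close>;
  if there is none, both graphs are stars at \<open>v1\<close>, and otherwise the absence of
  \<open>{v1, v3}\<close> in the other graph leads back to a single edge.\<close>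

lemma cross_graphs:
  assumes V: "finite V" "\<And>v. v \<in> V \<Longrightarrow> 0 \<le> (x::nat \<Rightarrow> real) v"
    and G: "G \<subseteq> ksets V 2" "compressed V G" and H: "H \<subseteq> ksets V 2" "compressed V H" and X: "cross_intersecting G H"
    and v: "v1 \<in> V" "v2 \<in> V" "v3 \<in> V" "v1 < v2" "v2 < v3" "\<And>u. u \<in> V \<Longrightarrow> u = v1 \<or> u = v2 \<or> v3 \<le> u"
  shows "2 * (wt x G + wt x H) \<le> (sum x V)\<^sup>2 \<or> ({v2, v3} \<in> G \<and> {v1, v3} \<in> H) \<or> ({v2, v3} \<in> H \<and> {v1, v3} \<in> G)"
proof -
  have escape: "{v2, v3} \<in> F" if "F \<subseteq> ksets V 2" "compressed V F" "e \<in> F" "v1 \<notin> e" for F e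
  proof -
    have "e \<in> ksets V 2" using that by auto
    then obtain a b where ab: "e = {a, b}" "a < b" "a \<in> V" "b \<in> V" by (rule pair_of_ksets)
    then have "v2 \<le> a" "v3 \<le> b" using v(6)[OF ab(3)] v(6)[OF ab(4)] that(4) v(4,5) by auto
    then show ?thesis using compressed_pair[OF that(2), of a b v2 v3] that(3) ab v(1-5) by auto
  qed
  consider "G = {}" | "H = {}" | "G \<noteq> {}" "H \<noteq> {}" "\<forall>e\<in>G. v1 \<in> e" "\<forall>e\<in>H. v1 \<in> e"
    | "G \<noteq> {}" "H \<noteq> {}" "{v2, v3} \<in> G" | "G \<noteq> {}" "H \<noteq> {}" "{v2, v3} \<in> H"
    using escape[OF G] escape[OF H] by blast
  then show ?thesis
  proof cases
    case 1
    then show ?thesis using wt_le[of V H 2 x] V H by (simp add: wt_empty)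
  next
    case 2
    then show ?thesis using wt_le[of V G 2 x] V G by (simp add: wt_empty)
  next
    case 3
    have "4 * wt x G \<le> (sum x V)\<^sup>2" by (rule star_graph_le[of V x v1 G, OF V v(1) G(1)]) (use 3 in auto)
    moreover have "4 * wt x H \<le> (sum x V)\<^sup>2" by (rule star_graph_le[of V x v1 H, OF V v(1) H(1)]) (use 3 in auto)
    ultimately show ?thesis by auto
  next
    case 4
    then show ?thesis using cross_graphs_aux[of V x G H v1 v2 v3, OF V G(1) H(1) _ H(2) X v] by blast
  next
    case 5
    then show ?thesis using cross_graphs_aux[of V x H G v1 v2 v3, OF V H(1) G(1) _ G(2) cross_sym[OF X] v] by (auto simp: add.commute)
  qed
qed

text \<open>Shifting the largest vertex \<open>n\<close> puts every \<open>{p, q, v}\<close> into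
  the second family. A triple avoiding both \<open>p\<close> and \<open>q\<close> would be disjoint
  from one of these, as it occupies with them only five of at least six vertices.\<close>

lemma cross_hits:
  assumes "finite V" "\<A> \<subseteq> ksets V 3" "compressed V \<B>" "cross_intersecting \<A> \<B>"
    "\<And>v. v \<in> V \<Longrightarrow> v \<le> n" "6 \<le> card V" "{p, q, n} \<in> \<B>" "p \<noteq> n" "q \<noteq> n" "A \<in> \<A>"
  shows "p \<in> A \<or> q \<in> A"
proof (rule ccontr)
  assume no: "\<not> (p \<in> A \<or> q \<in> A)"
  have A: "finite A" "card A = 3" "A \<subseteq> V" using assms(2,10) ksets_finite[OF assms(1), of A 3] by (auto simp: ksets_def)
  have "card (insert p (insert q A)) \<le> 5" using A by (simp add: card_insert_if)
  then have "\<not> V \<subseteq> insert p (insert q A)" using card_mono[of "insert p (insert q A)" V] A assms(6) by auto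
  then obtain v where v: "v \<in> V" "v \<noteq> p" "v \<noteq> q" "v \<notin> A" by auto
  have "{p, q, v} \<in> \<B>"
  proof (cases "v = n")
    case False
    then have "v < n" using assms(5)[OF v(1)] by simp
    then have "insert v ({p, q, n} - {n}) \<in> \<B>" using compressedD[OF assms(3,7), of n v] v by auto
    moreover have "insert v ({p, q, n} - {n}) = {p, q, v}" using assms v by auto
    ultimately show ?thesis by simp
  qed (use assms in simp)
  then have "A \<inter> {p, q, v} \<noteq> {}" using assms(4,10) unfolding cross_intersecting_def by blast
  then show False using no v by auto
qed

text \<open>The exceptional pair of links determines the shape of the triples: members of the first
  family contain \<open>v1\<close> or both \<open>v2\<close> and \<open>v3\<close>, members of the
  second contain two of the three. Both weights become cubic polynomials in the weights
  \<open>a\<close>, \<open>b\<close>, \<open>c\<close> of these vertices and the total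
  \<open>d\<close> of all others.\<close>

lemma cross_triples_special:
  assumes V: "finite V" "\<And>v. v \<in> V \<Longrightarrow> 0 \<le> (x::nat \<Rightarrow> real) v"
    and A: "\<A> \<subseteq> ksets V 3" "compressed V \<A>" and B: "\<B> \<subseteq> ksets V 3" "compressed V \<B>"
    and X: "cross_intersecting \<A> \<B>"
    and v: "v1 \<in> V" "v2 \<in> V" "v3 \<in> V" "v1 < v2" "v2 < v3"
    and n: "\<And>v. v \<in> V \<Longrightarrow> v \<le> n" "v3 < n" "6 \<le> card V"
    and e: "{v2, v3, n} \<in> \<A>" "{v1, v3, n} \<in> \<B>"
  shows "6 * (wt x \<A> + wt x \<B>) \<le> (sum x V) ^ 3"
proof -
  have B2: "{v1, v2, n} \<in> \<B>"
  proof -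
    have "insert v2 ({v1, v3, n} - {v3}) \<in> \<B>" using compressedD[OF B(2) e(2), of v3 v2] v n by auto
    moreover have "insert v2 ({v1, v3, n} - {v3}) = {v1, v2, n}" using v n by auto
    ultimately show ?thesis by simp
  qed
  have A2: "{v1, v3, n} \<in> \<A>"
  proof -
    have "insert v1 ({v2, v3, n} - {v2}) \<in> \<A>" using compressedD[OF A(2) e(1), of v2 v1] v n by auto
    moreover have "insert v1 ({v2, v3, n} - {v2}) = {v1, v3, n}" using v n by auto
    ultimately show ?thesis by simp
  qed
  have A3: "{v1, v2, n} \<in> \<A>"
  proof -
    have "insert v2 ({v1, v3, n} - {v3}) \<in> \<A>" using compressedD[OF A(2) A2, of v3 v2] v n by auto
    moreover have "insert v2 ({v1, v3, n} - {v3}) = {v1, v2, n}" using v n by auto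
    ultimately show ?thesis by simp
  qed
  have hA: "v1 \<in> S \<or> (v2 \<in> S \<and> v3 \<in> S)" if "S \<in> \<A>" for S
    using cross_hits[OF V(1) A(1) B(2) X n(1) n(3) B2 _ _ that] cross_hits[OF V(1) A(1) B(2) X n(1) n(3) e(2) _ _ that] v n by auto
  have hB: "(v1 \<in> S \<and> v2 \<in> S) \<or> (v1 \<in> S \<and> v3 \<in> S) \<or> (v2 \<in> S \<and> v3 \<in> S)" if "S \<in> \<B>" for S
    using cross_hits[OF V(1) B(1) A(2) cross_sym[OF X] n(1) n(3) A3 _ _ that]
      cross_hits[OF V(1) B(1) A(2) cross_sym[OF X] n(1) n(3) A2 _ _ that]
      cross_hits[OF V(1) B(1) A(2) cross_sym[OF X] n(1) n(3) e(1) _ _ that] v n by auto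
  define U where "U = V - {v1, v2, v3}"
  define a b c d where "a = x v1" and "b = x v2" and "c = x v3" and "d = sum x U"
  have U: "finite U" "v1 \<notin> U" "v2 \<notin> U" "v3 \<notin> U" "V = insert v1 (insert v2 (insert v3 U))"
    unfolding U_def using V v by auto
  have nn: "0 \<le> a" "0 \<le> b" "0 \<le> c" "0 \<le> d" unfolding a_def b_def c_def d_def U_def using V v by (auto intro: sum_nonneg)
  have SV: "sum x V = a + b + c + d" unfolding a_def b_def c_def d_def using U v by simp
  define K where "K = ksets U 1"
  have wK: "wt x K = d" "K \<subseteq> ksets U 1" unfolding K_def d_def using wt_ksets_1 U by auto
  have K: "e - {p, q} \<in> K" if "e \<in> ksets V 3" "p \<in> e" "q \<in> e" "p \<noteq> q" "{v1, v2, v3} = {p, q, w}" "w \<notin> e" for e p q w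
  proof -
    have "finite e" "card e = 3" using that ksets_finite[OF V(1), of e 3] by (auto simp: ksets_def)
    then have "card (e - {p, q}) = 1" using that by (simp add: card_Diff_subset)
    moreover have "e - {p, q} \<subseteq> U" using that unfolding U_def ksets_def by auto
    ultimately show ?thesis unfolding K_def ksets_def by simp
  qed
  have in3: "insert p (insert q k) \<in> ksets V 3" if "k \<in> K" "p \<noteq> q" "p \<in> {v1,v2,v3}" "q \<in> {v1,v2,v3}" for p q k
  proof -
    have k: "finite k" "card k = 1" "k \<subseteq> U" using that ksets_finite[OF U(1), of k 1] unfolding K_def by (auto simp: ksets_def)
    have "p \<notin> k" "q \<notin> k" using that k U by auto
    then show ?thesis using k that v unfolding ksets_def U_def by auto
  qed
  have w2: "wt x (insert p ` insert q ` K) = x p * x q * d" if "p \<noteq> q" "p \<in> {v1,v2,v3}" "q \<in> {v1,v2,v3}" for p q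
  proof -
    have 1: "wt x (insert q ` K) = x q * d" using wt_insert_image[OF U(1) wK(2), of q x] wK that U by auto
    have "insert q ` K \<subseteq> ksets (insert q U) 2"
    proof
      fix z assume "z \<in> insert q ` K"
      then obtain k where k: "k \<in> K" "z = insert q k" by auto
      then have "finite k" "card k = 1" "k \<subseteq> U" using ksets_finite[OF U(1), of k 1] unfolding K_def by (auto simp: ksets_def)
      moreover then have "q \<notin> k" using that U by auto
      ultimately show "z \<in> ksets (insert q U) 2" using k unfolding ksets_def by auto
    qed
    then show ?thesis using wt_insert_image[of "insert q U" "insert q ` K" 2 p x] U that 1 by auto
  qed
  define A1 where "A1 = {e \<in> ksets V 3. v1 \<in> e}"
  define F where "F = (\<lambda>p q. insert p ` insert q ` K)"
  have Fs: "F p q \<subseteq> ksets V 3" if "p \<noteq> q" "p \<in> {v1,v2,v3}" "q \<in> {v1,v2,v3}" for p q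
    unfolding F_def using in3 that by auto
  have Fi: "e \<in> F p q" if "e \<in> ksets V 3" "p \<in> e" "q \<in> e" "p \<noteq> q" "{v1, v2, v3} = {p, q, w}" "w \<notin> e" for e p q w
  proof -
    have "e = insert p (insert q (e - {p, q}))" using that by auto
    then show ?thesis unfolding F_def using K[OF that] by blast
  qed
  have "\<A> \<subseteq> A1 \<union> F v2 v3"
  proof
    fix S assume S: "S \<in> \<A>"
    then have "S \<in> ksets V 3" using A by auto
    then show "S \<in> A1 \<union> F v2 v3" using hA[OF S] Fi[of S v2 v3 v1] v unfolding A1_def by auto
  qed
  moreover have A1s: "A1 \<subseteq> ksets V 3" unfolding A1_def by auto
  ultimately have wA: "wt x \<A> \<le> wt x A1 + b * c * d"
    using wt_mono[of V \<A> "A1 \<union> F v2 v3" 3 x] wt_Un_le[of V A1 3 "F v2 v3" x] Fs[of v2 v3] w2[of v2 v3] V v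
    unfolding F_def b_def c_def by auto
  have wA1: "wt x A1 \<le> a * (d\<^sup>2 / 2 + (b + c) * d + b * c)"
  proof -
    define V' where "V' = insert v2 (insert v3 U)"
    have V': "finite V'" "v1 \<notin> V'" "V = insert v1 V'" using U v V'_def by auto
    have "wt x A1 = a * wt x (link v1 (ksets V 3))"
      unfolding A1_def a_def using wt_containing[of V "ksets V 3" 2 x v1] V by (simp add: numeral_3_eq_3 numeral_2_eq_2)
    also have "link v1 (ksets V 3) = ksets V' 2" using link_ksets[OF V'(1,2), of 2] V' by (simp add: numeral_3_eq_3 numeral_2_eq_2)
    also have "wt x (ksets V' 2) = wt x (ksets U 2) + c * wt x (ksets U 1) + b * (wt x (ksets U 1) + c * 1)"
      unfolding V'_def b_def c_def
      using wt_ksets_insert[of "insert v3 U" v2 x 1] wt_ksets_insert[of U v3 x 1] wt_ksets_insert[of U v3 x 0] U v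
      by (simp add: numeral_2_eq_2)
    finally have "wt x A1 = a * (wt x (ksets U 2) + c * d + b * (d + c))" using wK K_def by simp
    moreover have "wt x (ksets U 2) \<le> d\<^sup>2 / 2" using wt_ksets_2_le[of U x] U V unfolding d_def by auto
    ultimately show ?thesis using nn mult_left_mono[of "wt x (ksets U 2)" "d\<^sup>2 / 2" a] by (simp add: algebra_simps)
  qed
  have "\<B> \<subseteq> (F v1 v2 \<union> F v1 v3) \<union> (F v2 v3 \<union> {{v1, v2, v3}})"
  proof
    fix S assume S: "S \<in> \<B>"
    then have Sk: "S \<in> ksets V 3" using B by auto
    show "S \<in> (F v1 v2 \<union> F v1 v3) \<union> (F v2 v3 \<union> {{v1, v2, v3}})"
    proof (cases "v1 \<in> S \<and> v2 \<in> S \<and> v3 \<in> S")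
      case True
      then have "{v1, v2, v3} \<subseteq> S" "finite S" "card S = card {v1, v2, v3}"
        using Sk ksets_finite[OF V(1) Sk] v by (auto simp: ksets_def)
      then have "{v1, v2, v3} = S" using card_subset_eq by metis
      then show ?thesis by auto
    next
      case False
      then show ?thesis using hB[OF S] Fi[OF Sk, of v1 v2 v3] Fi[OF Sk, of v1 v3 v2] Fi[OF Sk, of v2 v3 v1] v by auto
    qed
  qed
  moreover have T: "{{v1, v2, v3}} \<subseteq> ksets V 3" using v by (auto simp: ksets_def)
  moreover have wT: "wt x {{v1, v2, v3}} = a * b * c" unfolding wt_def a_def b_def c_def using v by simp
  ultimately have wB: "wt x \<B> \<le> (a * b * d + a * c * d) + (b * c * d + a * b * c)"
  proof -
    assume sub: "\<B> \<subseteq> (F v1 v2 \<union> F v1 v3) \<union> (F v2 v3 \<union> {{v1, v2, v3}})"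
    have f: "F v1 v2 \<subseteq> ksets V 3" "F v1 v3 \<subseteq> ksets V 3" "F v2 v3 \<subseteq> ksets V 3" using Fs v by auto
    have "wt x \<B> \<le> wt x ((F v1 v2 \<union> F v1 v3) \<union> (F v2 v3 \<union> {{v1, v2, v3}}))"
      by (rule wt_mono[of V _ _ 3]) (use sub f T V in auto)
    also have "\<dots> \<le> wt x (F v1 v2 \<union> F v1 v3) + wt x (F v2 v3 \<union> {{v1, v2, v3}})"
      by (rule wt_Un_le[of V _ 3]) (use f T V in auto)
    also have "\<dots> \<le> (wt x (F v1 v2) + wt x (F v1 v3)) + (wt x (F v2 v3) + wt x {{v1, v2, v3}})"
      by (intro add_mono wt_Un_le[of V _ 3]) (use f T V in auto)
    also have "\<dots> = (a * b * d + a * c * d) + (b * c * d + a * b * c)"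
      unfolding wT unfolding F_def using w2[of v1 v2] w2[of v1 v3] w2[of v2 v3] v a_def b_def c_def by simp
    finally show ?thesis .
  qed
  have "6 * (wt x \<A> + wt x \<B>) \<le> 6 * ((a * (d\<^sup>2 / 2 + (b + c) * d + b * c) + b * c * d) + ((a * b * d + a * c * d) + (b * c * d + a * b * c)))"
    using wA wA1 wB by simp
  \<comment> \<open>An explicit certificate: the difference from the cube is a sum of products of
    nonnegative quantities and squares.\<close>
  also have "\<dots> = (a + b + c + d) ^ 3 - (a ^ 3 + b ^ 3 + c ^ 3 + d ^ 3 + 3 * b * (a - d)\<^sup>2 + 3 * c * (a - d)\<^sup>2
       + 3 * d * (b - c)\<^sup>2 + 3 * a * (b - c)\<^sup>2 + 3 * a\<^sup>2 * d + 3 * b\<^sup>2 * c + 3 * b * c\<^sup>2)"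
    by (simp add: power2_eq_square power3_eq_cube algebra_simps)
  also have "\<dots> \<le> (a + b + c + d) ^ 3"
  proof -
    have "0 \<le> a ^ 3 + b ^ 3 + c ^ 3 + d ^ 3 + 3 * b * (a - d)\<^sup>2 + 3 * c * (a - d)\<^sup>2
       + 3 * d * (b - c)\<^sup>2 + 3 * a * (b - c)\<^sup>2 + 3 * a\<^sup>2 * d + 3 * b\<^sup>2 * c + 3 * b * c\<^sup>2"
      using nn by (intro add_nonneg_nonneg mult_nonneg_nonneg) auto
    then show ?thesis by linarith
  qed
  finally show ?thesis using SV by simp
qed

lemma three_smallest:
  fixes V :: "nat set" assumes "finite V" "3 \<le> card V"
  obtains v1 v2 v3 where "v1 \<in> V" "v2 \<in> V" "v3 \<in> V" "v1 < v2" "v2 < v3" "\<And>u. u \<in> V \<Longrightarrow> u = v1 \<or> u = v2 \<or> v3 \<le> u"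
proof -
  define v1 where "v1 = Min V"
  have ne: "V \<noteq> {}" using assms by auto
  have v1: "v1 \<in> V" "\<And>u. u \<in> V \<Longrightarrow> v1 \<le> u" unfolding v1_def using assms ne by auto
  have c1: "card (V - {v1}) \<ge> 2" using assms v1 by simp
  then have ne1: "V - {v1} \<noteq> {}" by (metis card.empty not_numeral_le_zero)
  define v2 where "v2 = Min (V - {v1})"
  have v2: "v2 \<in> V - {v1}" "\<And>u. u \<in> V - {v1} \<Longrightarrow> v2 \<le> u" unfolding v2_def using assms ne1
    by (auto intro: Min_in Min_le) (use Min_in[of "V - {v1}"] in auto)
  have c2: "card (V - {v1} - {v2}) \<ge> 1" using c1 v2(1) assms by simp
  then have ne2: "V - {v1} - {v2} \<noteq> {}" by (metis card.empty not_one_le_zero)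
  define v3 where "v3 = Min (V - {v1} - {v2})"
  have v3: "v3 \<in> V - {v1} - {v2}" "\<And>u. u \<in> V - {v1} - {v2} \<Longrightarrow> v3 \<le> u" unfolding v3_def
    using Min_in[of "V - {v1} - {v2}"] Min_le[of "V - {v1} - {v2}"] assms ne2 by auto
  have "v1 < v2" using v1(2)[of v2] v2(1) by force
  moreover have "v2 < v3" using v2(2)[of v3] v3(1) by force
  ultimately show ?thesis using that[of v1 v2 v3] v1 v2 v3 by blast
qed

text \<open>Induction on \<open>card V + j\<close> by removing the largest vertex \<open>n\<close>.
  The members avoiding \<open>n\<close> and the links at \<open>n\<close> are again compressed and
  cross-intersecting, and their bounds are the first two terms of the expanded power.\<close>

theorem cross_sum:
  assumes "finite V" "\<And>v. v \<in> V \<Longrightarrow> 0 \<le> (x::nat \<Rightarrow> real) v" "3 \<le> j"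
    and "\<A> \<subseteq> ksets V j" "compressed V \<A>" "\<B> \<subseteq> ksets V j" "compressed V \<B>" "cross_intersecting \<A> \<B>"
  shows "fact j * (wt x \<A> + wt x \<B>) \<le> (sum x V) ^ j"
  using assms
proof (induction "card V + j" arbitrary: V j \<A> \<B> rule: less_induct)
  case less
  note IH = less.hyps and P = less.prems
  show ?case
  proof (cases "card V \<le> 2 * j - 1")
    case True
    then show ?thesis using cross_small[of V x j] P by auto
  next
    case False
    then have cV: "2 * j \<le> card V" using P(3) by linarith
    obtain k where k: "j = Suc k" "2 \<le> k" using P(3) by (cases j) auto
    have ne: "V \<noteq> {}" using cV P(3) by auto
    define n where "n = Max V"
    have n: "n \<in> V" "\<And>v. v \<in> V \<Longrightarrow> v \<le> n" unfolding n_def using ne P(1) by auto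
    define V' where "V' = V - {n}"
    have V': "finite V'" "card V' < card V" "\<And>v. v \<in> V' \<Longrightarrow> 0 \<le> x v" "card V' = card V - 1" unfolding V'_def
      using P(1,2) card_Diff1_less[OF P(1) n(1)] card_Diff_singleton[OF n(1)] by auto
    define S where "S = sum x V'"
    have S0: "0 \<le> S" unfolding S_def using V' by (auto intro: sum_nonneg)
    have xn: "0 \<le> x n" using P n by auto
    have SV: "sum x V = S + x n" unfolding S_def V'_def using n P by (simp add: sum.remove)
    define LA where "LA = link n \<A>"
    define LB where "LB = link n \<B>"
    have L: "LA \<subseteq> ksets V' k" "LB \<subseteq> ksets V' k" "compressed V' LA" "compressed V' LB"
      unfolding LA_def LB_def V'_def using link_subset[of V] compressed_link P k by auto
    have LX: "cross_intersecting LA LB" unfolding LA_def LB_def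
      using cross_link[of V \<A> k \<B> n] P k n cV by auto
    define A' where "A' = {A \<in> \<A>. n \<notin> A}"
    define B' where "B' = {A \<in> \<B>. n \<notin> A}"
    have A'B': "A' \<subseteq> ksets V' j" "B' \<subseteq> ksets V' j" "compressed V' A'" "compressed V' B'" "cross_intersecting A' B'"
      unfolding A'_def B'_def V'_def using P compressed_avoid by (auto simp: ksets_def cross_intersecting_def)
    have I1: "fact j * (wt x A' + wt x B') \<le> S ^ j"
      unfolding S_def by (rule IH) (use V' P A'B' in auto)
    have sp: "wt x \<A> = wt x A' + x n * wt x LA" "wt x \<B> = wt x B' + x n * wt x LB"
      unfolding A'_def B'_def LA_def LB_def using wt_split[of V _ k x n] P k by auto
    have fin: "fact j * (wt x \<A> + wt x \<B>) \<le> (sum x V) ^ j" if "fact k * (wt x LA + wt x LB) \<le> S ^ k"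
    proof -
      have "fact j * (wt x \<A> + wt x \<B>) = fact j * (wt x A' + wt x B') + real j * x n * (fact k * (wt x LA + wt x LB))"
        unfolding sp k by (simp add: algebra_simps)
      also have "\<dots> \<le> S ^ j + real j * x n * S ^ k" using I1 that xn by (intro add_mono mult_left_mono) auto
      also have "\<dots> \<le> (S + x n) ^ j" unfolding k using pow_add_ge[OF S0 xn, of k] by simp
      finally show ?thesis using SV by simp
    qed
    show ?thesis
    proof (cases "3 \<le> k")
      case True
      have "fact k * (wt x LA + wt x LB) \<le> S ^ k"
        unfolding S_def by (rule IH) (use V' k True L LX in auto)
      then show ?thesis by (rule fin)
    next
      case False
      \<comment> \<open>The links are graphs, where the inductive bound may be false; in the
        exceptional configuration the triples are bounded directly instead.\<close>
      then have k2: "k = 2" "j = 3" using k by auto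
      have "5 \<le> card V'" using V' cV k2 by linarith
      then obtain v1 v2 v3 where v: "v1 \<in> V'" "v2 \<in> V'" "v3 \<in> V'" "v1 < v2" "v2 < v3"
        "\<And>u. u \<in> V' \<Longrightarrow> u = v1 \<or> u = v2 \<or> v3 \<le> u" using three_smallest[OF V'(1)] by auto
      have vV: "v1 \<in> V" "v2 \<in> V" "v3 \<in> V" "v3 < n" using v n(2)[of v3] unfolding V'_def by auto
      have m: "insert n {p, q} = {p, q, n}" for p q :: nat by auto
      have "2 * (wt x LA + wt x LB) \<le> S\<^sup>2 \<or> ({v2, v3} \<in> LA \<and> {v1, v3} \<in> LB) \<or> ({v2, v3} \<in> LB \<and> {v1, v3} \<in> LA)"
        unfolding S_def using cross_graphs[of V' x LA LB v1 v2 v3] V' L LX v k2 by blast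
      then show ?thesis
      proof (elim disjE)
        assume "2 * (wt x LA + wt x LB) \<le> S\<^sup>2"
        then show ?thesis using fin k2 by simp
      next
        assume "{v2, v3} \<in> LA \<and> {v1, v3} \<in> LB"
        then have "{v2, v3, n} \<in> \<A>" "{v1, v3, n} \<in> \<B>" unfolding LA_def LB_def link_def by (auto simp: m)
        then have "6 * (wt x \<A> + wt x \<B>) \<le> (sum x V) ^ 3"
          using cross_triples_special[of V x \<A> \<B> v1 v2 v3 n] P k2 v vV n cV by auto
        then show ?thesis using k2 by (simp add: fact_numeral)
      next
        assume "{v2, v3} \<in> LB \<and> {v1, v3} \<in> LA"
        then have "{v2, v3, n} \<in> \<B>" "{v1, v3, n} \<in> \<A>" unfolding LA_def LB_def link_def by (auto simp: m)
        then have "6 * (wt x \<B> + wt x \<A>) \<le> (sum x V) ^ 3"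
          using cross_triples_special[of V x \<B> \<A> v1 v2 v3 n] P k2 v vV n cV cross_sym[OF P(8)] by auto
        then show ?thesis using k2 by (simp add: fact_numeral add.commute)
      qed
    qed
  qed
qed

section \<open>Compressed intersecting families\<close>

text \<open>Among the intersecting families of no smaller weight one with the least total of labels
  is compressed: a possible shift would preserve the intersection property, not lower the weight
  since \<open>x\<close> decreases, and lower the total.\<close>

lemma compress_exists:
  assumes E: "E \<subseteq> ksets {..<n} r" "cross_intersecting E E"
    and x: "\<And>v. 0 \<le> (x::nat \<Rightarrow> real) v" "antimono x"
  obtains E' where "E' \<subseteq> ksets {..<n} r" "cross_intersecting E' E'" "compressed {..<n} E'" "wt x E \<le> wt x E'"
proof -
  define pot where "pot F = (\<Sum>e\<in>F. \<Sum>e)" for F :: "nat set set"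
  define P where "P F \<longleftrightarrow> F \<subseteq> ksets {..<n} r \<and> cross_intersecting F F \<and> wt x E \<le> wt x F" for F
  have "P E" using E P_def by auto
  then obtain F where F: "P F" "\<And>F'. P F' \<Longrightarrow> pot F \<le> pot F'"
    using ex_has_least_nat[of P E pot] by auto
  have Fk: "F \<subseteq> ksets {..<n} r" and FX: "cross_intersecting F F" using F P_def by auto
  have finF: "finite F" using finite_fam[OF _ Fk] by simp
  have fe: "finite e" if "e \<in> F" for e using finite_edge[OF _ Fk that] by simp
  have "compressed {..<n} F"
  proof (rule ccontr)
    assume "\<not> compressed {..<n} F"
    then obtain e0 j i where e0: "e0 \<in> F" "j \<in> e0" "i \<in> {..<n}" "i < j" "i \<notin> e0" "insert i (e0 - {j}) \<notin> F"
      unfolding compressed_def by blast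
    \<comment> \<open>An edge is moved only if its image is not yet present; this keeps the shift
      injective.\<close>
    define mv where "mv e \<longleftrightarrow> j \<in> e \<and> i \<notin> e \<and> insert i (e - {j}) \<notin> F" for e
    define T where "T e = (if mv e then insert i (e - {j}) else e)" for e
    have mv0: "mv e0" using e0 mv_def by auto
    have Tk: "T e \<in> ksets {..<n} r" if "e \<in> F" for e
    proof (cases "mv e")
      case True
      then have ji: "j \<in> e" "i \<notin> e" by (auto simp: mv_def)
      then have "card (insert i (e - {j})) = card e" using fe[OF that] card.remove[of e j] by simp
      moreover have "e \<subseteq> {..<n}" "card e = r" using Fk that by (auto simp: ksets_def)
      ultimately show ?thesis using True e0(3) unfolding T_def ksets_def by auto
    qed (use Fk that T_def in auto)
    have inj: "inj_on T F"
    proof (rule inj_onI)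
      fix a b assume ab: "a \<in> F" "b \<in> F" "T a = T b"
      consider "mv a" "mv b" | "mv a" "\<not> mv b" | "\<not> mv a" "mv b" | "\<not> mv a" "\<not> mv b" by blast
      then show "a = b"
      proof cases
        case 1
        then have "insert i (a - {j}) = insert i (b - {j})" using ab T_def by simp
        moreover have "i \<notin> a - {j}" "i \<notin> b - {j}" "j \<in> a" "j \<in> b" using 1 mv_def by auto
        ultimately have "a - {j} = b - {j}" by (metis insert_ident)
        then show ?thesis using \<open>j \<in> a\<close> \<open>j \<in> b\<close> by (metis insert_Diff)
      qed (use ab T_def mv_def in auto)
    qed
    \<comment> \<open>If the unmoved edge \<open>b\<close> contains \<open>j\<close> but not
      \<open>i\<close>, it was blocked, so its shifted version already lies in \<open>F\<close> and
      has to meet \<open>a\<close>.\<close>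
    have TX: "T a \<inter> T b \<noteq> {}" if ab: "a \<in> F" "b \<in> F" "mv a" "\<not> mv b" for a b
    proof
      assume em: "T a \<inter> T b = {}"
      have Ta: "T a = insert i (a - {j})" and Tb: "T b = b" using ab T_def by auto
      have ib: "i \<notin> b" using em Ta Tb by auto
      have "a \<inter> b \<noteq> {}" using FX ab unfolding cross_intersecting_def by blast
      then have jb: "j \<in> b" using em Ta Tb by auto
      then have "insert i (b - {j}) \<in> F" using ab ib mv_def by auto
      then have "a \<inter> insert i (b - {j}) \<noteq> {}" using FX ab unfolding cross_intersecting_def by blast
      then show False using em Ta Tb ab(3) mv_def by auto
    qed
    have X: "cross_intersecting (T ` F) (T ` F)"
      unfolding cross_intersecting_def
    proof (intro ballI)
      fix A B assume "A \<in> T ` F" "B \<in> T ` F"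
      then obtain a b where ab: "a \<in> F" "b \<in> F" "A = T a" "B = T b" by auto
      consider "mv a" "mv b" | "mv a" "\<not> mv b" | "\<not> mv a" "mv b" | "\<not> mv a" "\<not> mv b" by blast
      then show "A \<inter> B \<noteq> {}"
      proof cases
        case 1 then show ?thesis using ab T_def by auto
      next
        case 2 then show ?thesis using TX[of a b] ab by auto
      next
        case 3 then show ?thesis using TX[of b a] ab by (auto simp: Int_commute)
      next
        case 4 then show ?thesis using FX ab T_def unfolding cross_intersecting_def by auto
      qed
    qed
    have "wt x F \<le> wt x (T ` F)"
    proof -
      have "wt x (T ` F) = (\<Sum>e\<in>F. \<Prod>v\<in>T e. x v)" unfolding wt_def by (simp add: sum.reindex[OF inj])
      moreover have "(\<Prod>v\<in>e. x v) \<le> (\<Prod>v\<in>T e. x v)" if "e \<in> F" for e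
      proof (cases "mv e")
        case True
        then have "(\<Prod>v\<in>e. x v) = x j * (\<Prod>v\<in>e - {j}. x v)" using fe[OF that] by (simp add: mv_def prod.remove)
        also have "\<dots> \<le> x i * (\<Prod>v\<in>e - {j}. x v)"
          using x e0 by (intro mult_right_mono prod_nonneg) (auto simp: antimono_def)
        also have "\<dots> = (\<Prod>v\<in>T e. x v)" using True fe[OF that] by (simp add: T_def mv_def)
        finally show ?thesis .
      qed (simp add: T_def)
      ultimately show ?thesis unfolding wt_def by (simp add: sum_mono)
    qed
    then have "P (T ` F)" using X Tk F(1) unfolding P_def by auto
    then have "pot F \<le> pot (T ` F)" by (rule F(2))
    moreover have "pot (T ` F) = (\<Sum>e\<in>F. \<Sum>(T e))" unfolding pot_def by (simp add: sum.reindex[OF inj])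
    moreover have "(\<Sum>e\<in>F. \<Sum>(T e)) < (\<Sum>e\<in>F. \<Sum>e)"
    proof (rule sum_strict_mono_ex1[OF finF])
      have lt: "\<Sum>(T e) < \<Sum>e" if "e \<in> F" "mv e" for e
      proof -
        have "\<Sum>(T e) = i + \<Sum>(e - {j})" using that fe by (simp add: T_def mv_def)
        moreover have "\<Sum>e = j + \<Sum>(e - {j})" using that(2) fe[OF that(1)] sum.remove[of e j "\<lambda>v. v"] by (simp add: mv_def)
        ultimately show ?thesis using e0 by simp
      qed
      then show "\<exists>e\<in>F. \<Sum>(T e) < \<Sum>e" using e0(1) mv0 by blast
      show "\<forall>e\<in>F. \<Sum>(T e) \<le> \<Sum>e"
      proof
        fix e assume "e \<in> F"
        then show "\<Sum>(T e) \<le> \<Sum>e" using lt[of e] by (cases "mv e") (auto simp: T_def)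
      qed
    qed
    ultimately show False unfolding pot_def by simp
  qed
  then show ?thesis using that F(1) unfolding P_def by blast
qed

text \<open>If every prefix of \<open>e\<close> were at most half full, there would always be room
  to push a second member further away from \<open>e\<close> by shifting its smallest common element
  downwards, until it is disjoint from \<open>e\<close>.\<close>

lemma frankl_ballot:
  assumes E: "E \<subseteq> ksets {..<n} r" "cross_intersecting E E" "compressed {..<n} E" and e: "e \<in> E"
  shows "\<exists>t\<le>n. t < 2 * card (e \<inter> {..<t})"
proof (rule ccontr)
  assume no: "\<not> ?thesis"
  have fin: "finite f" if "f \<in> E" for f using finite_edge[OF _ E(1) that] by simp
  have sub: "f \<subseteq> {..<n}" "card f = r" if "f \<in> E" for f using E(1) that by (auto simp: ksets_def)
  \<comment> \<open>\<open>P f\<close> states that \<open>f\<close> misses exactly an initial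
    segment of \<open>e\<close>; \<open>e\<close> itself qualifies with the empty segment.\<close>
  define P where "P f \<longleftrightarrow> f \<in> E \<and> (\<exists>m. e - f = e \<inter> {..<m})" for f
  have "e - e = e \<inter> {..<0}" by auto
  then have "P e" using e unfolding P_def by blast
  then obtain f where f: "P f" "\<And>g. P g \<Longrightarrow> card (e \<inter> f) \<le> card (e \<inter> g)"
    using ex_has_least_nat[of P e "\<lambda>f. card (e \<inter> f)"] by auto
  have fE: "f \<in> E" using f P_def by simp
  obtain m where m: "e - f = e \<inter> {..<m}" using f(1) P_def by blast
  have "e \<inter> f \<noteq> {}" using E(2) e fE unfolding cross_intersecting_def by blast
  moreover define j where "j = Min (e \<inter> f)"
  ultimately have j: "j \<in> e" "j \<in> f" "\<And>i. i \<in> e \<Longrightarrow> i \<in> f \<Longrightarrow> j \<le> i"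
    using Min_in[of "e \<inter> f"] fin[OF e] by auto
  have mj: "m \<le> j"
  proof (rule ccontr)
    assume "\<not> m \<le> j"
    then have "j \<in> e \<inter> {..<m}" using j(1) by simp
    then show False using m j(2) by blast
  qed
  have ef: "e - f = e \<inter> {..<j}"
  proof
    show "e - f \<subseteq> e \<inter> {..<j}" unfolding m using mj by auto
    show "e \<inter> {..<j} \<subseteq> e - f" using j(3) by force
  qed
  have jn: "j < n" using sub(1)[OF e] j by auto
  have cb: "2 * card (e \<inter> {..<Suc j}) \<le> Suc j" using no jn by (metis Suc_leI not_less)
  have c1: "card (e \<inter> {..<Suc j}) = Suc (card (e \<inter> {..<j}))"
  proof -
    have "e \<inter> {..<Suc j} = insert j (e \<inter> {..<j})" using j by (auto simp: less_Suc_eq)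
    then show ?thesis by simp
  qed
  have c2: "card (f - e) = card (e \<inter> {..<j})"
  proof -
    have "card (f - e) + card (f \<inter> e) = card f" using fin[OF fE] by (metis card_Int_Diff add.commute)
    moreover have "card (e - f) + card (e \<inter> f) = card e" using fin[OF e] by (metis card_Int_Diff add.commute)
    ultimately show ?thesis using sub(2)[OF e] sub(2)[OF fE] ef by (simp add: Int_commute)
  qed
  \<comment> \<open>Up to and including \<open>j\<close> there are \<open>Suc j\<close> places. If
    \<open>e\<close> has \<open>c\<close> elements below \<open>j\<close>, then \<open>e\<close>
    fills \<open>c + 1\<close> places and \<open>f\<close> at most \<open>c\<close> more, and the
    failed ballot property at \<open>Suc j\<close> makes \<open>2 * c + 1\<close> smaller than
    \<open>Suc j\<close>.\<close>
  have "\<exists>i<j. i \<notin> e \<and> i \<notin> f"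
  proof (rule ccontr)
    assume "\<not> ?thesis"
    then have "{..<Suc j} \<subseteq> (e \<inter> {..<Suc j}) \<union> (f - e)" using j by (auto simp: less_Suc_eq)
    then have "card {..<Suc j} \<le> card ((e \<inter> {..<Suc j}) \<union> (f - e))" using fin[OF fE] by (intro card_mono) auto
    also have "\<dots> \<le> card (e \<inter> {..<Suc j}) + card (f - e)" by (rule card_Un_le)
    finally show False using cb c1 c2 by simp
  qed
  then obtain i where i: "i < j" "i \<notin> e" "i \<notin> f" by blast
  define g where "g = insert i (f - {j})"
  have "g \<in> E" unfolding g_def using compressedD[OF E(3) fE j(2), of i] i jn by auto
  moreover have "e - g = e \<inter> {..<Suc j}" using ef j i unfolding g_def by (auto simp: less_Suc_eq)
  ultimately have "P g" unfolding P_def by blast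
  then have "card (e \<inter> f) \<le> card (e \<inter> g)" by (rule f(2))
  moreover have "e \<inter> g = (e \<inter> f) - {j}" unfolding g_def using i by auto
  moreover have "card ((e \<inter> f) - {j}) < card (e \<inter> f)" using j fin[OF e] by (intro card_Diff1_less) auto
  ultimately show False by simp
qed

section \<open>Lattice paths and the two links at the heaviest vertices\<close>

definition walk :: "nat set \<Rightarrow> nat \<Rightarrow> int" where
  "walk e t = 2 * int (card (e \<inter> {..<t})) - int t"

lemma walk_Suc: "walk e (Suc t) = (if t \<in> e then walk e t + 1 else walk e t - 1)"
proof -
  have "e \<inter> {..<Suc t} = (if t \<in> e then insert t (e \<inter> {..<t}) else e \<inter> {..<t})" by (auto simp: less_Suc_eq)
  then show ?thesis unfolding walk_def by simp
qed

lemma walk_0 [simp]: "walk e 0 = 0" unfolding walk_def by simp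

lemma walk_remove: "v \<in> e \<Longrightarrow> walk (e - {v}) t = (if t \<le> v then walk e t else walk e t - 2)"
proof (induction t)
  case 0 then show ?case by simp
next
  case (Suc t)
  then show ?case by (auto simp: walk_Suc not_less_eq_eq)
qed

text \<open>\<open>v\<close> is the up-step by which the path first attains its maximum. As
  \<open>0 \<notin> e\<close>, the path is at -1 after one step and at most at 0 after two, so a
  positive maximum is not reached before time 3; this is why \<open>v\<close> is at least 2 and
  \<open>x 2\<close> appears in the weight bound.\<close>

lemma first_maximum:
  assumes "\<exists>t\<le>n. 0 < walk e t" "0 \<notin> e"
  obtains v where "v \<in> e" "v < n" "2 \<le> v" "\<And>t. t \<le> v \<Longrightarrow> walk e t \<le> walk e v" "\<And>t. t \<le> n \<Longrightarrow> walk e t \<le> walk e v + 1"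
proof -
  define M where "M = Max (walk e ` {..n})"
  have M: "walk e t \<le> M" if "t \<le> n" for t unfolding M_def using that by auto
  have "M \<in> walk e ` {..n}" unfolding M_def by (rule Max_in) auto
  then have ex: "\<exists>t. t \<le> n \<and> walk e t = M" by auto
  define s where "s = (LEAST t. t \<le> n \<and> walk e t = M)"
  have s: "s \<le> n" "walk e s = M" using LeastI_ex[OF ex] unfolding s_def by auto
  have least: "walk e t < M" if "t < s" for t
  proof -
    have "\<not> (t \<le> n \<and> walk e t = M)" using not_less_Least[of t] that unfolding s_def by blast
    then show ?thesis using M[of t] that s by linarith
  qed
  have M1: "1 \<le> M" using assms(1) M by force
  have w1: "walk e 1 = -1" using assms(2) walk_Suc[of e 0] by simp
  have w2: "walk e 2 \<le> 0" using walk_Suc[of e 1] w1 by (simp add: numeral_2_eq_2)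
  have "s \<noteq> 0" using M1 s(2) walk_0[of e] by (intro notI) simp
  moreover have "s \<noteq> 1" using M1 s(2) w1 by (intro notI) simp
  moreover have "s \<noteq> 2" using M1 s(2) w2 by (intro notI) simp
  ultimately have s3: "3 \<le> s" by linarith
  define v where "v = s - 1"
  have v: "s = Suc v" using s3 v_def by simp
  have "v \<in> e" using least[of v] s walk_Suc[of e v] v by (auto split: if_splits)
  then have wv: "walk e v = M - 1" using walk_Suc[of e v] s v by simp
  show ?thesis
  proof (rule that[of v])
    show "walk e t \<le> walk e v" if "t \<le> v" for t using least[of t] that v wv by simp
    show "walk e t \<le> walk e v + 1" if "t \<le> n" for t using M[OF that] wv by simp
  qed (use \<open>v \<in> e\<close> s v s3 in auto)
qed

text \<open>Deleting the up-step \<open>p e\<close> that first attains the maximum sends an edge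
  avoiding 0 into the link of 0, since compression allows \<open>p e\<close> to be replaced by 0.
  The deleted weight is at most \<open>x 2\<close> because \<open>2 \<le> p e\<close>, so an
  injective deletion suffices.\<close>

lemma wt_avoid_0_le:
  assumes E: "E \<subseteq> ksets {..<n} (Suc k)" "cross_intersecting E E" "compressed {..<n} E"
    and x: "\<And>v. 0 \<le> (x::nat \<Rightarrow> real) v" "antimono x" and n: "0 < n"
  shows "wt x {e \<in> E. 0 \<notin> e} \<le> x 2 * wt x (link 0 E)"
proof -
  define F where "F = {e \<in> E. 0 \<notin> e}"
  have finE: "finite E" using finite_fam[OF _ E(1)] by simp
  have "\<forall>e\<in>F. \<exists>v. v \<in> e \<and> v < n \<and> 2 \<le> v \<and> (\<forall>t\<le>v. walk e t \<le> walk e v) \<and> (\<forall>t\<le>n. walk e t \<le> walk e v + 1)"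
  proof
    fix e assume e: "e \<in> F"
    then obtain t where "t \<le> n" "t < 2 * card (e \<inter> {..<t})" using frankl_ballot[OF E] F_def by blast
    then have "\<exists>t\<le>n. 0 < walk e t" unfolding walk_def by (intro exI[of _ t]) linarith
    moreover have "0 \<notin> e" using e F_def by simp
    ultimately obtain v where "v \<in> e" "v < n" "2 \<le> v" "\<And>t. t \<le> v \<Longrightarrow> walk e t \<le> walk e v"
      "\<And>t. t \<le> n \<Longrightarrow> walk e t \<le> walk e v + 1" using first_maximum by blast
    then show "\<exists>v. v \<in> e \<and> v < n \<and> 2 \<le> v \<and> (\<forall>t\<le>v. walk e t \<le> walk e v) \<and> (\<forall>t\<le>n. walk e t \<le> walk e v + 1)"
      by blast
  qed
  then obtain p where p: "\<And>e. e \<in> F \<Longrightarrow> p e \<in> e" "\<And>e. e \<in> F \<Longrightarrow> p e < n" "\<And>e. e \<in> F \<Longrightarrow> 2 \<le> p e"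
     "\<And>e t. e \<in> F \<Longrightarrow> t \<le> p e \<Longrightarrow> walk e t \<le> walk e (p e)"
     "\<And>e t. e \<in> F \<Longrightarrow> t \<le> n \<Longrightarrow> walk e t \<le> walk e (p e) + 1"
  proof -
    assume a: "\<And>p. (\<And>e. e \<in> F \<Longrightarrow> p e \<in> e) \<Longrightarrow> (\<And>e. e \<in> F \<Longrightarrow> p e < n) \<Longrightarrow> (\<And>e. e \<in> F \<Longrightarrow> 2 \<le> p e) \<Longrightarrow>
      (\<And>e t. e \<in> F \<Longrightarrow> t \<le> p e \<Longrightarrow> walk e t \<le> walk e (p e)) \<Longrightarrow>
      (\<And>e t. e \<in> F \<Longrightarrow> t \<le> n \<Longrightarrow> walk e t \<le> walk e (p e) + 1) \<Longrightarrow> thesis"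
    assume "\<forall>e\<in>F. \<exists>v. v \<in> e \<and> v < n \<and> 2 \<le> v \<and> (\<forall>t\<le>v. walk e t \<le> walk e v) \<and> (\<forall>t\<le>n. walk e t \<le> walk e v + 1)"
    from bchoice[OF this] obtain p where p: "\<forall>e\<in>F. p e \<in> e \<and> p e < n \<and> 2 \<le> p e \<and> (\<forall>t\<le>p e. walk e t \<le> walk e (p e)) \<and> (\<forall>t\<le>n. walk e t \<le> walk e (p e) + 1)" ..
    show thesis by (rule a[of p]) (use p in blast)+
  qed
  define \<phi> where "\<phi> e = e - {p e}" for e
  \<comment> \<open>After the deletion the path has its last maximum exactly at \<open>p e\<close>:
    the values before are not larger, those after are strictly smaller. Hence \<open>p e\<close> can
    be recovered from \<open>\<phi> e\<close>.\<close>
  have lo: "walk (\<phi> e) t \<le> walk (\<phi> e) (p e)" if "e \<in> F" "t \<le> p e" for e t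
    unfolding \<phi>_def using walk_remove[OF p(1)[OF that(1)]] p(4)[OF that] that by simp
  have hi: "walk (\<phi> e) t < walk (\<phi> e) (p e)" if "e \<in> F" "p e < t" "t \<le> n" for e t
    unfolding \<phi>_def using walk_remove[OF p(1)[OF that(1)]] p(5)[OF that(1,3)] that by simp
  have inj: "inj_on \<phi> F"
  proof (rule inj_onI)
    fix a b assume ab: "a \<in> F" "b \<in> F" "\<phi> a = \<phi> b"
    have no: False if "a \<in> F" "b \<in> F" "\<phi> a = \<phi> b" "p a < p b" for a b
      using hi[OF that(1), of "p b"] lo[OF that(2), of "p a"] that p(2)[OF that(2)] by simp
    have "p a = p b" using no[of a b] no[of b a] ab by (metis nat_neq_iff)
    then show "a = b" using ab p(1)[OF ab(1)] p(1)[OF ab(2)] unfolding \<phi>_def by (metis insert_Diff)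
  qed
  have im: "\<phi> ` F \<subseteq> link 0 E"
  proof
    fix A assume "A \<in> \<phi> ` F"
    then obtain e where e: "e \<in> F" "A = e - {p e}" unfolding \<phi>_def by auto
    then have "insert 0 (e - {p e}) \<in> E"
      using compressedD[OF E(3), of e "p e" 0] p(1,3)[of e] n unfolding F_def by force
    then show "A \<in> link 0 E" using e unfolding link_def F_def by auto
  qed
  have lk: "link 0 E \<subseteq> ksets ({..<n} - {0}) k" using link_subset[OF _ E(1)] by simp
  have "wt x F = (\<Sum>e\<in>F. x (p e) * (\<Prod>v\<in>\<phi> e. x v))"
    unfolding wt_def
  proof (rule sum.cong[OF refl])
    fix e assume e: "e \<in> F"
    then have "finite e" using finite_edge[OF _ E(1), of e] F_def by simp
    then show "(\<Prod>v\<in>e. x v) = x (p e) * (\<Prod>v\<in>\<phi> e. x v)" unfolding \<phi>_def using p(1)[OF e] by (simp add: prod.remove)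
  qed
  also have "\<dots> \<le> (\<Sum>e\<in>F. x 2 * (\<Prod>v\<in>\<phi> e. x v))"
    using x p(3) by (intro sum_mono mult_right_mono prod_nonneg) (auto simp: antimono_def)
  also have "\<dots> = x 2 * wt x (\<phi> ` F)" unfolding wt_def by (simp add: sum.reindex[OF inj] sum_distrib_left)
  also have "\<dots> \<le> x 2 * wt x (link 0 E)"
    using wt_mono[OF _ im lk] x by (intro mult_left_mono) auto
  finally show ?thesis unfolding F_def .
qed

text \<open>The uniformity \<open>r\<close> is written as \<open>k + 4\<close> to keep the exponents
  free of subtraction. The parts of the links at 0 and 1 avoiding the other vertex are
  cross-intersecting and satisfy the sum bound; the common part is bounded by all sets, with the
  loss at vertex 2 retained.\<close>

lemma compressed_bounds:
  fixes x :: "nat \<Rightarrow> real"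
  assumes E: "E \<subseteq> ksets {..<n} (k + 4)" "cross_intersecting E E" "compressed {..<n} E"
    and x: "\<And>v. 0 \<le> x v" "antimono x" "sum x {..<n} = 1" and n: "3 \<le> n"
  defines "D \<equiv> fact (k + 4) * wt x E" and "D0 \<equiv> fact (k + 3) * wt x (link 0 E)"
    and "D1 \<equiv> fact (k + 3) * wt x (link 1 E)" and "y \<equiv> x 0 + x 1"
  shows "D \<le> real (k + 4) * (x 0 + x 2) * D0"
    and "D0 + D1 \<le> (1 - y) ^ (k + 3) + real (k + 3) * y * ((1 - y) ^ (k + 2) - (x 2)\<^sup>2 * (1 - y) ^ k)"
    and "D0 \<le> (1 - x 0) ^ (k + 3)"
proof -
  have E': "E \<subseteq> ksets {..<n} (Suc (k + 3))" using E(1) by (simp add: numeral_eq_Suc)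
  have "wt x E = wt x {e \<in> E. 0 \<notin> e} + x 0 * wt x (link 0 E)" using wt_split[OF _ E'] by simp
  also have "\<dots> \<le> (x 0 + x 2) * wt x (link 0 E)"
    using wt_avoid_0_le[OF E' E(2,3) x(1,2)] n by (simp add: algebra_simps)
  finally have "fact (k + 4) * wt x E \<le> fact (k + 4) * ((x 0 + x 2) * wt x (link 0 E))" by (intro mult_left_mono) auto
  moreover have "(fact (k + 4) :: real) = real (k + 4) * fact (k + 3)" by (simp add: numeral_eq_Suc)
  ultimately show "D \<le> real (k + 4) * (x 0 + x 2) * D0" unfolding D_def D0_def by (simp only: mult_ac)
  define U where "U = {..<n} - {0, 1}"
  have U: "{..<n} - {0} - {1} = U" "{..<n} - {1} - {0} = U" "finite U" unfolding U_def by auto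
  have "{..<n} = insert 0 (insert 1 U)" unfolding U_def using n by auto
  moreover have "0 \<notin> U" "1 \<notin> U" unfolding U_def by auto
  ultimately have "sum x {..<n} = x 0 + (x 1 + sum x U)" using U(3) by simp
  then have SU: "sum x U = 1 - y" unfolding y_def using x(3) by simp
  have L0: "link 0 E \<subseteq> ksets ({..<n} - {0}) (Suc (k + 2))" and L1: "link 1 E \<subseteq> ksets ({..<n} - {1}) (Suc (k + 2))"
    using link_subset[OF _ E'] by (auto simp: numeral_eq_Suc)
  define A where "A = {A \<in> link 0 E. 1 \<notin> A}"
  define B where "B = {A \<in> link 1 E. 0 \<notin> A}"
  define C where "C = link 1 (link 0 E)"
  \<comment> \<open>The double link is the same from both sides, so it enters the sum with the total
    weight \<open>x 0 + x 1\<close>.\<close>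
  have C': "link 0 (link 1 E) = C" unfolding C_def link_def by (auto simp: insert_commute)
  have Ck: "C \<subseteq> ksets U (k + 2)" unfolding C_def using link_subset[OF _ L0, of 1] U by simp
  have AB: "A \<subseteq> ksets U (k + 3)" "B \<subseteq> ksets U (k + 3)"
    unfolding A_def B_def using L0 L1 by (auto simp: ksets_def U_def numeral_eq_Suc)
  have "compressed ({..<n} - {0} - {1}) A" "compressed ({..<n} - {1} - {0}) B"
    unfolding A_def B_def by (auto intro!: compressed_avoid compressed_link E(3))
  then have cAB: "compressed U A" "compressed U B" using U by auto
  have X: "cross_intersecting A B" unfolding cross_intersecting_def
  proof (intro ballI)
    fix a b assume ab: "a \<in> A" "b \<in> B"
    then have "insert 0 a \<in> E" "insert 1 b \<in> E" "0 \<notin> b" "1 \<notin> a" "0 \<notin> a" unfolding A_def B_def link_def by auto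
    moreover then have "insert 0 a \<inter> insert 1 b \<noteq> {}" using E(2) unfolding cross_intersecting_def by blast
    ultimately show "a \<inter> b \<noteq> {}" by auto
  qed
  have xU: "0 \<le> sum x U" using x by (auto intro: sum_nonneg)
  have 1: "fact (k + 3) * (wt x A + wt x B) \<le> (1 - y) ^ (k + 3)"
    using cross_sum[of U x "k + 3" A B] AB cAB X U x SU by auto
  have "2 \<in> U" unfolding U_def using n by auto
  then have "fact (k + 2) * wt x (ksets U (k + 2)) \<le> (1 - y) ^ (k + 2) - (x 2)\<^sup>2 * (1 - y) ^ k"
    using wt_ksets_le_gap[of U x 2 k] U x SU by auto
  moreover have "fact (k + 2) * wt x C \<le> fact (k + 2) * wt x (ksets U (k + 2))"
    using wt_mono[of U C "ksets U (k + 2)" "k + 2" x] Ck U x by (intro mult_left_mono) auto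
  ultimately have 2: "fact (k + 2) * wt x C \<le> (1 - y) ^ (k + 2) - (x 2)\<^sup>2 * (1 - y) ^ k" by linarith
  have "wt x (link 0 E) = wt x A + x 1 * wt x C" unfolding A_def C_def using wt_split[OF _ L0, of x 1] by simp
  moreover have "wt x (link 1 E) = wt x B + x 0 * wt x C" unfolding B_def C'[symmetric] using wt_split[OF _ L1, of x 0] by simp
  moreover have f3: "(fact (k + 3) :: real) = real (k + 3) * fact (k + 2)" by (simp add: numeral_eq_Suc)
  ultimately have "D0 + D1 = fact (k + 3) * (wt x A + wt x B) + real (k + 3) * y * (fact (k + 2) * wt x C)"
    unfolding D0_def D1_def y_def by (simp add: algebra_simps)
  also have "\<dots> \<le> (1 - y) ^ (k + 3) + real (k + 3) * y * ((1 - y) ^ (k + 2) - (x 2)\<^sup>2 * (1 - y) ^ k)"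
    using 1 2 x(1) unfolding y_def by (intro add_mono mult_left_mono) auto
  finally show "D0 + D1 \<le> (1 - y) ^ (k + 3) + real (k + 3) * y * ((1 - y) ^ (k + 2) - (x 2)\<^sup>2 * (1 - y) ^ k)" .
  have "{..<n} = insert 0 ({..<n} - {0})" using n by auto
  then have "sum x {..<n} = x 0 + sum x ({..<n} - {0})" using n by (metis finite_lessThan lessThan_iff less_le_trans sum.remove zero_less_numeral)
  then have "sum x ({..<n} - {0}) = 1 - x 0" using x(3) by simp
  moreover have "fact (k + 3) * wt x (link 0 E) \<le> (sum x ({..<n} - {0})) ^ (k + 3)"
    by (rule wt_le) (use L0 x in \<open>auto simp: numeral_eq_Suc\<close>)
  ultimately show "D0 \<le> (1 - x 0) ^ (k + 3)" unfolding D0_def by simp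
qed

section \<open>Perturbing the weights\<close>

text \<open>The density of the star of all \<open>r\<close>-sets through one vertex in the limit of
  many vertices, with weight \<open>1 / r\<close> on the centre: the maximum of
  \<open>r * z * (1 - z) ^ (r - 1)\<close> over \<open>z\<close>.\<close>

definition star_density :: "nat \<Rightarrow> real" where
  "star_density r = (1 - 1 / real r) ^ (r - 1)"

definition weighting :: "'a set \<Rightarrow> ('a \<Rightarrow> real) \<Rightarrow> bool" where
  "weighting V x \<longleftrightarrow> (\<forall>v\<in>V. 0 \<le> x v) \<and> sum x V = 1"

lemma star_density_pos: "2 \<le> r \<Longrightarrow> 0 < star_density r"
  unfolding star_density_def by (intro zero_less_power) (simp add: field_simps)

lemma wt_scale:
  assumes "F \<subseteq> ksets V k"
  shows "wt (\<lambda>u. c * x u) F = c ^ k * wt x F"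
  unfolding wt_def sum_distrib_left
proof (rule sum.cong[OF refl])
  fix e assume "e \<in> F"
  then have "card e = k" using assms by (auto simp: ksets_def)
  then show "(\<Prod>v\<in>e. c * x v) = c ^ k * (\<Prod>v\<in>e. x v)" by (simp add: prod.distrib)
qed

text \<open>Euler's identity for the homogeneous edge polynomial: summing over vertices counts each
  edge once per element.\<close>

lemma wt_euler:
  assumes "finite V" "E \<subseteq> ksets V (Suc m)"
  shows "(\<Sum>v\<in>V. x v * wt x (link v E)) = real (Suc m) * wt x E"
proof -
  have fE: "finite E" using finite_fam[OF assms] .
  have "(\<Sum>v\<in>V. x v * wt x (link v E)) = (\<Sum>v\<in>V. \<Sum>e | e \<in> E \<and> v \<in> e. \<Prod>u\<in>e. x u)"
    using wt_containing[OF assms, of x] by (simp add: wt_def)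
  also have "\<dots> = (\<Sum>e\<in>E. \<Sum>v | v \<in> V \<and> v \<in> e. \<Prod>u\<in>e. x u)"
    by (rule sum.swap_restrict[OF assms(1) fE])
  also have "\<dots> = (\<Sum>e\<in>E. real (Suc m) * (\<Prod>u\<in>e. x u))"
  proof (rule sum.cong[OF refl])
    fix e assume "e \<in> E"
    then have "e \<subseteq> V" "card e = Suc m" using assms(2) by (auto simp: ksets_def)
    moreover then have "{v. v \<in> V \<and> v \<in> e} = e" by auto
    ultimately show "(\<Sum>v | v \<in> V \<and> v \<in> e. \<Prod>u\<in>e. x u) = real (Suc m) * (\<Prod>u\<in>e. x u)" by simp
  qed
  finally show ?thesis unfolding wt_def by (simp add: sum_distrib_left)
qed

lemma wt_shift_weight:
  assumes "finite V" "E \<subseteq> ksets V (Suc m)" "v \<in> V"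
  shows "wt (\<lambda>u. (1 - \<tau>) * x u + (if u = v then \<tau> else 0)) E
     = (1 - \<tau>) ^ Suc m * wt x E + \<tau> * (1 - \<tau>) ^ m * wt x (link v E)"
proof -
  define y where "y = (\<lambda>u. (1 - \<tau>) * x u + (if u = v then \<tau> else 0))"
  have L: "link v E \<subseteq> ksets (V - {v}) m" by (rule link_subset[OF assms(1,2)])
  have "wt y {e \<in> E. v \<notin> e} = wt (\<lambda>u. (1 - \<tau>) * x u) {e \<in> E. v \<notin> e}"
    by (rule wt_cong) (auto simp: y_def)
  also have "\<dots> = (1 - \<tau>) ^ Suc m * wt x {e \<in> E. v \<notin> e}"
    by (rule wt_scale[of _ V]) (use assms(2) in auto)
  finally have 1: "wt y {e \<in> E. v \<notin> e} = (1 - \<tau>) ^ Suc m * wt x {e \<in> E. v \<notin> e}" .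
  have "wt y (link v E) = wt (\<lambda>u. (1 - \<tau>) * x u) (link v E)"
    by (rule wt_cong) (auto simp: y_def link_def)
  also have "\<dots> = (1 - \<tau>) ^ m * wt x (link v E)" by (rule wt_scale[OF L])
  finally have 2: "wt y (link v E) = (1 - \<tau>) ^ m * wt x (link v E)" .
  have "wt y E = (1 - \<tau>) ^ Suc m * wt x {e \<in> E. v \<notin> e} + ((1 - \<tau>) * x v + \<tau>) * ((1 - \<tau>) ^ m * wt x (link v E))"
    using wt_split[OF assms(1,2), of y v] 1 2 by (simp add: y_def)
  also have "\<dots> = (1 - \<tau>) ^ Suc m * (wt x {e \<in> E. v \<notin> e} + x v * wt x (link v E)) + \<tau> * (1 - \<tau>) ^ m * wt x (link v E)"
    by (simp add: algebra_simps)
  also have "\<dots> = (1 - \<tau>) ^ Suc m * wt x E + \<tau> * (1 - \<tau>) ^ m * wt x (link v E)"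
    using wt_split[OF assms(1,2), of x v] by simp
  finally show ?thesis unfolding y_def .
qed

lemma link_density_le_1:
  assumes "finite V" "E \<subseteq> ksets V (Suc m)" "weighting V x"
  shows "fact m * wt x (link v E) \<le> 1" "0 \<le> fact m * wt x (link v E)"
proof -
  have L: "link v E \<subseteq> ksets V m" using link_subset[OF assms(1,2), of v] ksets_mono[of "V - {v}" V] by fastforce
  have nn: "\<And>v. v \<in> V \<Longrightarrow> 0 \<le> x v" and S: "sum x V = 1" using assms(3) by (auto simp: weighting_def)
  show "fact m * wt x (link v E) \<le> 1" using wt_le[of V _ m x, OF assms(1) L nn] S by simp
  show "0 \<le> fact m * wt x (link v E)" using wt_nonneg[of _ V m x, OF L nn] by simp
qed

text \<open>Moving a little weight onto \<open>v\<close> cannot push the density above its supremum \<open>M\<close>; so near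
  a maximiser no link is much denser than \<open>M\<close>, and a link at a heavy vertex is not much sparser.\<close>

lemma link_density_upper:
  assumes "finite V" "E \<subseteq> ksets V (Suc m)" "weighting V x" "v \<in> V"
    and M: "\<And>y. weighting V y \<Longrightarrow> fact (Suc m) * wt y E \<le> M"
    and D: "M - \<epsilon> \<le> fact (Suc m) * wt x E" and e: "0 \<le> \<epsilon>" and t: "0 < \<tau>" "\<tau> < 1"
  shows "fact m * wt x (link v E) \<le> M + real m * \<tau> + \<epsilon> / \<tau>"
proof -
  define D where "D = fact (Suc m) * wt x E"
  define d where "d = fact m * wt x (link v E)"
  have d: "0 \<le> d" "d \<le> 1" using link_density_le_1[OF assms(1-3)] by (auto simp: d_def)
  define y where "y = (\<lambda>u. (1 - \<tau>) * x u + (if u = v then \<tau> else 0))"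
  have "sum y V = (1 - \<tau>) * sum x V + \<tau>"
    unfolding y_def using assms(1,4) by (simp add: sum.distrib sum_distrib_left sum.delta)
  then have "weighting V y" using assms(3) t unfolding weighting_def y_def by auto
  then have "fact (Suc m) * wt y E \<le> M" by (rule M)
  moreover have "fact (Suc m) * wt y E = (1 - \<tau>) ^ Suc m * D + real (Suc m) * \<tau> * (1 - \<tau>) ^ m * d"
    unfolding y_def wt_shift_weight[OF assms(1,2,4)] D_def d_def by (simp add: algebra_simps)
  ultimately have a: "(1 - \<tau>) ^ Suc m * D + real (Suc m) * \<tau> * (1 - \<tau>) ^ m * d \<le> M" by simp
  have D0: "0 \<le> D" unfolding D_def using wt_nonneg[OF assms(2), of x] assms(3) by (auto simp: weighting_def)
  have DM: "D \<le> M" unfolding D_def by (rule M) (rule assms(3))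
  have b1: "1 - real (Suc m) * \<tau> \<le> (1 - \<tau>) ^ Suc m" using Bernoulli_inequality[of "-\<tau>" "Suc m"] t by simp
  have b2: "1 - real m * \<tau> \<le> (1 - \<tau>) ^ m" using Bernoulli_inequality[of "-\<tau>" m] t by simp
  have "(1 - real (Suc m) * \<tau>) * D \<le> (1 - \<tau>) ^ Suc m * D" using b1 D0 by (intro mult_right_mono)
  moreover have "real (Suc m) * \<tau> * ((1 - real m * \<tau>) * d) \<le> real (Suc m) * \<tau> * ((1 - \<tau>) ^ m * d)"
    using b2 d t by (intro mult_left_mono mult_right_mono) auto
  ultimately have "D - real (Suc m) * \<tau> * D + real (Suc m) * \<tau> * ((1 - real m * \<tau>) * d) \<le> M"
    using a by (simp add: algebra_simps)
  then have "real (Suc m) * \<tau> * ((1 - real m * \<tau>) * d) \<le> \<epsilon> + real (Suc m) * \<tau> * D"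
    using assms(6) D_def by simp
  also have "\<dots> \<le> real (Suc m) * \<epsilon> + real (Suc m) * \<tau> * M"
    using e DM t mult_right_mono[of 1 "real (Suc m)" \<epsilon>] by (intro add_mono mult_left_mono) auto
  finally have "real (Suc m) * (\<tau> * ((1 - real m * \<tau>) * d)) \<le> real (Suc m) * (\<epsilon> + \<tau> * M)"
    by (simp add: algebra_simps)
  then have "\<tau> * ((1 - real m * \<tau>) * d) \<le> \<epsilon> + \<tau> * M" by (simp only: mult_le_cancel_left_pos of_nat_0_less_iff zero_less_Suc)
  then have "(1 - real m * \<tau>) * d \<le> (\<epsilon> + \<tau> * M) / \<tau>" using t by (simp add: pos_le_divide_eq mult.commute)
  also have "\<dots> = \<epsilon> / \<tau> + M" using t by (simp add: add_divide_distrib)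
  finally have "d \<le> M + real m * \<tau> * d + \<epsilon> / \<tau>" by (simp add: algebra_simps)
  also have "real m * \<tau> * d \<le> real m * \<tau> * 1" using d t by (intro mult_left_mono) auto
  finally show ?thesis unfolding d_def by simp
qed

text \<open>By Euler's identity the density is the \<open>x\<close>-average of the link densities.
  All other links contribute at most \<open>M + \<eta>\<close> each, so the remainder has to come
  from \<open>v\<close>.\<close>

lemma link_density_lower:
  assumes "finite V" "E \<subseteq> ksets V (Suc m)" "weighting V x" "v \<in> V" "0 \<le> \<eta>"
    and M: "M - \<epsilon> \<le> fact (Suc m) * wt x E"
    and u: "\<And>u. u \<in> V \<Longrightarrow> fact m * wt x (link u E) \<le> M + \<eta>"
  shows "x v * M - (\<epsilon> + \<eta>) \<le> x v * (fact m * wt x (link v E))"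
proof -
  have x: "\<And>u. u \<in> V \<Longrightarrow> 0 \<le> x u" "sum x V = 1" using assms(3) by (auto simp: weighting_def)
  have "fact (Suc m) * wt x E = fact m * (\<Sum>u\<in>V. x u * wt x (link u E))"
    unfolding wt_euler[OF assms(1,2)] by (simp add: algebra_simps)
  also have "\<dots> = (\<Sum>u\<in>V. x u * (fact m * wt x (link u E)))" by (simp add: sum_distrib_left mult_ac)
  also have "\<dots> = x v * (fact m * wt x (link v E)) + (\<Sum>u\<in>V - {v}. x u * (fact m * wt x (link u E)))"
    using assms(1,4) by (simp add: sum.remove)
  also have "(\<Sum>u\<in>V - {v}. x u * (fact m * wt x (link u E))) \<le> (\<Sum>u\<in>V - {v}. x u * (M + \<eta>))"
    using x u by (intro sum_mono mult_left_mono) auto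
  also have "\<dots> = (1 - x v) * (M + \<eta>)"
    using x(2) assms(1,4) by (simp add: sum.remove sum_distrib_right[symmetric])
  finally have "M - \<epsilon> \<le> x v * (fact m * wt x (link v E)) + (1 - x v) * (M + \<eta>)" using M by simp
  moreover have "0 \<le> x v * \<eta>" using x(1)[OF assms(4)] assms(5) by simp
  ultimately show ?thesis by (simp add: algebra_simps)
qed

section \<open>Reduction to a sorted and compressed family\<close>

definition pullback :: "('a \<Rightarrow> 'b) \<Rightarrow> 'a set \<Rightarrow> 'b set set \<Rightarrow> 'a set set" where
  "pullback f U E = {e. e \<subseteq> U \<and> f ` e \<in> E}"

lemma pullback:
  assumes f: "bij_betw f U V" and E: "E \<subseteq> ksets V r" and V: "finite V"
    and X: "cross_intersecting E E" and y: "\<And>u. u \<in> U \<Longrightarrow> y u = x (f u)"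
  shows "pullback f U E \<subseteq> ksets U r" "cross_intersecting (pullback f U E) (pullback f U E)"
    "wt y (pullback f U E) = wt x E"
proof -
  have inj: "inj_on f U" "f ` U = V" using f by (auto simp: bij_betw_def)
  show "pullback f U E \<subseteq> ksets U r"
    unfolding pullback_def ksets_def using E inj(1) by (auto simp: ksets_def card_image inj_on_subset)
  show "cross_intersecting (pullback f U E) (pullback f U E)"
    unfolding cross_intersecting_def
  proof (intro ballI)
    fix a b assume ab: "a \<in> pullback f U E" "b \<in> pullback f U E"
    then have "f ` a \<inter> f ` b \<noteq> {}" using X unfolding cross_intersecting_def pullback_def by blast
    then obtain p q where "p \<in> a" "q \<in> b" "f p = f q" by auto
    moreover then have "p = q" using inj(1) ab unfolding pullback_def inj_on_def by blast
    ultimately show "a \<inter> b \<noteq> {}" by auto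
  qed
  have im: "(`) f ` pullback f U E = E"
  proof
    show "E \<subseteq> (`) f ` pullback f U E"
    proof
      fix e assume e: "e \<in> E"
      then have "e \<subseteq> f ` U" using E inj(2) by (auto simp: ksets_def)
      then obtain a where "a \<subseteq> U" "e = f ` a" by (metis subset_imageE)
      then show "e \<in> (`) f ` pullback f U E" using e unfolding pullback_def by auto
    qed
  qed (auto simp: pullback_def)
  have ii: "inj_on ((`) f) (pullback f U E)"
    by (rule inj_on_subset[OF inj_on_image_Pow[OF inj(1)]]) (auto simp: pullback_def)
  have "wt x E = (\<Sum>e\<in>pullback f U E. \<Prod>v\<in>f ` e. x v)"
    unfolding wt_def by (subst im[symmetric]) (simp add: sum.reindex[OF ii])
  also have "\<dots> = wt y (pullback f U E)" unfolding wt_def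
  proof (rule sum.cong[OF refl])
    fix e assume e: "e \<in> pullback f U E"
    then have "e \<subseteq> U" "inj_on f e" using inj(1) inj_on_subset unfolding pullback_def by auto
    then show "(\<Prod>v\<in>f ` e. x v) = (\<Prod>v\<in>e. y v)" using y by (simp add: prod.reindex subset_eq)
  qed
  finally show "wt y (pullback f U E) = wt x E" by simp
qed

lemma sorted_enumeration:
  assumes "finite (V :: 'a set)"
  obtains f where "bij_betw f {..<card V} V" "\<And>i j. i \<le> j \<Longrightarrow> j < card V \<Longrightarrow> (x :: 'a \<Rightarrow> real) (f j) \<le> x (f i)"
proof -
  obtain xs where xs: "set xs = V" "distinct xs" using finite_distinct_list[OF assms] by blast
  define ys where "ys = sort_key (\<lambda>v. - x v) xs"
  have ys: "set ys = V" "distinct ys" "sorted (map (\<lambda>v. - x v) ys)" unfolding ys_def using xs by auto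
  have len: "length ys = card V" using ys distinct_card by fastforce
  have "bij_betw ((!) ys) {..<length ys} (set ys)" by (rule bij_betw_nth[OF ys(2)]) auto
  then have "bij_betw ((!) ys) {..<card V} V" using len ys by simp
  moreover have "x (ys ! j) \<le> x (ys ! i)" if "i \<le> j" "j < card V" for i j
    using sorted_nth_mono[OF ys(3), of i j] that len by simp
  ultimately show ?thesis using that by blast
qed

text \<open>Vertices are relabelled by decreasing weight, padded with vertices of weight zero up to
  \<open>n\<close>, and the family is then compressed. The final clause, that no new weight exceeds
  all old ones, carries an upper bound on the weights into the gap theorem.\<close>

lemma normal_form:
  assumes V: "finite V" and E: "E \<subseteq> ksets V r" "cross_intersecting E E" and x: "weighting V x" and n: "card V \<le> n"
  obtains E' y where "E' \<subseteq> ksets {..<n} r" "cross_intersecting E' E'" "compressed {..<n} E'"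
    "\<And>i. 0 \<le> y i" "antimono y" "sum y {..<n} = 1" "wt x E \<le> wt y E'" "\<And>i. \<exists>v\<in>V. y i \<le> x v"
proof -
  obtain f where f: "bij_betw f {..<card V} V" "\<And>i j. i \<le> j \<Longrightarrow> j < card V \<Longrightarrow> x (f j) \<le> x (f i)"
    using sorted_enumeration[OF V, of x] by blast
  define y where "y i = (if i < card V then x (f i) else 0)" for i
  have fV: "f i \<in> V" if "i < card V" for i using bij_betwE[OF f(1)] that by auto
  have xV: "\<And>v. v \<in> V \<Longrightarrow> 0 \<le> x v" "sum x V = 1" using x by (auto simp: weighting_def)
  have y0: "0 \<le> y i" for i unfolding y_def using fV xV by auto
  have am: "antimono y"
  proof (rule antimonoI)
    fix i j :: nat assume "i \<le> j"
    then show "y j \<le> y i" using f(2)[of i j] y0[of i] unfolding y_def by auto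
  qed
  have "sum y {..<card V} = sum x V"
    using sum.reindex_bij_betw[OF f(1), of x] unfolding y_def by simp
  moreover have "sum y {..<n} = sum y {..<card V}"
    by (rule sum.mono_neutral_right) (use n in \<open>auto simp: y_def\<close>)
  ultimately have y1: "sum y {..<n} = 1" using xV by simp
  define P where "P = pullback f {..<card V} E"
  have P: "P \<subseteq> ksets {..<card V} r" "cross_intersecting P P" "wt y P = wt x E"
    unfolding P_def using pullback[OF f(1) E(1) V E(2), of y x] unfolding y_def by auto
  have "P \<subseteq> ksets {..<n} r" using P(1) ksets_mono[of "{..<card V}" "{..<n}" r] n by auto
  from compress_exists[OF this P(2) y0 am] obtain E' where E': "E' \<subseteq> ksets {..<n} r" "cross_intersecting E' E'"
    "compressed {..<n} E'" "wt y P \<le> wt y E'" by blast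
  have ne: "V \<noteq> {}" using xV by auto
  have "\<exists>v\<in>V. y i \<le> x v" for i
  proof (cases "i < card V")
    case True then show ?thesis unfolding y_def using fV by auto
  next
    case False then show ?thesis unfolding y_def using ne xV by auto
  qed
  then show ?thesis using that[of E' y] E' y0 am y1 P by auto
qed

text \<open>The bound for the sum of two link densities in terms of the joint weight
  \<open>y\<close> of their vertices, with the squared term dropped. Its decrease in
  \<open>y\<close> turns a lower bound on \<open>y\<close> into an upper bound on the
  density.\<close>

definition phi :: "nat \<Rightarrow> real \<Rightarrow> real" where
  "phi k y = (1 - y) ^ (k + 3) + real (k + 3) * y * (1 - y) ^ (k + 2)"

lemma phi_antimono:
  assumes "0 \<le> a" "a \<le> b" "b \<le> 1" shows "phi k b \<le> phi k a"
proof (rule DERIV_nonpos_imp_nonincreasing[OF assms(2)])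
  fix y assume y: "a \<le> y" "y \<le> b"
  have "(phi k has_real_derivative - (real (k + 3) * real (k + 2) * y * (1 - y) ^ (k + 1))) (at y)"
    unfolding phi_def
    apply (rule derivative_eq_intros refl)+
    apply (simp add: algebra_simps numeral_eq_Suc)
    done
  moreover have "- (real (k + 3) * real (k + 2) * y * (1 - y) ^ (k + 1)) \<le> 0" using y assms by simp
  ultimately show "\<exists>z. DERIV (phi k) y :> z \<and> z \<le> 0" by blast
qed

lemma phi_star: "phi k (1 / real (k + 4)) = 2 * star_density (k + 4)"
proof -
  define z where "z = 1 / real (k + 4)"
  have z: "real (k + 3) * z = 1 - z" unfolding z_def by (simp add: field_simps)
  have "phi k z = (1 - z) ^ (k + 3) + (1 - z) * (1 - z) ^ (k + 2)" unfolding phi_def z ..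
  also have "\<dots> = 2 * (1 - z) ^ (k + 3)" by (simp add: numeral_eq_Suc)
  finally show ?thesis unfolding star_density_def z_def by (simp add: add.commute)
qed

section \<open>The Lagrangian of intersecting families\<close>

text \<open>Weights are functions on all naturals that vanish from \<open>n\<close> on, so that
  Tychonoff's theorem for the product topology yields compactness.\<close>

lemma compact_weights:
  "compact {x :: nat \<Rightarrow> real. (\<forall>i. x i \<in> (if i < n then {0..1} else {0})) \<and> sum x {..<n} = 1}"
proof -
  define S where "S i = (if i < n then {0..1} else {0::real})" for i :: nat
  have "compactin (product_topology (\<lambda>i::nat. euclidean :: real topology) UNIV) (Pi\<^sub>E UNIV S)"
    unfolding compactin_PiE by (auto simp: S_def)
  then have "compact (Pi\<^sub>E UNIV S)" unfolding euclidean_product_topology by simp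
  moreover have "closed {x :: nat \<Rightarrow> real. sum x {..<n} = 1}"
    by (intro closed_Collect_eq continuous_intros continuous_on_sum continuous_on_product_coordinates)
  ultimately have "compact (Pi\<^sub>E UNIV S \<inter> {x. sum x {..<n} = 1})" by (rule compact_Int_closed)
  moreover have "Pi\<^sub>E UNIV S \<inter> {x. sum x {..<n} = 1}
     = {x. (\<forall>i. x i \<in> (if i < n then {0..1} else {0})) \<and> sum x {..<n} = 1}"
    by (auto simp: S_def PiE_def Pi_def)
  ultimately show ?thesis by simp
qed

text \<open>The maximum is over the family and the weights together: each of the finitely many
  families attains its maximum by compactness, and the best one is taken.\<close>

lemma maximiser_exists:
  fixes n r :: nat
  assumes "0 < n"
  obtains E and x :: "nat \<Rightarrow> real" where "E \<subseteq> ksets {..<n} r" "cross_intersecting E E" "weighting {..<n} x"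
    "\<And>F y. F \<subseteq> ksets {..<n} r \<Longrightarrow> cross_intersecting F F \<Longrightarrow> weighting {..<n} y \<Longrightarrow> wt y F \<le> wt x E"
proof -
  define K where "K = {x :: nat \<Rightarrow> real. (\<forall>i. x i \<in> (if i < n then {0..1} else {0})) \<and> sum x {..<n} = 1}"
  have K: "compact K" unfolding K_def by (rule compact_weights)
  have "(\<lambda>i. if i = 0 then 1 else 0) \<in> K" unfolding K_def using assms by (auto simp: sum.delta)
  then have ne: "K \<noteq> {}" by blast
  have Kw: "weighting {..<n} x" if "x \<in> K" for x
    using that unfolding K_def weighting_def by (auto split: if_splits)
  define Fam where "Fam = {F. F \<subseteq> ksets {..<n} r \<and> cross_intersecting F F}"
  have fin: "finite Fam" unfolding Fam_def
    by (rule finite_subset[of _ "Pow (ksets {..<n} r)"]) (auto simp: finite_ksets)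
  have "{} \<in> Fam" unfolding Fam_def cross_intersecting_def by simp
  then have neF: "Fam \<noteq> {}" by blast
  have "\<exists>x\<in>K. \<forall>y\<in>K. wt y F \<le> wt x F" for F
  proof (rule continuous_attains_sup[OF K ne])
    show "continuous_on K (\<lambda>x. wt x F)" unfolding wt_def
      by (intro continuous_on_sum continuous_on_prod) (auto intro: continuous_on_subset[OF continuous_on_product_coordinates])
  qed
  then obtain X where X: "\<And>F. X F \<in> K" "\<And>F y. y \<in> K \<Longrightarrow> wt y F \<le> wt (X F) F" by metis
  define m where "m = Max ((\<lambda>F. wt (X F) F) ` Fam)"
  have "m \<in> (\<lambda>F. wt (X F) F) ` Fam" unfolding m_def using fin neF by (intro Max_in) auto
  then obtain E where E: "E \<in> Fam" "m = wt (X E) E" by auto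
  have "wt y F \<le> wt (X E) E" if F: "F \<subseteq> ksets {..<n} r" "cross_intersecting F F" "weighting {..<n} y" for F y
  proof -
    define z where "z i = (if i < n then y i else 0)" for i
    have yi: "0 \<le> y i" "y i \<le> 1" if "i < n" for i
    proof -
      show "0 \<le> y i" using F(3) that by (auto simp: weighting_def)
      have "y i \<le> sum y {..<n}" using F(3) that by (intro member_le_sum) (auto simp: weighting_def)
      then show "y i \<le> 1" using F(3) by (simp add: weighting_def)
    qed
    have "sum z {..<n} = sum y {..<n}" by (rule sum.cong) (auto simp: z_def)
    then have "z \<in> K" unfolding K_def using yi F(3) by (auto simp: z_def weighting_def)
    then have "wt z F \<le> wt (X F) F" by (rule X(2))
    moreover have "wt y F = wt z F" by (rule wt_cong) (use F(1) in \<open>auto simp: z_def ksets_def\<close>)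
    moreover have "wt (X F) F \<le> m" unfolding m_def using fin F by (intro Max_ge) (auto simp: Fam_def)
    ultimately show ?thesis using E by simp
  qed
  then show ?thesis using that[of E "X E"] E Kw[OF X(1)] unfolding Fam_def by blast
qed

theorem lagrangian_intersecting_nat:
  fixes n k :: nat and z :: "nat \<Rightarrow> real"
  assumes F: "F \<subseteq> ksets {..<n} (k + 4)" "cross_intersecting F F" "weighting {..<n} z" and n: "3 \<le> n"
  shows "fact (k + 4) * wt z F \<le> star_density (k + 4)"
proof -
  obtain E0 x0 where E0: "E0 \<subseteq> ksets {..<n} (k + 4)" "cross_intersecting E0 E0" "weighting {..<n} x0"
    and max0: "\<And>F y. F \<subseteq> ksets {..<n} (k + 4) \<Longrightarrow> cross_intersecting F F \<Longrightarrow> weighting {..<n} y \<Longrightarrow> wt y F \<le> wt x0 E0"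
    using maximiser_exists[of n "k + 4"] n by auto
  obtain E x where E: "E \<subseteq> ksets {..<n} (k + 4)" "cross_intersecting E E" "compressed {..<n} E"
    and x: "\<And>i. 0 \<le> x i" "antimono x" "sum x {..<n} = 1" "wt x0 E0 \<le> wt x E"
    by (rule normal_form[OF _ E0(1,2,3), of n]) auto
  have xw: "weighting {..<n} x" using x by (simp add: weighting_def)
  define M where "M = fact (k + 4) * wt x E"
  have max: "fact (k + 4) * wt y G \<le> M" if "G \<subseteq> ksets {..<n} (k + 4)" "cross_intersecting G G" "weighting {..<n} y" for G y
    unfolding M_def using max0[OF that] x(4) by (intro mult_left_mono) auto
  define r where "r = real (k + 4)"
  have r: "0 < r" unfolding r_def by simp
  have r1: "1 / r \<le> 1" unfolding r_def by simp
  have "M \<le> star_density (k + 4)"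
  proof (rule ccontr)
    assume "\<not> M \<le> star_density (k + 4)"
    then have M: "star_density (k + 4) < M" by simp
    then have M0: "0 < M" using star_density_pos[of "k + 4"] by simp
    define d where "d v = fact (k + 3) * wt x (link v E)" for v
    have E': "E \<subseteq> ksets {..<n} (Suc (k + 3))" using E(1) by (simp add: numeral_eq_Suc)
    have fS: "fact (Suc (k + 3)) = (fact (k + 4) :: real)" by (simp add: numeral_eq_Suc)
    have up: "d v \<le> M" if v: "v < n" for v
    proof (rule field_le_epsilon)
      fix e :: real assume e: "0 < e"
      \<comment> \<open>At an exact maximiser the error \<open>\<epsilon> / \<tau>\<close> vanishes,
        so \<open>\<tau>\<close> may be as small as needed to push \<open>(k + 3) * \<tau>\<close>
        below \<open>e\<close>.\<close>
      define \<tau> where "\<tau> = min (1/2) (e / real (k + 3))"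
      have t: "0 < \<tau>" "\<tau> < 1" unfolding \<tau>_def using e by auto
      have "fact (k + 3) * wt x (link v E) \<le> M + real (k + 3) * \<tau> + 0 / \<tau>"
      proof (rule link_density_upper[OF _ E' xw])
        show "fact (Suc (k + 3)) * wt y E \<le> M" if "weighting {..<n} y" for y
          using max[OF E(1,2) that] fS by simp
        show "M - 0 \<le> fact (Suc (k + 3)) * wt x E" unfolding M_def fS by simp
      qed (use v t in auto)
      moreover have "real (k + 3) * \<tau> \<le> e"
      proof -
        have "\<tau> \<le> e / real (k + 3)" unfolding \<tau>_def by simp
        then show ?thesis by (simp add: pos_le_divide_eq mult.commute)
      qed
      ultimately show "d v \<le> M + e" unfolding d_def by simp
    qed
    have eq: "d v = M" if v: "v < n" "0 < x v" for v
    proof -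
      have "x v * M - (0 + 0) \<le> x v * (fact (k + 3) * wt x (link v E))"
      proof (rule link_density_lower[OF _ E' xw])
        show "M - 0 \<le> fact (Suc (k + 3)) * wt x E" unfolding M_def fS by simp
        show "fact (k + 3) * wt x (link u E) \<le> M + 0" if "u \<in> {..<n}" for u
          using up[of u] that unfolding d_def by simp
      qed (use v in auto)
      then have "M \<le> d v" using v unfolding d_def by simp
      then show ?thesis using up[OF v(1)] by simp
    qed
    note cb = compressed_bounds[OF E x(1-3) n]
    have b1: "M \<le> r * (x 0 + x 2) * d 0" using cb(1) unfolding M_def d_def r_def .
    also have "\<dots> \<le> r * (x 0 + x 2) * M" using up[of 0] n r x(1) by (intro mult_left_mono) auto
    finally have "1 * M \<le> (r * (x 0 + x 2)) * M" by simp
    then have "1 \<le> r * (x 0 + x 2)" using M0 by (simp only: mult_le_cancel_right_pos)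
    then have b: "1 / r \<le> x 0 + x 2" using r by (simp add: divide_le_eq mult.commute)
    have a12: "x 2 \<le> x 1" "x 1 \<le> x 0" using x(2) by (auto simp: antimono_def)
    show False
    \<comment> \<open>Only at vertices of positive weight is the link density known to equal
      \<open>M\<close>. If \<open>x 1\<close> vanishes, vertex 0 alone has weight at least
      \<open>1 / r\<close>, and the trivial bound on its link is strong enough.\<close>
    proof (cases "0 < x 1")
      case True
      define y where "y = x 0 + x 1"
      have "y \<le> 1"
      proof -
        have "sum x {0, 1} \<le> sum x {..<n}" using x(1) n by (intro sum_mono2) auto
        then show ?thesis unfolding y_def using x(3) by simp
      qed
      have "2 * M = d 0 + d 1" using eq[of 0] eq[of 1] n True a12 by simp
      also have "\<dots> \<le> (1 - y) ^ (k + 3) + real (k + 3) * y * ((1 - y) ^ (k + 2) - (x 2)\<^sup>2 * (1 - y) ^ k)"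
        using cb(2) unfolding d_def y_def by simp
      also have "\<dots> \<le> (1 - y) ^ (k + 3) + real (k + 3) * y * ((1 - y) ^ (k + 2))"
        using \<open>y \<le> 1\<close> x(1) unfolding y_def by (intro add_left_mono mult_left_mono) auto
      also have "\<dots> = phi k y" unfolding phi_def ..
      also have "\<dots> \<le> phi k (1 / r)" by (rule phi_antimono) (use b a12 r \<open>y \<le> 1\<close> in \<open>auto simp: y_def\<close>)
      also have "\<dots> = 2 * star_density (k + 4)" unfolding r_def by (rule phi_star)
      finally show False using M by simp
    next
      case False
      then have "x 2 = 0" using a12 x(1)[of 1] x(1)[of 2] by simp
      then have x0: "1 / r \<le> x 0" using b by simp
      then have "0 < x 0" using r by (metis divide_pos_pos less_le_trans zero_less_one)
      then have "M = d 0" using eq[of 0] n by simp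
      also have "\<dots> \<le> (1 - x 0) ^ (k + 3)" using cb(3) unfolding d_def .
      also have "\<dots> \<le> (1 - 1 / r) ^ (k + 3)"
      proof (rule power_mono)
        have "x 0 \<le> sum x {..<n}" using x(1) n by (intro member_le_sum) auto
        then show "0 \<le> 1 - x 0" using x(3) by simp
      qed (use x0 in simp)
      also have "\<dots> = star_density (k + 4)" unfolding star_density_def r_def by (simp add: add.commute)
      finally show False using M by simp
    qed
  qed
  then show ?thesis using max[OF F] by linarith
qed

theorem lagrangian_intersecting:
  assumes r: "4 \<le> r" and V: "finite V" and E: "E \<subseteq> ksets V r" "cross_intersecting E E" and x: "weighting V x"
  shows "fact r * wt x E \<le> star_density r"
proof -
  obtain k where k: "r = k + 4" using r by (metis le_add_diff_inverse2)
  obtain E' y where E': "E' \<subseteq> ksets {..<card V + 3} r" "cross_intersecting E' E'"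
    and y: "\<And>i. 0 \<le> y i" "sum y {..<card V + 3} = 1" "wt x E \<le> wt y E'"
    by (rule normal_form[OF V E x, of "card V + 3"]) auto
  have "fact r * wt x E \<le> fact r * wt y E'" using y(3) by (intro mult_left_mono) auto
  also have "\<dots> \<le> star_density r"
    using lagrangian_intersecting_nat[of E' "card V + 3" k y] E' y k by (simp add: weighting_def)
  finally show ?thesis .
qed

text \<open>The numerical core of the gap: \<open>D\<close>, \<open>d0\<close>, \<open>d1\<close>
  stand for the density and the densities of the links at the two heaviest vertices, and
  \<open>x0\<close>, \<open>x1\<close>, \<open>x2\<close> for the three largest weights.
  \<open>sqrt \<delta>\<close> is the perturbation size that balances the errors
  \<open>(k + 3) * \<tau>\<close> and \<open>\<delta> / \<tau>\<close>.\<close>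

lemma gap_constants:
  fixes \<xi> :: real
  assumes "\<xi> < 1 / real (k + 4)"
  obtains \<delta> where "0 < \<delta>" "\<delta> < 1"
    "\<And>D d0 d1 x0 x1 x2. star_density (k + 4) - \<delta> < D \<Longrightarrow>
       d0 \<le> star_density (k + 4) + (real (k + 3) * sqrt \<delta> + sqrt \<delta>) \<Longrightarrow>
       (x0 * star_density (k + 4) - (\<delta> + (real (k + 3) * sqrt \<delta> + sqrt \<delta>)) \<le> x0 * d0) \<Longrightarrow>
       (x1 * star_density (k + 4) - (\<delta> + (real (k + 3) * sqrt \<delta> + sqrt \<delta>)) \<le> x1 * d1) \<Longrightarrow>
       D \<le> real (k + 4) * (x0 + x2) * d0 \<Longrightarrow>
       d0 + d1 \<le> (1 - (x0 + x1)) ^ (k + 3) + real (k + 3) * (x0 + x1) * ((1 - (x0 + x1)) ^ (k + 2) - x2\<^sup>2 * (1 - (x0 + x1)) ^ k) \<Longrightarrow>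
       0 \<le> x2 \<Longrightarrow> x2 \<le> x1 \<Longrightarrow> x1 \<le> x0 \<Longrightarrow> x0 \<le> \<xi> \<Longrightarrow> 0 \<le> d0 \<Longrightarrow> False"
proof -
  define r where "r = real (k + 4)"
  define M where "M = star_density (k + 4)"
  have r: "4 \<le> r" unfolding r_def by simp
  have M0: "0 < M" unfolding M_def by (rule star_density_pos) simp
  \<comment> \<open>The ballot inequality will give \<open>x0 + x2 \<ge> 1 / r - \<kappa>\<close>;
    together with \<open>x0 \<le> \<xi> = 1 / r - 2 * \<kappa>\<close> this leaves
    \<open>x2 \<ge> \<kappa>\<close>.\<close>
  define \<kappa> where "\<kappa> = (1 / r - \<xi>) / 2"
  have \<kappa>: "0 < \<kappa>" using assms unfolding \<kappa>_def r_def by simp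
  \<comment> \<open>A lower bound for the squared term, from
    \<open>x0 + x1 \<ge> 2 * \<kappa>\<close>, \<open>x2 \<ge> \<kappa>\<close> and
    \<open>1 - (x0 + x1) \<ge> 1 / 2\<close>.\<close>
  define c where "c = real (k + 3) * (2 * \<kappa>) * (\<kappa>\<^sup>2 * (1 / 2) ^ k)"
  have c: "0 < c" unfolding c_def using \<kappa> by simp
  \<comment> \<open>\<open>x0 + x1\<close> may now lie slightly below \<open>1 / r\<close>, where
    monotonicity points the wrong way; continuity limits the excess of \<open>phi\<close> to
    \<open>c / 2\<close>.\<close>
  have "isCont (phi k) (1 / r)" unfolding phi_def by (intro continuous_intros)
  then obtain \<theta>0 where \<theta>0: "0 < \<theta>0" "\<And>y. \<bar>y - 1 / r\<bar> < \<theta>0 \<Longrightarrow> \<bar>phi k y - phi k (1 / r)\<bar> < c / 2"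
    unfolding continuous_at_eps_delta dist_real_def using c by (metis half_gt_zero)
  have phi_le: "phi k y \<le> 2 * M + c / 2" if "1 / r - \<theta>0 < y" "y \<le> 1" for y
  proof (cases "1 / r \<le> y")
    case True
    then have "phi k y \<le> phi k (1 / r)" using phi_antimono[of "1 / r" y k] that r by simp
    then show ?thesis using c phi_star[of k] unfolding M_def r_def by simp
  next
    case False
    then have "\<bar>phi k y - phi k (1 / r)\<bar> < c / 2" using \<theta>0(2)[of y] that by simp
    then show ?thesis using phi_star[of k] unfolding M_def r_def by linarith
  qed
  \<comment> \<open>The total error \<open>s\<close> will be at most \<open>s0\<close>. The first
    two entries bound the defect in \<open>x0 + x2\<close> by \<open>\<kappa>\<close> and
    \<open>\<theta>0 / 2\<close>; the third makes the two link defects, after division by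
    \<open>\<kappa>\<close>, add up to at most \<open>c / 4\<close>.\<close>
  define s0 where "s0 = Min {r * M * \<kappa> / (1 + r), r * M * \<theta>0 / (2 * (1 + r)), \<kappa> * c / 8, M / 2}"
  have s0: "0 < s0" unfolding s0_def using r M0 \<kappa> c \<theta>0 by (subst Min_gr_iff) auto
  have s0': "s0 \<le> r * M * \<kappa> / (1 + r)" "s0 \<le> r * M * \<theta>0 / (2 * (1 + r))" "s0 \<le> \<kappa> * c / 8" "s0 \<le> M / 2"
    unfolding s0_def by (intro Min_le; simp)+
  define a where "a = min (1/2) (s0 / real (k + 5))"
  have a: "0 < a" "a \<le> 1/2" "a \<le> s0 / real (k + 5)" unfolding a_def using s0 by (auto simp: min_def)
  define \<delta> where "\<delta> = a\<^sup>2"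
  have d: "0 < \<delta>" "sqrt \<delta> = a" "\<delta> < 1" unfolding \<delta>_def using a by (auto simp: power2_eq_square intro!: mult_strict_mono[of a 1 a 1, simplified])
  define s where "s = \<delta> + (real (k + 3) * sqrt \<delta> + sqrt \<delta>)"
  have "\<delta> \<le> a" unfolding \<delta>_def using a mult_left_le[of a a] by (simp add: power2_eq_square)
  then have "s \<le> real (k + 5) * a" unfolding s_def d(2) by (simp add: algebra_simps)
  also have "\<dots> \<le> s0" using a(3) by (simp add: pos_le_divide_eq mult.commute)
  finally have ss: "s \<le> s0" .
  have s1: "\<delta> \<le> s" "real (k + 3) * sqrt \<delta> + sqrt \<delta> \<le> s" "0 < s" unfolding s_def using d a by (auto simp: add_pos_pos)
  show ?thesis
  proof (rule that[OF d(1,3)])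
    fix D d0 d1 x0 x1 x2 :: real
    assume A: "star_density (k + 4) - \<delta> < D"
       "d0 \<le> star_density (k + 4) + (real (k + 3) * sqrt \<delta> + sqrt \<delta>)"
       "x0 * star_density (k + 4) - (\<delta> + (real (k + 3) * sqrt \<delta> + sqrt \<delta>)) \<le> x0 * d0"
       "x1 * star_density (k + 4) - (\<delta> + (real (k + 3) * sqrt \<delta> + sqrt \<delta>)) \<le> x1 * d1"
       "D \<le> real (k + 4) * (x0 + x2) * d0"
       "d0 + d1 \<le> (1 - (x0 + x1)) ^ (k + 3) + real (k + 3) * (x0 + x1) * ((1 - (x0 + x1)) ^ (k + 2) - x2\<^sup>2 * (1 - (x0 + x1)) ^ k)"
       "0 \<le> x2" "x2 \<le> x1" "x1 \<le> x0" "x0 \<le> \<xi>" "0 \<le> d0"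
    have x02: "0 \<le> x0 + x2" "0 \<le> x0" using A by auto
    have "x0 + x2 \<le> 1"
    proof -
      have "x0 < 1 / r" using A(10) assms unfolding r_def by simp
      moreover have "1 / r \<le> 1 / 4" using r by (intro divide_left_mono) auto
      ultimately show ?thesis using A by linarith
    qed
    have "M - s \<le> r * (x0 + x2) * d0" using A(1,5) s1 unfolding M_def r_def by linarith
    also have "\<dots> \<le> r * (x0 + x2) * (M + s)" using A(2) s1 x02 r unfolding M_def by (intro mult_left_mono) auto
    finally have "M - s \<le> r * (x0 + x2) * (M + s)" .
    moreover have "r * (x0 + x2) * s \<le> r * s" using \<open>x0 + x2 \<le> 1\<close> r s1 x02 mult_right_mono[of "r * (x0 + x2)" r s] mult_left_le[of "x0 + x2" r] by simp
    ultimately have q: "M - s - r * s \<le> r * (x0 + x2) * M" by (simp add: algebra_simps)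
    have q2: "1 / r - (1 + r) * s / (r * M) \<le> x0 + x2"
    proof -
      have "1 - (1 + r) * s / M \<le> r * (x0 + x2)"
        using divide_right_mono[OF q, of M] M0 by (simp add: diff_divide_distrib add_divide_distrib algebra_simps)
      then have "(1 - (1 + r) * s / M) / r \<le> x0 + x2" using r by (simp add: pos_divide_le_eq mult.commute)
      then show ?thesis by (simp add: diff_divide_distrib mult.commute)
    qed
    have ra: "(1 + r) * s / (r * M) \<le> \<kappa>"
    proof -
      have "s * (1 + r) \<le> r * M * \<kappa>" using ss s0'(1) r by (simp add: pos_le_divide_eq)
         (meson dual_order.trans mult_right_mono add_nonneg_nonneg order.trans zero_le_numeral zero_le_one)
      then show ?thesis using r M0 by (simp add: pos_divide_le_eq mult.commute mult.left_commute)
    qed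
    have rb: "(1 + r) * s / (r * M) \<le> \<theta>0 / 2"
    proof -
      have "s \<le> r * M * \<theta>0 / (2 * (1 + r))" using ss s0'(2) by linarith
      then have "s * (2 * (1 + r)) \<le> r * M * \<theta>0" using r by (subst (asm) pos_le_divide_eq) auto
      then have "(1 + r) * s \<le> \<theta>0 / 2 * (r * M)" by (simp add: algebra_simps)
      then show ?thesis using r M0 by (simp add: pos_divide_le_eq)
    qed
    have "2 * \<kappa> = 1 / r - \<xi>" unfolding \<kappa>_def by (simp only: times_divide_eq_right nonzero_mult_div_cancel_left[OF zero_neq_numeral[symmetric]])
    then have k2: "\<xi> = 1 / r - 2 * \<kappa>" by (simp only: diff_diff_eq2 add_diff_cancel_left')
    have x2: "\<kappa> \<le> x2" using q2 ra A(10) k2 by linarith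
    then have x1: "\<kappa> \<le> x1" and x0: "\<kappa> \<le> x0" using A by auto
    define y where "y = x0 + x1"
    have r4: "1 / r \<le> 1 / 4" using r by (intro divide_left_mono) auto
    have y: "1 / r - \<theta>0 < y" "2 * \<kappa> \<le> y" "y \<le> 1 / 2"
    proof -
      show "1 / r - \<theta>0 < y" using q2 rb \<theta>0(1) A(8) unfolding y_def by linarith
      show "2 * \<kappa> \<le> y" using x0 x1 unfolding y_def by linarith
      show "y \<le> 1 / 2" using A(9,10) k2 r4 \<kappa> unfolding y_def by linarith
    qed
    have low: "\<kappa> * (M - d) \<le> s" if "\<kappa> \<le> x" "x * M - s \<le> x * d" for x d
    proof (cases "d \<le> M")
      case True
      have "\<kappa> * (M - d) \<le> x * (M - d)" using that True by (intro mult_right_mono) auto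
      then show ?thesis using that by (simp add: algebra_simps)
    next
      case False
      then have "\<kappa> * (M - d) \<le> 0" using \<kappa> by (intro mult_nonneg_nonpos) auto
      then show ?thesis using s1 by linarith
    qed
    have "\<kappa> * (M - d0) \<le> s" "\<kappa> * (M - d1) \<le> s"
      using low[OF x0, of d0] low[OF x1, of d1] A(3,4) unfolding M_def s_def by auto
    then have "\<kappa> * (2 * M - d0 - d1) \<le> \<kappa> * (c / 4)" using ss s0'(3) by (simp add: algebra_simps)
    then have lo: "2 * M - d0 - d1 \<le> c / 4" using \<kappa> by (simp only: mult_le_cancel_left_pos)
    have "c \<le> real (k + 3) * y * (x2\<^sup>2 * (1 - y) ^ k)"
      unfolding c_def using y x2 \<kappa> by (intro mult_mono power_mono) auto
    moreover have "d0 + d1 \<le> phi k y - real (k + 3) * y * (x2\<^sup>2 * (1 - y) ^ k)"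
      using A(6) unfolding phi_def y_def[symmetric] by (simp add: algebra_simps)
    moreover have "phi k y \<le> 2 * M + c / 2" using phi_le y by simp
    ultimately show False using lo c by linarith
  qed
qed

text \<open>The family need not be a maximiser, but the absolute bound on intersecting families
  serves as the supremum \<open>M\<close> in the perturbation lemmas, and being within
  \<open>\<delta>\<close> of it yields the approximate link densities.\<close>

theorem lagrangian_gap:
  assumes r: "4 \<le> r" and xi: "\<xi> < 1 / real r"
  obtains \<delta> where "0 < \<delta>"
    "\<And>(V :: 'a set) E x. finite V \<Longrightarrow> E \<subseteq> ksets V r \<Longrightarrow> cross_intersecting E E \<Longrightarrow> weighting V x \<Longrightarrow>
       (\<And>v. v \<in> V \<Longrightarrow> x v \<le> \<xi>) \<Longrightarrow> fact r * wt x E \<le> star_density r - \<delta>"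
proof -
  define k where "k = r - 4"
  have k: "r = k + 4" using r by (simp add: k_def)
  obtain \<delta> where d: "0 < \<delta>" "\<delta> < 1" and gap:
    "\<And>D d0 d1 x0 x1 x2. star_density (k + 4) - \<delta> < D \<Longrightarrow>
       d0 \<le> star_density (k + 4) + (real (k + 3) * sqrt \<delta> + sqrt \<delta>) \<Longrightarrow>
       (x0 * star_density (k + 4) - (\<delta> + (real (k + 3) * sqrt \<delta> + sqrt \<delta>)) \<le> x0 * d0) \<Longrightarrow>
       (x1 * star_density (k + 4) - (\<delta> + (real (k + 3) * sqrt \<delta> + sqrt \<delta>)) \<le> x1 * d1) \<Longrightarrow>
       D \<le> real (k + 4) * (x0 + x2) * d0 \<Longrightarrow>
       d0 + d1 \<le> (1 - (x0 + x1)) ^ (k + 3) + real (k + 3) * (x0 + x1) * ((1 - (x0 + x1)) ^ (k + 2) - x2\<^sup>2 * (1 - (x0 + x1)) ^ k) \<Longrightarrow>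
       0 \<le> x2 \<Longrightarrow> x2 \<le> x1 \<Longrightarrow> x1 \<le> x0 \<Longrightarrow> x0 \<le> \<xi> \<Longrightarrow> 0 \<le> d0 \<Longrightarrow> False"
    using gap_constants[of \<xi> k] xi k by metis
  show ?thesis
  proof (rule that[OF d(1)], rule ccontr)
    fix V :: "'a set" and E x
    assume V: "finite V" and E: "E \<subseteq> ksets V r" "cross_intersecting E E" and x: "weighting V x"
      and cap: "\<And>v. v \<in> V \<Longrightarrow> x v \<le> \<xi>" and no: "\<not> fact r * wt x E \<le> star_density r - \<delta>"
    define n where "n = card V + 3"
    have n: "3 \<le> n" unfolding n_def by simp
    obtain F y where F: "F \<subseteq> ksets {..<n} r" "cross_intersecting F F" "compressed {..<n} F"
      and y: "\<And>i. 0 \<le> y i" "antimono y" "sum y {..<n} = 1" "wt x E \<le> wt y F" "\<And>i. \<exists>v\<in>V. y i \<le> x v"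
      by (rule normal_form[OF V E x, of n]) (auto simp: n_def)
    define M where "M = star_density (k + 4)"
    have yw: "weighting {..<n} y" using y by (simp add: weighting_def)
    define D where "D = fact (k + 4) * wt y F"
    define d where "d v = fact (k + 3) * wt y (link v F)" for v
    have "fact r * wt x E \<le> D" unfolding D_def k using y(4) by (intro mult_left_mono) auto
    then have D: "M - \<delta> < D" using no unfolding M_def k by linarith
    have F4: "F \<subseteq> ksets {..<n} (k + 4)" using F(1) unfolding k .
    have F': "F \<subseteq> ksets {..<n} (Suc (k + 3))" using F4 by (simp add: numeral_eq_Suc)
    have fS: "fact (Suc (k + 3)) = (fact (k + 4) :: real)" by (simp add: numeral_eq_Suc)
    define s where "s = real (k + 3) * sqrt \<delta> + sqrt \<delta>"
    have sq: "0 < sqrt \<delta>" "sqrt \<delta> < 1" "\<delta> / sqrt \<delta> = sqrt \<delta>" using d by (auto simp: real_div_sqrt)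
    have s0: "0 \<le> s" unfolding s_def using sq by simp
    have up: "d v \<le> M + s" if v: "v < n" for v
    proof -
      have "fact (k + 3) * wt y (link v F) \<le> M + real (k + 3) * sqrt \<delta> + \<delta> / sqrt \<delta>"
      proof (rule link_density_upper[OF _ F' yw])
        show "fact (Suc (k + 3)) * wt z F \<le> M" if "weighting {..<n} z" for z
          using lagrangian_intersecting_nat[OF F4 F(2) that n] fS unfolding M_def by simp
        show "M - \<delta> \<le> fact (Suc (k + 3)) * wt y F" using D unfolding D_def fS by simp
      qed (use v sq d in auto)
      then show ?thesis unfolding d_def s_def sq(3) by simp
    qed
    have lo: "y v * M - (\<delta> + s) \<le> y v * d v" if v: "v < n" for v
      unfolding d_def
    proof (rule link_density_lower[OF _ F' yw _ s0])
      show "M - \<delta> \<le> fact (Suc (k + 3)) * wt y F" using D unfolding D_def fS by simp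
      show "fact (k + 3) * wt y (link u F) \<le> M + s" if "u \<in> {..<n}" for u
        using up[of u] that unfolding d_def by simp
    qed (use v in auto)
    note cb = compressed_bounds[OF F4 F(2,3) y(1-3) n]
    obtain v where "v \<in> V" "y 0 \<le> x v" using y(5)[of 0] by blast
    then have y0: "y 0 \<le> \<xi>" using cap[of v] by linarith
    have d00: "0 \<le> d 0" unfolding d_def using link_density_le_1(2)[OF _ F' yw] by simp
    show False
    proof (rule gap[of D "d 0" "y 0" "y 1" "d 1" "y 2"])
      show "star_density (k + 4) - \<delta> < D" using D unfolding M_def .
      show "D \<le> real (k + 4) * (y 0 + y 2) * d 0" using cb(1) unfolding D_def d_def .
      show "d 0 + d 1 \<le> (1 - (y 0 + y 1)) ^ (k + 3) + real (k + 3) * (y 0 + y 1) * ((1 - (y 0 + y 1)) ^ (k + 2) - (y 2)\<^sup>2 * (1 - (y 0 + y 1)) ^ k)"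
        using cb(2) unfolding d_def by simp
    qed (use y0 d00 y(1) up[of 0] lo[of 0] lo[of 1] n y(2) in \<open>auto simp: M_def s_def antimono_def\<close>)
  qed
qed

section \<open>Weighted symmetrization\<close>

definition adj :: "'a set set \<Rightarrow> 'a \<Rightarrow> 'a \<Rightarrow> bool" where
  "adj E u v \<longleftrightarrow> (\<exists>e\<in>E. u \<in> e \<and> v \<in> e)"

text \<open>\<open>u\<close> counts as its own non-neighbour: this is the set whose weight
  symmetrization collects at \<open>u\<close>, and a bound on its weight also bounds the weight of
  \<open>u\<close>.\<close>

definition non_nbrs :: "'a set \<Rightarrow> 'a set set \<Rightarrow> 'a \<Rightarrow> 'a set" where
  "non_nbrs V E u = {w \<in> V. w = u \<or> \<not> adj E u w}"

definition pair_free :: "'a set set \<Rightarrow> bool" where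
  "pair_free E \<longleftrightarrow> (\<forall>A\<in>E. \<forall>B\<in>E. A \<inter> B = {} \<longrightarrow> (\<exists>a\<in>A. \<exists>b\<in>B. \<not> adj E a b))"

lemma adj_sym: "adj E u v \<longleftrightarrow> adj E v u"
  unfolding adj_def by blast

lemma non_nbrs_sym: "u \<in> V \<Longrightarrow> v \<in> non_nbrs V E u \<Longrightarrow> u \<in> non_nbrs V E v"
  unfolding non_nbrs_def using adj_sym by fastforce

lemma wt_hitting_le:
  assumes "finite V" "E \<subseteq> ksets V (Suc m)" "N \<subseteq> V" "\<And>v. v \<in> V \<Longrightarrow> 0 \<le> x v"
  shows "wt x {e \<in> E. e \<inter> N \<noteq> {}} \<le> (\<Sum>w\<in>N. x w * wt x (link w E))"
proof -
  have fN: "finite N" using assms finite_subset by blast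
  have fE: "finite E" by (rule finite_fam[OF assms(1,2)])
  have nn: "0 \<le> (\<Prod>v\<in>e. x v)" if "e \<in> E" for e
    using that assms(2,4) by (intro prod_nonneg) (auto simp: ksets_def)
  have "wt x {e \<in> E. e \<inter> N \<noteq> {}} \<le> (\<Sum>e\<in>{e \<in> E. e \<inter> N \<noteq> {}}. real (card {w\<in>N. w \<in> e}) * (\<Prod>v\<in>e. x v))"
    unfolding wt_def
  proof (rule sum_mono)
    fix e assume e: "e \<in> {e \<in> E. e \<inter> N \<noteq> {}}"
    then have "{w\<in>N. w \<in> e} \<noteq> {}" by blast
    then have "1 \<le> card {w\<in>N. w \<in> e}" using fN by (simp add: Suc_le_eq card_gt_0_iff)
    then have "1 * (\<Prod>v\<in>e. x v) \<le> real (card {w\<in>N. w \<in> e}) * (\<Prod>v\<in>e. x v)"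
      using nn e by (intro mult_right_mono) auto
    then show "(\<Prod>v\<in>e. x v) \<le> real (card {w\<in>N. w \<in> e}) * (\<Prod>v\<in>e. x v)" by simp
  qed
  also have "\<dots> \<le> (\<Sum>e\<in>E. real (card {w\<in>N. w \<in> e}) * (\<Prod>v\<in>e. x v))"
    using fE nn by (intro sum_mono2) auto
  also have "\<dots> = (\<Sum>e\<in>E. \<Sum>w | w \<in> N \<and> w \<in> e. \<Prod>v\<in>e. x v)" by simp
  also have "\<dots> = (\<Sum>w\<in>N. \<Sum>e | e \<in> E \<and> w \<in> e. \<Prod>v\<in>e. x v)"
    by (rule sum.swap_restrict[OF fN fE, symmetric])
  also have "\<dots> = (\<Sum>w\<in>N. x w * wt x (link w E))"
    using wt_containing[OF assms(1,2), of x] by (simp add: wt_def)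
  finally show ?thesis .
qed

text \<open>Edges meeting the non-neighbour set \<open>N\<close> weigh at most the sum of
  \<open>x w * wt x (link w E)\<close> over \<open>w\<close> in \<open>N\<close>, hence at most
  \<open>sum x N\<close> times the link of \<open>v\<close>. No member of that link meets
  \<open>N\<close>, so the moved weight realises this bound exactly.\<close>

lemma zykov_step:
  assumes V: "finite V" and E: "E \<subseteq> ksets V (Suc m)" and x: "weighting V x" and v: "v \<in> V"
    and mx: "\<And>w. w \<in> non_nbrs V E v \<Longrightarrow> 0 < x w \<Longrightarrow> wt x (link w E) \<le> wt x (link v E)"
    and y: "y = (\<lambda>u. if u = v then sum x (non_nbrs V E v) else if u \<in> non_nbrs V E v then 0 else x u)"
  shows "weighting V y" "wt x E \<le> wt y E"
proof -
  define N where "N = non_nbrs V E v"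
  have N: "N \<subseteq> V" "v \<in> N" "finite N" using v V unfolding N_def non_nbrs_def by auto
  have x0: "\<And>u. u \<in> V \<Longrightarrow> 0 \<le> x u" "sum x V = 1" using x by (auto simp: weighting_def)
  have sN: "0 \<le> sum x N" using N x0 by (intro sum_nonneg) auto
  have "sum y V = sum y (V - N) + sum y N" using V N by (intro sum.subset_diff) auto
  also have "sum y (V - N) = sum x (V - N)" using N(2) by (intro sum.cong) (auto simp: y N_def)
  also have "sum y N = sum y {v} + sum y (N - {v})" using N by (subst sum.subset_diff[of "{v}"]) auto
  also have "sum y (N - {v}) = 0" by (rule sum.neutral) (auto simp: y N_def)
  also have "sum y {v} = sum x N" by (simp add: y N_def)
  finally have "sum y V = sum x (V - N) + sum x N" by simp
  also have "\<dots> = sum x V" using V N by (intro sum.subset_diff[symmetric]) auto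
  finally have sy: "sum y V = 1" using x0 by simp
  have y0: "0 \<le> y u" if "u \<in> V" for u using x0 sN that unfolding y N_def by auto
  show "weighting V y" unfolding weighting_def using sy y0 by blast
  have fE: "finite E" by (rule finite_fam[OF V E])
  have Nlink: "u \<notin> N" if "A \<in> link v E" "u \<in> A" for u A
  proof -
    have "u \<noteq> v" "adj E v u" using that unfolding link_def adj_def by auto
    then show ?thesis unfolding N_def non_nbrs_def by simp
  qed
  have ly: "wt y (link v E) = wt x (link v E)"
    by (rule wt_cong) (metis Nlink N(2) N_def y)
  define R where "R = {e \<in> E. e \<inter> N = {}}"
  have Ry: "wt y R = wt x R" by (rule wt_cong) (use N(2) in \<open>auto simp: R_def y N_def\<close>)
  have "wt x E = wt x R + wt x {e \<in> E. e \<inter> N \<noteq> {}}"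
    unfolding wt_def R_def using fE by (subst sum.union_disjoint[symmetric]) (auto intro!: sum.cong)
  also have "wt x {e \<in> E. e \<inter> N \<noteq> {}} \<le> (\<Sum>w\<in>N. x w * wt x (link w E))"
    by (rule wt_hitting_le[OF V E N(1) x0(1)])
  also have "\<dots> \<le> (\<Sum>w\<in>N. x w * wt x (link v E))"
  proof (rule sum_mono)
    fix w assume w: "w \<in> N"
    then have "0 \<le> x w" using x0 N by auto
    then show "x w * wt x (link w E) \<le> x w * wt x (link v E)"
      using mx[of w] w unfolding N_def by (cases "x w = 0") (auto intro: mult_left_mono)
  qed
  also have "\<dots> = y v * wt y (link v E)" unfolding ly by (simp add: sum_distrib_right y N_def)
  also have "\<dots> = wt y {e \<in> E. v \<in> e}" using wt_containing[OF V E, of y v] by simp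
  finally have "wt x E \<le> wt y R + wt y {e \<in> E. v \<in> e}" unfolding Ry by simp
  also have "\<dots> = wt y (R \<union> {e \<in> E. v \<in> e})"
    unfolding wt_def R_def using fE N(2) by (subst sum.union_disjoint) auto
  also have "\<dots> \<le> wt y E" by (rule wt_mono[OF V _ E y0]) (auto simp: R_def)
  finally show "wt x E \<le> wt y E" .
qed

text \<open>The step is repeated at a vertex of largest link among those in conflict, which removes
  it from the conflict set and creates no new conflict. The cap survives: at \<open>v\<close> the
  collected total is unchanged, and any other vertex keeping its weight is adjacent to
  \<open>v\<close>, so its non-neighbour set only loses weight.\<close>

lemma zykov:
  assumes V: "finite V" and E: "E \<subseteq> ksets V (Suc m)" and x: "weighting V x"
    and cap: "\<And>u. u \<in> V \<Longrightarrow> 0 < x u \<Longrightarrow> sum x (non_nbrs V E u) \<le> \<xi>"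
  obtains y where "weighting V y" "wt x E \<le> wt y E"
    "\<And>u. u \<in> V \<Longrightarrow> 0 < y u \<Longrightarrow> sum y (non_nbrs V E u) \<le> \<xi>"
    "\<And>u w. u \<in> V \<Longrightarrow> w \<in> V \<Longrightarrow> u \<noteq> w \<Longrightarrow> 0 < y u \<Longrightarrow> 0 < y w \<Longrightarrow> adj E u w"
proof -
  \<comment> \<open>Vertices of positive weight having a non-neighbour of positive weight; their
    number is the induction measure.\<close>
  define bad where "bad x = {u \<in> V. 0 < x u \<and> (\<exists>w\<in>V. w \<noteq> u \<and> 0 < x w \<and> \<not> adj E u w)}" for x :: "'a \<Rightarrow> real"
  have "\<exists>y. weighting V y \<and> wt x E \<le> wt y E \<and> (\<forall>u\<in>V. 0 < y u \<longrightarrow> sum y (non_nbrs V E u) \<le> \<xi>) \<and> bad y = {}"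
    using x cap
  proof (induction "card (bad x)" arbitrary: x rule: less_induct)
    case less
    show ?case
    proof (cases "bad x = {}")
      case True
      then show ?thesis using less.prems by blast
    next
      case False
      have fb: "finite (bad x)" unfolding bad_def using V by simp
      have "Max ((\<lambda>v. wt x (link v E)) ` bad x) \<in> (\<lambda>v. wt x (link v E)) ` bad x"
        using fb False by (intro Max_in) auto
      then obtain v where v: "v \<in> bad x" and "wt x (link v E) = Max ((\<lambda>v. wt x (link v E)) ` bad x)" by auto
      then have mx: "wt x (link w E) \<le> wt x (link v E)" if "w \<in> bad x" for w
        using fb that by (auto intro!: Max_ge)
      have vV: "v \<in> V" "0 < x v" using v unfolding bad_def by auto
      define N where "N = non_nbrs V E v"
      define y where "y = (\<lambda>u. if u = v then sum x N else if u \<in> N then 0 else x u)"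
      have x0: "\<And>u. u \<in> V \<Longrightarrow> 0 \<le> x u" using less.prems(1) by (auto simp: weighting_def)
      have N: "N \<subseteq> V" "v \<in> N" "finite N" using vV V unfolding N_def non_nbrs_def by auto
      have mx': "wt x (link w E) \<le> wt x (link v E)" if "w \<in> non_nbrs V E v" "0 < x w" for w
      proof (cases "w = v")
        case False
        then have "w \<in> bad x" using that vV unfolding bad_def non_nbrs_def by (auto simp: adj_sym[of E w v])
        then show ?thesis by (rule mx)
      qed simp
      have yw: "weighting V y" "wt x E \<le> wt y E"
        using zykov_step[OF V E less.prems(1) vV(1) mx', of y] unfolding y_def N_def by auto
      have supp: "0 < x u" "u \<notin> N \<or> u = v" "u \<noteq> v \<Longrightarrow> y u = x u" if "0 < y u" for u
        using that vV unfolding y_def by (auto split: if_splits)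
      have "bad y \<subseteq> bad x - {v}"
      proof
        fix u assume u: "u \<in> bad y"
        then obtain w where w: "u \<in> V" "0 < y u" "w \<in> V" "w \<noteq> u" "0 < y w" "\<not> adj E u w" unfolding bad_def by auto
        have "u \<noteq> v"
        proof
          assume "u = v"
          then have "w \<in> N" using w unfolding N_def non_nbrs_def by auto
          then show False using supp(2)[OF w(5)] w(4) \<open>u = v\<close> by blast
        qed
        then show "u \<in> bad x - {v}" using w supp(1) unfolding bad_def by blast
      qed
      then have "card (bad y) < card (bad x)" using fb v by (metis Diff_subset card_Diff1_less card_mono finite_Diff le_less_trans)
      moreover have "sum y (non_nbrs V E u) \<le> \<xi>" if u: "u \<in> V" "0 < y u" for u
      proof (cases "u = v")
        case True
        have "sum y N = sum y {v} + sum y (N - {v})" using N by (subst sum.subset_diff[of "{v}"]) auto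
        also have "sum y (N - {v}) = 0" by (rule sum.neutral) (auto simp: y_def)
        finally have "sum y N = sum x N" by (simp add: y_def)
        then show ?thesis using less.prems(2)[OF vV] True unfolding N_def by simp
      next
        case False
        have "v \<notin> non_nbrs V E u"
        proof
          assume "v \<in> non_nbrs V E u"
          then have "u \<in> N" unfolding N_def by (rule non_nbrs_sym[OF u(1)])
          then show False using supp(2)[OF u(2)] False by blast
        qed
        then have "sum y (non_nbrs V E u) \<le> sum x (non_nbrs V E u)"
          using x0 by (intro sum_mono) (auto simp: y_def non_nbrs_def)
        also have "\<dots> \<le> \<xi>" using less.prems(2)[of u] u supp(1) by blast
        finally show ?thesis .
      qed
      ultimately obtain z where "weighting V z" "wt y E \<le> wt z E" "\<forall>u\<in>V. 0 < z u \<longrightarrow> sum z (non_nbrs V E u) \<le> \<xi>" "bad z = {}"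
        using less.hyps[of y] yw(1) by blast
      then show ?thesis using yw(2) by (intro exI[of _ z]) auto
    qed
  qed
  then obtain y where y: "weighting V y" "wt x E \<le> wt y E" "\<forall>u\<in>V. 0 < y u \<longrightarrow> sum y (non_nbrs V E u) \<le> \<xi>" "bad y = {}"
    by blast
  show ?thesis
  proof (rule that[OF y(1,2)])
    show "sum y (non_nbrs V E u) \<le> \<xi>" if "u \<in> V" "0 < y u" for u using y(3) that by blast
    show "adj E u w" if "u \<in> V" "w \<in> V" "u \<noteq> w" "0 < y u" "0 < y w" for u w
    proof (rule ccontr)
      assume "\<not> adj E u w"
      then have "u \<in> bad y" using that unfolding bad_def by auto
      then show False using y(4) by simp
    qed
  qed
qed

text \<open>All pairs in the support are covered by edges of \<open>E\<close>, possibly by edges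
  leaving the support. This is enough, since pair-freeness refers to adjacency in \<open>E\<close>:
  two disjoint edges inside the support would have all their cross pairs covered.\<close>

lemma pair_free_support:
  assumes V: "finite V" and E: "E \<subseteq> ksets V r" and pf: "pair_free E" and y: "weighting V y"
    and cl: "\<And>u w. u \<in> V \<Longrightarrow> w \<in> V \<Longrightarrow> u \<noteq> w \<Longrightarrow> 0 < y u \<Longrightarrow> 0 < y w \<Longrightarrow> adj E u w"
    and T: "T = {u \<in> V. 0 < y u}" and F: "F = {e \<in> E. e \<subseteq> T}"
  shows "F \<subseteq> ksets T r" "cross_intersecting F F" "weighting T y" "wt y E = wt y F" "finite T"
proof -
  show fT: "finite T" using V T by simp
  show "F \<subseteq> ksets T r" using E unfolding F ksets_def by auto
  have y0: "\<And>u. u \<in> V \<Longrightarrow> 0 \<le> y u" "sum y V = 1" using y by (auto simp: weighting_def)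
  show "cross_intersecting F F" unfolding cross_intersecting_def
  proof (intro ballI notI)
    fix A B assume AB: "A \<in> F" "B \<in> F" "A \<inter> B = {}"
    then have "A \<in> E" "B \<in> E" "A \<subseteq> T" "B \<subseteq> T" unfolding F by auto
    then obtain a b where ab: "a \<in> A" "b \<in> B" "\<not> adj E a b" using pf AB(3) unfolding pair_free_def by meson
    then have "a \<in> T" "b \<in> T" "a \<noteq> b" using AB(3) \<open>A \<subseteq> T\<close> \<open>B \<subseteq> T\<close> by auto
    then have "a \<in> V" "0 < y a" "b \<in> V" "0 < y b" unfolding T by auto
    from cl[OF this(1,3) \<open>a \<noteq> b\<close> this(2,4)] show False using ab(3) by simp
  qed
  have z: "y u = 0" if "u \<in> V" "u \<notin> T" for u using that y0(1)[of u] unfolding T by force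
  have "sum y T = sum y V" using V z by (intro sum.mono_neutral_left) (auto simp: T)
  then show "weighting T y" unfolding weighting_def using y0 by (auto simp: T)
  have fE: "finite E" by (rule finite_fam[OF V E])
  show "wt y E = wt y F" unfolding wt_def
  proof (rule sum.mono_neutral_right[OF fE])
    show "F \<subseteq> E" unfolding F by blast
    show "\<forall>e\<in>E - F. (\<Prod>v\<in>e. y v) = 0"
    proof
      fix e assume e: "e \<in> E - F"
      then obtain u where "u \<in> e" "u \<notin> T" unfolding F by blast
      moreover have "e \<subseteq> V" using e E unfolding ksets_def by auto
      moreover have "finite e" using finite_subset[OF \<open>e \<subseteq> V\<close> V] .
      ultimately show "(\<Prod>v\<in>e. y v) = 0" using z[of u] by (intro prod_zero) auto
    qed
  qed
qed

theorem pair_free_density: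
  assumes r: "4 \<le> r" and V: "finite V" and E: "E \<subseteq> ksets V r" and pf: "pair_free E" and x: "weighting V x"
  shows "fact r * wt x E \<le> star_density r"
proof -
  define m where "m = r - 1"
  have m: "r = Suc m" using r by (simp add: m_def)
  \<comment> \<open>At the value 1 the cap holds for every weighting.\<close>
  have cap: "sum x (non_nbrs V E u) \<le> 1" if "u \<in> V" "0 < x u" for u
  proof -
    have "sum x (non_nbrs V E u) \<le> sum x V"
      using V x by (intro sum_mono2) (auto simp: non_nbrs_def weighting_def)
    then show ?thesis using x by (simp add: weighting_def)
  qed
  obtain y where y: "weighting V y" "wt x E \<le> wt y E"
    and cl: "\<And>u w. u \<in> V \<Longrightarrow> w \<in> V \<Longrightarrow> u \<noteq> w \<Longrightarrow> 0 < y u \<Longrightarrow> 0 < y w \<Longrightarrow> adj E u w"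
    by (rule zykov[of V E m x 1, OF V E[unfolded m] x cap]) (assumption | rule that | blast)+
  define T where "T = {u \<in> V. 0 < y u}"
  define F where "F = {e \<in> E. e \<subseteq> T}"
  have s: "F \<subseteq> ksets T r" "cross_intersecting F F" "weighting T y" "wt y E = wt y F" "finite T"
    by (rule pair_free_support[of V E r y T F]; use V E pf y(1) cl T_def F_def in blast)+
  have "fact r * wt x E \<le> fact r * wt y E" using y(2) by (intro mult_left_mono) auto
  also have "\<dots> \<le> star_density r" unfolding s(4) by (rule lagrangian_intersecting[OF r s(5,1,2,3)])
  finally show ?thesis .
qed

text \<open>Symmetrization does not increase the largest weight of a non-neighbour set beyond the
  cap, and a single weight is at most that of its own non-neighbour set. So the intersecting family
  on the support has all weights at most \<open>\<xi>\<close>.\<close>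

theorem pair_free_gap:
  assumes r: "4 \<le> r" and xi: "\<xi> < 1 / real r"
  obtains \<delta> where "0 < \<delta>"
    "\<And>(V :: 'a set) E x. finite V \<Longrightarrow> E \<subseteq> ksets V r \<Longrightarrow> pair_free E \<Longrightarrow> weighting V x \<Longrightarrow>
       (\<And>u. u \<in> V \<Longrightarrow> 0 < x u \<Longrightarrow> sum x (non_nbrs V E u) \<le> \<xi>) \<Longrightarrow> fact r * wt x E \<le> star_density r - \<delta>"
proof -
  define m where "m = r - 1"
  have m: "r = Suc m" using r by (simp add: m_def)
  obtain \<delta> where d: "0 < \<delta>" and gap:
    "\<And>(V :: 'a set) E x. finite V \<Longrightarrow> E \<subseteq> ksets V r \<Longrightarrow> cross_intersecting E E \<Longrightarrow> weighting V x \<Longrightarrow>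
       (\<And>v. v \<in> V \<Longrightarrow> x v \<le> \<xi>) \<Longrightarrow> fact r * wt x E \<le> star_density r - \<delta>"
    using lagrangian_gap[OF r xi] by metis
  show ?thesis
  proof (rule that[OF d])
    fix V :: "'a set" and E x
    assume V: "finite V" and E: "E \<subseteq> ksets V r" and pf: "pair_free E" and x: "weighting V x"
      and cap: "\<And>u. u \<in> V \<Longrightarrow> 0 < x u \<Longrightarrow> sum x (non_nbrs V E u) \<le> \<xi>"
    obtain y where y: "weighting V y" "wt x E \<le> wt y E"
      and cy: "\<And>u. u \<in> V \<Longrightarrow> 0 < y u \<Longrightarrow> sum y (non_nbrs V E u) \<le> \<xi>"
      and cl: "\<And>u w. u \<in> V \<Longrightarrow> w \<in> V \<Longrightarrow> u \<noteq> w \<Longrightarrow> 0 < y u \<Longrightarrow> 0 < y w \<Longrightarrow> adj E u w"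
      by (rule zykov[of V E m x \<xi>, OF V E[unfolded m] x cap]) (assumption | rule that | blast)+
    define T where "T = {u \<in> V. 0 < y u}"
    define F where "F = {e \<in> E. e \<subseteq> T}"
    have s: "F \<subseteq> ksets T r" "cross_intersecting F F" "weighting T y" "wt y E = wt y F" "finite T"
      by (rule pair_free_support[of V E r y T F]; use V E pf y(1) cl T_def F_def in blast)+
    have capT: "y u \<le> \<xi>" if "u \<in> T" for u
    proof -
      have u: "u \<in> V" "0 < y u" using that unfolding T_def by auto
      have "y u \<le> sum y (non_nbrs V E u)"
        using u V y(1) by (intro member_le_sum) (auto simp: non_nbrs_def weighting_def)
      then show ?thesis using cy[OF u] by linarith
    qed
    have "fact r * wt x E \<le> fact r * wt y E" using y(2) by (intro mult_left_mono) auto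
    also have "\<dots> \<le> star_density r - \<delta>" unfolding s(4) by (rule gap[OF s(5,1,2,3) capT])
    finally show "fact r * wt x E \<le> star_density r - \<delta>" .
  qed
qed

section \<open>Stability\<close>

lemma power_diff_le_linear:
  fixes p q :: real
  assumes "0 \<le> p" "p \<le> q" "q \<le> 1"
  shows "q ^ k - p ^ k \<le> real k * (q - p)"
proof (induction k)
  case (Suc k)
  have "q ^ Suc k - p ^ Suc k = q * (q ^ k - p ^ k) + p ^ k * (q - p)" by (simp add: algebra_simps)
  also have "q * (q ^ k - p ^ k) \<le> 1 * (q ^ k - p ^ k)"
    using assms power_mono[of p q k] by (intro mult_right_mono) auto
  also have "p ^ k * (q - p) \<le> 1 * (q - p)"
    using assms by (intro mult_right_mono power_le_one) auto
  finally show ?case using Suc by (simp add: algebra_simps)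
qed simp

lemma wt_const: "E \<subseteq> ksets V k \<Longrightarrow> wt (\<lambda>_. c) E = c ^ k * real (card E)"
proof -
  assume "E \<subseteq> ksets V k"
  then have "wt (\<lambda>_. c) E = (\<Sum>e\<in>E. c ^ k)" unfolding wt_def by (intro sum.cong) (auto simp: ksets_def)
  then show ?thesis by simp
qed

lemma sum_degrees_on:
  assumes "finite V" "E \<subseteq> ksets V (Suc m)" "W \<subseteq> V"
  shows "(\<Sum>v\<in>W. real (card (link v E))) = (\<Sum>e\<in>E. real (card (e \<inter> W)))"
proof -
  have fW: "finite W" using assms finite_subset by blast
  have fE: "finite E" by (rule finite_fam[OF assms(1,2)])
  have c: "real (card (link v E)) = (\<Sum>e | e \<in> E \<and> v \<in> e. 1)" for v
  proof -
    have "wt (\<lambda>_. 1) {e \<in> E. v \<in> e} = 1 * wt (\<lambda>_. 1) (link v E)" by (rule wt_containing[OF assms(1,2)])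
    then show ?thesis using wt_const[OF link_subset[OF assms(1,2)], where c = 1] by (simp add: wt_def)
  qed
  have "(\<Sum>v\<in>W. real (card (link v E))) = (\<Sum>v\<in>W. \<Sum>e | e \<in> E \<and> v \<in> e. 1)" unfolding c ..
  also have "\<dots> = (\<Sum>e\<in>E. \<Sum>v | v \<in> W \<and> v \<in> e. 1)" by (rule sum.swap_restrict[OF fW fE])
  also have "\<dots> = (\<Sum>e\<in>E. real (card (e \<inter> W)))"
    by (intro sum.cong refl) (simp add: Int_def conj_commute)
  finally show ?thesis .
qed

lemma card_ksets_le: "finite V \<Longrightarrow> real (card (ksets V k)) * fact k \<le> real (card V) ^ k"
proof -
  assume V: "finite V"
  have "(card V choose k) * fact k \<le> card V ^ k" by (rule binomial_fact_pow)
  then have "real ((card V choose k) * fact k) \<le> real (card V ^ k)" by (simp only: of_nat_le_iff)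
  then show ?thesis using card_ksets[OF V, of k] by simp
qed

lemma card_ksets_le': "finite V \<Longrightarrow> real (card (ksets V k)) \<le> real (card V) ^ k"
  using card_ksets_le[of V k] by (smt (verit) fact_ge_1 mult_le_cancel_left1 of_nat_0_le_iff)

lemma card_ksets_ge:
  assumes "finite V" "0 < k" "real k \<le> c" "c \<le> real (card V)"
  shows "(c / real k) ^ k \<le> real (card (ksets V k))"
proof -
  have "k \<le> card V" using assms by linarith
  have "(c / real k) ^ k \<le> (real (card V) / real k) ^ k"
    using assms by (intro power_mono divide_right_mono) auto
  also have "\<dots> \<le> real (card V choose k)" by (rule binomial_ge_n_over_k_pow_k[OF \<open>k \<le> card V\<close>])
  finally show ?thesis using card_ksets[OF assms(1)] by simp
qed

lemma card_link_le:
  assumes "finite V" "E \<subseteq> ksets V (Suc m)"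
  shows "real (card (link v E)) \<le> real (card V) ^ m"
proof -
  have "card (link v E) \<le> card (ksets (V - {v}) m)"
    using link_subset[OF assms, of v] assms(1) by (intro card_mono finite_ksets) auto
  also have "\<dots> \<le> card (ksets V m)" using assms(1) by (intro card_mono finite_ksets ksets_mono) auto
  finally have "real (card (link v E)) \<le> real (card (ksets V m))" by simp
  also have "\<dots> \<le> real (card V) ^ m" by (rule card_ksets_le'[OF assms(1)])
  finally show ?thesis .
qed

lemma card_hitting_le:
  assumes "finite V" "E \<subseteq> ksets V (Suc m)" "N \<subseteq> V"
  shows "real (card {e \<in> E. e \<inter> N \<noteq> {}}) \<le> real (card N) * real (card V) ^ m"
proof -
  have "wt (\<lambda>_. 1) {e \<in> E. e \<inter> N \<noteq> {}} \<le> (\<Sum>w\<in>N. 1 * wt (\<lambda>_. 1) (link w E))"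
    by (rule wt_hitting_le[OF assms]) simp
  moreover have "wt (\<lambda>_. 1) {e \<in> E. e \<inter> N \<noteq> {}} = real (card {e \<in> E. e \<inter> N \<noteq> {}})"
    using assms(2) by (subst wt_const[of _ V "Suc m"]) auto
  moreover have "wt (\<lambda>_. 1) (link w E) = real (card (link w E))" for w
    using wt_const[OF link_subset[OF assms(1,2)], where c = 1] by simp
  ultimately have "real (card {e \<in> E. e \<inter> N \<noteq> {}}) \<le> (\<Sum>w\<in>N. real (card (link w E)))" by simp
  also have "\<dots> \<le> (\<Sum>w\<in>N. real (card V) ^ m)" by (intro sum_mono card_link_le[OF assms(1,2)])
  finally show ?thesis by simp
qed

text \<open>Pointwise, the indicator of \<open>card (e \<inter> V1) \<noteq> 1\<close> is at most
  \<open>card (e \<inter> V1) - 1\<close> plus twice the indicator of an empty intersection. Thus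
  bad edges are controlled by the edges missing \<open>V1\<close> and the degree sum on
  \<open>V1\<close>.\<close>

lemma off_by_one_count:
  assumes "finite V" "E \<subseteq> ksets V (Suc m)" "V1 \<subseteq> V"
  shows "real (card {e \<in> E. card (e \<inter> V1) \<noteq> 1})
    \<le> 2 * real (card {e \<in> E. e \<inter> V1 = {}}) + (\<Sum>v\<in>V1. real (card (link v E))) - real (card E)"
proof -
  have fE: "finite E" by (rule finite_fam[OF assms(1,2)])
  have fe: "finite e" if "e \<in> E" for e
    using that assms finite_subset[of e V] unfolding ksets_def by blast
  have "real (card {e \<in> E. card (e \<inter> V1) \<noteq> 1}) = (\<Sum>e\<in>E. if card (e \<inter> V1) \<noteq> 1 then 1 else 0)"
    using fE by (simp add: sum.If_cases Int_def)
  also have "\<dots> \<le> (\<Sum>e\<in>E. 2 * (if e \<inter> V1 = {} then 1 else 0) + real (card (e \<inter> V1)) - 1)"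
  proof (rule sum_mono)
    fix e assume e: "e \<in> E"
    have "card (e \<inter> V1) = 0 \<longleftrightarrow> e \<inter> V1 = {}" using fe[OF e] by simp
    then show "(if card (e \<inter> V1) \<noteq> 1 then 1 else 0) \<le> 2 * (if e \<inter> V1 = {} then 1 else 0) + real (card (e \<inter> V1)) - 1"
      by auto
  qed
  also have "\<dots> = 2 * (\<Sum>e\<in>E. if e \<inter> V1 = {} then 1 else 0) + (\<Sum>e\<in>E. real (card (e \<inter> V1))) - real (card E)"
    by (simp add: sum.distrib sum_subtractf sum_distrib_left)
  also have "(\<Sum>e\<in>E. if e \<inter> V1 = {} then 1 else 0) = real (card {e \<in> E. e \<inter> V1 = {}})"
    using fE by (simp add: sum.If_cases Int_def)
  also have "(\<Sum>e\<in>E. real (card (e \<inter> V1))) = (\<Sum>v\<in>V1. real (card (link v E)))"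
    by (rule sum_degrees_on[OF assms, symmetric])
  finally show ?thesis .
qed

text \<open>The degrees are bounded above by almost their average, so only few of them can lie well
  below it.\<close>

lemma few_low_degree:
  assumes V: "finite V" "V \<noteq> {}" and E: "E \<subseteq> ksets V (Suc m)" and n: "n = real (card V)"
    and D: "(M - \<delta>) * n ^ Suc m \<le> fact (Suc m) * real (card E)"
    and up: "\<And>v. v \<in> V \<Longrightarrow> fact m * real (card (link v E)) \<le> (M + \<eta>) * n ^ m"
    and U: "U = {v \<in> V. fact m * real (card (link v E)) < (M - \<eta>') * n ^ m}"
  shows "real (card U) * (\<eta>' + \<eta>) \<le> n * (\<delta> + \<eta>)"
proof -
  have n0: "0 < n" using V n by (simp add: card_gt_0_iff)
  have UV: "U \<subseteq> V" unfolding U by blast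
  have "fact (Suc m) * real (card E) = fact m * (\<Sum>v\<in>V. real (card (link v E)))"
  proof -
    have "(\<Sum>e\<in>E. real (card (e \<inter> V))) = (\<Sum>e\<in>E. real (Suc m))"
    proof (rule sum.cong[OF refl])
      fix e assume "e \<in> E"
      then have "e \<subseteq> V" "card e = Suc m" using E by (auto simp: ksets_def)
      then show "real (card (e \<inter> V)) = real (Suc m)" by (simp add: Int_absorb2)
    qed
    then show ?thesis using sum_degrees_on[OF V(1) E, of V] by (simp add: algebra_simps)
  qed
  also have "\<dots> = (\<Sum>v\<in>V. fact m * real (card (link v E)))" by (simp add: sum_distrib_left)
  also have "\<dots> = (\<Sum>v\<in>V - U. fact m * real (card (link v E))) + (\<Sum>v\<in>U. fact m * real (card (link v E)))"
    by (rule sum.subset_diff[OF UV V(1)])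
  also have "\<dots> \<le> (\<Sum>v\<in>V - U. (M + \<eta>) * n ^ m) + (\<Sum>v\<in>U. (M - \<eta>') * n ^ m)"
    using up by (intro add_mono sum_mono) (auto simp: U)
  also have "\<dots> = (n - real (card U)) * ((M + \<eta>) * n ^ m) + real (card U) * ((M - \<eta>') * n ^ m)"
    using UV V(1) finite_subset[OF UV V(1)] card_mono[OF V(1) UV] by (simp add: card_Diff_subset n of_nat_diff)
  finally have "n ^ m * ((M - \<delta>) * n) \<le> n ^ m * ((n - real (card U)) * (M + \<eta>) + real (card U) * (M - \<eta>'))"
    using D by (simp add: algebra_simps)
  then have "(M - \<delta>) * n \<le> (n - real (card U)) * (M + \<eta>) + real (card U) * (M - \<eta>')"
    using n0 by (simp only: mult_le_cancel_left_pos zero_less_power)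
  then show ?thesis by (simp add: algebra_simps)
qed

text \<open>An edge \<open>B\<close> inside \<open>V2\<close> whose vertices all have few
  non-neighbours there leaves a large set \<open>S\<close> adjacent to all of \<open>B\<close>. The
  nearly complete link of \<open>u\<close> has a member inside \<open>S\<close>, and this member
  with \<open>u\<close> contradicts pair-freeness. So edges inside \<open>V2\<close> meet the set
  \<open>Z\<close> of vertices with many non-neighbours, and \<open>Z\<close> is small because it
  forces sets to be missing from the link of \<open>u\<close>.\<close>

lemma few_edges_outside:
  assumes V: "finite V" and E: "E \<subseteq> ksets V (Suc m)" and pf: "pair_free E" and m: "3 \<le> m"
    and n: "n = real (card V)" and u: "u \<in> V" and V2: "V2 = V - non_nbrs V E u"
    and big: "n / 2 \<le> real (card V2)" and n8: "8 * real (Suc m) * real m \<le> n"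
    and miss: "real (card (ksets V2 m - link u E)) \<le> \<epsilon> * n ^ m"
    and eps: "\<epsilon> < (1 / (4 * real m)) ^ m"
  shows "real (card {e \<in> E. e \<subseteq> V2}) * (1 / (8 * real (Suc m) * real (m - 1))) ^ (m - 1) \<le> real m * \<epsilon> * n ^ Suc m"
proof -
  \<comment> \<open>The \<open>Suc m\<close> vertices of an edge then exclude at most
    \<open>n / 4\<close> vertices, half of what \<open>V2\<close> is known to contain.\<close>
  define c where "c = 1 / (4 * real (Suc m))"
  define Z where "Z = {w \<in> V2. c * n \<le> real (card (non_nbrs V E w \<inter> V2))}"
  have fV2: "finite V2" "V2 \<subseteq> V" "u \<notin> V2" using V u unfolding V2 non_nbrs_def by auto
  have fZ: "finite Z" "Z \<subseteq> V" "Z \<subseteq> V2" using fV2 unfolding Z_def by auto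
  define F where "F = ksets V2 m - link u E"
  have fF: "finite F" unfolding F_def using fV2 by (simp add: finite_ksets)
  have n0: "0 < n" using n8 m by (smt (verit) mult_pos_pos of_nat_0_less_iff zero_less_Suc neq0_conv not_numeral_le_zero)
  define L where "L = (1 / (8 * real (Suc m) * real (m - 1))) ^ (m - 1) * n ^ (m - 1)"
  \<comment> \<open>A set consisting of \<open>w\<close> and non-neighbours of \<open>w\<close>
    cannot belong to the link of \<open>u\<close>, since the edge through \<open>u\<close> would
    make them adjacent.\<close>
  have zbig: "L \<le> real (card {A \<in> F. w \<in> A})" if w: "w \<in> Z" for w
  proof -
    define N where "N = non_nbrs V E w \<inter> V2 - {w}"
    have fN: "finite N" unfolding N_def using fV2 by simp
    have "w \<in> non_nbrs V E w \<inter> V2" using w fZ fV2 unfolding non_nbrs_def by auto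
    then have "Suc (card N) = card (non_nbrs V E w \<inter> V2)"
      unfolding N_def using fV2 by (intro card_Suc_Diff1) auto
    then have cN: "real (card N) = real (card (non_nbrs V E w \<inter> V2)) - 1" by linarith
    have "1 \<le> c * n / 2"
    proof -
      have "8 * real (Suc m) * 1 \<le> 8 * real (Suc m) * real m" using m by (intro mult_left_mono) auto
      then have "8 * real (Suc m) \<le> n" using n8 by linarith
      then show ?thesis unfolding c_def by (simp add: field_simps)
    qed
    then have cN2: "c * n / 2 \<le> real (card N)" using w cN unfolding Z_def by simp
    have mc: "real (m - 1) \<le> c * n / 2"
    proof -
      have "8 * real (Suc m) * real (m - 1) \<le> 8 * real (Suc m) * real m" by (intro mult_left_mono) auto
      then have "real (m - 1) * (8 * real (Suc m)) \<le> n" using n8 by (metis mult.commute order.trans)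
      then have "real (m - 1) \<le> n / (8 * real (Suc m))" by (subst pos_le_divide_eq) auto
      then show ?thesis unfolding c_def by simp
    qed
    have "L = (c * n / 2 / real (m - 1)) ^ (m - 1)"
      unfolding L_def c_def power_mult_distrib[symmetric] by (simp add: mult.commute mult.left_commute)
    also have "\<dots> \<le> real (card (ksets N (m - 1)))"
      by (rule card_ksets_ge[OF fN _ mc cN2]) (use m in simp)
    also have "card (ksets N (m - 1)) = card (insert w ` ksets N (m - 1))"
    proof (rule card_image[symmetric], rule inj_onI)
      fix A B assume "A \<in> ksets N (m - 1)" "B \<in> ksets N (m - 1)" "insert w A = insert w B"
      moreover have "w \<notin> N" unfolding N_def by simp
      ultimately show "A = B" unfolding ksets_def by (metis (no_types, lifting) insert_ident mem_Collect_eq subsetD)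
    qed
    also have "real \<dots> \<le> real (card {A \<in> F. w \<in> A})"
    proof (simp only: of_nat_le_iff, rule card_mono)
      show "finite {A \<in> F. w \<in> A}" using fF by simp
      show "insert w ` ksets N (m - 1) \<subseteq> {A \<in> F. w \<in> A}"
      proof
        fix A assume "A \<in> insert w ` ksets N (m - 1)"
        then obtain B where B: "A = insert w B" "B \<subseteq> N" "card B = m - 1" unfolding ksets_def by auto
        have wB: "w \<notin> B" using B(2) unfolding N_def by auto
        have fB: "finite B" using finite_subset[OF B(2) fN] .
        have "card A = m" unfolding B(1) using wB fB B(3) m by simp
        moreover have "A \<subseteq> V2" using B w fZ unfolding N_def by auto
        moreover have "A \<notin> link u E"
        proof
          assume "A \<in> link u E"
          then have e: "insert u A \<in> E" unfolding link_def by simp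
          have "B \<noteq> {}" using B(3) m by (metis card.empty not_numeral_le_zero diff_is_0_eq less_numeral_extra(3) numeral_le_one_iff order.trans semiring_norm(70))
          then obtain b where b: "b \<in> B" by (meson all_not_in_conv)
          have "w \<in> insert u A" "b \<in> insert u A" using b B(1) by simp_all
          then have "adj E w b" unfolding adj_def by (intro bexI[OF _ e]) simp
          moreover have "b \<in> non_nbrs V E w" "b \<noteq> w" using b B(2) unfolding N_def by auto
          ultimately show False unfolding non_nbrs_def by simp
        qed
        ultimately show "A \<in> {A \<in> F. w \<in> A}" unfolding F_def ksets_def B(1) by simp
      qed
    qed
    finally show ?thesis .
  qed
  have "real (card Z) * L = (\<Sum>w\<in>Z. L)" by simp
  also have "\<dots> \<le> (\<Sum>w\<in>Z. real (card {A \<in> F. w \<in> A}))" by (rule sum_mono[OF zbig])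
  also have "\<dots> = (\<Sum>w\<in>Z. \<Sum>A | A \<in> F \<and> w \<in> A. 1)" by simp
  also have "\<dots> = (\<Sum>A\<in>F. \<Sum>w | w \<in> Z \<and> w \<in> A. 1)" by (rule sum.swap_restrict[OF fZ(1) fF])
  also have "\<dots> \<le> (\<Sum>A\<in>F. real m)"
  proof (rule sum_mono)
    fix A assume "A \<in> F"
    then have A: "A \<subseteq> V2" "card A = m" unfolding F_def ksets_def by auto
    then have "finite A" using fV2 finite_subset by blast
    then have "card {w. w \<in> Z \<and> w \<in> A} \<le> card A" by (intro card_mono) auto
    then show "(\<Sum>w | w \<in> Z \<and> w \<in> A. 1) \<le> real m" using A by simp
  qed
  also have "\<dots> = real (card F) * real m" by simp
  also have "\<dots> \<le> \<epsilon> * n ^ m * real m" using miss unfolding F_def by (intro mult_right_mono) auto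
  finally have Zc: "real (card Z) * L \<le> \<epsilon> * n ^ m * real m" .
  have "{e \<in> E. e \<subseteq> V2} \<subseteq> {e \<in> E. e \<inter> Z \<noteq> {}}"
  proof (rule subsetI, rule ccontr)
    fix B assume "B \<in> {e \<in> E. e \<subseteq> V2}" "B \<notin> {e \<in> E. e \<inter> Z \<noteq> {}}"
    then have B: "B \<in> E" "B \<subseteq> V2" "B \<inter> Z = {}" by auto
    then have cB: "card B = Suc m" "finite B" using E fV2 finite_subset[of B V2] unfolding ksets_def by auto
    define S where "S = V2 - (\<Union>b\<in>B. non_nbrs V E b \<inter> V2)"
    have "real (card (\<Union>b\<in>B. non_nbrs V E b \<inter> V2)) \<le> (\<Sum>b\<in>B. real (card (non_nbrs V E b \<inter> V2)))"
      using card_UN_le[OF cB(2), of "\<lambda>b. non_nbrs V E b \<inter> V2"] by (metis of_nat_le_iff of_nat_sum)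
    also have "\<dots> \<le> (\<Sum>b\<in>B. c * n)"
    proof (rule sum_mono)
      fix b assume "b \<in> B"
      then have "b \<in> V2" "b \<notin> Z" using B by auto
      then show "real (card (non_nbrs V E b \<inter> V2)) \<le> c * n" unfolding Z_def by simp
    qed
    also have "\<dots> = (c * real (Suc m)) * n" using cB by simp
    also have "c * real (Suc m) = 1 / 4" unfolding c_def by (simp del: of_nat_Suc)
    also have "1 / 4 * n = n / 4" by simp
    finally have "real (card (\<Union>b\<in>B. non_nbrs V E b \<inter> V2)) \<le> n / 4" .
    moreover have "card V2 - card (\<Union>b\<in>B. non_nbrs V E b \<inter> V2) \<le> card S"
      unfolding S_def by (rule diff_card_le_card_Diff) (use cB fV2 in auto)
    ultimately have S: "n / 4 \<le> real (card S)" using big by linarith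
    have fS: "finite S" unfolding S_def using fV2 by simp
    have mn: "real m \<le> n / 4"
    proof -
      have "real m * 4 \<le> real m * (8 * real (Suc m))" by (intro mult_left_mono) auto
      moreover have "real m * (8 * real (Suc m)) = 8 * real (Suc m) * real m" by (simp only: mult_ac)
      ultimately show ?thesis using n8 by linarith
    qed
    have "\<epsilon> * n ^ m < (1 / (4 * real m)) ^ m * n ^ m" using eps n0 by simp
    also have "\<dots> = (n / 4 / real m) ^ m" unfolding power_mult_distrib[symmetric] by (simp add: mult.commute)
    also have "\<dots> \<le> real (card (ksets S m))" by (rule card_ksets_ge[OF fS _ mn S]) (use m in simp)
    finally have "real (card F) < real (card (ksets S m))" using miss unfolding F_def by linarith
    then have "\<not> ksets S m \<subseteq> F" using card_mono[OF fF, of "ksets S m"] by auto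
    moreover have "ksets S m \<subseteq> ksets V2 m" by (rule ksets_mono) (auto simp: S_def)
    ultimately obtain A where A: "A \<in> ksets S m" "A \<in> link u E" unfolding F_def by blast
    then have Ae: "insert u A \<in> E" "A \<subseteq> S" unfolding link_def ksets_def by auto
    have SB: "S \<inter> B = {}"
    proof -
      have "b \<in> non_nbrs V E b \<inter> V2" if "b \<in> B" for b using that B(2) fV2 unfolding non_nbrs_def by auto
      then show ?thesis unfolding S_def by blast
    qed
    have "insert u A \<inter> B = {}" using SB Ae(2) B(2) fV2(3) by auto
    then obtain a b where ab: "a \<in> insert u A" "b \<in> B" "\<not> adj E a b"
      using pf Ae(1) B(1) unfolding pair_free_def by meson
    have bV: "b \<in> V" "b \<in> V2" using ab B(2) fV2 by auto
    show False
    proof (cases "a = u")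
      case True
      then have "b \<in> non_nbrs V E u" using ab bV unfolding non_nbrs_def by simp
      then show False using bV unfolding V2 by simp
    next
      case False
      then have a: "a \<in> S" using ab(1) Ae(2) by auto
      then have "a \<in> V2" unfolding S_def by auto
      then have "a \<in> non_nbrs V E b \<inter> V2" using ab(3) fV2(2) unfolding non_nbrs_def by (auto simp: adj_sym)
      then show False using a ab(2) unfolding S_def by auto
    qed
  qed
  then have "card {e \<in> E. e \<subseteq> V2} \<le> card {e \<in> E. e \<inter> Z \<noteq> {}}"
    using finite_fam[OF V E] by (intro card_mono) auto
  then have "real (card {e \<in> E. e \<subseteq> V2}) \<le> real (card Z) * n ^ m"
    using card_hitting_le[OF V E fZ(2)] unfolding n by linarith
  then have "real (card {e \<in> E. e \<subseteq> V2}) * L \<le> real (card Z) * n ^ m * L"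
    using n0 unfolding L_def by (intro mult_right_mono) auto
  also have "\<dots> = (real (card Z) * L) * n ^ m" by simp
  also have "\<dots> \<le> (\<epsilon> * n ^ m * real m) * n ^ m" using Zc n0 by (intro mult_right_mono) auto
  finally have "real (card {e \<in> E. e \<subseteq> V2}) * L \<le> (\<epsilon> * n ^ m * real m) * n ^ m" .
  moreover have "n ^ m = n ^ (m - 1) * n" using m by (intro power_minus_mult[symmetric]) simp
  ultimately have "n ^ (m - 1) * (real (card {e \<in> E. e \<subseteq> V2}) * (1 / (8 * real (Suc m) * real (m - 1))) ^ (m - 1))
      \<le> n ^ (m - 1) * (real m * \<epsilon> * n ^ Suc m)"
    unfolding L_def by (simp add: mult_ac)
  then show ?thesis using n0 by (simp only: mult_le_cancel_left_pos zero_less_power)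
qed

text \<open>The perturbation bound at the uniform weighting, with
  \<open>\<epsilon> = s\<^sup>2\<close> and \<open>\<tau> = s\<close> so that both error terms are
  multiples of \<open>s\<close>.\<close>

lemma pair_free_degree_le:
  assumes r: "3 \<le> m" and V: "finite V" "V \<noteq> {}" and E: "E \<subseteq> ksets V (Suc m)" and pf: "pair_free E"
    and n: "n = real (card V)" and s: "0 < s" "s < 1"
    and D: "(star_density (Suc m) - s\<^sup>2) * n ^ Suc m \<le> fact (Suc m) * real (card E)" and v: "v \<in> V"
  shows "fact m * real (card (link v E)) \<le> (star_density (Suc m) + real (Suc m) * s) * n ^ m"
proof -
  have n0: "0 < n" using V n by (simp add: card_gt_0_iff)
  have w: "weighting V (\<lambda>_. 1 / n)" unfolding weighting_def using n0 by (simp add: n)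
  have "fact m * wt (\<lambda>_. 1 / n) (link v E) \<le> star_density (Suc m) + real m * s + s\<^sup>2 / s"
  proof (rule link_density_upper[OF V(1) E w v])
    show "fact (Suc m) * wt y E \<le> star_density (Suc m)" if "weighting V y" for y
      by (rule pair_free_density[OF _ V(1) E pf that]) (use r in simp)
    have "(star_density (Suc m) - s\<^sup>2) \<le> fact (Suc m) * real (card E) / n ^ Suc m"
      using D n0 by (subst pos_le_divide_eq) auto
    also have "\<dots> = fact (Suc m) * wt (\<lambda>_. 1 / n) E"
      using wt_const[OF E, of "1 / n"] by (simp only: power_one_over) simp
    finally show "star_density (Suc m) - s\<^sup>2 \<le> fact (Suc m) * wt (\<lambda>_. 1 / n) E" .
  qed (use s in auto)
  moreover have "wt (\<lambda>_. 1 / n) (link v E) = real (card (link v E)) / n ^ m"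
    using wt_const[OF link_subset[OF V(1) E], of "1 / n"] by (simp add: power_one_over)
  moreover have "s\<^sup>2 / s = s" using s by (simp add: power2_eq_square)
  ultimately have "fact m * real (card (link v E)) / n ^ m \<le> star_density (Suc m) + real (Suc m) * s"
    by (simp add: algebra_simps)
  then show ?thesis using n0 by (simp add: pos_divide_le_eq)
qed

lemma star_density_le_1: "0 < r \<Longrightarrow> star_density r \<le> 1"
  unfolding star_density_def by (intro power_le_one) auto

text \<open>In a nearly extremal graph some vertex \<open>u\<close> of high degree has close to \<open>n / r\<close>
  non-neighbours: otherwise the uniform weighting would violate the gap theorem.\<close>

lemma heavy_non_nbrs:
  assumes m: "3 \<le> m" and V: "finite V" "V \<noteq> {}" and E: "E \<subseteq> ksets V (Suc m)" and pf: "pair_free E"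
    and n: "n = real (card V)" and s: "0 < s" "s < 1" and e1: "0 < \<eta>" and \<sigma>: "real (m + 2) * s / \<eta> \<le> \<sigma>" "\<sigma> < 1"
    and D: "(star_density (Suc m) - s\<^sup>2) * n ^ Suc m \<le> fact (Suc m) * real (card E)"
    and gap: "\<And>x. weighting V x \<Longrightarrow> (\<And>u. u \<in> V \<Longrightarrow> 0 < x u \<Longrightarrow> sum x (non_nbrs V E u) \<le> \<xi>) \<Longrightarrow>
       fact (Suc m) * wt x E \<le> star_density (Suc m) - \<delta>" and xi: "0 \<le> \<xi>" "\<xi> \<le> 1"
    and d: "s\<^sup>2 + fact (Suc m) * \<sigma> < \<delta>"
  obtains u where "u \<in> V" "(\<xi> - \<sigma>) * n \<le> real (card (non_nbrs V E u))"
    "(star_density (Suc m) - \<eta>) * n ^ m \<le> fact m * real (card (link u E))"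
proof -
  define M where "M = star_density (Suc m)"
  \<comment> \<open>Vertices of low degree; the uniform weighting is restricted to their complement,
    so that the vertex supplied by the gap theorem has high degree too.\<close>
  define U where "U = {v \<in> V. fact m * real (card (link v E)) < (M - \<eta>) * n ^ m}"
  have n0: "0 < n" using V n by (simp add: card_gt_0_iff)
  have "real (card U) * (\<eta> + real (Suc m) * s) \<le> n * (s\<^sup>2 + real (Suc m) * s)"
    by (rule few_low_degree[OF V E n _ _ U_def]) (use D pair_free_degree_le[OF m V E pf n s D] in \<open>auto simp: M_def\<close>)
  also have "\<dots> \<le> n * (real (m + 2) * s)"
  proof -
    have "s\<^sup>2 \<le> s" using s mult_left_le[of s s] by (simp add: power2_eq_square)
    then show ?thesis using n0 by (intro mult_left_mono) (auto simp: algebra_simps)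
  qed
  also have "\<dots> \<le> n * (\<sigma> * \<eta>)" using \<sigma>(1) e1 n0 by (intro mult_left_mono) (simp_all add: pos_divide_le_eq)
  finally have "real (card U) * (\<eta> + real (Suc m) * s) \<le> n * (\<sigma> * \<eta>)" .
  moreover have "real (card U) * \<eta> \<le> real (card U) * (\<eta> + real (Suc m) * s)" using s by (intro mult_left_mono) auto
  ultimately have "real (card U) * \<eta> \<le> (\<sigma> * n) * \<eta>" by (simp add: mult_ac)
  then have cU: "real (card U) \<le> \<sigma> * n" using e1 by (simp only: mult_le_cancel_right_pos)
  define W where "W = V - U"
  have UV: "U \<subseteq> V" "finite U" using V unfolding U_def by auto
  have fW: "finite W" "W \<subseteq> V" unfolding W_def using V by auto
  have cW: "real (card W) = n - real (card U)"
    unfolding W_def n using UV V(1) card_mono[OF V(1) UV(1)] by (simp add: card_Diff_subset of_nat_diff)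
  have W1: "(1 - \<sigma>) * n \<le> real (card W)" using cW cU by (simp add: algebra_simps)
  moreover have "0 < (1 - \<sigma>) * n" using \<sigma> n0 by simp
  ultimately have W0: "0 < real (card W)" "real (card W) \<le> n" using cW by linarith+
  define N where "N = real (card W)"
  define x where "x v = (if v \<in> W then 1 / N else 0)" for v
  have sx: "sum x A = real (card (A \<inter> W)) / N" if "A \<subseteq> V" for A
  proof -
    have "finite A" using that V finite_subset by blast
    then show ?thesis unfolding x_def by (simp add: sum.If_cases)
  qed
  have xw: "weighting V x" unfolding weighting_def
  proof (intro conjI ballI)
    have "V \<inter> W = W" using fW by auto
    then show "sum x V = 1" using sx[of V] W0 by (simp add: N_def)
  qed (use W0 in \<open>auto simp: x_def N_def\<close>)
  have "\<not> fact (Suc m) * wt x E \<le> M - \<delta>"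
  proof
    assume le: "fact (Suc m) * wt x E \<le> M - \<delta>"
    define F where "F = {e \<in> E. e \<subseteq> W}"
    have FE: "F \<subseteq> E" and FW: "F \<subseteq> ksets W (Suc m)" using E unfolding F_def ksets_def by auto
    have fE: "finite E" by (rule finite_fam[OF V(1) E])
    have "wt x F = wt (\<lambda>_. 1 / N) F" by (rule wt_cong) (auto simp: x_def F_def)
    also have "\<dots> = real (card F) / N ^ Suc m" using wt_const[OF FW, of "1 / N"] by (simp only: power_one_over) simp
    finally have wF: "wt x F = real (card F) / N ^ Suc m" .
    have "E - F \<subseteq> {e \<in> E. e \<inter> U \<noteq> {}}" using E unfolding F_def W_def ksets_def by auto
    then have "card (E - F) \<le> card {e \<in> E. e \<inter> U \<noteq> {}}" using fE by (intro card_mono) auto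
    also have "real \<dots> \<le> real (card U) * n ^ m" unfolding n by (rule card_hitting_le[OF V(1) E UV(1)])
    also have "\<dots> \<le> \<sigma> * n * n ^ m" using cU n0 by (intro mult_right_mono) auto
    finally have "real (card (E - F)) \<le> \<sigma> * n ^ Suc m" by simp
    moreover have "card (E - F) = card E - card F" "card F \<le> card E"
      using FE fE by (auto simp: card_Diff_subset finite_subset card_mono)
    ultimately have cF: "real (card E) \<le> real (card F) + \<sigma> * n ^ Suc m" by linarith
    have "(M - s\<^sup>2) * n ^ Suc m \<le> fact (Suc m) * (real (card F) + \<sigma> * n ^ Suc m)"
      using D cF unfolding M_def by (meson fact_ge_zero mult_left_mono order.trans)
    then have "(M - s\<^sup>2 - fact (Suc m) * \<sigma>) * n ^ Suc m \<le> fact (Suc m) * real (card F)"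
      by (simp add: algebra_simps)
    then have "M - s\<^sup>2 - fact (Suc m) * \<sigma> \<le> fact (Suc m) * real (card F) / n ^ Suc m"
      using n0 by (subst pos_le_divide_eq) auto
    also have "\<dots> \<le> fact (Suc m) * real (card F) / N ^ Suc m"
      using W0 n0 unfolding N_def by (intro divide_left_mono power_mono mult_pos_pos zero_less_power) auto
    also have "\<dots> = fact (Suc m) * wt x F" unfolding wF by simp
    also have "\<dots> \<le> fact (Suc m) * wt x E"
      by (intro mult_left_mono wt_mono[OF V(1) FE E]) (use W0 in \<open>auto simp: x_def N_def\<close>)
    finally show False using le d by linarith
  qed
  then obtain u where u: "u \<in> V" "0 < x u" "\<xi> < sum x (non_nbrs V E u)"
    using gap[OF xw] unfolding M_def by fastforce
  have uW: "u \<in> W" using u(2) unfolding x_def by (auto split: if_splits)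
  have nV: "non_nbrs V E u \<subseteq> V" unfolding non_nbrs_def by auto
  have "\<xi> * N \<le> real (card (non_nbrs V E u \<inter> W))"
    using u(3) sx[OF nV] W0 by (simp add: N_def pos_less_divide_eq)
  also have "\<dots> \<le> real (card (non_nbrs V E u))"
    using finite_subset[OF nV V(1)] by (simp add: card_mono)
  finally have "\<xi> * N \<le> real (card (non_nbrs V E u))" .
  moreover have "(\<xi> - \<sigma>) * n \<le> \<xi> * N"
  proof -
    have "\<xi> * ((1 - \<sigma>) * n) \<le> \<xi> * N" using W1 xi unfolding N_def by (intro mult_left_mono) auto
    moreover have "\<xi> * (\<sigma> * n) \<le> 1 * (\<sigma> * n)"
      using xi \<sigma> n0 cU by (intro mult_right_mono) (auto intro: order.trans[of 0 "real (card U)"])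
    ultimately show ?thesis by (simp add: algebra_simps)
  qed
  moreover have "(M - \<eta>) * n ^ m \<le> fact m * real (card (link u E))"
    using uW u(1) unfolding W_def U_def by auto
  ultimately show ?thesis using that[of u] u(1) unfolding M_def by simp
qed

text \<open>\<open>\<epsilon>'\<close> limits the sets missing from the link of \<open>u\<close>,
  \<open>\<theta>\<close> the excess of the first part over \<open>n / r\<close>, and
  \<open>\<eta>\<close> the degree defect of \<open>u\<close>. The final inequality makes a first
  part that is too large incompatible with this degree.\<close>

lemma stability_constants:
  assumes r: "4 \<le> r" and e: "0 < \<epsilon>" and m: "m = r - 1"
  obtains \<epsilon>' \<theta> \<eta> where "0 < \<epsilon>'" "\<epsilon>' \<le> 1 / 2" "\<epsilon>' < (1 / (4 * real m)) ^ m"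
    "real m * \<epsilon>' \<le> \<epsilon> / 6 * (1 / (8 * real (Suc m) * real (m - 1))) ^ (m - 1)"
    "0 < \<theta>" "\<theta> \<le> 1 / 4" "real r * \<theta> \<le> \<epsilon> / 9" "0 < \<eta>" "\<eta> \<le> \<epsilon>' / 2"
    "(1 - 1 / real r - \<theta>) ^ m < star_density r - \<eta>"
proof -
  define c7 where "c7 = (1 / (4 * real m)) ^ m"
  define c8 where "c8 = (1 / (8 * real (Suc m) * real (m - 1))) ^ (m - 1)"
  have c: "0 < c7" "0 < c8" unfolding c7_def c8_def using r m by (intro zero_less_power divide_pos_pos mult_pos_pos; simp)+
  define \<epsilon>' where "\<epsilon>' = min (1 / 2) (min (c7 / 2) (\<epsilon> / 6 * c8 / real m))"
  have e': "0 < \<epsilon>'" unfolding \<epsilon>'_def using c e r m by simp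
  have e1: "\<epsilon>' \<le> 1 / 2" "\<epsilon>' \<le> c7 / 2" "\<epsilon>' \<le> \<epsilon> / 6 * c8 / real m" unfolding \<epsilon>'_def by linarith+
  define \<theta> where "\<theta> = min (1 / 4) (\<epsilon> / 9 / real r)"
  have t: "0 < \<theta>" unfolding \<theta>_def using e r by simp
  have t1: "\<theta> \<le> 1 / 4" "\<theta> \<le> \<epsilon> / 9 / real r" unfolding \<theta>_def by linarith+
  have r4: "1 / real r \<le> 1 / 4" using r by (intro divide_left_mono) auto
  have "(1 - 1 / real r - \<theta>) ^ m < (1 - 1 / real r) ^ m"
  proof (rule power_strict_mono)
    show "0 \<le> 1 - 1 / real r - \<theta>" using t1(1) r4 by linarith
  qed (use t r m in auto)
  then have g: "(1 - 1 / real r - \<theta>) ^ m < star_density r" unfolding star_density_def m .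
  define \<eta> where "\<eta> = min (\<epsilon>' / 2) ((star_density r - (1 - 1 / real r - \<theta>) ^ m) / 2)"
  have n: "0 < \<eta>" unfolding \<eta>_def using g e' by simp
  have n1: "\<eta> \<le> \<epsilon>' / 2" "\<eta> \<le> (star_density r - (1 - 1 / real r - \<theta>) ^ m) / 2" unfolding \<eta>_def by linarith+
  show ?thesis
  proof (rule that[OF e' e1(1) _ _ t t1(1) _ n n1(1)])
    show "\<epsilon>' < (1 / (4 * real m)) ^ m" using e1(2) c unfolding c7_def by linarith
    have m0: "0 < real m" using r m by simp
    show "real m * \<epsilon>' \<le> \<epsilon> / 6 * (1 / (8 * real (Suc m) * real (m - 1))) ^ (m - 1)"
      using e1(3) m0 unfolding c8_def[symmetric] by (simp add: pos_le_divide_eq mult.commute)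
    show "real r * \<theta> \<le> \<epsilon> / 9" using t1(2) r by (simp add: pos_le_divide_eq mult.commute)
    show "(1 - 1 / real r - \<theta>) ^ m < star_density r - \<eta>" using n1(2) g by (simp add: field_simps)
  qed
qed

text \<open>The first part is the non-neighbour set of the vertex \<open>u\<close>: the gap theorem
  makes it at least about \<open>n / r\<close>, and the degree of \<open>u\<close>, whose link lies
  in the complement, makes it at most that. So the link is almost complete on \<open>V2\<close>, few
  edges lie inside \<open>V2\<close>, and the degree sum on \<open>V1\<close> is close to
  \<open>card E\<close>.\<close>

theorem pair_free_stability:
  assumes r: "4 \<le> r" and e: "0 < \<epsilon>"
  obtains \<delta> N where "0 < \<delta>" "\<And>(V :: 'a set) E. finite V \<Longrightarrow> N \<le> card V \<Longrightarrow> E \<subseteq> ksets V r \<Longrightarrow> pair_free E \<Longrightarrow>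
      (star_density r - \<delta>) * real (card V) ^ r \<le> fact r * real (card E) \<Longrightarrow>
      \<exists>V1\<subseteq>V. real (card {e \<in> E. card (e \<inter> V1) \<noteq> 1}) \<le> \<epsilon> * real (card V) ^ r"
proof -
  define m where "m = r - 1"
  have m: "r = Suc m" "3 \<le> m" using r unfolding m_def by auto
  obtain \<epsilon>' \<theta> \<eta> where e': "0 < \<epsilon>'" "\<epsilon>' \<le> 1 / 2" "\<epsilon>' < (1 / (4 * real m)) ^ m"
    "real m * \<epsilon>' \<le> \<epsilon> / 6 * (1 / (8 * real (Suc m) * real (m - 1))) ^ (m - 1)"
    and th: "0 < \<theta>" "\<theta> \<le> 1 / 4" "real r * \<theta> \<le> \<epsilon> / 9" and et: "0 < \<eta>" "\<eta> \<le> \<epsilon>' / 2"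
    "(1 - 1 / real r - \<theta>) ^ m < star_density r - \<eta>"
    by (rule stability_constants[OF r e m_def]) (rule that)
  define M where "M = star_density r"
  \<comment> \<open>Chosen so that replacing \<open>1 / r\<close> by \<open>1 / r - 2 * q\<close>
    raises the power \<open>(1 - 1 / r) ^ m\<close> by at most
    \<open>\<epsilon>' / 4\<close>.\<close>
  define q where "q = \<epsilon>' / (8 * real r)"
  have rr: "4 \<le> real r" using r by simp
  have q: "0 < q" unfolding q_def using e' r by simp
  have qr: "real r * q = \<epsilon>' / 8" unfolding q_def using r by simp
  define \<xi> where "\<xi> = 1 / real r - q"
  have xi1: "\<xi> < 1 / real r" unfolding \<xi>_def using q by simp
  have qq: "q \<le> 1 / (16 * real r)"
    unfolding q_def using e'(2) rr by (simp add: field_simps)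
  have "1 / (16 * real r) \<le> 1 / real r" using rr by (simp add: field_simps)
  moreover have "1 / real r \<le> 1 / 4" using r by (intro divide_left_mono) auto
  ultimately have xi: "0 \<le> \<xi>" "\<xi> \<le> 1" using qq q unfolding \<xi>_def by linarith+
  have "\<exists>\<delta>>0. \<forall>(V :: 'a set) E x. finite V \<longrightarrow> E \<subseteq> ksets V r \<longrightarrow> pair_free E \<longrightarrow> weighting V x \<longrightarrow>
       (\<forall>u\<in>V. 0 < x u \<longrightarrow> sum x (non_nbrs V E u) \<le> \<xi>) \<longrightarrow> fact r * wt x E \<le> star_density r - \<delta>"
  proof (rule pair_free_gap[OF r xi1])
    fix \<delta> :: real
    assume d: "0 < \<delta>" and g: "\<And>(V :: 'a set) E x. finite V \<Longrightarrow> E \<subseteq> ksets V r \<Longrightarrow> pair_free E \<Longrightarrow> weighting V x \<Longrightarrow>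
       (\<And>u. u \<in> V \<Longrightarrow> 0 < x u \<Longrightarrow> sum x (non_nbrs V E u) \<le> \<xi>) \<Longrightarrow> fact r * wt x E \<le> star_density r - \<delta>"
    show ?thesis by (intro exI[of _ \<delta>] conjI allI impI d g) (assumption | simp)+
  qed
  then obtain \<delta>g where dg: "0 < \<delta>g" and gap: "\<forall>(V :: 'a set) E x. finite V \<longrightarrow> E \<subseteq> ksets V r \<longrightarrow> pair_free E \<longrightarrow> weighting V x \<longrightarrow>
       (\<forall>u\<in>V. 0 < x u \<longrightarrow> sum x (non_nbrs V E u) \<le> \<xi>) \<longrightarrow> fact r * wt x E \<le> star_density r - \<delta>g"
    by blast
  define \<sigma> where "\<sigma> = min q (\<delta>g / (4 * fact r))"
  have sg0: "0 < \<sigma>" unfolding \<sigma>_def using q dg by simp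
  have sg: "\<sigma> \<le> q" "\<sigma> \<le> \<delta>g / (4 * fact r)" unfolding \<sigma>_def by linarith+
  have sgf: "fact r * \<sigma> \<le> \<delta>g / 4" using sg(2) by (simp add: pos_le_divide_eq mult_ac)
  have "q \<le> real r * q" using rr q by simp
  then have sg1: "\<sigma> < 1" using sg(1) qr e'(2) by linarith
  define s where "s = Min {1 / 2, \<sigma> * \<eta> / real (m + 2), \<delta>g / 4, \<epsilon> / 9 / real r, 1 / real r}"
  have s0: "0 < s" unfolding s_def using sg0 et dg e r by (subst Min_gr_iff) auto
  have s: "s \<le> 1 / 2" "s \<le> \<sigma> * \<eta> / real (m + 2)" "s \<le> \<delta>g / 4" "s \<le> \<epsilon> / 9 / real r" "s \<le> 1 / real r"
    unfolding s_def by (intro Min_le; simp)+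
  have s1: "s < 1" using s(1) by simp
  have ss: "s\<^sup>2 \<le> s" using s0 s1 mult_left_le[of s s] by (simp add: power2_eq_square)
  have rs: "real r * s \<le> \<epsilon> / 9" "real r * s \<le> 1" using s(4,5) r by (auto simp: pos_le_divide_eq mult.commute)
  have ssm: "real (m + 2) * s / \<eta> \<le> \<sigma>"
  proof -
    have "s * real (m + 2) \<le> \<sigma> * \<eta>" using s(2) by (subst (asm) pos_le_divide_eq) auto
    then show ?thesis using et by (subst pos_divide_le_eq) (auto simp: mult.commute)
  qed
  have sd: "s\<^sup>2 + fact (Suc m) * \<sigma> < \<delta>g" using sgf s(3) ss dg unfolding m(1) by linarith
  define N where "N = 8 * Suc m * m"
  show ?thesis
  proof (rule that[of "s\<^sup>2" N])
    show "0 < s\<^sup>2" using s0 by simp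
    fix V :: "'a set" and E
    assume V: "finite V" "N \<le> card V" and E: "E \<subseteq> ksets V r" and pf: "pair_free E"
      and D: "(star_density r - s\<^sup>2) * real (card V) ^ r \<le> fact r * real (card E)"
    define n where "n = real (card V)"
    have "real N \<le> n" using V unfolding n_def by simp
    then have n8: "8 * real (Suc m) * real m \<le> n" unfolding N_def by (simp only: of_nat_mult of_nat_numeral)
    have N0: "0 < N" unfolding N_def using m by simp
    then have Vne: "V \<noteq> {}" and n0: "0 < n" using V unfolding n_def by (auto simp: card_gt_0_iff)
    note E' = E[unfolded m(1)]
    note D' = D[unfolded n_def[symmetric], unfolded m(1)]
    have gapV: "fact (Suc m) * wt x E \<le> star_density (Suc m) - \<delta>g"
      if "weighting V x" "\<And>u. u \<in> V \<Longrightarrow> 0 < x u \<Longrightarrow> sum x (non_nbrs V E u) \<le> \<xi>" for x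
      using gap[rule_format, OF V(1) E pf that] unfolding m(1) .
    obtain u where u: "u \<in> V" "(\<xi> - \<sigma>) * n \<le> real (card (non_nbrs V E u))"
      "(star_density (Suc m) - \<eta>) * n ^ m \<le> fact m * real (card (link u E))"
      by (rule heavy_non_nbrs[OF m(2) V(1) Vne E' pf n_def s0 s1 et(1) ssm sg1 D' gapV xi sd]) (assumption | rule that)+
    define V1 where "V1 = non_nbrs V E u"
    define V2 where "V2 = V - V1"
    have V12: "V1 \<subseteq> V" "V2 \<subseteq> V" "finite V1" "finite V2" using V unfolding V1_def V2_def non_nbrs_def by auto
    have c12: "real (card V2) = n - real (card V1)"
      unfolding V2_def n_def using V12 card_mono[OF V(1) V12(1)] by (simp add: card_Diff_subset of_nat_diff)
    have lk: "link u E \<subseteq> ksets V2 m"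
    proof
      fix A assume A: "A \<in> link u E"
      have "A \<in> ksets (V - {u}) m" using link_subset[OF V(1) E'] A by blast
      then have AV: "A \<subseteq> V" "u \<notin> A" "card A = m" unfolding ksets_def by auto
      have "w \<notin> V1" if "w \<in> A" for w
      proof -
        have "insert u A \<in> E" using A unfolding link_def by simp
        then have "adj E u w" unfolding adj_def using that by blast
        then show ?thesis using that AV(2) unfolding V1_def non_nbrs_def by auto
      qed
      then show "A \<in> ksets V2 m" using AV unfolding V2_def ksets_def by auto
    qed
    have flk: "finite (link u E)" using finite_subset[OF lk] finite_ksets[OF V12(4)] by blast
    have kV2: "real (card (ksets V2 m)) * fact m \<le> real (card V2) ^ m" by (rule card_ksets_le[OF V12(4)])
    have "card (link u E) \<le> card (ksets V2 m)" by (rule card_mono[OF finite_ksets[OF V12(4)] lk])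
    then have "fact m * real (card (link u E)) \<le> real (card (ksets V2 m)) * fact m" by simp
    then have low: "(M - \<eta>) * n ^ m \<le> real (card V2) ^ m" using u(3) kV2 unfolding M_def m(1) by linarith
    \<comment> \<open>If \<open>V1\<close> were larger, \<open>V2\<close> could not hold a link as
      dense as that of \<open>u\<close>.\<close>
    have up: "real (card V1) \<le> (1 / real r + \<theta>) * n"
    proof (rule ccontr)
      assume "\<not> ?thesis"
      then have "real (card V2) \<le> (1 - 1 / real r - \<theta>) * n" using c12 by (simp add: algebra_simps)
      then have "real (card V2) ^ m \<le> ((1 - 1 / real r - \<theta>) * n) ^ m" by (intro power_mono) auto
      also have "\<dots> = (1 - 1 / real r - \<theta>) ^ m * n ^ m" by (rule power_mult_distrib)
      also have "\<dots> < (M - \<eta>) * n ^ m" using et(3) n0 unfolding M_def by simp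
      finally show False using low by simp
    qed
    have r4: "1 / real r \<le> 1 / 4" using r by (intro divide_left_mono) auto
    have "(1 / real r + \<theta>) * n \<le> (1 / 2) * n" using r4 th n0 by (intro mult_right_mono) auto
    then have half: "n / 2 \<le> real (card V2)" using up c12 by linarith
    define \<alpha> where "\<alpha> = \<xi> - \<sigma>"
    have a: "1 / real r - 2 * q \<le> \<alpha>" unfolding \<alpha>_def \<xi>_def using sg(1) by simp
    have "real (card V2) ^ m \<le> ((1 - \<alpha>) * n) ^ m"
      using u(2) c12 unfolding V1_def[symmetric] \<alpha>_def by (intro power_mono) (auto simp: algebra_simps)
    also have "\<dots> = (1 - \<alpha>) ^ m * n ^ m" by (rule power_mult_distrib)
    also have "\<dots> \<le> (M + \<epsilon>' / 4) * n ^ m"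
    proof (rule mult_right_mono)
      have q2: "2 * q \<le> 1 / real r" using qq rr by (simp add: field_simps)
      have a1: "\<alpha> \<le> 1 / real r" unfolding \<alpha>_def \<xi>_def using q sg0 by simp
      have "(1 - \<alpha>) ^ m - (1 - 1 / real r) ^ m \<le> real m * ((1 - \<alpha>) - (1 - 1 / real r))"
        by (rule power_diff_le_linear) (use a a1 q2 rr in auto)
      also have "\<dots> \<le> real r * (2 * q)" using a a1 by (intro mult_mono) (auto simp: m(1))
      also have "\<dots> = \<epsilon>' / 4" using qr by simp
      finally show "(1 - \<alpha>) ^ m \<le> M + \<epsilon>' / 4" unfolding M_def star_density_def m_def by simp
    qed (use n0 in simp)
    finally have V2up: "real (card V2) ^ m \<le> (M + \<epsilon>' / 4) * n ^ m" .
    have miss: "real (card (ksets V2 m - link u E)) \<le> \<epsilon>' * n ^ m"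
    proof -
      have "card (ksets V2 m - link u E) = card (ksets V2 m) - card (link u E)"
        by (rule card_Diff_subset[OF flk lk])
      then have "real (card (ksets V2 m - link u E)) = real (card (ksets V2 m)) - real (card (link u E))"
        using card_mono[OF finite_ksets[OF V12(4)] lk] by simp
      then have "fact m * real (card (ksets V2 m - link u E)) = real (card (ksets V2 m)) * fact m - fact m * real (card (link u E))"
        by (simp only: right_diff_distrib mult.commute)
      also have "\<dots> \<le> (M + \<epsilon>' / 4) * n ^ m - (M - \<eta>) * n ^ m"
        using kV2 V2up u(3) unfolding M_def m(1) by linarith
      also have "\<dots> = (\<epsilon>' / 4 + \<eta>) * n ^ m" by (simp add: algebra_simps)
      also have "\<dots> \<le> \<epsilon>' * n ^ m" using et e' n0 by (intro mult_right_mono) auto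
      finally have "fact m * real (card (ksets V2 m - link u E)) \<le> \<epsilon>' * n ^ m" .
      moreover have "1 * real (card (ksets V2 m - link u E)) \<le> fact m * real (card (ksets V2 m - link u E))"
        by (intro mult_right_mono) auto
      ultimately show ?thesis by linarith
    qed
    define c8 where "c8 = (1 / (8 * real (Suc m) * real (m - 1))) ^ (m - 1)"
    have c8: "0 < c8" unfolding c8_def using m by (intro zero_less_power divide_pos_pos mult_pos_pos) auto
    have "real (card {e \<in> E. e \<subseteq> V2}) * c8 \<le> real m * \<epsilon>' * n ^ Suc m"
      unfolding c8_def
      by (rule few_edges_outside[OF V(1) E' pf m(2) n_def u(1) _ half n8 miss e'(3)]) (simp add: V2_def V1_def)
    also have "\<dots> \<le> \<epsilon> / 6 * c8 * n ^ Suc m" using e'(4) n0 unfolding c8_def by (intro mult_right_mono) auto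
    finally have "real (card {e \<in> E. e \<subseteq> V2}) * c8 \<le> (\<epsilon> / 6 * n ^ Suc m) * c8" by (simp only: mult_ac)
    then have E0: "real (card {e \<in> E. e \<subseteq> V2}) \<le> \<epsilon> / 6 * n ^ Suc m" using c8 by (simp only: mult_le_cancel_right_pos)
    have E0eq: "{e \<in> E. e \<inter> V1 = {}} = {e \<in> E. e \<subseteq> V2}" using E unfolding V2_def ksets_def by auto
    \<comment> \<open>Each degree is at most about \<open>M * n ^ m / fact m\<close> and
      \<open>V1\<close> has about \<open>n / r\<close> vertices, so \<open>S\<close> exceeds
      \<open>card E\<close> only by a small multiple of \<open>n ^ r\<close>.\<close>
    define S where "S = (\<Sum>v\<in>V1. real (card (link v E)))"
    have "fact m * S = (\<Sum>v\<in>V1. fact m * real (card (link v E)))" unfolding S_def by (rule sum_distrib_left)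
    also have "\<dots> \<le> (\<Sum>v\<in>V1. (M + real r * s) * n ^ m)"
    proof (rule sum_mono)
      fix v assume "v \<in> V1"
      then have "v \<in> V" using V12 by blast
      from pair_free_degree_le[OF m(2) V(1) Vne E' pf n_def s0 s1 D' this]
      show "fact m * real (card (link v E)) \<le> (M + real r * s) * n ^ m" unfolding M_def m(1) .
    qed
    also have "\<dots> = real (card V1) * ((M + real r * s) * n ^ m)" by simp
    also have "\<dots> \<le> ((1 / real r + \<theta>) * n) * ((M + real r * s) * n ^ m)"
      using up n0 s0 star_density_pos[of r] r unfolding M_def by (intro mult_right_mono) auto
    finally have "real r * (fact m * S) \<le> real r * (((1 / real r + \<theta>) * n) * ((M + real r * s) * n ^ m))"
      by (intro mult_left_mono) auto
    also have "\<dots> = (real r * (1 / real r + \<theta>)) * (M + real r * s) * (n ^ m * n)" by (simp only: mult_ac)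
    also have "real r * (1 / real r + \<theta>) = 1 + real r * \<theta>" using rr by (simp add: distrib_left)
    also have "n ^ m * n = n ^ Suc m" by (simp only: power_Suc2)
    also have "real r * (fact m * S) = fact r * S" by (simp only: m(1) fact_Suc mult.assoc)
    finally have "fact r * S \<le> (1 + real r * \<theta>) * (M + real r * s) * n ^ Suc m" .
    also have "\<dots> \<le> (M + \<epsilon> / 3) * n ^ Suc m"
    proof (rule mult_right_mono)
      have "M \<le> 1" unfolding M_def using r by (intro star_density_le_1) simp
      have "real r * \<theta> * (M + real r * s) \<le> real r * \<theta> * 2"
        using th rs \<open>M \<le> 1\<close> by (intro mult_left_mono) auto
      then show "(1 + real r * \<theta>) * (M + real r * s) \<le> M + \<epsilon> / 3" using th(3) rs(1) by (simp add: algebra_simps)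
    qed (use n0 in simp)
    finally have "fact r * S \<le> (M + \<epsilon> / 3) * n ^ Suc m" .
    moreover have "(M - \<epsilon> / 9) * n ^ Suc m \<le> fact r * real (card E)"
    proof -
      have "s \<le> real r * s" using rr s0 by simp
      then have "(M - \<epsilon> / 9) * n ^ Suc m \<le> (M - s\<^sup>2) * n ^ Suc m" using ss rs n0 by (intro mult_right_mono) auto
      then show ?thesis using D' unfolding M_def m(1) by linarith
    qed
    ultimately have "fact r * (S - real (card E)) \<le> 4 * \<epsilon> / 9 * n ^ Suc m" by (simp add: algebra_simps)
    moreover have "S - real (card E) \<le> fact r * (S - real (card E)) \<or> S - real (card E) \<le> 0"
    proof (cases "0 \<le> S - real (card E)")
      case True
      have "1 * (S - real (card E)) \<le> fact r * (S - real (card E))" by (rule mult_right_mono[OF fact_ge_1 True])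
      then show ?thesis by simp
    qed simp
    moreover have "0 \<le> 4 * \<epsilon> / 9 * n ^ Suc m" using e n0 by simp
    ultimately have SE: "S - real (card E) \<le> 4 * \<epsilon> / 9 * n ^ Suc m" by linarith
    have "real (card {e \<in> E. card (e \<inter> V1) \<noteq> 1}) \<le> 2 * (\<epsilon> / 6 * n ^ Suc m) + 4 * \<epsilon> / 9 * n ^ Suc m"
      using off_by_one_count[OF V(1) E' V12(1)] E0 SE unfolding E0eq S_def by linarith
    also have "\<dots> = (7 / 9 * \<epsilon>) * n ^ Suc m" by (simp add: algebra_simps)
    also have "\<dots> \<le> \<epsilon> * n ^ Suc m" using e n0 by (intro mult_right_mono) auto
    finally have "real (card {e \<in> E. card (e \<inter> V1) \<noteq> 1}) \<le> \<epsilon> * real (card V) ^ r" unfolding n_def m(1) .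
    then show "\<exists>V1\<subseteq>V. real (card {e \<in> E. card (e \<inter> V1) \<noteq> 1}) \<le> \<epsilon> * real (card V) ^ r" using V12(1) by blast
  qed
qed

section \<open>Embedding the expansion\<close>

definition codeg :: "'a set set \<Rightarrow> 'a \<Rightarrow> 'a \<Rightarrow> nat" where
  "codeg E a b = card {e \<in> E. a \<in> e \<and> b \<in> e}"

text \<open>A copy is recorded by its vertex set alone, since packings and hitting sets depend on
  nothing else.\<close>

definition hcopy :: "nat \<Rightarrow> 'a set \<Rightarrow> 'a set set \<Rightarrow> 'a set \<Rightarrow> bool" where
  "hcopy r V E W \<longleftrightarrow> W \<subseteq> V \<and> (\<exists>F\<subseteq>E. hiso (expansion r (matching2 r)) (HGraph W F))"

text \<open>\<open>r * r\<close> connecting edges with \<open>r\<close> vertices each, the two core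
  edges, and one prescribed connecting edge: a bound on the vertices to be avoided while a copy is
  assembled.\<close>

definition emb_const :: "nat \<Rightarrow> nat" where
  "emb_const r = r * r * r + 3 * r"

definition copy_size :: "nat \<Rightarrow> nat" where
  "copy_size r = card (verts (expansion r (matching2 r)))"

lemma card_containing_le:
  assumes "finite V" "E \<subseteq> ksets V r" "S \<subseteq> V"
  shows "real (card {e \<in> E. S \<subseteq> e}) \<le> real (card V) ^ (r - card S)"
proof -
  have fS: "finite S" using assms finite_subset by blast
  have "card {e \<in> E. S \<subseteq> e} = card ((\<lambda>e. e - S) ` {e \<in> E. S \<subseteq> e})"
    by (rule card_image[symmetric]) (auto simp: inj_on_def)
  also have "\<dots> \<le> card (ksets V (r - card S))"
  proof (rule card_mono[OF finite_ksets[OF assms(1)]])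
    show "(\<lambda>e. e - S) ` {e \<in> E. S \<subseteq> e} \<subseteq> ksets V (r - card S)"
      using assms(2) fS unfolding ksets_def by (auto simp: card_Diff_subset)
  qed
  finally have "real (card {e \<in> E. S \<subseteq> e}) \<le> real (card (ksets V (r - card S)))" by simp
  also have "\<dots> \<le> real (card V) ^ (r - card S)" by (rule card_ksets_le'[OF assms(1)])
  finally show ?thesis .
qed

text \<open>An edge through \<open>a\<close> and \<open>b\<close> that hits \<open>Z\<close>
  elsewhere contains a third prescribed vertex, and for each such vertex there are at most
  \<open>card V ^ (r - 3)\<close> edges.\<close>

lemma avoiding_edge:
  assumes V: "finite V" and E: "E \<subseteq> ksets V r" and ab: "a \<in> V" "b \<in> V" "a \<noteq> b" and Z: "finite Z"
    and c: "real (card Z) * real (card V) ^ (r - 3) < real (codeg E a b)"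
  obtains e where "e \<in> E" "a \<in> e" "b \<in> e" "e \<inter> Z \<subseteq> {a, b}"
proof (rule ccontr)
  assume "\<not> thesis"
  with that have "\<not> (\<exists>e\<in>E. a \<in> e \<and> b \<in> e \<and> e \<inter> Z \<subseteq> {a, b})" by blast
  then have no: "\<not> e \<inter> Z \<subseteq> {a, b}" if "e \<in> E" "a \<in> e" "b \<in> e" for e using that by blast
  define Z' where "Z' = Z \<inter> V - {a, b}"
  have fZ': "finite Z'" unfolding Z'_def using Z by simp
  have "{e \<in> E. a \<in> e \<and> b \<in> e} \<subseteq> (\<Union>z\<in>Z'. {e \<in> E. {a, b, z} \<subseteq> e})"
  proof
    fix e assume e: "e \<in> {e \<in> E. a \<in> e \<and> b \<in> e}"
    then obtain z where "z \<in> e" "z \<in> Z" "z \<notin> {a, b}" using no[of e] by blast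
    moreover have "e \<subseteq> V" using e E unfolding ksets_def by auto
    ultimately show "e \<in> (\<Union>z\<in>Z'. {e \<in> E. {a, b, z} \<subseteq> e})" using e unfolding Z'_def by auto
  qed
  moreover have "finite (\<Union>z\<in>Z'. {e \<in> E. {a, b, z} \<subseteq> e})" using fZ' finite_fam[OF V E] by auto
  ultimately have "codeg E a b \<le> card (\<Union>z\<in>Z'. {e \<in> E. {a, b, z} \<subseteq> e})"
    unfolding codeg_def by (intro card_mono)
  also have "\<dots> \<le> (\<Sum>z\<in>Z'. card {e \<in> E. {a, b, z} \<subseteq> e})" by (rule card_UN_le[OF fZ'])
  finally have "real (codeg E a b) \<le> real (\<Sum>z\<in>Z'. card {e \<in> E. {a, b, z} \<subseteq> e})"
    by (simp only: of_nat_le_iff)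
  also have "\<dots> = (\<Sum>z\<in>Z'. real (card {e \<in> E. {a, b, z} \<subseteq> e}))" by (rule of_nat_sum)
  also have "\<dots> \<le> (\<Sum>z\<in>Z'. real (card V) ^ (r - 3))"
  proof (rule sum_mono)
    fix z assume "z \<in> Z'"
    then have "card {a, b, z} = 3" "{a, b, z} \<subseteq> V" using ab unfolding Z'_def by auto
    with card_containing_le[OF V E, of "{a, b, z}"]
    show "real (card {e \<in> E. {a, b, z} \<subseteq> e}) \<le> real (card V) ^ (r - 3)" by simp
  qed
  also have "\<dots> \<le> real (card Z) * real (card V) ^ (r - 3)"
  proof -
    have "card Z' \<le> card Z" using Z unfolding Z'_def by (intro card_mono) auto
    then show ?thesis by (simp add: mult_right_mono)
  qed
  finally show False using c by simp
qed

text \<open>The edges are chosen one pair after another, each avoiding \<open>Z\<close> and all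
  edges chosen before; \<open>K\<close> bounds the size of every set to be avoided.\<close>

lemma greedy_edges:
  assumes V: "finite V" and E: "E \<subseteq> ksets V r" and Z: "finite Z" and r: "2 \<le> r"
    and Q: "finite Q" "\<And>a b. (a, b) \<in> Q \<Longrightarrow> a \<in> V \<inter> Z \<and> b \<in> V \<inter> Z \<and> a \<noteq> b"
    and K: "card Z + card Q * r \<le> K"
    and c: "\<And>a b. (a, b) \<in> Q \<Longrightarrow> real K * real (card V) ^ (r - 3) < real (codeg E a b)"
  shows "\<exists>g. (\<forall>a b. (a, b) \<in> Q \<longrightarrow> g (a, b) \<in> E \<and> g (a, b) \<inter> Z = {a, b}) \<and>
    (\<forall>p\<in>Q. \<forall>q\<in>Q. p \<noteq> q \<longrightarrow> g p \<inter> g q \<subseteq> Z)"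
  using Q K c
proof (induction Q rule: finite_induct)
  case empty
  then show ?case by simp
next
  case (insert q Q)
  have KQ: "card Z + card Q * r \<le> K" using insert.prems(2) insert.hyps by simp
  have "\<exists>g. (\<forall>a b. (a, b) \<in> Q \<longrightarrow> g (a, b) \<in> E \<and> g (a, b) \<inter> Z = {a, b}) \<and>
    (\<forall>p\<in>Q. \<forall>q\<in>Q. p \<noteq> q \<longrightarrow> g p \<inter> g q \<subseteq> Z)"
  proof (rule insert.IH[OF _ KQ])
    show "a \<in> V \<inter> Z \<and> b \<in> V \<inter> Z \<and> a \<noteq> b" if "(a, b) \<in> Q" for a b
      by (rule insert.prems(1)[OF insertI2[OF that]])
    show "real K * real (card V) ^ (r - 3) < real (codeg E a b)" if "(a, b) \<in> Q" for a b
      by (rule insert.prems(3)[OF insertI2[OF that]])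
  qed
  then obtain g where G: "(\<forall>a b. (a, b) \<in> Q \<longrightarrow> g (a, b) \<in> E \<and> g (a, b) \<inter> Z = {a, b}) \<and>
    (\<forall>p\<in>Q. \<forall>q\<in>Q. p \<noteq> q \<longrightarrow> g p \<inter> g q \<subseteq> Z)" ..
  note g = conjunct1[OF G, rule_format] conjunct2[OF G, rule_format]
  obtain a b where q: "q = (a, b)" by (cases q)
  have ab: "a \<in> V" "a \<in> Z" "b \<in> V" "b \<in> Z" "a \<noteq> b" using insert.prems(1)[of a b] q by auto
  define U where "U = Z \<union> (\<Union>p\<in>Q. g p)"
  have gE: "g p \<in> E" if "p \<in> Q" for p using g(1)[of "fst p" "snd p"] that by simp
  have gc: "finite (g p)" "card (g p) = r" if "p \<in> Q" for p
    using gE[OF that] E V finite_subset[of "g p" V] unfolding ksets_def by auto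
  have fU: "finite U" unfolding U_def using Z insert.hyps gc by simp
  have "card (\<Union>p\<in>Q. g p) \<le> (\<Sum>p\<in>Q. card (g p))" by (rule card_UN_le[OF insert.hyps(1)])
  also have "\<dots> = card Q * r" using gc by simp
  finally have "card U \<le> card Z + card Q * r" unfolding U_def using card_Un_le[of Z "\<Union>p\<in>Q. g p"] by linarith
  also have "\<dots> \<le> K" by fact
  finally have "real (card U) * real (card V) ^ (r - 3) \<le> real K * real (card V) ^ (r - 3)"
    by (intro mult_right_mono) auto
  also have "\<dots> < real (codeg E a b)" using insert.prems(3)[of a b] q by simp
  finally obtain e where e: "e \<in> E" "a \<in> e" "b \<in> e" "e \<inter> U \<subseteq> {a, b}"
    by (rule avoiding_edge[OF V E ab(1,3,5) fU]) (rule that)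
  define h where "h = g(q := e)"
  have hQ: "h p = g p" if "p \<in> Q" for p using that insert.hyps unfolding h_def by auto
  have hq: "h q = e" unfolding h_def by simp
  have "h (c, d) \<in> E \<and> h (c, d) \<inter> Z = {c, d}" if "(c, d) \<in> insert q Q" for c d
  proof (cases "(c, d) = q")
    case True
    then have "c = a" "d = b" "h (c, d) = e" using q hq by auto
    moreover have "e \<inter> Z = {a, b}" using e ab unfolding U_def by blast
    ultimately show ?thesis using e(1) by simp
  next
    case False
    then have "(c, d) \<in> Q" using that by simp
    then show ?thesis using g(1) hQ by simp
  qed
  moreover have eg: "e \<inter> g p \<subseteq> Z" if "p \<in> Q" for p using e(4) ab that unfolding U_def by blast
  have "h p \<inter> h p' \<subseteq> Z" if "p \<in> insert q Q" "p' \<in> insert q Q" "p \<noteq> p'" for p p'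
  proof (cases "p = q")
    case True
    then have "p' \<in> Q" using that by simp
    then show ?thesis using eg[of p'] True hq hQ by simp
  next
    case False
    then have p: "p \<in> Q" using that by simp
    show ?thesis
    proof (cases "p' = q")
      case True
      then show ?thesis using eg[OF p] hq hQ[OF p] by (simp add: Int_commute)
    next
      case F: False
      then have "p' \<in> Q" using that by simp
      then show ?thesis using g(2)[of p p'] p that(3) hQ by simp
    qed
  qed
  ultimately show ?case by (intro exI[of _ h]) blast
qed

section \<open>Copies of the expansion from two disjoint edges\<close>

lemma uncovered_matching2:
  assumes "2 \<le> r"
  shows "uncovered_pairs (matching2 r) = {{i, j} | i j. i < r \<and> r \<le> j \<and> j < 2 * r}"
proof (rule set_eqI, rule iffI)
  fix p assume "p \<in> uncovered_pairs (matching2 r)"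
  then have p: "p \<subseteq> {0..<2 * r}" "card p = 2" "\<not> p \<subseteq> {0..<r}" "\<not> p \<subseteq> {r..<2 * r}"
    unfolding uncovered_pairs_def matching2_def by auto
  then obtain i j where ij: "i \<in> p" "\<not> i < r" "j \<in> p" "\<not> (r \<le> j)" by force
  have "{j, i} = p"
  proof (rule card_subset_eq)
    show "finite p" using p(2) card.infinite by fastforce
    show "card {j, i} = card p" using ij p(2) by auto
  qed (use ij in auto)
  moreover have "j < r" "r \<le> i" "i < 2 * r" using ij p(1) by auto
  ultimately show "p \<in> {{i, j} | i j. i < r \<and> r \<le> j \<and> j < 2 * r}" by blast
next
  fix p assume "p \<in> {{i, j} | i j. i < r \<and> r \<le> j \<and> j < 2 * r}"
  then obtain i j where "p = {i, j}" "i < r" "r \<le> j" "j < 2 * r" by blast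
  then show "p \<in> uncovered_pairs (matching2 r)"
    unfolding uncovered_pairs_def matching2_def by auto
qed

lemma expansion_embedding:
  assumes r: "2 \<le> r" and A: "finite A" "card A = r" and B: "finite B" "card B = r" and AB: "A \<inter> B = {}"
    and g: "\<And>a b. a \<in> A \<Longrightarrow> b \<in> B \<Longrightarrow> finite (g a b) \<and> card (g a b) = r \<and> g a b \<inter> (A \<union> B) = {a, b}"
    and dj: "\<And>a b c d. a \<in> A \<Longrightarrow> b \<in> B \<Longrightarrow> c \<in> A \<Longrightarrow> d \<in> B \<Longrightarrow> (a, b) \<noteq> (c, d) \<Longrightarrow> g a b \<inter> g c d \<subseteq> A \<union> B"
  shows "hiso (expansion r (matching2 r))
    (HGraph (A \<union> B \<union> (\<Union>a\<in>A. \<Union>b\<in>B. g a b)) ({A, B} \<union> {g a b | a b. a \<in> A \<and> b \<in> B}))"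
proof -
  obtain \<alpha> where al: "bij_betw \<alpha> {0..<r} A" using A ex_bij_betw_nat_finite by blast
  obtain \<beta>0 where be0: "bij_betw \<beta>0 {0..<r} B" using B ex_bij_betw_nat_finite by blast
  define \<beta> where "\<beta> j = \<beta>0 (j - r)" for j
  have "bij_betw (\<lambda>j. j - r) {r..<2 * r} {0..<r}"
    by (rule bij_betwI[where g = "\<lambda>j. j + r"]) auto
  then have be: "bij_betw \<beta> {r..<2 * r} B" unfolding \<beta>_def using bij_betw_trans[OF _ be0] by (simp add: comp_def)
  have alA: "\<alpha> i \<in> A" if "i < r" for i using bij_betwE[OF al] that by auto
  have beB: "\<beta> j \<in> B" if "r \<le> j" "j < 2 * r" for j using bij_betwE[OF be] that by auto
  have "\<exists>h. bij_betw h {..<r - 2} (g a b - {a, b})" if "a \<in> A" "b \<in> B" for a b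
  proof -
    have "{a, b} \<subseteq> g a b" "a \<noteq> b" using g[OF that] AB that by auto
    then have "card (g a b - {a, b}) = r - 2" using g[OF that] by (simp add: card_Diff_subset)
    moreover have "finite (g a b - {a, b})" using g[OF that] by simp
    ultimately show ?thesis using ex_bij_betw_nat_finite[of "g a b - {a, b}"] by (simp add: atLeast0LessThan)
  qed
  then obtain \<gamma> where ga: "\<And>a b. a \<in> A \<Longrightarrow> b \<in> B \<Longrightarrow> bij_betw (\<gamma> a b) {..<r - 2} (g a b - {a, b})" by metis
  \<comment> \<open>\<open>Min p\<close> is the end of the pair in the first matching edge and
    \<open>Max p\<close> the end in the second, so \<open>p\<close> determines the connecting edge
    that receives its new vertices.\<close>
  define f where "f = case_sum (\<lambda>v. if v < r then \<alpha> v else \<beta> v) (\<lambda>(p, k). \<gamma> (\<alpha> (Min p)) (\<beta> (Max p)) k)"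
  define P where "P = uncovered_pairs (matching2 r)"
  have P: "P = {{i, j} | i j. i < r \<and> r \<le> j \<and> j < 2 * r}" unfolding P_def by (rule uncovered_matching2[OF r])
  define h where "h p = g (\<alpha> (Min p)) (\<beta> (Max p))" for p
  have mm: "Min {i, j} = i" "Max {i, j} = j" if "i < r" "r \<le> j" for i j using that by auto
  have hP: "\<alpha> (Min p) \<in> A" "\<beta> (Max p) \<in> B" "p = {Min p, Max p}" "Min p < r" "r \<le> Max p" "Max p < 2 * r" if "p \<in> P" for p
    using that alA beB mm unfolding P by auto
  have fA: "f ` Inl ` {0..<r} = A" using bij_betw_imp_surj_on[OF al] unfolding f_def by (simp add: image_image)
  have fB: "f ` Inl ` {r..<2 * r} = B" using bij_betw_imp_surj_on[OF be] unfolding f_def by (simp add: image_image)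
  have fnew: "f ` new_verts r p = h p - (A \<union> B)" if "p \<in> P" for p
  proof -
    have "new_verts r p = (\<lambda>k. Inr (p, k)) ` {..<r - 2}" unfolding new_verts_def by auto
    then have "f ` new_verts r p = \<gamma> (\<alpha> (Min p)) (\<beta> (Max p)) ` {..<r - 2}" unfolding f_def by (simp add: image_image)
    also have "\<dots> = h p - {\<alpha> (Min p), \<beta> (Max p)}"
      using bij_betw_imp_surj_on[OF ga[OF hP(1,2)[OF that]]] unfolding h_def .
    also have "\<dots> = h p - (A \<union> B)" using g[OF hP(1,2)[OF that]] unfolding h_def by blast
    finally show ?thesis .
  qed
  have fpair: "f ` Inl ` p = {\<alpha> (Min p), \<beta> (Max p)}" if "p \<in> P" for p
  proof -
    have "f (Inl (Min p)) = \<alpha> (Min p)" "f (Inl (Max p)) = \<beta> (Max p)" unfolding f_def using hP[OF that] by auto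
    then show ?thesis by (subst hP(3)[OF that]) simp
  qed
  have fedge: "f ` (Inl ` p \<union> new_verts r p) = h p" if "p \<in> P" for p
    using fpair[OF that] fnew[OF that] g[OF hP(1,2)[OF that]] unfolding h_def image_Un by blast
  have gh: "\<exists>p\<in>P. h p = g a b" if "a \<in> A" "b \<in> B" for a b
  proof -
    from that(1) obtain i where i: "i < r" "\<alpha> i = a" using bij_betw_imp_surj_on[OF al] by auto
    from that(2) obtain j where j: "r \<le> j" "j < 2 * r" "\<beta> j = b" using bij_betw_imp_surj_on[OF be] by auto
    show ?thesis by (rule bexI[of _ "{i, j}"]) (use i j mm[OF i(1) j(1)] in \<open>auto simp: h_def P\<close>)
  qed
  have hset: "h ` P = {g a b | a b. a \<in> A \<and> b \<in> B}"
  proof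
    show "h ` P \<subseteq> {g a b | a b. a \<in> A \<and> b \<in> B}" unfolding h_def using hP by blast
    show "{g a b | a b. a \<in> A \<and> b \<in> B} \<subseteq> h ` P"
    proof (rule subsetI, clarify)
      fix a b assume "a \<in> A" "b \<in> B"
      from gh[OF this] obtain p where "p \<in> P" "h p = g a b" by (rule bexE)
      then show "g a b \<in> h ` P" by (intro image_eqI[of _ _ p]) simp_all
    qed
  qed
  have inj1: "inj_on f (Inl ` {0..<2 * r})"
  proof (rule inj_onI, clarsimp)
    fix u v assume uv: "u < 2 * r" "v < 2 * r" "f (Inl u) = f (Inl v)"
    have iA: "u = v" if "u < r" "v < r" "\<alpha> u = \<alpha> v" using that bij_betw_imp_inj_on[OF al] by (auto dest: inj_onD)
    have iB: "u = v" if "\<not> u < r" "\<not> v < r" "\<beta> u = \<beta> v" using that uv bij_betw_imp_inj_on[OF be] by (auto dest: inj_onD)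
    have ne: "\<alpha> i \<noteq> \<beta> j" if "i < r" "\<not> j < r" "j < 2 * r" for i j using alA[of i] beB[of j] that AB by force
    show "u = v"
      using uv iA iB ne[of u v] ne[of v u] unfolding f_def by (cases "u < r"; cases "v < r") auto
  qed
  have inj2: "inj_on f (\<Union>p\<in>P. new_verts r p)"
  proof (rule inj_onI)
    fix x y assume xy: "x \<in> (\<Union>p\<in>P. new_verts r p)" "y \<in> (\<Union>p\<in>P. new_verts r p)" "f x = f y"
    then obtain p k where x: "p \<in> P" "k < r - 2" "x = Inr (p, k)" unfolding new_verts_def by auto
    obtain p' k' where y: "p' \<in> P" "k' < r - 2" "y = Inr (p', k')" using xy unfolding new_verts_def by auto
    have fx: "f x \<in> h p - (A \<union> B)" using fnew[OF x(1)] x unfolding new_verts_def by auto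
    have fy: "f y \<in> h p' - (A \<union> B)" using fnew[OF y(1)] y unfolding new_verts_def by auto
    have "p = p'"
    proof (rule ccontr)
      assume ne: "p \<noteq> p'"
      have "(\<alpha> (Min p), \<beta> (Max p)) \<noteq> (\<alpha> (Min p'), \<beta> (Max p'))"
      proof
        assume eq: "(\<alpha> (Min p), \<beta> (Max p)) = (\<alpha> (Min p'), \<beta> (Max p'))"
        have "Min p = Min p'" using eq hP[OF x(1)] hP[OF y(1)] bij_betw_imp_inj_on[OF al] by (auto dest: inj_onD)
        moreover have "Max p = Max p'" using eq hP[OF x(1)] hP[OF y(1)] bij_betw_imp_inj_on[OF be] by (auto dest: inj_onD)
        ultimately show False using ne hP(3)[OF x(1)] hP(3)[OF y(1)] by simp
      qed
      from dj[OF hP(1,2)[OF x(1)] hP(1,2)[OF y(1)] this]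
      show False using fx fy xy(3) unfolding h_def by auto
    qed
    moreover have "\<gamma> (\<alpha> (Min p)) (\<beta> (Max p)) k = \<gamma> (\<alpha> (Min p)) (\<beta> (Max p)) k'"
      using xy(3) x y \<open>p = p'\<close> unfolding f_def by simp
    then have "k = k'" using bij_betw_imp_inj_on[OF ga[OF hP(1,2)[OF x(1)]]] x y by (auto dest: inj_onD)
    ultimately show "x = y" using x y by simp
  qed
  have im1: "f ` Inl ` {0..<2 * r} = A \<union> B"
  proof -
    have "{0..<2 * r} = {0..<r} \<union> {r..<2 * r}" by auto
    then show ?thesis using fA fB by (simp only: image_Un)
  qed
  have im2: "f ` (\<Union>p\<in>P. new_verts r p) = (\<Union>p\<in>P. h p - (A \<union> B))"
    unfolding image_UN using fnew by simp
  have inj: "inj_on f (Inl ` {0..<2 * r} \<union> (\<Union>p\<in>P. new_verts r p))"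
    unfolding inj_on_Un
  proof (intro conjI inj1 inj2)
    have s1: "f ` (Inl ` {0..<2 * r} - (\<Union>p\<in>P. new_verts r p)) \<subseteq> A \<union> B" using im1 by blast
    have s2: "f ` ((\<Union>p\<in>P. new_verts r p) - Inl ` {0..<2 * r}) \<subseteq> (\<Union>p\<in>P. h p - (A \<union> B))" using im2 by blast
    show "f ` (Inl ` {0..<2 * r} - (\<Union>p\<in>P. new_verts r p)) \<inter> f ` ((\<Union>p\<in>P. new_verts r p) - Inl ` {0..<2 * r}) = {}"
      using s1 s2 by blast
  qed
  have UN: "(\<Union>a\<in>A. \<Union>b\<in>B. g a b) = (\<Union>p\<in>P. h p)"
  proof -
    have "(\<Union>a\<in>A. \<Union>b\<in>B. g a b) = \<Union> {g a b | a b. a \<in> A \<and> b \<in> B}" by blast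
    then show ?thesis unfolding hset[symmetric] .
  qed
  have V: "verts (expansion r (matching2 r)) = Inl ` {0..<2 * r} \<union> (\<Union>p\<in>P. new_verts r p)"
    unfolding expansion_def P_def by (simp add: matching2_def)
  have Ed: "edges (expansion r (matching2 r)) = {Inl ` {0..<r}, Inl ` {r..<2 * r}} \<union> (\<lambda>p. Inl ` p \<union> new_verts r p) ` P"
    unfolding expansion_def P_def by (auto simp: matching2_def)
  show ?thesis unfolding hiso_def
  proof (intro exI[of _ f] conjI)
    show "bij_betw f (verts (expansion r (matching2 r)))
      (verts (HGraph (A \<union> B \<union> (\<Union>a\<in>A. \<Union>b\<in>B. g a b)) ({A, B} \<union> {g a b | a b. a \<in> A \<and> b \<in> B})))"
      unfolding bij_betw_def V
    proof (intro conjI inj)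
      have "f ` (Inl ` {0..<2 * r} \<union> (\<Union>p\<in>P. new_verts r p)) = (A \<union> B) \<union> (\<Union>p\<in>P. h p - (A \<union> B))"
        using im1 im2 by (simp only: image_Un)
      also have "\<dots> = A \<union> B \<union> (\<Union>p\<in>P. h p)" by blast
      finally show "f ` (Inl ` {0..<2 * r} \<union> (\<Union>p\<in>P. new_verts r p)) =
        verts (HGraph (A \<union> B \<union> (\<Union>a\<in>A. \<Union>b\<in>B. g a b)) ({A, B} \<union> {g a b | a b. a \<in> A \<and> b \<in> B}))"
        unfolding UN by simp
    qed
    have "(\<lambda>e. f ` e) ` (\<lambda>p. Inl ` p \<union> new_verts r p) ` P = h ` P"
      unfolding image_image using fedge by (intro image_cong) auto
    then show "edges (HGraph (A \<union> B \<union> (\<Union>a\<in>A. \<Union>b\<in>B. g a b)) ({A, B} \<union> {g a b | a b. a \<in> A \<and> b \<in> B}))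
      = (\<lambda>e. f ` e) ` edges (expansion r (matching2 r))"
      unfolding Ed image_Un hset[symmetric] using fA fB by simp
  qed
qed

text \<open>The pair \<open>(p, q)\<close> is served by the given edge \<open>e0\<close> and is
  exempt from the codegree condition. This is what makes an edge with two vertices in the first part
  usable: in a semibipartite graph such a pair has codegree zero.\<close>

lemma hcopy_with_edge:
  assumes r: "4 \<le> r" and V: "finite V" and E: "E \<subseteq> ksets V r" and A: "A \<in> E" and B: "B \<in> E" and e0: "e0 \<in> E"
    and AB: "A \<inter> B = {}" and pq: "p \<in> A" "q \<in> B" "e0 \<inter> (A \<union> B) = {p, q}"
    and Y: "finite Y" "A \<inter> Y = {}" "B \<inter> Y = {}" "e0 \<inter> Y = {}"
    and c: "\<And>a b. a \<in> A \<Longrightarrow> b \<in> B \<Longrightarrow> (a, b) \<noteq> (p, q) \<Longrightarrow>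
      real (emb_const r + card Y) * real (card V) ^ (r - 3) < real (codeg E a b)"
  obtains W where "hcopy r V E W" "W \<inter> Y = {}"
proof -
  have fin: "finite e \<and> card e = r \<and> e \<subseteq> V" if "e \<in> E" for e
    using that E V finite_subset[of e V] unfolding ksets_def by auto
  note fA = fin[OF A] and fB = fin[OF B] and fe = fin[OF e0]
  define Z where "Z = A \<union> B \<union> Y \<union> e0"
  define Q where "Q = A \<times> B - {(p, q)}"
  have fQ: "finite Q" unfolding Q_def using fA fB by simp
  have fZ: "finite Z" unfolding Z_def using fA fB fe Y by simp
  have "card Q \<le> r * r"
  proof -
    have "card Q \<le> card (A \<times> B)" unfolding Q_def using fA fB by (intro card_mono) auto
    then show ?thesis using fA fB by (simp add: card_cartesian_product)
  qed
  moreover have "card Z \<le> 3 * r + card Y"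
  proof -
    have "card Z \<le> card A + card B + card Y + card e0"
      unfolding Z_def using card_Un_le[of "A \<union> B \<union> Y" e0] card_Un_le[of "A \<union> B" Y] card_Un_le[of A B] by linarith
    then show ?thesis using fA fB fe by simp
  qed
  ultimately have K: "card Z + card Q * r \<le> emb_const r + card Y"
    unfolding emb_const_def by (smt (verit) add.commute add.left_commute add_mono mult_le_mono1)
  have Q1: "a \<in> V \<inter> Z \<and> b \<in> V \<inter> Z \<and> a \<noteq> b" if "(a, b) \<in> Q" for a b
    using that fA fB AB unfolding Q_def Z_def by auto
  have Q2: "real (emb_const r + card Y) * real (card V) ^ (r - 3) < real (codeg E a b)" if "(a, b) \<in> Q" for a b
    using c[of a b] that unfolding Q_def by auto
  have r2: "2 \<le> r" using r by simp
  obtain g where G: "(\<forall>a b. (a, b) \<in> Q \<longrightarrow> g (a, b) \<in> E \<and> g (a, b) \<inter> Z = {a, b}) \<and>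
    (\<forall>p\<in>Q. \<forall>q\<in>Q. p \<noteq> q \<longrightarrow> g p \<inter> g q \<subseteq> Z)"
    using greedy_edges[OF V E fZ r2 fQ Q1 K Q2] ..
  note g1 = conjunct1[OF G, rule_format] and g2 = conjunct2[OF G, rule_format]
  define h where "h a b = (if (a, b) = (p, q) then e0 else g (a, b))" for a b
  have hE: "h a b \<in> E" "h a b \<inter> (A \<union> B) = {a, b}" "h a b \<inter> Y = {}" if "a \<in> A" "b \<in> B" for a b
  proof -
    show "h a b \<in> E" using g1[of a b] that e0 unfolding h_def Q_def by auto
    show "h a b \<inter> (A \<union> B) = {a, b}"
    proof (cases "(a, b) = (p, q)")
      case False
      then have "g (a, b) \<inter> Z = {a, b}" using g1[of a b] that unfolding Q_def by auto
      then have "g (a, b) \<inter> (A \<union> B) = {a, b}" using that unfolding Z_def by blast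
      then show ?thesis using False unfolding h_def by auto
    qed (use pq in \<open>auto simp: h_def\<close>)
    show "h a b \<inter> Y = {}"
    proof (cases "(a, b) = (p, q)")
      case False
      then have "g (a, b) \<inter> Z = {a, b}" using g1[of a b] that unfolding Q_def by auto
      then have "g (a, b) \<inter> Y \<subseteq> {a, b}" unfolding Z_def by blast
      then have "g (a, b) \<inter> Y = {}" using that Y by blast
      then show ?thesis using False unfolding h_def by auto
    qed (use Y in \<open>auto simp: h_def\<close>)
  qed
  have sub: "g (a, b) \<inter> e0 \<subseteq> A \<union> B" if "(a, b) \<in> Q" for a b
  proof -
    have "g (a, b) \<inter> Z = {a, b}" "{a, b} \<subseteq> A \<union> B" using g1[OF that] that unfolding Q_def by auto
    then show ?thesis unfolding Z_def by blast
  qed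
  have sub2: "g (a, b) \<inter> Z \<subseteq> A \<union> B" if "(a, b) \<in> Q" for a b
    using g1[OF that] that unfolding Q_def by auto
  have dj: "h a b \<inter> h c d \<subseteq> A \<union> B" if "a \<in> A" "b \<in> B" "c \<in> A" "d \<in> B" "(a, b) \<noteq> (c, d)" for a b c d
  proof (cases "(a, b) = (p, q)")
    case True
    then have "(c, d) \<in> Q" using that unfolding Q_def by auto
    then show ?thesis using sub[of c d] True that(5) unfolding h_def by auto
  next
    case False
    then have abQ: "(a, b) \<in> Q" using that unfolding Q_def by auto
    show ?thesis
    proof (cases "(c, d) = (p, q)")
      case True
      then show ?thesis using sub[OF abQ] False unfolding h_def by auto
    next
      case F: False
      then have cdQ: "(c, d) \<in> Q" using that unfolding Q_def by auto
      have "g (a, b) \<inter> g (c, d) \<subseteq> Z" by (rule g2[OF abQ cdQ that(5)])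
      then have "g (a, b) \<inter> g (c, d) \<subseteq> A \<union> B" using sub2[OF abQ] by blast
      then show ?thesis using False F unfolding h_def by auto
    qed
  qed
  define W where "W = A \<union> B \<union> (\<Union>a\<in>A. \<Union>b\<in>B. h a b)"
  define F where "F = {A, B} \<union> {h a b | a b. a \<in> A \<and> b \<in> B}"
  have iso: "hiso (expansion r (matching2 r)) (HGraph W F)"
    unfolding W_def F_def
  proof (rule expansion_embedding[OF r2 _ _ _ _ AB])
    show "finite A" "card A = r" "finite B" "card B = r" using fA fB by auto
    show "finite (h a b) \<and> card (h a b) = r \<and> h a b \<inter> (A \<union> B) = {a, b}" if "a \<in> A" "b \<in> B" for a b
      using hE(1,2)[OF that] fin[of "h a b"] by simp
    show "h a b \<inter> h c d \<subseteq> A \<union> B" if "a \<in> A" "b \<in> B" "c \<in> A" "d \<in> B" "(a, b) \<noteq> (c, d)" for a b c d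
      by (rule dj[OF that])
  qed
  have "F \<subseteq> E" unfolding F_def using A B hE by auto
  moreover have "W \<subseteq> V"
  proof -
    have "h a b \<subseteq> V" if "a \<in> A" "b \<in> B" for a b using fin[OF hE(1)[OF that]] by simp
    then show ?thesis unfolding W_def using fA fB by auto
  qed
  ultimately have "hcopy r V E W" unfolding hcopy_def using iso by auto
  moreover have "W \<inter> Y = {}"
  proof -
    have "x \<notin> Y" if "a \<in> A" "b \<in> B" "x \<in> h a b" for a b x using hE(3)[OF that(1,2)] that(3) by blast
    then show ?thesis unfolding W_def using Y by auto
  qed
  ultimately show ?thesis by (rule that)
qed

lemma hcopy_codeg:
  assumes r: "4 \<le> r" and V: "finite V" and E: "E \<subseteq> ksets V r" and A: "A \<in> E" and B: "B \<in> E"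
    and AB: "A \<inter> B = {}" and Y: "finite Y" "A \<inter> Y = {}" "B \<inter> Y = {}"
    and c: "\<And>a b. a \<in> A \<Longrightarrow> b \<in> B \<Longrightarrow>
      real (emb_const r + card Y) * real (card V) ^ (r - 3) < real (codeg E a b)"
  obtains W where "hcopy r V E W" "W \<inter> Y = {}"
proof -
  have fin: "finite e \<and> card e = r \<and> e \<subseteq> V" if "e \<in> E" for e
    using that E V finite_subset[of e V] unfolding ksets_def by auto
  note fA = fin[OF A] and fB = fin[OF B]
  have "A \<noteq> {}" "B \<noteq> {}" using fA fB r by auto
  then obtain p q where pq: "p \<in> A" "q \<in> B" by blast
  have pqV: "p \<in> V" "q \<in> V" "p \<noteq> q" using pq fA fB AB by auto
  define Z where "Z = A \<union> B \<union> Y"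
  have fZ: "finite Z" unfolding Z_def using fA fB Y by simp
  have "card Z \<le> card A + card B + card Y"
    unfolding Z_def using card_Un_le[of "A \<union> B" Y] card_Un_le[of A B] by linarith
  then have "card Z \<le> emb_const r + card Y" using fA fB unfolding emb_const_def by simp
  then have "real (card Z) * real (card V) ^ (r - 3) \<le> real (emb_const r + card Y) * real (card V) ^ (r - 3)"
    by (intro mult_right_mono) auto
  also have "\<dots> < real (codeg E p q)" by (rule c[OF pq])
  finally obtain e where e: "e \<in> E" "p \<in> e" "q \<in> e" "e \<inter> Z \<subseteq> {p, q}"
    by (rule avoiding_edge[OF V E pqV fZ]) (rule that)
  have e1: "e \<inter> (A \<union> B) = {p, q}" using e pq unfolding Z_def by blast
  have e2: "e \<inter> Y = {}" using e pq Y unfolding Z_def by blast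
  show ?thesis
    by (rule hcopy_with_edge[OF r V E A B e(1) AB pq e1 Y e2 c]) (assumption | rule that)+
qed

lemma hcopy_card: "hcopy r V E W \<Longrightarrow> card W = copy_size r"
  unfolding hcopy_def hiso_def copy_size_def by (auto dest: bij_betw_same_card)

text \<open>The property that rules out copies in a semibipartite graph: the connecting edges stay
  inside the copy, so they are subject to the same restriction as the two core edges.\<close>

lemma hcopy_pairs:
  assumes r: "2 \<le> r" and W: "hcopy r V E W"
  obtains A B where "A \<in> E" "B \<in> E" "A \<subseteq> W" "B \<subseteq> W" "A \<inter> B = {}"
    "\<And>a b. a \<in> A \<Longrightarrow> b \<in> B \<Longrightarrow> \<exists>e\<in>E. e \<subseteq> W \<and> a \<in> e \<and> b \<in> e"
proof -
  obtain F f where F: "F \<subseteq> E" and f: "bij_betw f (verts (expansion r (matching2 r))) W"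
    "F = (\<lambda>e. f ` e) ` edges (expansion r (matching2 r))"
    using W unfolding hcopy_def hiso_def by auto
  define X where "X = verts (expansion r (matching2 r))"
  have sub: "e \<subseteq> X" if "e \<in> edges (expansion r (matching2 r))" for e
    using that unfolding X_def expansion_def matching2_def uncovered_pairs_def by auto
  have e1: "Inl ` {0..<r} \<in> edges (expansion r (matching2 r))" "Inl ` {r..<2 * r} \<in> edges (expansion r (matching2 r))"
    unfolding expansion_def matching2_def by auto
  have inj: "inj_on f X" and im: "f ` X = W" using f(1) unfolding X_def bij_betw_def by auto
  define A where "A = f ` Inl ` {0..<r}"
  define B where "B = f ` Inl ` {r..<2 * r}"
  have "A \<inter> B = f ` (Inl ` {0..<r} \<inter> Inl ` {r..<2 * r})"
    unfolding A_def B_def by (rule inj_on_image_Int[OF inj sub[OF e1(1)] sub[OF e1(2)], symmetric])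
  also have "\<dots> = {}" by auto
  finally have "A \<inter> B = {}" .
  moreover have "\<exists>e\<in>E. e \<subseteq> W \<and> a \<in> e \<and> b \<in> e" if "a \<in> A" "b \<in> B" for a b
  proof -
    from that obtain i j where ij: "i < r" "a = f (Inl i)" "r \<le> j" "j < 2 * r" "b = f (Inl j)"
      unfolding A_def B_def by auto
    have "{i, j} \<in> uncovered_pairs (matching2 r)" unfolding uncovered_matching2[OF r] using ij by blast
    then have "Inl ` {i, j} \<union> new_verts r {i, j} \<in> edges (expansion r (matching2 r))"
      unfolding expansion_def by auto
    note e = this
    have "f ` (Inl ` {i, j} \<union> new_verts r {i, j}) \<in> E" using e F f(2) by blast
    moreover have "f ` (Inl ` {i, j} \<union> new_verts r {i, j}) \<subseteq> W" using sub[OF e] im by blast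
    moreover have "a \<in> f ` (Inl ` {i, j} \<union> new_verts r {i, j})" "b \<in> f ` (Inl ` {i, j} \<union> new_verts r {i, j})"
      using ij by auto
    ultimately show ?thesis by blast
  qed
  moreover have "A \<in> E" "B \<in> E" using e1 F f(2) unfolding A_def B_def by auto
  moreover have "A \<subseteq> W" "B \<subseteq> W" unfolding A_def B_def using image_mono[OF sub[OF e1(1)], of f] image_mono[OF sub[OF e1(2)], of f] im by auto
  ultimately show ?thesis using that[of A B] by simp
qed

section \<open>Packings of copies\<close>

definition packs :: "nat \<Rightarrow> 'a set \<Rightarrow> 'a set set \<Rightarrow> 'a set set \<Rightarrow> bool" where
  "packs r V E \<W> \<longleftrightarrow> finite \<W> \<and> (\<forall>W\<in>\<W>. hcopy r V E W) \<and> disjoint \<W>"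

lemma copy_size_pos: "2 \<le> r \<Longrightarrow> 0 < copy_size r"
proof -
  assume r: "2 \<le> r"
  have "finite (verts (expansion r (matching2 r)))"
  proof -
    have "uncovered_pairs (matching2 r) \<subseteq> Pow {0..<2 * r}" unfolding uncovered_pairs_def matching2_def by auto
    then have "finite (uncovered_pairs (matching2 r))" by (rule finite_subset) simp
    moreover have "finite (new_verts r p)" for p :: "nat set"
    proof -
      have "new_verts r p = (\<lambda>k. Inr (p, k)) ` {..<r - 2}" unfolding new_verts_def by auto
      then show ?thesis by simp
    qed
    ultimately show ?thesis unfolding expansion_def matching2_def by simp
  qed
  moreover have "Inl 0 \<in> verts (expansion r (matching2 r))" unfolding expansion_def matching2_def using r by auto
  ultimately show ?thesis unfolding copy_size_def by (auto simp: card_gt_0_iff)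
qed

lemma packs_insert:
  assumes r: "2 \<le> r" and p: "packs r V E \<W>" and W: "hcopy r V E W" "W \<inter> \<Union>\<W> = {}"
  shows "packs r V E (insert W \<W>)" "card (insert W \<W>) = Suc (card \<W>)"
proof -
  have "W \<noteq> {}" using hcopy_card[OF W(1)] copy_size_pos[OF r] by auto
  then have "W \<notin> \<W>" using W(2) by auto
  then show "card (insert W \<W>) = Suc (card \<W>)" using p unfolding packs_def by simp
  have "disjoint (insert W \<W>)"
    unfolding disjoint_def using p W(2) unfolding packs_def disjoint_def by auto
  then show "packs r V E (insert W \<W>)" using p W(1) unfolding packs_def by auto
qed

lemma packs_Union:
  assumes V: "finite V" and p: "packs r V E \<W>"
  shows "\<Union>\<W> \<subseteq> V" "finite (\<Union>\<W>)" "card (\<Union>\<W>) \<le> card \<W> * copy_size r"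
proof -
  show s: "\<Union>\<W> \<subseteq> V" using p unfolding packs_def hcopy_def by auto
  show "finite (\<Union>\<W>)" using finite_subset[OF s V] .
  have "card (\<Union>\<W>) \<le> (\<Sum>W\<in>\<W>. card W)" by (rule card_Union_le_sum_card)
  also have "\<dots> = (\<Sum>W\<in>\<W>. copy_size r)"
    using p unfolding packs_def by (intro sum.cong[OF refl] hcopy_card[of r V E]) auto
  finally show "card (\<Union>\<W>) \<le> card \<W> * copy_size r" by simp
qed

text \<open>The union of a largest packing avoiding \<open>L\<close> meets every copy disjoint from
  \<open>L\<close>, as the packing could otherwise grow.\<close>

lemma maximal_packs:
  assumes r: "2 \<le> r" and V: "finite V" and t: "\<And>\<W>. packs r V E \<W> \<Longrightarrow> \<Union>\<W> \<inter> L = {} \<Longrightarrow> card \<W> \<le> t"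
  obtains Y where "Y \<subseteq> V" "card Y \<le> t * copy_size r" "\<And>W. hcopy r V E W \<Longrightarrow> W \<inter> (Y \<union> L) \<noteq> {}"
proof -
  define P where "P k \<longleftrightarrow> (\<exists>\<W>. packs r V E \<W> \<and> \<Union>\<W> \<inter> L = {} \<and> card \<W> = k)" for k
  have "P 0" unfolding P_def packs_def disjoint_def by (rule exI[of _ "{}"]) simp
  moreover have bd: "k \<le> t" if "P k" for k
  proof -
    from that obtain \<W> where "packs r V E \<W>" "\<Union>\<W> \<inter> L = {}" "card \<W> = k" unfolding P_def by (elim exE conjE)
    then show ?thesis using t[of \<W>] by simp
  qed
  ultimately have "P (Greatest P)" by (rule GreatestI_nat)
  moreover have "k \<le> Greatest P" if "P k" for k using that bd by (rule Greatest_le_nat)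
  ultimately have g: "P (Greatest P)" "\<And>k. P k \<Longrightarrow> k \<le> Greatest P" by simp_all
  then obtain \<W> where W: "packs r V E \<W>" "\<Union>\<W> \<inter> L = {}" "card \<W> = Greatest P" unfolding P_def by (elim exE conjE)
  note U = packs_Union[OF V W(1)]
  have "card \<W> \<le> t" by (rule t[OF W(1,2)])
  then have "card (\<Union>\<W>) \<le> t * copy_size r" using U(3) by (meson le_trans mult_le_mono1)
  moreover have "X \<inter> (\<Union>\<W> \<union> L) \<noteq> {}" if X: "hcopy r V E X" for X
  proof
    assume d: "X \<inter> (\<Union>\<W> \<union> L) = {}"
    then have "X \<inter> \<Union>\<W> = {}" by blast
    note I = packs_insert[OF r W(1) X this]
    have "\<Union>(insert X \<W>) \<inter> L = {}" using d W(2) by auto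
    then have "P (Suc (card \<W>))" using I unfolding P_def by (intro exI[of _ "insert X \<W>"]) simp
    then show False using g(2)[of "Suc (card \<W>)"] W(3) by simp
  qed
  ultimately show ?thesis by (rule that[OF U(1)])
qed

text \<open>One copy is added for each \<open>v\<close> in \<open>L\<close>. It avoids the earlier
  copies and the rest of \<open>L\<close>, so each remaining vertex stays outside the set that its
  own copy will have to avoid.\<close>

lemma packs_extend:
  assumes r: "2 \<le> r" and V: "finite V" and L: "finite L" "L \<subseteq> V"
    and rich: "\<And>v Y. v \<in> L \<Longrightarrow> Y \<subseteq> V \<Longrightarrow> v \<notin> Y \<Longrightarrow> card Y \<le> K \<Longrightarrow> \<exists>W. hcopy r V E W \<and> W \<inter> Y = {}"
    and p: "packs r V E \<W>" "\<Union>\<W> \<inter> L = {}" and K: "(card \<W> + card L) * copy_size r + card L \<le> K"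
  shows "\<exists>\<W>'. packs r V E \<W>' \<and> card \<W>' = card \<W> + card L"
  using L rich p K
proof (induction L arbitrary: \<W> rule: finite_induct)
  case empty
  then show ?case by auto
next
  case (insert v L)
  note U = packs_Union[OF V insert.prems(3)]
  define Y where "Y = \<Union>\<W> \<union> L"
  have "card Y \<le> card \<W> * copy_size r + card L" unfolding Y_def using card_Un_le[of "\<Union>\<W>" L] U(3) by linarith
  also have "\<dots> \<le> (card \<W> + card (insert v L)) * copy_size r + card (insert v L)"
    using insert.hyps by (simp add: algebra_simps)
  finally have cY: "card Y \<le> K" using insert.prems(5) by linarith
  have "\<exists>W. hcopy r V E W \<and> W \<inter> Y = {}"
    by (rule insert.prems(2)[of v]) (use insert.prems(1,4) insert.hyps(2) U(1) cY in \<open>auto simp: Y_def\<close>)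
  then obtain W where W: "hcopy r V E W" "W \<inter> Y = {}" by blast
  then have WU: "W \<inter> \<Union>\<W> = {}" "W \<inter> L = {}" unfolding Y_def by auto
  note I = packs_insert[OF r insert.prems(3) W(1) WU(1)]
  have "\<exists>\<W>'. packs r V E \<W>' \<and> card \<W>' = card (insert W \<W>) + card L"
  proof (rule insert.IH[OF _ _ I(1)])
    show "L \<subseteq> V" using insert.prems(1) by simp
    show "\<exists>W. hcopy r V E W \<and> W \<inter> Y = {}" if "u \<in> L" "Y \<subseteq> V" "u \<notin> Y" "card Y \<le> K" for u Y
      by (rule insert.prems(2)[OF insertI2[OF that(1)] that(2-4)])
    show "\<Union>(insert W \<W>) \<inter> L = {}" using WU insert.prems(4) by auto
    show "(card (insert W \<W>) + card L) * copy_size r + card L \<le> K"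
      unfolding I(2) using insert.prems(5) insert.hyps by simp
  qed
  then show ?case unfolding I(2) using insert.hyps by simp
qed

text \<open>Deleted are the edges meeting the hitting set \<open>Y\<close> of a largest packing and
  the edges containing a pair of small codegree. In the rest, adjacency implies large codegree in
  \<open>E\<close>, so a violation of pair-freeness would give a copy avoiding \<open>Y\<close>. The
  deletions cost at most \<open>card Y * n ^ (r - 1)\<close> edges plus
  \<open>K * n ^ (r - 3)\<close> for each of at most \<open>n * n\<close> pairs.\<close>

theorem packing_stability:
  assumes r: "4 \<le> r" and e: "0 < \<epsilon>"
  obtains \<delta> c :: real and N :: nat where "0 < \<delta>" "0 < c"
    "\<And>(V :: 'a set) E t. finite V \<Longrightarrow> N \<le> card V \<Longrightarrow> E \<subseteq> ksets V r \<Longrightarrow> real t \<le> c * real (card V) \<Longrightarrow>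
      (\<And>\<W>. packs r V E \<W> \<Longrightarrow> card \<W> \<le> t) \<Longrightarrow>
      (star_density r - \<delta>) * real (card V) ^ r \<le> fact r * real (card E) \<Longrightarrow>
      \<exists>V1\<subseteq>V. real (card {e \<in> E. card (e \<inter> V1) \<noteq> 1}) \<le> \<epsilon> * real (card V) ^ r"
proof -
  have e2: "0 < \<epsilon> / 2" using e by simp
  show ?thesis
  proof (rule pair_free_stability[OF r e2])
    fix \<delta>0 and N0 :: nat
    assume d0: "0 < \<delta>0" and st: "\<And>(V :: 'a set) E. finite V \<Longrightarrow> N0 \<le> card V \<Longrightarrow> E \<subseteq> ksets V r \<Longrightarrow> pair_free E \<Longrightarrow>
      (star_density r - \<delta>0) * real (card V) ^ r \<le> fact r * real (card E) \<Longrightarrow>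
      \<exists>V1\<subseteq>V. real (card {e \<in> E. card (e \<inter> V1) \<noteq> 1}) \<le> \<epsilon> / 2 * real (card V) ^ r"
    define \<gamma> where "\<gamma> = min (\<delta>0 / (2 * fact r)) (\<epsilon> / 2)"
    have g: "0 < \<gamma>" "\<gamma> \<le> \<epsilon> / 2" "\<gamma> \<le> \<delta>0 / (2 * fact r)" unfolding \<gamma>_def using d0 e by auto
    have gf: "fact r * \<gamma> \<le> \<delta>0 / 2" using g(3) by (simp add: pos_le_divide_eq mult_ac)
    define cs where "cs = real (copy_size r)"
    have cs: "0 < cs" unfolding cs_def using copy_size_pos[of r] r by simp
    define c where "c = \<gamma> / (4 * cs)"
    have c0: "0 < c" unfolding c_def using g cs by simp
    define N where "N = N0 + nat \<lceil>2 * real (emb_const r) / \<gamma>\<rceil> + 1"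
    show ?thesis
    proof (rule that[of "\<delta>0 / 2" c N])
      show "0 < \<delta>0 / 2" "0 < c" using d0 c0 by auto
      fix V :: "'a set" and E t
      assume V: "finite V" "N \<le> card V" and E: "E \<subseteq> ksets V r" and t: "real t \<le> c * real (card V)"
        and pk: "\<And>\<W>. packs r V E \<W> \<Longrightarrow> card \<W> \<le> t"
        and D: "(star_density r - \<delta>0 / 2) * real (card V) ^ r \<le> fact r * real (card E)"
      define n where "n = real (card V)"
      have n0: "0 < n" using V unfolding n_def N_def by simp
      have emb: "real (emb_const r) \<le> \<gamma> / 2 * n"
      proof -
        have "2 * real (emb_const r) / \<gamma> \<le> real N" unfolding N_def by linarith
        also have "\<dots> \<le> n" using V unfolding n_def by simp
        finally show ?thesis using g by (simp add: pos_divide_le_eq mult_ac)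
      qed
      have r2: "2 \<le> r" using r by simp
      obtain Y where Y: "Y \<subseteq> V" "card Y \<le> t * copy_size r" "\<And>W. hcopy r V E W \<Longrightarrow> W \<inter> (Y \<union> {}) \<noteq> {}"
        by (rule maximal_packs[OF r2 V(1), of E "{}" t]) (use pk in auto)
      have fY: "finite Y" using finite_subset[OF Y(1) V(1)] .
      have cY: "real (card Y) \<le> \<gamma> / 4 * n"
      proof -
        have "real (card Y) \<le> real (t * copy_size r)" using Y(2) by (simp only: of_nat_le_iff)
        also have "\<dots> = real t * cs" unfolding cs_def by simp
        also have "\<dots> \<le> c * n * cs" using t cs unfolding n_def by (intro mult_right_mono) auto
        also have "\<dots> = \<gamma> / 4 * n" unfolding c_def using cs by simp
        finally show ?thesis .
      qed
      define K where "K = real (emb_const r + card Y)"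
      have K: "0 \<le> K" "K \<le> 3 / 4 * \<gamma> * n" unfolding K_def using emb cY by auto
      \<comment> \<open>The codegree is taken in \<open>E\<close>, so the deletion needs no
        iteration: the greedy embedding also takes place in \<open>E\<close>.\<close>
      define E2 where "E2 = {e \<in> E. e \<inter> Y = {} \<and> (\<forall>a\<in>e. \<forall>b\<in>e. a \<noteq> b \<longrightarrow> K * n ^ (r - 3) < real (codeg E a b))}"
      have E2: "E2 \<subseteq> E" "E2 \<subseteq> ksets V r" using E unfolding E2_def by auto
      have fE: "finite E" by (rule finite_fam[OF V(1) E])
      have pf: "pair_free E2" unfolding pair_free_def
      proof (intro ballI impI, rule ccontr)
        fix A B assume AB: "A \<in> E2" "B \<in> E2" "A \<inter> B = {}" "\<not> (\<exists>a\<in>A. \<exists>b\<in>B. \<not> adj E2 a b)"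
        have cg: "real (emb_const r + card Y) * real (card V) ^ (r - 3) < real (codeg E a b)" if "a \<in> A" "b \<in> B" for a b
        proof -
          have "adj E2 a b" "a \<noteq> b" using AB(3,4) that by auto
          then obtain e where "e \<in> E2" "a \<in> e" "b \<in> e" unfolding adj_def by auto
          then show ?thesis using \<open>a \<noteq> b\<close> unfolding E2_def K_def n_def by auto
        qed
        have AE: "A \<in> E" "B \<in> E" "A \<inter> Y = {}" "B \<inter> Y = {}" using AB unfolding E2_def by auto
        obtain W where "hcopy r V E W" "W \<inter> Y = {}"
          by (rule hcopy_codeg[OF r V(1) E AE(1,2) AB(3) fY AE(3,4) cg])
        then show False using Y(3)[of W] by simp
      qed
      define Q where "Q = {p \<in> V \<times> V. real (codeg E (fst p) (snd p)) \<le> K * n ^ (r - 3)}"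
      have fQ: "finite Q" "card Q \<le> card V * card V"
      proof -
        show "finite Q" unfolding Q_def using V by simp
        have "card Q \<le> card (V \<times> V)" unfolding Q_def using V by (intro card_mono) auto
        then show "card Q \<le> card V * card V" by (simp add: card_cartesian_product)
      qed
      have "E - E2 \<subseteq> {e \<in> E. e \<inter> Y \<noteq> {}} \<union> (\<Union>p\<in>Q. {e \<in> E. fst p \<in> e \<and> snd p \<in> e})"
      proof
        fix e assume e: "e \<in> E - E2"
        have eV: "e \<subseteq> V" using e E unfolding ksets_def by auto
        show "e \<in> {e \<in> E. e \<inter> Y \<noteq> {}} \<union> (\<Union>p\<in>Q. {e \<in> E. fst p \<in> e \<and> snd p \<in> e})"
        proof (cases "e \<inter> Y = {}")
          case True
          then obtain a b where ab: "a \<in> e" "b \<in> e" "\<not> K * n ^ (r - 3) < real (codeg E a b)" using e unfolding E2_def by auto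
          then have "(a, b) \<in> Q" using eV unfolding Q_def by auto
          then show ?thesis using ab e by force
        qed (use e in auto)
      qed
      then have "card (E - E2) \<le> card ({e \<in> E. e \<inter> Y \<noteq> {}} \<union> (\<Union>p\<in>Q. {e \<in> E. fst p \<in> e \<and> snd p \<in> e}))"
        using fE fQ by (intro card_mono) auto
      also have "\<dots> \<le> card {e \<in> E. e \<inter> Y \<noteq> {}} + card (\<Union>p\<in>Q. {e \<in> E. fst p \<in> e \<and> snd p \<in> e})" by (rule card_Un_le)
      also have "card (\<Union>p\<in>Q. {e \<in> E. fst p \<in> e \<and> snd p \<in> e}) \<le> (\<Sum>p\<in>Q. codeg E (fst p) (snd p))"
        unfolding codeg_def by (rule card_UN_le[OF fQ(1)])
      finally have "card (E - E2) \<le> card {e \<in> E. e \<inter> Y \<noteq> {}} + (\<Sum>p\<in>Q. codeg E (fst p) (snd p))" by simp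
      then have "real (card (E - E2)) \<le> real (card {e \<in> E. e \<inter> Y \<noteq> {}} + (\<Sum>p\<in>Q. codeg E (fst p) (snd p)))"
        by (simp only: of_nat_le_iff)
      also have "\<dots> = real (card {e \<in> E. e \<inter> Y \<noteq> {}}) + (\<Sum>p\<in>Q. real (codeg E (fst p) (snd p)))" by simp
      also have "real (card {e \<in> E. e \<inter> Y \<noteq> {}}) \<le> real (card Y) * n ^ (r - 1)"
        using card_hitting_le[OF V(1) _ Y(1), of E "r - 1"] E r unfolding n_def by simp
      also have "(\<Sum>p\<in>Q. real (codeg E (fst p) (snd p))) \<le> (\<Sum>p\<in>Q. K * n ^ (r - 3))"
        by (rule sum_mono) (auto simp: Q_def)
      also have "\<dots> = real (card Q) * (K * n ^ (r - 3))" by simp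
      also have "\<dots> \<le> (n * n) * (K * n ^ (r - 3))"
      proof (rule mult_right_mono)
        have "real (card Q) \<le> real (card V * card V)" using fQ(2) by (simp only: of_nat_le_iff)
        then show "real (card Q) \<le> n * n" unfolding n_def by simp
      qed (use K n0 in simp)
      finally have "real (card (E - E2)) \<le> real (card Y) * n ^ (r - 1) + (n * n) * (K * n ^ (r - 3))" by simp
      also have "(n * n) * (K * n ^ (r - 3)) = K * n ^ (r - 1)"
      proof -
        have "r - 1 = Suc (Suc (r - 3))" using r by simp
        then show ?thesis by simp
      qed
      also have "real (card Y) * n ^ (r - 1) + K * n ^ (r - 1) = (real (card Y) + K) * n ^ (r - 1)" by (simp add: algebra_simps)
      also have "\<dots> \<le> (\<gamma> * n) * n ^ (r - 1)" using K cY n0 by (intro mult_right_mono) auto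
      also have "\<dots> = \<gamma> * n ^ r"
      proof -
        have "r = Suc (r - 1)" using r by simp
        then show ?thesis by (metis mult.assoc power_Suc)
      qed
      finally have del: "real (card (E - E2)) \<le> \<gamma> * n ^ r" .
      have "card E = card E2 + card (E - E2)"
        using E2(1) fE by (metis card_Diff_subset card_mono finite_subset le_add_diff_inverse)
      then have cE: "real (card E) = real (card E2) + real (card (E - E2))" by simp
      have "fact r * real (card (E - E2)) \<le> fact r * (\<gamma> * n ^ r)" using del by (intro mult_left_mono) auto
      also have "\<dots> = (fact r * \<gamma>) * n ^ r" by simp
      also have "\<dots> \<le> \<delta>0 / 2 * n ^ r" using gf n0 by (intro mult_right_mono) auto
      finally have "(star_density r - \<delta>0) * n ^ r \<le> fact r * real (card E2)"
        using D cE unfolding n_def[symmetric] by (simp add: algebra_simps)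
      then obtain V1 where V1: "V1 \<subseteq> V" "real (card {e \<in> E2. card (e \<inter> V1) \<noteq> 1}) \<le> \<epsilon> / 2 * n ^ r"
        using st[OF V(1) _ E2(2) pf] V(2) unfolding n_def N_def by auto
      have "{e \<in> E. card (e \<inter> V1) \<noteq> 1} \<subseteq> {e \<in> E2. card (e \<inter> V1) \<noteq> 1} \<union> (E - E2)" by auto
      then have "card {e \<in> E. card (e \<inter> V1) \<noteq> 1} \<le> card ({e \<in> E2. card (e \<inter> V1) \<noteq> 1} \<union> (E - E2))"
        using fE E2(1) by (intro card_mono) (auto intro: rev_finite_subset)
      also have "\<dots> \<le> card {e \<in> E2. card (e \<inter> V1) \<noteq> 1} + card (E - E2)" by (rule card_Un_le)
      finally have "real (card {e \<in> E. card (e \<inter> V1) \<noteq> 1}) \<le> \<epsilon> / 2 * n ^ r + \<gamma> * n ^ r" using V1(2) del by linarith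
      also have "\<dots> \<le> \<epsilon> / 2 * n ^ r + \<epsilon> / 2 * n ^ r" using g n0 by (intro add_left_mono mult_right_mono) auto
      also have "\<dots> = \<epsilon> * n ^ r" by (simp add: algebra_simps)
      finally show "\<exists>V1\<subseteq>V. real (card {e \<in> E. card (e \<inter> V1) \<noteq> 1}) \<le> \<epsilon> * real (card V) ^ r"
        using V1(1) unfolding n_def by (intro exI[of _ V1]) simp
    qed
  qed
qed

section \<open>Nearly extremal hypergraphs\<close>

lemma card_Un_real: "real (card (A \<union> B)) \<le> real (card A) + real (card B)"
  using card_Un_le[of A B] by linarith

lemma card_UN_real: "finite I \<Longrightarrow> (\<And>i. i \<in> I \<Longrightarrow> real (card (A i)) \<le> c) \<Longrightarrow> real (card (\<Union>i\<in>I. A i)) \<le> real (card I) * c"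
proof -
  assume I: "finite I" and c: "\<And>i. i \<in> I \<Longrightarrow> real (card (A i)) \<le> c"
  have "real (card (\<Union>i\<in>I. A i)) \<le> real (\<Sum>i\<in>I. card (A i))" using card_UN_le[OF I, of A] by (simp only: of_nat_le_iff)
  also have "\<dots> = (\<Sum>i\<in>I. real (card (A i)))" by (rule of_nat_sum)
  also have "\<dots> \<le> (\<Sum>i\<in>I. c)" by (rule sum_mono[OF c])
  finally show ?thesis by simp
qed

lemma sum_card_containing_le:
  assumes F: "finite F" "\<And>e. e \<in> F \<Longrightarrow> finite e \<and> card e = r" and W: "finite W"
  shows "(\<Sum>w\<in>W. real (card {e \<in> F. w \<in> e})) \<le> real r * real (card F)"
proof -
  have "(\<Sum>w\<in>W. real (card {e \<in> F. w \<in> e})) = (\<Sum>w\<in>W. \<Sum>e | e \<in> F \<and> w \<in> e. 1)" by simp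
  also have "\<dots> = (\<Sum>e\<in>F. \<Sum>w | w \<in> W \<and> w \<in> e. 1)" by (rule sum.swap_restrict[OF W F(1)])
  also have "\<dots> \<le> (\<Sum>e\<in>F. real r)"
  proof (rule sum_mono)
    fix e assume "e \<in> F"
    then have "finite e" "card e = r" using F(2) by auto
    then have "card {w. w \<in> W \<and> w \<in> e} \<le> r" using card_mono[of e "{w. w \<in> W \<and> w \<in> e}"] by auto
    then show "(\<Sum>w | w \<in> W \<and> w \<in> e. 1) \<le> real r" by simp
  qed
  finally show ?thesis by (simp add: mult.commute)
qed

text \<open>The edges of the complete semibipartite \<open>r\<close>-graph on \<open>V\<close> whose
  first part is \<open>V1 \<inter> V\<close>.\<close>

definition good_sets :: "'a set \<Rightarrow> nat \<Rightarrow> 'a set \<Rightarrow> 'a set set" where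
  "good_sets V r V1 = {e \<in> ksets V r. card (e \<inter> V1) = 1}"

text \<open>A vertex of \<open>W1\<close> and a \<open>k\<close>-subset of \<open>W2\<close> are
  added to the fixed set \<open>S\<close>; the trace on \<open>V1\<close> and what remains of the
  second part recover both choices.\<close>

lemma good_count:
  assumes V: "finite V" and W: "W1 \<subseteq> V1" "V1 \<subseteq> V" "W2 \<subseteq> V - V1" "S \<subseteq> V - V1" "S \<inter> W2 = {}" and k: "card S + k + 1 = r"
  shows "card W1 * card (ksets W2 k) \<le> card {e \<in> good_sets V r V1. S \<subseteq> e \<and> e \<subseteq> W1 \<union> W2 \<union> S}"
proof -
  have fin: "finite W1" "finite W2" "finite S" using W V by (meson finite_Diff rev_finite_subset)+
  define f where "f = (\<lambda>(v, A). insert v (S \<union> A))"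
  have V1: "f (v, A) \<inter> V1 = {v}" "f (v, A) - V1 - S = A" if "v \<in> W1" "A \<in> ksets W2 k" for v A
    using that W unfolding f_def ksets_def by auto
  have inj: "inj_on f (W1 \<times> ksets W2 k)"
  proof (rule inj_onI, clarify)
    fix v A w B assume a: "v \<in> W1" "A \<in> ksets W2 k" "w \<in> W1" "B \<in> ksets W2 k" "f (v, A) = f (w, B)"
    have "{v} = {w}" using V1(1)[OF a(1,2)] V1(1)[OF a(3,4)] a(5) by simp
    moreover have "A = B" using V1(2)[OF a(1,2)] V1(2)[OF a(3,4)] a(5) by simp
    ultimately show "v = w \<and> A = B" by simp
  qed
  have "card W1 * card (ksets W2 k) = card (f ` (W1 \<times> ksets W2 k))"
    using card_image[OF inj] by (simp add: card_cartesian_product)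
  also have "\<dots> \<le> card {e \<in> good_sets V r V1. S \<subseteq> e \<and> e \<subseteq> W1 \<union> W2 \<union> S}"
  proof (rule card_mono)
    show "finite {e \<in> good_sets V r V1. S \<subseteq> e \<and> e \<subseteq> W1 \<union> W2 \<union> S}"
      unfolding good_sets_def using V by (simp add: finite_ksets)
    show "f ` (W1 \<times> ksets W2 k) \<subseteq> {e \<in> good_sets V r V1. S \<subseteq> e \<and> e \<subseteq> W1 \<union> W2 \<union> S}"
    proof (rule subsetI)
      fix e assume "e \<in> f ` (W1 \<times> ksets W2 k)"
      then obtain v A where e: "e = f (v, A)" "v \<in> W1" "A \<in> ksets W2 k" by auto
      have A: "A \<subseteq> W2" "card A = k" using e(3) unfolding ksets_def by auto
      have fA: "finite A" using A(1) fin(2) rev_finite_subset by blast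
      have "card (S \<union> A) = card S + k" using fA fin W A by (subst card_Un_disjoint) auto
      moreover have "v \<notin> S \<union> A" using e(2) W A by auto
      ultimately have "card e = r" using k fA fin unfolding e(1) f_def by simp
      moreover have "e \<subseteq> V" using e(2) W A unfolding e(1) f_def by auto
      moreover have "card (e \<inter> V1) = 1" unfolding e(1) V1(1)[OF e(2,3)] by simp
      moreover have "S \<subseteq> e" "e \<subseteq> W1 \<union> W2 \<union> S" using e(2) A unfolding e(1) f_def by auto
      ultimately show "e \<in> {e \<in> good_sets V r V1. S \<subseteq> e \<and> e \<subseteq> W1 \<union> W2 \<union> S}"
        unfolding good_sets_def ksets_def by simp
    qed
  qed
  finally show ?thesis .
qed

text \<open>The setting after stability. \<open>\<gamma>\<close> is the codegree threshold,
  \<open>\<eta>2\<close> and \<open>\<theta>\<close> bound the missing sets at a typical vertex,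
  \<open>\<eta>1\<close> separates large from small bad degree, and \<open>\<mu> * n\<close> bounds
  the vertices that a copy has to avoid. The inequalities \<open>large\<close> absorb additive
  constants for big \<open>n\<close>.\<close>

locale near_extremal =
  fixes r :: nat and V :: "'a set" and E :: "'a set set" and V1 :: "'a set"
    and n c1 \<gamma> \<eta>1 \<eta>2 \<theta> \<epsilon> \<mu> :: real
  assumes r: "4 \<le> r" and V: "finite V" and E: "E \<subseteq> ksets V r" and V1: "V1 \<subseteq> V" and n: "n = real (card V)"
    and big: "c1 * n \<le> real (card V1)" "c1 * n \<le> real (card (V - V1))"
    and miss: "real (card (good_sets V r V1 - E)) \<le> \<epsilon> * n ^ r"
    and best: "\<And>U. U \<subseteq> V \<Longrightarrow> card {e \<in> E. card (e \<inter> V1) \<noteq> 1} \<le> card {e \<in> E. card (e \<inter> U) \<noteq> 1}"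
    and pos: "0 < n" "0 < c1" "c1 \<le> 1" "0 < \<gamma>" "0 < \<eta>1" "0 < \<eta>2" "0 < \<theta>" "0 < \<mu>"
    and large: "16 * real r \<le> c1 * n" "32 * real r \<le> \<eta>1 * n" "2 * real (emb_const r) \<le> \<gamma> * n" "16 * real (emb_const r) \<le> \<eta>1 * n"
    and mu: "\<mu> < \<gamma> / 2" "\<mu> \<le> \<eta>1 / 32" "\<mu> \<le> c1 / 8"
    and gamma: "2 * \<gamma> \<le> (c1 / (2 * real r)) ^ r"
    and eta2: "real r * (real r * \<eta>2 / \<gamma>) \<le> c1 / 8" "\<eta>2 < (c1 / 2 / real (r - 1)) ^ (r - 1)"
    and theta: "real r * (real r * \<theta> / \<gamma>) \<le> \<eta>1 / 32"
    and eps: "real r * \<epsilon> / \<eta>2 \<le> c1 / 8" "real r * \<epsilon> / \<eta>2 \<le> \<eta>1 / 32" "real r * \<epsilon> / \<theta> \<le> \<eta>1 / 32"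
      "\<epsilon> < (\<eta>1 / 4) * ((\<eta>1 / 4) / real (r - 1)) ^ (r - 1)"
    and eta1: "\<eta>1 \<le> c1"
begin

section \<open>Missing sets, weak pairs and codegrees\<close>

definition "V2 = V - V1"
definition "Miss = good_sets V r V1 - E"
definition "mis v = real (card {e \<in> Miss. v \<in> e})"
definition "bd v = real (card {e \<in> E. card (e \<inter> V1) \<noteq> 1 \<and> v \<in> e})"
text \<open>The threshold is half the number of good sets guaranteed by \<open>good_codeg\<close>,
  so a pair that is not weak and not inside \<open>V1\<close> keeps codegree at least
  \<open>\<gamma> * n ^ (r - 2)\<close> in \<open>E\<close>.\<close>

definition "weak v = {w \<in> V. w \<noteq> v \<and> \<gamma> * n ^ (r - 2) \<le> real (card {e \<in> Miss. v \<in> e \<and> w \<in> e})}"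
definition "atypical \<tau> = {v \<in> V. \<tau> * n ^ (r - 1) \<le> mis v}"

lemma fin: "finite V1" "finite V2" "finite Miss" "finite E" "V2 \<subseteq> V" "V1 \<inter> V2 = {}"
  unfolding V2_def Miss_def good_sets_def using V V1 finite_subset finite_ksets[OF V, of r] finite_fam[OF V E] by auto

lemma bigV2: "c1 * n \<le> real (card V2)" using big(2) unfolding V2_def .

lemma edge: "e \<in> E \<Longrightarrow> e \<subseteq> V" "e \<in> E \<Longrightarrow> finite e" "e \<in> E \<Longrightarrow> card e = r"
proof -
  assume "e \<in> E"
  then show "e \<subseteq> V" "card e = r" using E unfolding ksets_def by auto
  then show "finite e" using V finite_subset by blast
qed

lemma good: "e \<in> good_sets V r V1 \<Longrightarrow> finite e \<and> card e = r \<and> e \<subseteq> V"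
  unfolding good_sets_def ksets_def using V finite_subset by blast

lemma npow: "n ^ r = n * n ^ (r - 1)" "n ^ (r - 1) = n * n ^ (r - 2)" "n ^ (r - 2) = n * n ^ (r - 3)"
proof -
  have "r = Suc (r - 1)" "r - 1 = Suc (r - 2)" "r - 2 = Suc (r - 3)" using r by auto
  then show "n ^ r = n * n ^ (r - 1)" "n ^ (r - 1) = n * n ^ (r - 2)" "n ^ (r - 2) = n * n ^ (r - 3)"
    by (metis power_Suc)+
qed

lemma card_weak: "mis v \<le> \<tau> * n ^ (r - 1) \<Longrightarrow> real (card (weak v)) \<le> real r * \<tau> / \<gamma> * n"
proof -
  assume m: "mis v \<le> \<tau> * n ^ (r - 1)"
  have fw: "finite (weak v)" unfolding weak_def using V by simp
  have "real (card (weak v)) * (\<gamma> * n ^ (r - 2)) = (\<Sum>w\<in>weak v. \<gamma> * n ^ (r - 2))" by simp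
  also have "\<dots> \<le> (\<Sum>w\<in>weak v. real (card {e \<in> {e \<in> Miss. v \<in> e}. w \<in> e}))"
    by (rule sum_mono) (simp add: weak_def)
  also have "\<dots> \<le> real r * real (card {e \<in> Miss. v \<in> e})"
    by (rule sum_card_containing_le[OF _ _ fw]) (use fin good in \<open>auto simp: Miss_def\<close>)
  also have "\<dots> \<le> real r * (\<tau> * n ^ (r - 1))" using m unfolding mis_def by (intro mult_left_mono) auto
  finally have "n ^ (r - 2) * (real (card (weak v)) * \<gamma>) \<le> n ^ (r - 2) * (real r * \<tau> * n)"
    unfolding npow(2) by (simp only: mult_ac)
  then have "real (card (weak v)) * \<gamma> \<le> real r * \<tau> * n" using pos by (simp only: mult_le_cancel_left_pos zero_less_power)
  then show ?thesis using pos by (simp add: pos_le_divide_eq mult_ac)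
qed

lemma card_atypical: "0 < \<tau> \<Longrightarrow> real (card (atypical \<tau>)) \<le> real r * \<epsilon> / \<tau> * n"
proof -
  assume t: "0 < \<tau>"
  have fw: "finite (atypical \<tau>)" unfolding atypical_def using V by simp
  have "real (card (atypical \<tau>)) * (\<tau> * n ^ (r - 1)) = (\<Sum>w\<in>atypical \<tau>. \<tau> * n ^ (r - 1))" by simp
  also have "\<dots> \<le> (\<Sum>w\<in>atypical \<tau>. real (card {e \<in> Miss. w \<in> e}))"
    by (rule sum_mono) (simp add: atypical_def mis_def)
  also have "\<dots> \<le> real r * real (card Miss)"
    by (rule sum_card_containing_le[OF _ _ fw]) (use fin good in \<open>auto simp: Miss_def\<close>)
  also have "\<dots> \<le> real r * (\<epsilon> * n ^ r)" using miss unfolding Miss_def by (intro mult_left_mono) auto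
  finally have "n ^ (r - 1) * (real (card (atypical \<tau>)) * \<tau>) \<le> n ^ (r - 1) * (real r * \<epsilon> * n)"
    unfolding npow(1) by (simp only: mult_ac)
  then have "real (card (atypical \<tau>)) * \<tau> \<le> real r * \<epsilon> * n" using pos by (simp only: mult_le_cancel_left_pos zero_less_power)
  then show ?thesis using t by (simp add: pos_le_divide_eq mult_ac)
qed

lemma base: "0 < c1 / (2 * real r)" "c1 / (2 * real r) \<le> 1"
  using pos r by (auto simp: divide_le_eq)

lemma ksets_lower:
  assumes "finite W" "c1 / 2 * n \<le> real (card W)" "0 < k" "k \<le> r"
  shows "(c1 / (2 * real r)) ^ k * n ^ k \<le> real (card (ksets W k))"
proof -
  have "real k \<le> c1 / 2 * n" using large(1) assms(4) pos by auto
  from card_ksets_ge[OF assms(1,3) this assms(2)]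
  have 1: "(c1 / 2 * n / real k) ^ k \<le> real (card (ksets W k))" .
  have "c1 / (2 * real r) * n \<le> c1 / (2 * real k) * n"
    using assms pos by (intro mult_right_mono divide_left_mono mult_left_mono) auto
  also have "\<dots> = c1 / 2 * n / real k" by simp
  finally have "(c1 / (2 * real r) * n) ^ k \<le> (c1 / 2 * n / real k) ^ k"
    using base pos by (intro power_mono) auto
  then have "(c1 / (2 * real r) * n) ^ k \<le> real (card (ksets W k))" using 1 by (rule order.trans)
  then show ?thesis by (simp only: power_mult_distrib)
qed

text \<open>With \<open>b\<close> in the second part there is always room: if \<open>a\<close> lies
  in \<open>V1\<close> the set is completed inside \<open>V2\<close>, otherwise by one vertex of
  \<open>V1\<close> and \<open>r - 3\<close> vertices of \<open>V2\<close>.\<close>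

lemma good_codeg:
  assumes a: "a \<in> V" "b \<in> V2" "a \<noteq> b"
  shows "2 * \<gamma> * n ^ (r - 2) \<le> real (card {e \<in> good_sets V r V1. a \<in> e \<and> b \<in> e})"
proof -
  define c where "c = c1 / (2 * real r)"
  have c: "0 < c" "c \<le> 1" using base unfolding c_def by auto
  have half: "c1 / 2 * n \<le> real (card (V2 - S))" if "finite S" "card S \<le> 2" for S
  proof -
    have "card V2 - card S \<le> card (V2 - S)" by (rule diff_card_le_card_Diff[OF that(1)])
    moreover have "2 \<le> c1 / 2 * n" using large(1) r by simp
    ultimately show ?thesis using bigV2 that by linarith
  qed
  have "2 * \<gamma> * n ^ (r - 2) \<le> c ^ (r - 2) * n ^ (r - 2)"
  proof (rule mult_right_mono)
    have "2 * \<gamma> \<le> c ^ r" using gamma unfolding c_def .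
    also have "\<dots> \<le> c ^ (r - 2)" using c by (intro power_decreasing) auto
    finally show "2 * \<gamma> \<le> c ^ (r - 2)" .
  qed (use pos in simp)
  also have "\<dots> \<le> real (card {e \<in> good_sets V r V1. a \<in> e \<and> b \<in> e})"
  proof (cases "a \<in> V1")
    case True
    have "c ^ (r - 2) * n ^ (r - 2) \<le> real (card (ksets (V2 - {b}) (r - 2)))"
      unfolding c_def by (rule ksets_lower) (use fin r half[of "{b}"] in auto)
    also have "card (ksets (V2 - {b}) (r - 2)) = card {a} * card (ksets (V2 - {b}) (r - 2))" by simp
    also have "\<dots> \<le> card {e \<in> good_sets V r V1. {b} \<subseteq> e \<and> e \<subseteq> {a} \<union> (V2 - {b}) \<union> {b}}"
      by (rule good_count[OF V]) (use True V1 a r in \<open>auto simp: V2_def\<close>)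
    also have "\<dots> \<le> card {e \<in> good_sets V r V1. a \<in> e \<and> b \<in> e}"
    proof (rule card_mono)
      show "finite {e \<in> good_sets V r V1. a \<in> e \<and> b \<in> e}" unfolding good_sets_def using finite_ksets[OF V] by simp
      show "{e \<in> good_sets V r V1. {b} \<subseteq> e \<and> e \<subseteq> {a} \<union> (V2 - {b}) \<union> {b}} \<subseteq> {e \<in> good_sets V r V1. a \<in> e \<and> b \<in> e}"
      proof
        fix e assume "e \<in> {e \<in> good_sets V r V1. {b} \<subseteq> e \<and> e \<subseteq> {a} \<union> (V2 - {b}) \<union> {b}}"
        then have H: "e \<in> good_sets V r V1 \<and> {b} \<subseteq> e \<and> e \<subseteq> {a} \<union> (V2 - {b}) \<union> {b}" by (rule CollectD)
        note e = conjunct1[OF H] conjunct1[OF conjunct2[OF H]] conjunct2[OF conjunct2[OF H]]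
        from e(1) have "card (e \<inter> V1) = 1" unfolding good_sets_def by simp
        then obtain x where x: "x \<in> e" "x \<in> V1" by (metis IntD1 IntD2 card.empty ex_in_conv zero_neq_one)
        then have "x \<notin> V2" unfolding V2_def by simp
        then have "x = a" using x(1) subsetD[OF e(3) x(1)] a(2) by auto
        then show "e \<in> {e \<in> good_sets V r V1. a \<in> e \<and> b \<in> e}" using e(1,2) x(1) by simp
      qed
    qed
    finally show ?thesis by simp
  next
    case False
    then have a2: "a \<in> V2" using a unfolding V2_def by simp
    have "c ^ (r - 2) * n ^ (r - 2) = (c * n) * (c ^ (r - 3) * n ^ (r - 3))"
    proof -
      have "r - 2 = Suc (r - 3)" using r by simp
      then show ?thesis by simp
    qed
    also have "\<dots> \<le> real (card V1) * real (card (ksets (V2 - {a, b}) (r - 3)))"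
    proof (rule mult_mono)
      have "c \<le> c1" unfolding c_def using pos r by (simp add: divide_le_eq)
      then have "c * n \<le> c1 * n" using pos by (intro mult_right_mono) auto
      then show "c * n \<le> real (card V1)" using big(1) by linarith
      show "c ^ (r - 3) * n ^ (r - 3) \<le> real (card (ksets (V2 - {a, b}) (r - 3)))"
        unfolding c_def by (rule ksets_lower) (use fin r half[of "{a, b}"] a(3) in auto)
    qed (use c pos in auto)
    also have "\<dots> = real (card V1 * card (ksets (V2 - {a, b}) (r - 3)))" by simp
    also have "\<dots> \<le> real (card {e \<in> good_sets V r V1. {a, b} \<subseteq> e \<and> e \<subseteq> V1 \<union> (V2 - {a, b}) \<union> {a, b}})"
      by (simp only: of_nat_le_iff, rule good_count[OF V]) (use V1 a a2 r in \<open>auto simp: V2_def\<close>)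
    also have "\<dots> \<le> real (card {e \<in> good_sets V r V1. a \<in> e \<and> b \<in> e})"
      using finite_ksets[OF V, of r] by (simp only: of_nat_le_iff, intro card_mono) (auto simp: good_sets_def)
    finally show ?thesis .
  qed
  finally show ?thesis .
qed

lemma codeg_sym: "codeg E a b = codeg E b a"
  unfolding codeg_def by (simp add: conj_commute)

lemma codeg_lower:
  assumes "a \<in> V" "b \<in> V2" "a \<noteq> b" "b \<notin> weak a \<or> a \<notin> weak b"
  shows "\<gamma> * n ^ (r - 2) \<le> real (codeg E a b)"
proof -
  have bV: "b \<in> V" using assms fin by auto
  have w: "real (card {e \<in> Miss. a \<in> e \<and> b \<in> e}) \<le> \<gamma> * n ^ (r - 2)"
  proof -
    have "{e \<in> Miss. b \<in> e \<and> a \<in> e} = {e \<in> Miss. a \<in> e \<and> b \<in> e}" by auto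
    moreover have "\<not> \<gamma> * n ^ (r - 2) \<le> real (card {e \<in> Miss. a \<in> e \<and> b \<in> e}) \<or>
        \<not> \<gamma> * n ^ (r - 2) \<le> real (card {e \<in> Miss. b \<in> e \<and> a \<in> e})"
      using assms(1,3,4) bV unfolding weak_def by blast
    ultimately show ?thesis by (metis linear)
  qed
  have "{e \<in> good_sets V r V1. a \<in> e \<and> b \<in> e} \<subseteq> {e \<in> E. a \<in> e \<and> b \<in> e} \<union> {e \<in> Miss. a \<in> e \<and> b \<in> e}"
    unfolding Miss_def by auto
  then have "card {e \<in> good_sets V r V1. a \<in> e \<and> b \<in> e} \<le> card ({e \<in> E. a \<in> e \<and> b \<in> e} \<union> {e \<in> Miss. a \<in> e \<and> b \<in> e})"
    using fin by (intro card_mono) auto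
  then have "real (card {e \<in> good_sets V r V1. a \<in> e \<and> b \<in> e}) \<le> real (codeg E a b) + real (card {e \<in> Miss. a \<in> e \<and> b \<in> e})"
    using card_Un_real[of "{e \<in> E. a \<in> e \<and> b \<in> e}" "{e \<in> Miss. a \<in> e \<and> b \<in> e}"] unfolding codeg_def by linarith
  then show ?thesis using good_codeg[OF assms(1-3)] w by (simp add: algebra_simps)
qed

lemma emb_bound:
  assumes c: "\<kappa> * n ^ (r - 2) \<le> real (codeg E a b)" and Y: "real (card Y) \<le> \<mu> * n" and l: "\<kappa> = \<gamma> \<or> \<kappa> = \<eta>1 / 8"
  shows "real (emb_const r + card Y) * real (card V) ^ (r - 3) < real (codeg E a b)"
proof -
  have "real (emb_const r + card Y) < \<kappa> * n"
    using l
  proof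
    assume g: "\<kappa> = \<gamma>"
    have "\<mu> * n < \<gamma> / 2 * n" using mu pos by (intro mult_strict_right_mono) auto
    then show ?thesis using Y large(3) unfolding g by simp
  next
    assume g: "\<kappa> = \<eta>1 / 8"
    have "\<mu> * n \<le> \<eta>1 / 32 * n" using mu pos by (intro mult_right_mono) auto
    moreover have "0 < \<eta>1 * n" using pos by simp
    ultimately show ?thesis using Y large(4) unfolding g by simp
  qed
  then have "real (emb_const r + card Y) * n ^ (r - 3) < \<kappa> * n * n ^ (r - 3)" using pos by (intro mult_strict_right_mono) auto
  also have "\<dots> = \<kappa> * n ^ (r - 2)" unfolding npow(3) by simp
  finally show ?thesis using c unfolding n by linarith
qed

text \<open>The good sets through \<open>p\<close> completed inside \<open>W\<close> outnumber the
  missing sets at \<open>p\<close>, so one of them is an edge.\<close>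

lemma pick_through:
  assumes p: "p \<in> V1" "mis p < \<eta>2 * n ^ (r - 1)" and W: "W \<subseteq> V2" "c1 / 2 * n \<le> real (card W)"
  obtains e where "e \<in> E" "p \<in> e" "e \<subseteq> insert p W"
proof -
  define G where "G = {e \<in> good_sets V r V1. {} \<subseteq> e \<and> e \<subseteq> {p} \<union> W \<union> {}}"
  have fW: "finite W" using W fin(2) finite_subset by blast
  have m: "0 < r - 1" "real (r - 1) \<le> c1 / 2 * n" using r large(1) pos by auto
  have "mis p < (c1 / 2 / real (r - 1)) ^ (r - 1) * n ^ (r - 1)"
  proof -
    have "\<eta>2 * n ^ (r - 1) < (c1 / 2 / real (r - 1)) ^ (r - 1) * n ^ (r - 1)"
      using eta2(2) pos by (intro mult_strict_right_mono) auto
    then show ?thesis using p(2) by linarith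
  qed
  also have "\<dots> = (c1 / 2 * n / real (r - 1)) ^ (r - 1)" unfolding power_mult_distrib[symmetric] by simp
  also have "\<dots> \<le> real (card (ksets W (r - 1)))" by (rule card_ksets_ge[OF fW m W(2)])
  also have "\<dots> = real (card {p} * card (ksets W (r - 1)))" by simp
  also have "\<dots> \<le> real (card G)"
    unfolding G_def by (simp only: of_nat_le_iff, rule good_count[OF V]) (use p V1 W r in \<open>auto simp: V2_def\<close>)
  finally have "card {e \<in> Miss. p \<in> e} < card G" unfolding mis_def by simp
  then have "\<not> G \<subseteq> {e \<in> Miss. p \<in> e}" using card_mono[of "{e \<in> Miss. p \<in> e}" G] fin(3) by auto
  moreover have pG: "p \<in> e" if "e \<in> G" for e
  proof -
    have "e \<inter> V1 \<noteq> {}" using that unfolding G_def good_sets_def by auto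
    then show ?thesis using that W unfolding G_def V2_def by auto
  qed
  ultimately obtain e where "e \<in> G" "e \<notin> Miss" by auto
  then show ?thesis using that[of e] pG[of e] unfolding G_def Miss_def by auto
qed

lemma pick_any:
  assumes W: "W1 \<subseteq> V1" "\<eta>1 / 4 * n \<le> real (card W1)" "W2 \<subseteq> V2" "\<eta>1 / 4 * n \<le> real (card W2)"
  obtains e where "e \<in> E" "e \<subseteq> W1 \<union> W2" "e \<inter> V2 \<subseteq> W2"
proof -
  define G where "G = {e \<in> good_sets V r V1. {} \<subseteq> e \<and> e \<subseteq> W1 \<union> W2 \<union> {}}"
  have fW: "finite W2" using W fin(2) finite_subset by blast
  have m: "0 < r - 1" "real (r - 1) \<le> \<eta>1 / 4 * n" using r large(2) pos by auto
  have "\<epsilon> * n ^ r < (\<eta>1 / 4) * ((\<eta>1 / 4) / real (r - 1)) ^ (r - 1) * n ^ r"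
    using eps(4) pos by (intro mult_strict_right_mono) auto
  also have "\<dots> = (\<eta>1 / 4 * n) * (\<eta>1 / 4 * n / real (r - 1)) ^ (r - 1)"
  proof -
    have "\<eta>1 / 4 * n / real (r - 1) = (\<eta>1 / 4) / real (r - 1) * n" by simp
    then have "(\<eta>1 / 4 * n / real (r - 1)) ^ (r - 1) = ((\<eta>1 / 4) / real (r - 1)) ^ (r - 1) * n ^ (r - 1)"
      by (simp only: power_mult_distrib)
    then show ?thesis unfolding npow(1) by (simp only: mult_ac)
  qed
  also have "\<dots> \<le> real (card W1) * real (card (ksets W2 (r - 1)))"
    using W pos by (intro mult_mono card_ksets_ge[OF fW m W(4)]) auto
  also have "\<dots> = real (card W1 * card (ksets W2 (r - 1)))" by simp
  also have "\<dots> \<le> real (card G)"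
    unfolding G_def by (simp only: of_nat_le_iff, rule good_count[OF V]) (use V1 W r in \<open>auto simp: V2_def\<close>)
  finally have "card Miss < card G" using miss unfolding Miss_def by linarith
  then have "\<not> G \<subseteq> Miss" using card_mono[of Miss G] fin(3) by auto
  then obtain e where "e \<in> G" "e \<notin> Miss" by auto
  then show ?thesis using that[of e] W unfolding G_def Miss_def V2_def by auto
qed

section \<open>Copies produced by bad edges\<close>

lemma typical: "v \<in> V \<Longrightarrow> v \<notin> atypical \<tau> \<Longrightarrow> mis v < \<tau> * n ^ (r - 1)"
  unfolding atypical_def by auto

lemma card_minus_ge: "finite S \<Longrightarrow> real (card W) - real (card S) \<le> real (card (W - S))"
  using diff_card_le_card_Diff[of S W] by linarith

text \<open>The core edges \<open>A\<close> and \<open>B\<close> are good edges through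
  \<open>p\<close> and \<open>q\<close>, so \<open>(p, q)\<close> is the only cross pair inside
  \<open>V1\<close>, and \<open>e\<close> itself connects it. Every other cross pair has a vertex in
  \<open>V2\<close>; the choice of \<open>A\<close> and \<open>B\<close> keeps these pairs from
  being weak.\<close>

lemma copy_two_in_V1:
  assumes e: "e \<in> E" and pq: "p \<in> e" "q \<in> e" "p \<in> V1" "q \<in> V1" "p \<noteq> q" "p \<notin> atypical \<eta>2" "q \<notin> atypical \<eta>2"
    and Y: "Y \<subseteq> V" "real (card Y) \<le> \<mu> * n" "e \<inter> Y = {}"
  shows "\<exists>W. hcopy r V E W \<and> W \<inter> Y = {}"
proof -
  have fY: "finite Y" using Y V finite_subset by blast
  have pqV: "p \<in> V" "q \<in> V" using pq V1 by auto
  have mp: "mis p < \<eta>2 * n ^ (r - 1)" and mq: "mis q < \<eta>2 * n ^ (r - 1)" using typical pqV pq by auto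
  define w where "w = real r * \<eta>2 / \<gamma> * n"
  have w0: "0 \<le> w" unfolding w_def using pos by simp
  have rw: "real r * w \<le> c1 / 8 * n"
  proof -
    have "real r * w = real r * (real r * \<eta>2 / \<gamma>) * n" unfolding w_def by simp
    also have "\<dots> \<le> c1 / 8 * n" using eta2(1) pos by (intro mult_right_mono) auto
    finally show ?thesis .
  qed
  have w1: "w \<le> real r * w" using w0 r mult_right_mono[of 1 "real r" w] by simp
  have wk: "real (card (weak v)) \<le> w" if "mis v < \<eta>2 * n ^ (r - 1)" for v
    using card_weak[of v \<eta>2] that unfolding w_def by simp
  have fwk: "finite (weak v)" for v unfolding weak_def using V by simp
  have fat: "finite (atypical \<eta>2)" unfolding atypical_def using V by simp
  have cY: "real (card Y) \<le> c1 / 8 * n" using Y(2) mult_right_mono[OF mu(3), of n] pos by linarith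
  have cX: "real (card (atypical \<eta>2)) \<le> c1 / 8 * n"
    using card_atypical[of \<eta>2] mult_right_mono[OF eps(1), of n] pos by linarith
  have r16: "real r \<le> c1 / 16 * n" using large(1) by simp
  note fe = edge(2)[OF e] and ce = edge(3)[OF e]
  have c0: "0 < c1 * n" using pos by simp
  \<comment> \<open>Besides \<open>Y\<close> and \<open>e\<close>, the set \<open>A\<close> has to
    avoid the atypical vertices, because \<open>B\<close> must later escape the weak sets of all of
    \<open>A\<close>, and the weak set of \<open>q\<close>, because of the pairs ending in
    \<open>q\<close>.\<close>
  define S where "S = Y \<union> atypical \<eta>2 \<union> weak q \<union> e"
  have fS: "finite S" unfolding S_def using fY fat fwk fe by simp
  have "real (card S) \<le> real (card Y) + real (card (atypical \<eta>2)) + real (card (weak q)) + real (card e)"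
    unfolding S_def using card_Un_real[of "Y \<union> atypical \<eta>2 \<union> weak q" e] card_Un_real[of "Y \<union> atypical \<eta>2" "weak q"] card_Un_real[of Y "atypical \<eta>2"] by linarith
  also have "\<dots> \<le> c1 / 2 * n" using cY cX wk[OF mq] ce r16 rw w1 c0 by linarith
  finally have h: "c1 / 2 * n \<le> real (card (V2 - S))" using card_minus_ge[OF fS, of V2] bigV2 by linarith
  obtain A where A: "A \<in> E" "p \<in> A" "A \<subseteq> insert p (V2 - S)"
    by (rule pick_through[OF pq(3) mp Diff_subset h])
  note fA = edge(2)[OF A(1)] and cA = edge(3)[OF A(1)] and AV = edge(1)[OF A(1)]
  have ma: "mis a < \<eta>2 * n ^ (r - 1)" if "a \<in> A" for a
  proof (cases "a = p")
    case False
    then have "a \<in> V" "a \<notin> atypical \<eta>2" using that A AV unfolding S_def by auto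
    then show ?thesis by (rule typical)
  qed (use mp in simp)
  define S' where "S' = Y \<union> (\<Union>a\<in>A. weak a) \<union> e \<union> A"
  have fS': "finite S'" unfolding S'_def using fY fwk fe fA by simp
  have "real (card (\<Union>a\<in>A. weak a)) \<le> real (card A) * w" by (rule card_UN_real[OF fA]) (use wk ma in auto)
  moreover have "real (card S') \<le> real (card Y) + real (card (\<Union>a\<in>A. weak a)) + real (card e) + real (card A)"
    unfolding S'_def using card_Un_real[of "Y \<union> (\<Union>a\<in>A. weak a) \<union> e" A] card_Un_real[of "Y \<union> (\<Union>a\<in>A. weak a)" e] card_Un_real[of Y "\<Union>a\<in>A. weak a"] by linarith
  ultimately have "real (card S') \<le> c1 / 2 * n" using cY ce cA r16 rw c0 by simp
  then have h': "c1 / 2 * n \<le> real (card (V2 - S'))" using card_minus_ge[OF fS', of V2] bigV2 by linarith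
  obtain B where B: "B \<in> E" "q \<in> B" "B \<subseteq> insert q (V2 - S')"
    by (rule pick_through[OF pq(4) mq Diff_subset h'])
  have pqn: "p \<notin> V2" "q \<notin> V2" using pq(3,4) fin(6) by auto
  have AB: "A \<inter> B = {}" using A(3) B(3) pq(2,5) pqn unfolding S_def S'_def by auto
  have eAB: "e \<inter> (A \<union> B) = {p, q}" using A B pq unfolding S_def S'_def by auto
  have AY: "A \<inter> Y = {}" using A(3) pq(1) Y(3) unfolding S_def by auto
  have BY: "B \<inter> Y = {}" using B(3) pq(2) Y(3) unfolding S'_def by auto
  have cod: "\<gamma> * n ^ (r - 2) \<le> real (codeg E a b)" if ab: "a \<in> A" "b \<in> B" "(a, b) \<noteq> (p, q)" for a b
  proof (cases "b = q")
    case True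
    then have "a \<noteq> p" using ab by simp
    then have "a \<in> V2" "a \<notin> weak q" "a \<noteq> q" using A(3) ab(1) pqn unfolding S_def by auto
    then show ?thesis unfolding True codeg_sym[of a q] by (intro codeg_lower) (use pqV in auto)
  next
    case False
    then have "b \<in> V2" "b \<notin> weak a" using B(3) ab(1,2) unfolding S'_def by auto
    moreover have "a \<noteq> b" using AB ab by auto
    ultimately show ?thesis by (intro codeg_lower) (use AV ab in auto)
  qed
  have cb: "real (emb_const r + card Y) * real (card V) ^ (r - 3) < real (codeg E a b)"
    if "a \<in> A" "b \<in> B" "(a, b) \<noteq> (p, q)" for a b
    by (rule emb_bound[OF cod[OF that] Y(2)]) simp
  obtain W where "hcopy r V E W" "W \<inter> Y = {}"
    by (rule hcopy_with_edge[OF r V E A(1) B(1) e AB A(2) B(2) eAB fY AY BY Y(3) cb]) (assumption | rule that)+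
  then show ?thesis by blast
qed

text \<open>\<open>e\<close> serves as a core edge. Any good edge outside the weak sets of its
  vertices can be the other one, since each cross pair has a vertex in \<open>V2\<close> and is
  therefore of large codegree.\<close>

lemma copy_in_V2:
  assumes e: "e \<in> E" "e \<subseteq> V2" "e \<inter> atypical \<eta>2 = {}" and Y: "Y \<subseteq> V" "real (card Y) \<le> \<mu> * n" "e \<inter> Y = {}"
  shows "\<exists>W. hcopy r V E W \<and> W \<inter> Y = {}"
proof -
  have fY: "finite Y" using Y V finite_subset by blast
  note fe = edge(2)[OF e(1)] and ce = edge(3)[OF e(1)] and eV = edge(1)[OF e(1)]
  have fwk: "finite (weak v)" for v unfolding weak_def using V by simp
  define w where "w = real r * \<eta>2 / \<gamma> * n"
  have rw: "real r * w \<le> c1 / 8 * n"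
  proof -
    have "real r * w = real r * (real r * \<eta>2 / \<gamma>) * n" unfolding w_def by simp
    also have "\<dots> \<le> c1 / 8 * n" using eta2(1) pos by (intro mult_right_mono) auto
    finally show ?thesis .
  qed
  have wk: "real (card (weak v)) \<le> w" if "v \<in> e" for v
  proof -
    have "mis v < \<eta>2 * n ^ (r - 1)" by (rule typical) (use that e(3) eV in auto)
    then show ?thesis using card_weak[of v \<eta>2] unfolding w_def by simp
  qed
  have cY: "real (card Y) \<le> c1 / 8 * n" using Y(2) mult_right_mono[OF mu(3), of n] pos by linarith
  have r16: "real r \<le> c1 / 16 * n" using large(1) by simp
  have c0: "0 < c1 * n" using pos by simp
  define S where "S = Y \<union> (\<Union>a\<in>e. weak a) \<union> e"
  have fS: "finite S" unfolding S_def using fY fwk fe by simp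
  have "real (card (\<Union>a\<in>e. weak a)) \<le> real (card e) * w" by (rule card_UN_real[OF fe]) (use wk in auto)
  moreover have "real (card S) \<le> real (card Y) + real (card (\<Union>a\<in>e. weak a)) + real (card e)"
    unfolding S_def using card_Un_real[of "Y \<union> (\<Union>a\<in>e. weak a)" e] card_Un_real[of Y "\<Union>a\<in>e. weak a"] by linarith
  ultimately have cS: "real (card S) \<le> c1 / 2 * n" using cY ce r16 rw c0 by simp
  have "\<eta>1 / 4 * n \<le> c1 / 2 * n" using eta1 pos by (intro mult_right_mono) auto
  then have h: "\<eta>1 / 4 * n \<le> real (card (V1 - S))" "\<eta>1 / 4 * n \<le> real (card (V2 - S))"
    using card_minus_ge[OF fS, of V2] card_minus_ge[OF fS, of V1] bigV2 big(1) cS by linarith+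
  obtain B where B: "B \<in> E" "B \<subseteq> (V1 - S) \<union> (V2 - S)"
    by (rule pick_any[OF Diff_subset h(1) Diff_subset h(2)])
  have AB: "e \<inter> B = {}" and BY: "B \<inter> Y = {}" using B(2) unfolding S_def by auto
  have cb: "real (emb_const r + card Y) * real (card V) ^ (r - 3) < real (codeg E a b)" if ab: "a \<in> e" "b \<in> B" for a b
  proof (rule emb_bound[OF _ Y(2)])
    have "b \<in> V" "b \<notin> weak a" "b \<noteq> a" using B(2) ab V1 fin(5) unfolding S_def by auto
    then show "\<gamma> * n ^ (r - 2) \<le> real (codeg E a b)"
      unfolding codeg_sym[of a b] using ab e(2) by (intro codeg_lower) auto
  qed simp
  obtain W where "hcopy r V E W" "W \<inter> Y = {}"
    by (rule hcopy_codeg[OF r V E e(1) B(1) AB fY Y(3) BY cb]) (assumption | rule that)+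
  then show ?thesis by blast
qed

lemma copy_typical_bad_edge:
  assumes e: "e \<in> E" "card (e \<inter> V1) \<noteq> 1" "e \<inter> atypical \<eta>2 = {}" and Y: "Y \<subseteq> V" "real (card Y) \<le> \<mu> * n" "e \<inter> Y = {}"
  shows "\<exists>W. hcopy r V E W \<and> W \<inter> Y = {}"
proof (cases "e \<inter> V1 = {}")
  case True
  then show ?thesis using copy_in_V2[OF e(1) _ e(3) Y] edge(1)[OF e(1)] unfolding V2_def by blast
next
  case False
  have "finite (e \<inter> V1)" using fin(1) by simp
  then have "\<not> is_singleton (e \<inter> V1)" using e(2) is_singleton_altdef by auto
  then obtain p q where "p \<in> e \<inter> V1" "q \<in> e \<inter> V1" "p \<noteq> q" using False by (metis is_singletonI' )
  then show ?thesis using copy_two_in_V1[OF e(1), of p q Y] e(3) Y by blast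
qed

section \<open>Minimality of the first part and vertices of large bad degree\<close>

lemma bad_split:
  assumes v: "v \<in> V"
  shows "card {e \<in> E. card (e \<inter> U) \<noteq> 1} = card {e \<in> E. v \<notin> e \<and> card (e \<inter> (U - {v})) \<noteq> 1}
    + card {A \<in> link v E. card (insert v A \<inter> U) \<noteq> 1}"
proof -
  have "{e \<in> E. card (e \<inter> U) \<noteq> 1} = {e \<in> E. v \<notin> e \<and> card (e \<inter> (U - {v})) \<noteq> 1} \<union> {e \<in> E. v \<in> e \<and> card (e \<inter> U) \<noteq> 1}"
  proof -
    have "e \<inter> (U - {v}) = e \<inter> U" if "v \<notin> e" for e using that by auto
    then show ?thesis by (intro set_eqI) (simp, metis)
  qed
  then have "card {e \<in> E. card (e \<inter> U) \<noteq> 1} = card {e \<in> E. v \<notin> e \<and> card (e \<inter> (U - {v})) \<noteq> 1} + card {e \<in> E. v \<in> e \<and> card (e \<inter> U) \<noteq> 1}"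
    using fin(4) by (simp only:) (intro card_Un_disjoint; auto)
  also have "{e \<in> E. v \<in> e \<and> card (e \<inter> U) \<noteq> 1} = insert v ` {A \<in> link v E. card (insert v A \<inter> U) \<noteq> 1}"
  proof
    show "insert v ` {A \<in> link v E. card (insert v A \<inter> U) \<noteq> 1} \<subseteq> {e \<in> E. v \<in> e \<and> card (e \<inter> U) \<noteq> 1}"
      unfolding link_def by (simp add: image_subset_iff)
    show "{e \<in> E. v \<in> e \<and> card (e \<inter> U) \<noteq> 1} \<subseteq> insert v ` {A \<in> link v E. card (insert v A \<inter> U) \<noteq> 1}"
    proof
      fix e assume e: "e \<in> {e \<in> E. v \<in> e \<and> card (e \<inter> U) \<noteq> 1}"
      then have "insert v (e - {v}) = e" by (simp add: insert_absorb)
      then show "e \<in> insert v ` {A \<in> link v E. card (insert v A \<inter> U) \<noteq> 1}"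
        using e unfolding link_def by (intro image_eqI[of _ _ "e - {v}"]) simp_all
    qed
  qed
  also have "card \<dots> = card {A \<in> link v E. card (insert v A \<inter> U) \<noteq> 1}"
    by (rule card_image) (auto simp: inj_on_def link_def insert_eq_iff)
  finally show ?thesis .
qed

text \<open>Moving \<open>v\<close> into or out of \<open>V1\<close> changes the status of the edges
  through \<open>v\<close> only. By minimality neither move helps, so the bad degree is at most the
  number of link members bad after either move.\<close>

lemma bad_degree:
  assumes v: "v \<in> V"
  shows "bd v \<le> real (card {A \<in> link v E. A \<inter> V1 \<noteq> {}})" "bd v \<le> real (card {A \<in> link v E. card (A \<inter> V1) \<noteq> 1})"
proof -
  have fA: "finite (A \<inter> V1)" for A using fin(1) by simp
  have vA: "v \<notin> A" if "A \<in> link v E" for A using that unfolding link_def by simp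
  have i1: "card (insert v A \<inter> insert v V1) \<noteq> 1 \<longleftrightarrow> A \<inter> V1 \<noteq> {}" if "A \<in> link v E" for A
  proof -
    have "insert v A \<inter> insert v V1 = insert v (A \<inter> V1)" by blast
    then have "card (insert v A \<inter> insert v V1) = Suc (card (A \<inter> V1))" using vA[OF that] fA[of A] by simp
    then show ?thesis using fA[of A] by auto
  qed
  have i2: "insert v A \<inter> (V1 - {v}) = A \<inter> V1" if "A \<in> link v E" for A using vA[OF that] by blast
  have s1: "{A \<in> link v E. card (insert v A \<inter> insert v V1) \<noteq> 1} = {A \<in> link v E. A \<inter> V1 \<noteq> {}}"
    using i1 by (intro Collect_cong conj_cong refl)
  have s2: "{A \<in> link v E. card (insert v A \<inter> (V1 - {v})) \<noteq> 1} = {A \<in> link v E. card (A \<inter> V1) \<noteq> 1}"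
    using i2 by (intro Collect_cong conj_cong refl) simp
  have d: "insert v V1 - {v} = V1 - {v}" "(V1 - {v}) - {v} = V1 - {v}" by auto
  have flk: "finite (link v E)"
  proof (rule finite_subset)
    show "link v E \<subseteq> Pow V" unfolding link_def using edge(1) by blast
  qed (use V in simp)
  have b: "bd v = real (card {A \<in> link v E. card (insert v A \<inter> V1) \<noteq> 1})"
  proof -
    have "{e \<in> E. card (e \<inter> V1) \<noteq> 1 \<and> v \<in> e} = insert v ` {A \<in> link v E. card (insert v A \<inter> V1) \<noteq> 1}"
    proof
      show "insert v ` {A \<in> link v E. card (insert v A \<inter> V1) \<noteq> 1} \<subseteq> {e \<in> E. card (e \<inter> V1) \<noteq> 1 \<and> v \<in> e}"
        unfolding link_def by (simp add: image_subset_iff)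
      show "{e \<in> E. card (e \<inter> V1) \<noteq> 1 \<and> v \<in> e} \<subseteq> insert v ` {A \<in> link v E. card (insert v A \<inter> V1) \<noteq> 1}"
      proof
        fix e assume e: "e \<in> {e \<in> E. card (e \<inter> V1) \<noteq> 1 \<and> v \<in> e}"
        then have "insert v (e - {v}) = e" by (simp add: insert_absorb)
        then show "e \<in> insert v ` {A \<in> link v E. card (insert v A \<inter> V1) \<noteq> 1}"
          using e unfolding link_def by (intro image_eqI[of _ _ "e - {v}"]) simp_all
      qed
    qed
    moreover have "inj_on (insert v) {A \<in> link v E. card (insert v A \<inter> V1) \<noteq> 1}"
      by (auto simp: inj_on_def link_def insert_eq_iff)
    ultimately show ?thesis unfolding bd_def by (simp add: card_image)
  qed
  have sub: "insert v V1 \<subseteq> V" "V1 - {v} \<subseteq> V" using v V1 by auto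
  have "card {A \<in> link v E. card (insert v A \<inter> V1) \<noteq> 1} \<le> card {A \<in> link v E. A \<inter> V1 \<noteq> {}}"
    using best[OF sub(1)] unfolding bad_split[OF v, of V1] bad_split[OF v, of "insert v V1"] d s1 by simp
  then show "bd v \<le> real (card {A \<in> link v E. A \<inter> V1 \<noteq> {}})" unfolding b by simp
  have "card {A \<in> link v E. card (insert v A \<inter> V1) \<noteq> 1} \<le> card {A \<in> link v E. card (A \<inter> V1) \<noteq> 1}"
    using best[OF sub(2)] unfolding bad_split[OF v, of V1] bad_split[OF v, of "V1 - {v}"] d s2 by simp
  then show "bd v \<le> real (card {A \<in> link v E. card (A \<inter> V1) \<noteq> 1})" unfolding b by simp
qed

lemma link_sets: "A \<in> link v E \<Longrightarrow> A \<subseteq> V \<and> card A = r - 1 \<and> finite A"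
proof -
  assume "A \<in> link v E"
  then have "insert v A \<in> E" "v \<notin> A" unfolding link_def by auto
  moreover then have "finite A" "A \<subseteq> V" using edge(1,2)[of "insert v A"] by auto
  ultimately show ?thesis using edge(3)[of "insert v A"] by simp
qed

lemma finite_link: "finite (link v E)"
  by (rule finite_subset[of _ "Pow V"]) (use link_sets V in auto)

lemma avoiding_link_set:
  assumes D: "D \<subseteq> link v E" "\<eta>1 / 2 * n ^ (r - 1) \<le> real (card D)" and Z: "Z \<subseteq> V" "real (card Z) \<le> \<eta>1 / 4 * n"
  obtains A where "A \<in> D" "A \<inter> Z = {}"
proof (rule ccontr)
  assume no: "\<not> thesis"
  have D': "D \<subseteq> ksets V (Suc (r - 2))"
  proof
    fix A assume "A \<in> D"
    then have "A \<subseteq> V" "card A = r - 1" using D(1) link_sets by auto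
    then show "A \<in> ksets V (Suc (r - 2))" unfolding ksets_def using r by simp
  qed
  have "{A \<in> D. A \<inter> Z \<noteq> {}} = D" using no that by blast
  then have "real (card D) \<le> real (card Z) * n ^ (r - 2)" using card_hitting_le[OF V D' Z(1)] unfolding n by simp
  also have "\<dots> \<le> \<eta>1 / 4 * n * n ^ (r - 2)" using Z(2) pos by (intro mult_right_mono) auto
  also have "\<dots> = \<eta>1 / 4 * n ^ (r - 1)" unfolding npow(2) by simp
  also have "\<dots> < \<eta>1 / 2 * n ^ (r - 1)" using pos by (intro mult_strict_right_mono) auto
  finally show False using D(2) by simp
qed

text \<open>Vertices of codegree below \<open>\<eta>1 / 8 * n ^ (r - 2)\<close> account for at most
  \<open>\<eta>1 / 8 * n ^ (r - 1)\<close> members of \<open>D\<close>, any other vertex for at most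
  \<open>n ^ (r - 2)\<close>; since every member meets \<open>W\<close>, the second kind must number
  at least \<open>3 / 8 * \<eta>1 * n\<close>.\<close>

lemma many_good_partners:
  assumes v: "v \<in> V" and D: "D \<subseteq> link v E" "\<eta>1 / 2 * n ^ (r - 1) \<le> real (card D)" and W: "W \<subseteq> V" "\<And>A. A \<in> D \<Longrightarrow> A \<inter> W \<noteq> {}"
  shows "3 / 8 * \<eta>1 * n \<le> real (card {w \<in> W. w \<noteq> v \<and> \<eta>1 / 8 * n ^ (r - 2) \<le> real (codeg E v w)})"
proof -
  define P where "P = {w \<in> W. w \<noteq> v \<and> \<eta>1 / 8 * n ^ (r - 2) \<le> real (codeg E v w)}"
  have fW: "finite W" using W(1) V finite_subset by blast
  have fD: "finite D" using D(1) finite_link finite_subset by blast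
  have cw: "real (card {A \<in> D. w \<in> A}) \<le> real (codeg E v w)" for w
  proof -
    have "inj_on (insert v) {A \<in> D. w \<in> A}" using D(1) by (auto simp: inj_on_def link_def insert_eq_iff)
    then have "card {A \<in> D. w \<in> A} = card (insert v ` {A \<in> D. w \<in> A})" by (simp add: card_image)
    also have "\<dots> \<le> codeg E v w" unfolding codeg_def
      using D(1) fin(4) by (intro card_mono) (auto simp: link_def)
    finally show ?thesis by simp
  qed
  have cP: "real (codeg E v w) \<le> n ^ (r - 2)" if "w \<in> P" for w
  proof -
    have "w \<in> V" "w \<noteq> v" using that W(1) unfolding P_def by auto
    then have "{v, w} \<subseteq> V" "card {v, w} = 2" using v by auto
    from card_containing_le[OF V E this(1)] this(2)
    show ?thesis unfolding codeg_def n by simp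
  qed
  have z: "card {A \<in> D. v \<in> A} = 0" using D(1) fD unfolding link_def by auto
  have "D \<subseteq> (\<Union>w\<in>W. {A \<in> D. w \<in> A})" using W(2) by blast
  then have "card D \<le> card (\<Union>w\<in>W. {A \<in> D. w \<in> A})" using fW fD by (intro card_mono) auto
  also have "\<dots> \<le> (\<Sum>w\<in>W. card {A \<in> D. w \<in> A})" by (rule card_UN_le[OF fW])
  finally have "real (card D) \<le> real (\<Sum>w\<in>W. card {A \<in> D. w \<in> A})" by (simp only: of_nat_le_iff)
  also have "\<dots> = (\<Sum>w\<in>W. real (card {A \<in> D. w \<in> A}))" by (rule of_nat_sum)
  also have "\<dots> = (\<Sum>w\<in>W - P. real (card {A \<in> D. w \<in> A})) + (\<Sum>w\<in>P. real (card {A \<in> D. w \<in> A}))"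
    by (rule sum.subset_diff[OF _ fW]) (auto simp: P_def)
  also have "(\<Sum>w\<in>W - P. real (card {A \<in> D. w \<in> A})) \<le> (\<Sum>w\<in>W - P. \<eta>1 / 8 * n ^ (r - 2))"
  proof (rule sum_mono)
    fix w assume w: "w \<in> W - P"
    show "real (card {A \<in> D. w \<in> A}) \<le> \<eta>1 / 8 * n ^ (r - 2)"
    proof (cases "w = v")
      case True
      then show ?thesis using z pos by simp
    next
      case False
      then have "real (codeg E v w) \<le> \<eta>1 / 8 * n ^ (r - 2)" using w unfolding P_def by auto
      then show ?thesis using cw[of w] by linarith
    qed
  qed
  also have "\<dots> = real (card (W - P)) * (\<eta>1 / 8 * n ^ (r - 2))" by simp
  also have "\<dots> \<le> n * (\<eta>1 / 8 * n ^ (r - 2))"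
  proof (rule mult_right_mono)
    have "card (W - P) \<le> card V" using W(1) V by (intro card_mono) auto
    then show "real (card (W - P)) \<le> n" unfolding n by simp
  qed (use pos in simp)
  also have "(\<Sum>w\<in>P. real (card {A \<in> D. w \<in> A})) \<le> (\<Sum>w\<in>P. n ^ (r - 2))"
  proof (rule sum_mono)
    fix w assume "w \<in> P"
    then show "real (card {A \<in> D. w \<in> A}) \<le> n ^ (r - 2)" using cw[of w] cP[of w] by linarith
  qed
  also have "\<dots> = real (card P) * n ^ (r - 2)" by simp
  finally have "real (card D) \<le> n * (\<eta>1 / 8 * n ^ (r - 2)) + real (card P) * n ^ (r - 2)" by simp
  then have "\<eta>1 / 2 * (n * n ^ (r - 2)) \<le> n * (\<eta>1 / 8 * n ^ (r - 2)) + real (card P) * n ^ (r - 2)"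
    using D(2) unfolding npow(2) by linarith
  then have "n ^ (r - 2) * (3 / 8 * \<eta>1 * n) \<le> n ^ (r - 2) * real (card P)" by (simp add: algebra_simps)
  then show ?thesis using pos unfolding P_def[symmetric] by (simp only: mult_le_cancel_left_pos zero_less_power)
qed

text \<open>If many link members have two vertices in \<open>V1\<close>, one of them gives a bad
  edge with two typical vertices there. Otherwise minimality of \<open>V1\<close> makes both the
  link members inside \<open>V2\<close> and those with one vertex in \<open>V1\<close> numerous:
  \<open>v\<close> has many partners on both sides, so a core edge through \<open>v\<close> with its
  other vertices in \<open>V2\<close> can be matched with a good edge among the partners.\<close>

lemma rich:
  assumes v: "v \<in> V" "\<eta>1 * n ^ (r - 1) \<le> bd v" and Y: "Y \<subseteq> V" "real (card Y) \<le> \<mu> * n" "v \<notin> Y"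
  shows "\<exists>W. hcopy r V E W \<and> W \<inter> Y = {}"
proof -
  have fY: "finite Y" using Y V finite_subset by blast
  have fwk: "finite (weak v)" for v unfolding weak_def using V by simp
  have fat: "finite (atypical \<tau>)" "atypical \<tau> \<subseteq> V" for \<tau> unfolding atypical_def using V by auto
  have cY: "real (card Y) \<le> \<eta>1 / 32 * n" using Y(2) mult_right_mono[OF mu(2), of n] pos by linarith
  have h0: "0 < \<eta>1 * n" using pos by simp
  define D0 where "D0 = {A \<in> link v E. A \<inter> V1 = {}}"
  define D1 where "D1 = {A \<in> link v E. card (A \<inter> V1) = 1}"
  define D2 where "D2 = {A \<in> link v E. A \<inter> V1 \<noteq> {} \<and> card (A \<inter> V1) \<noteq> 1}"
  have fD: "finite D0" "finite D1" "finite D2" unfolding D0_def D1_def D2_def using finite_link by auto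
  have Dl: "D0 \<subseteq> link v E" "D1 \<subseteq> link v E" "D2 \<subseteq> link v E" unfolding D0_def D1_def D2_def by auto
  have "{A \<in> link v E. A \<inter> V1 \<noteq> {}} \<subseteq> D1 \<union> D2" unfolding D1_def D2_def by auto
  then have "card {A \<in> link v E. A \<inter> V1 \<noteq> {}} \<le> card (D1 \<union> D2)" using fD by (intro card_mono) auto
  then have d1: "\<eta>1 * n ^ (r - 1) \<le> real (card D1) + real (card D2)"
    using bad_degree(1)[OF v(1)] v(2) card_Un_real[of D1 D2] by linarith
  have "{A \<in> link v E. card (A \<inter> V1) \<noteq> 1} \<subseteq> D0 \<union> D2" unfolding D0_def D2_def by auto
  then have "card {A \<in> link v E. card (A \<inter> V1) \<noteq> 1} \<le> card (D0 \<union> D2)" using fD by (intro card_mono) auto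
  then have d0: "\<eta>1 * n ^ (r - 1) \<le> real (card D0) + real (card D2)"
    using bad_degree(2)[OF v(1)] v(2) card_Un_real[of D0 D2] by linarith
  show ?thesis
  proof (cases "\<eta>1 / 2 * n ^ (r - 1) \<le> real (card D2)")
    case True
    define Z where "Z = Y \<union> atypical \<eta>2"
    have "real (card Z) \<le> real (card Y) + real (card (atypical \<eta>2))" unfolding Z_def by (rule card_Un_real)
    then have Z: "Z \<subseteq> V" "real (card Z) \<le> \<eta>1 / 4 * n"
      using cY card_atypical[of \<eta>2] mult_right_mono[OF eps(2), of n] pos h0 fat Y(1) unfolding Z_def by auto
    obtain A where A: "A \<in> D2" "A \<inter> Z = {}" by (rule avoiding_link_set[OF Dl(3) True Z])
    have Ae: "insert v A \<in> E" using A(1) unfolding D2_def link_def by simp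
    have ne: "A \<inter> V1 \<noteq> {}" "card (A \<inter> V1) \<noteq> 1" using A(1) unfolding D2_def by auto
    then have "\<not> is_singleton (A \<inter> V1)" using is_singleton_altdef by auto
    then obtain p q where "p \<in> A \<inter> V1" "q \<in> A \<inter> V1" "p \<noteq> q" using ne(1) by (metis is_singletonI')
    then have pq: "p \<in> insert v A" "q \<in> insert v A" "p \<in> V1" "q \<in> V1" "p \<noteq> q" "p \<notin> atypical \<eta>2" "q \<notin> atypical \<eta>2"
      using A(2) unfolding Z_def by auto
    have "insert v A \<inter> Y = {}" using A(2) Y(3) unfolding Z_def by auto
    then show ?thesis by (rule copy_two_in_V1[OF Ae pq Y(1,2)])
  next
    case False
    then have b1: "\<eta>1 / 2 * n ^ (r - 1) \<le> real (card D1)" and b0: "\<eta>1 / 2 * n ^ (r - 1) \<le> real (card D0)"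
      using d1 d0 by auto
    define P1 where "P1 = {w \<in> V1. w \<noteq> v \<and> \<eta>1 / 8 * n ^ (r - 2) \<le> real (codeg E v w)}"
    define P2 where "P2 = {w \<in> V2. w \<noteq> v \<and> \<eta>1 / 8 * n ^ (r - 2) \<le> real (codeg E v w)}"
    have c1: "3 / 8 * \<eta>1 * n \<le> real (card P1)" unfolding P1_def
      by (rule many_good_partners[OF v(1) Dl(2) b1 V1]) (auto simp: D1_def)
    have c2: "3 / 8 * \<eta>1 * n \<le> real (card P2)" unfolding P2_def
    proof (rule many_good_partners[OF v(1) Dl(1) b0 fin(5)])
      fix A assume A: "A \<in> D0"
      then have "A \<subseteq> V" "card A = r - 1" "A \<inter> V1 = {}" using link_sets unfolding D0_def by auto
      moreover have "A \<noteq> {}" using \<open>card A = r - 1\<close> r by (intro notI) simp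
      ultimately show "A \<inter> V2 \<noteq> {}" unfolding V2_def by auto
    qed
    \<comment> \<open>The other core edge has to fit into partner sets of size about
      \<open>\<eta>1 * n\<close>, so the weak sets to be avoided must be small compared with
      \<open>\<eta>1\<close>; the smaller threshold \<open>\<theta>\<close> serves this
      purpose.\<close>
    define Z where "Z = Y \<union> atypical \<theta>"
    have "real (card Z) \<le> real (card Y) + real (card (atypical \<theta>))" unfolding Z_def by (rule card_Un_real)
    then have Z: "Z \<subseteq> V" "real (card Z) \<le> \<eta>1 / 4 * n"
      using cY card_atypical[of \<theta>] mult_right_mono[OF eps(3), of n] pos h0 fat Y(1) unfolding Z_def by auto
    obtain A where A: "A \<in> D0" "A \<inter> Z = {}" by (rule avoiding_link_set[OF Dl(1) b0 Z])
    have Ae: "insert v A \<in> E" and A1: "A \<inter> V1 = {}" and Al: "A \<in> link v E" using A(1) unfolding D0_def link_def by auto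
    have AV: "A \<subseteq> V" "finite A" "card A = r - 1" using link_sets[OF Al] by auto
    have A2: "A \<subseteq> V2" using AV A1 unfolding V2_def by auto
    define w where "w = real r * \<theta> / \<gamma> * n"
    have w0: "0 \<le> w" unfolding w_def using pos by simp
    have wk: "real (card (weak a)) \<le> w" if "a \<in> A" for a
    proof -
      have "mis a < \<theta> * n ^ (r - 1)" by (rule typical) (use that A(2) AV in \<open>auto simp: Z_def\<close>)
      then show ?thesis using card_weak[of a \<theta>] unfolding w_def by simp
    qed
    have rw: "real r * w \<le> \<eta>1 / 32 * n"
    proof -
      have "real r * w = real r * (real r * \<theta> / \<gamma>) * n" unfolding w_def by simp
      also have "\<dots> \<le> \<eta>1 / 32 * n" using theta pos by (intro mult_right_mono) auto
      finally show ?thesis .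
    qed
    define S where "S = Y \<union> (\<Union>a\<in>A. weak a) \<union> insert v A"
    have fS: "finite S" unfolding S_def using fY fwk AV by simp
    have "real (card (\<Union>a\<in>A. weak a)) \<le> real (card A) * w" by (rule card_UN_real[OF AV(2)]) (use wk in auto)
    also have "\<dots> \<le> real r * w" using AV(3) w0 by (intro mult_right_mono) auto
    finally have "real (card (\<Union>a\<in>A. weak a)) \<le> real r * w" .
    moreover have "real (card S) \<le> real (card Y) + real (card (\<Union>a\<in>A. weak a)) + real (card (insert v A))"
      unfolding S_def using card_Un_real[of "Y \<union> (\<Union>a\<in>A. weak a)" "insert v A"] card_Un_real[of Y "\<Union>a\<in>A. weak a"] by linarith
    ultimately have cS: "real (card S) \<le> \<eta>1 / 8 * n" using cY rw edge(3)[OF Ae] large(2) h0 by simp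
    have PS: "P1 - S \<subseteq> V1" "P2 - S \<subseteq> V2" unfolding P1_def P2_def by auto
    have h: "\<eta>1 / 4 * n \<le> real (card (P1 - S))" "\<eta>1 / 4 * n \<le> real (card (P2 - S))"
      using card_minus_ge[OF fS, of P1] card_minus_ge[OF fS, of P2] c1 c2 cS by linarith+
    obtain B where B: "B \<in> E" "B \<subseteq> (P1 - S) \<union> (P2 - S)" by (rule pick_any[OF PS(1) h(1) PS(2) h(2)])
    have AB: "insert v A \<inter> B = {}" and BY: "B \<inter> Y = {}" using B(2) unfolding S_def by auto
    have AY: "insert v A \<inter> Y = {}" using A(2) Y(3) unfolding Z_def by auto
    have cb: "real (emb_const r + card Y) * real (card V) ^ (r - 3) < real (codeg E a b)" if ab: "a \<in> insert v A" "b \<in> B" for a b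
    proof (cases "a = v")
      case True
      have "\<eta>1 / 8 * n ^ (r - 2) \<le> real (codeg E a b)" using B(2) ab(2) unfolding True P1_def P2_def by auto
      then show ?thesis by (rule emb_bound[OF _ Y(2)]) simp
    next
      case False
      then have a: "a \<in> A" using ab by simp
      have b: "b \<in> V" "b \<notin> weak a" "b \<noteq> a" using B(2) ab(2) a V1 fin(5) unfolding S_def P1_def P2_def by auto
      have "\<gamma> * n ^ (r - 2) \<le> real (codeg E a b)"
        unfolding codeg_sym[of a b] using a A2 b by (intro codeg_lower) auto
      then show ?thesis by (rule emb_bound[OF _ Y(2)]) simp
    qed
    obtain W where "hcopy r V E W" "W \<inter> Y = {}"
      by (rule hcopy_codeg[OF r V E Ae B(1) AB fY AY BY cb]) (assumption | rule that)+
    then show ?thesis by blast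
  qed
qed

end

section \<open>Exact counting\<close>

definition join_sets :: "'a set \<Rightarrow> nat \<Rightarrow> 'a set \<Rightarrow> 'a set \<Rightarrow> 'a set set" where
  "join_sets V r T U = {e \<in> ksets V r. e \<inter> T \<noteq> {} \<or> card (e \<inter> U) = 1}"

lemma packs_subset: "packs r V E \<W> \<Longrightarrow> \<W>' \<subseteq> \<W> \<Longrightarrow> packs r V E \<W>'"
  unfolding packs_def by (meson pairwise_subset rev_finite_subset subsetD)

context near_extremal
begin

definition "heavy = {v \<in> V. \<eta>1 * n ^ (r - 1) \<le> bd v}"
definition "stray = {e \<in> E. card (e \<inter> V1) \<noteq> 1 \<and> e \<inter> heavy = {}}"

lemma rich_nat:
  assumes K: "real K \<le> \<mu> * n" and v: "v \<in> heavy" and Y: "Y \<subseteq> V" "v \<notin> Y" "card Y \<le> K"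
  shows "\<exists>W. hcopy r V E W \<and> W \<inter> Y = {}"
proof (rule rich)
  show "v \<in> V" "\<eta>1 * n ^ (r - 1) \<le> bd v" using v unfolding heavy_def by auto
  have "real (card Y) \<le> real K" using Y(3) by simp
  then show "real (card Y) \<le> \<mu> * n" using K by linarith
qed (use Y in auto)

text \<open>Disjoint copies can be added greedily, one for each heavy vertex. Hence
  \<open>t + 1\<close> heavy vertices, or a packing of \<open>t - card heavy + 1\<close> copies
  avoiding all of them, would lead to \<open>t + 1\<close> disjoint copies.\<close>

lemma heavy_few:
  assumes t: "\<And>\<W>. packs r V E \<W> \<Longrightarrow> card \<W> \<le> t" and K: "real ((t + 1) * copy_size r + (t + 1)) \<le> \<mu> * n"
  shows "card heavy \<le> t" "\<And>\<W>. packs r V E \<W> \<Longrightarrow> \<Union>\<W> \<inter> heavy = {} \<Longrightarrow> card \<W> \<le> t - card heavy"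
proof -
  have r2: "2 \<le> r" using r by simp
  have fh: "finite heavy" "heavy \<subseteq> V" unfolding heavy_def using V by auto
  show ct: "card heavy \<le> t"
  proof (rule ccontr)
    assume "\<not> card heavy \<le> t"
    then have "t + 1 \<le> card heavy" by simp
    then obtain L where L: "L \<subseteq> heavy" "card L = t + 1" "finite L" by (rule obtain_subset_with_card_n)
    have LV: "L \<subseteq> V" using L(1) fh(2) by (rule subset_trans)
    have p0: "packs r V E {}" unfolding packs_def disjoint_def by simp
    have "\<exists>\<W>'. packs r V E \<W>' \<and> card \<W>' = card ({} :: 'a set set) + card L"
    proof (rule packs_extend[OF r2 V L(3) LV _ p0])
      show "\<exists>W. hcopy r V E W \<and> W \<inter> Y = {}" if "v \<in> L" "Y \<subseteq> V" "v \<notin> Y" "card Y \<le> (t + 1) * copy_size r + (t + 1)" for v Y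
        by (rule rich_nat[OF K subsetD[OF L(1) that(1)] that(2-4)])
    qed (simp_all add: L(2))
    then obtain \<W> where "packs r V E \<W>" "card \<W> = t + 1" unfolding L(2) by auto
    then show False using t[of \<W>] by simp
  qed
  fix \<W> assume W: "packs r V E \<W>" "\<Union>\<W> \<inter> heavy = {}"
  show "card \<W> \<le> t - card heavy"
  proof (rule ccontr)
    assume "\<not> card \<W> \<le> t - card heavy"
    then have "t - card heavy + 1 \<le> card \<W>" by simp
    then obtain \<W>1 where W1: "\<W>1 \<subseteq> \<W>" "card \<W>1 = t - card heavy + 1" "finite \<W>1" by (rule obtain_subset_with_card_n)
    have p1: "packs r V E \<W>1" by (rule packs_subset[OF W(1) W1(1)])
    have d1: "\<Union>\<W>1 \<inter> heavy = {}" using W(2) W1(1) by blast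
    have c: "card \<W>1 + card heavy = t + 1" using W1(2) ct by simp
    have "\<exists>\<W>'. packs r V E \<W>' \<and> card \<W>' = card \<W>1 + card heavy"
    proof (rule packs_extend[OF r2 V fh _ p1 d1])
      show "\<exists>W. hcopy r V E W \<and> W \<inter> Y = {}" if "v \<in> heavy" "Y \<subseteq> V" "v \<notin> Y" "card Y \<le> (t + 1) * copy_size r + (t + 1)" for v Y
        by (rule rich_nat[OF K that])
      show "(card \<W>1 + card heavy) * copy_size r + card heavy \<le> (t + 1) * copy_size r + (t + 1)"
        unfolding c using ct by simp
    qed
    then obtain \<W>' where "packs r V E \<W>'" "card \<W>' = t + 1" unfolding c by auto
    then show False using t[of \<W>'] by simp
  qed
qed

text \<open>A stray edge meets the hitting set \<open>Y\<close> or an atypical vertex, and outside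
  \<open>heavy\<close> bad degrees are small. The atypical vertices are paid for by the missing sets
  that make them atypical; \<open>2 * r * \<eta>1 \<le> \<eta>2\<close> reduces this cost to half of
  \<open>Miss\<close>.\<close>

lemma few_stray:
  assumes t: "\<And>\<W>. packs r V E \<W> \<Longrightarrow> card \<W> \<le> t" and K: "real ((t + 1) * copy_size r + (t + 1)) \<le> \<mu> * n"
    and e12: "2 * real r * \<eta>1 \<le> \<eta>2"
  shows "real (card stray) \<le> real (t - card heavy) * real (copy_size r) * (\<eta>1 * n ^ (r - 1)) + real (card Miss) / 2"
proof -
  define k where "k = t - card heavy"
  have r2: "2 \<le> r" using r by simp
  have fh: "finite heavy" "heavy \<subseteq> V" unfolding heavy_def using V by auto
  have ct: "card heavy \<le> t" by (rule heavy_few(1)[OF t K])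
  obtain Y where Y: "Y \<subseteq> V" "card Y \<le> k * copy_size r" "\<And>W. hcopy r V E W \<Longrightarrow> W \<inter> (Y \<union> heavy) \<noteq> {}"
    by (rule maximal_packs[OF r2 V heavy_few(2)[OF t K, folded k_def]]) (assumption | rule that)+
  have fY: "finite Y" using Y(1) V finite_subset by blast
  define X where "X = atypical \<eta>2"
  have X: "finite X" "X \<subseteq> V" unfolding X_def atypical_def using V by auto
  have "stray \<subseteq> (\<Union>v\<in>(Y \<union> X) - heavy. {e \<in> E. card (e \<inter> V1) \<noteq> 1 \<and> v \<in> e})"
  proof
    fix e assume e: "e \<in> stray"
    then have eE: "e \<in> E" "card (e \<inter> V1) \<noteq> 1" "e \<inter> heavy = {}" unfolding stray_def by auto
    have "e \<inter> (Y \<union> X) \<noteq> {}"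
    proof
      assume d: "e \<inter> (Y \<union> X) = {}"
      have "card (Y \<union> heavy) \<le> card Y + card heavy" by (rule card_Un_le)
      also have "\<dots> \<le> k * copy_size r + t" using Y(2) ct by simp
      also have "\<dots> \<le> (t + 1) * copy_size r + (t + 1)" unfolding k_def by (intro add_mono mult_right_mono) auto
      finally have "real (card (Y \<union> heavy)) \<le> real ((t + 1) * copy_size r + (t + 1))" by (simp only: of_nat_le_iff)
      then have "real (card (Y \<union> heavy)) \<le> \<mu> * n" using K by linarith
      moreover have "e \<inter> atypical \<eta>2 = {}" "e \<inter> (Y \<union> heavy) = {}" using d eE(3) unfolding X_def by auto
      moreover have "Y \<union> heavy \<subseteq> V" using Y(1) fh(2) by simp
      ultimately obtain W where "hcopy r V E W" "W \<inter> (Y \<union> heavy) = {}"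
        using copy_typical_bad_edge[OF eE(1,2), of "Y \<union> heavy"] by auto
      then show False using Y(3)[of W] by simp
    qed
    then show "e \<in> (\<Union>v\<in>(Y \<union> X) - heavy. {e \<in> E. card (e \<inter> V1) \<noteq> 1 \<and> v \<in> e})" using eE by auto
  qed
  then have "card stray \<le> card (\<Union>v\<in>(Y \<union> X) - heavy. {e \<in> E. card (e \<inter> V1) \<noteq> 1 \<and> v \<in> e})"
    using fY X fin(4) by (intro card_mono) auto
  also have "real \<dots> \<le> real (card ((Y \<union> X) - heavy)) * (\<eta>1 * n ^ (r - 1))"
  proof (rule card_UN_real)
    fix v assume "v \<in> (Y \<union> X) - heavy"
    then have "v \<in> V" "v \<notin> heavy" using Y(1) X(2) by auto
    then show "real (card {e \<in> E. card (e \<inter> V1) \<noteq> 1 \<and> v \<in> e}) \<le> \<eta>1 * n ^ (r - 1)"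
      unfolding heavy_def bd_def by auto
  qed (use fY X in auto)
  also have "\<dots> \<le> (real (card Y) + real (card X)) * (\<eta>1 * n ^ (r - 1))"
  proof (rule mult_right_mono)
    have "card ((Y \<union> X) - heavy) \<le> card (Y \<union> X)" using fY X by (intro card_mono) auto
    then show "real (card ((Y \<union> X) - heavy)) \<le> real (card Y) + real (card X)" using card_Un_real[of Y X] by linarith
  qed (use pos in simp)
  also have "\<dots> = real (card Y) * (\<eta>1 * n ^ (r - 1)) + real (card X) * (\<eta>1 * n ^ (r - 1))" by (rule distrib_right)
  also have "real (card Y) * (\<eta>1 * n ^ (r - 1)) \<le> real k * real (copy_size r) * (\<eta>1 * n ^ (r - 1))"
  proof (rule mult_right_mono)
    have "real (card Y) \<le> real (k * copy_size r)" using Y(2) by (simp only: of_nat_le_iff)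
    then show "real (card Y) \<le> real k * real (copy_size r)" by simp
  qed (use pos in simp)
  also have "real (card X) * (\<eta>1 * n ^ (r - 1)) \<le> real (card Miss) / 2"
  proof -
    have "real (card X) * (\<eta>2 * n ^ (r - 1)) = (\<Sum>w\<in>X. \<eta>2 * n ^ (r - 1))" by simp
    also have "\<dots> \<le> (\<Sum>w\<in>X. real (card {e \<in> Miss. w \<in> e}))"
      by (rule sum_mono) (simp add: X_def atypical_def mis_def)
    also have "\<dots> \<le> real r * real (card Miss)"
      by (rule sum_card_containing_le[OF _ _ X(1)]) (use fin good in \<open>auto simp: Miss_def\<close>)
    finally have 1: "real (card X) * (\<eta>2 * n ^ (r - 1)) \<le> real r * real (card Miss)" .
    have "(real (card X) * n ^ (r - 1)) * (2 * real r * \<eta>1) \<le> (real (card X) * n ^ (r - 1)) * \<eta>2"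
      using e12 pos by (intro mult_left_mono) auto
    then have "real r * (2 * (real (card X) * (\<eta>1 * n ^ (r - 1)))) \<le> real r * real (card Miss)"
      using 1 by (simp add: mult_ac)
    moreover have "0 < real r" using r by simp
    ultimately show ?thesis by (simp only: mult_le_cancel_left_pos)
  qed
  finally show ?thesis unfolding k_def by simp
qed

text \<open>Each of the \<open>k\<close> vertices of \<open>Q\<close> adds at least
  \<open>(c1 / (2 * r)) ^ r * n ^ (r - 1)\<close> sets to the competitor but allows at most
  \<open>copy_size r * \<eta>1 * n ^ (r - 1)\<close> stray edges. As missing sets pay for only half
  of their own number in stray edges, maximality of \<open>E\<close> forces \<open>k\<close>, the
  missing sets and the stray edges all to vanish.\<close>

lemma exact:
  assumes t: "\<And>\<W>. packs r V E \<W> \<Longrightarrow> card \<W> \<le> t" and K: "real ((t + 1) * copy_size r + (t + 1)) \<le> \<mu> * n"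
    and e12: "2 * real r * \<eta>1 \<le> \<eta>2" and cs: "real (copy_size r) * \<eta>1 < (c1 / (2 * real r)) ^ r"
    and mx: "\<And>T. T \<subseteq> V \<Longrightarrow> card T = t \<Longrightarrow> card (join_sets V r T V1) \<le> card E"
  shows "\<exists>T\<subseteq>V. card T = t \<and> E = join_sets V r T V1"
proof -
  define k where "k = t - card heavy"
  have fh: "finite heavy" "heavy \<subseteq> V" unfolding heavy_def using V by auto
  have ct: "card heavy \<le> t" by (rule heavy_few(1)[OF t K])
  have tn: "real t \<le> c1 / 8 * n"
  proof -
    have "t \<le> (t + 1) * copy_size r + (t + 1)" by simp
    then have "real t \<le> real ((t + 1) * copy_size r + (t + 1))" by (simp only: of_nat_le_iff)
    also have "\<dots> \<le> c1 / 8 * n" using K mult_right_mono[OF mu(3), of n] pos by linarith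
    finally show ?thesis .
  qed
  have c0: "0 < c1 * n" using pos by simp
  have "real (card V2) - real (card heavy) \<le> real (card (V2 - heavy))" by (rule card_minus_ge[OF fh(1)])
  then have "real k \<le> real (card (V2 - heavy))" using bigV2 tn ct c0 unfolding k_def by simp
  then have "k \<le> card (V2 - heavy)" by (simp only: of_nat_le_iff)
  then obtain Q where Q: "Q \<subseteq> V2 - heavy" "card Q = k" "finite Q" by (rule obtain_subset_with_card_n)
  have QV: "Q \<subseteq> V" using Q(1) fin(5) by auto
  define T where "T = heavy \<union> Q"
  have "heavy \<inter> Q = {}" using Q(1) by auto
  then have cT: "card T = t" unfolding T_def using card_Un_disjoint[OF fh(1) Q(3)] Q(2) ct k_def by simp
  have TV: "T \<subseteq> V" unfolding T_def using fh(2) QV by simp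
  define A0 where "A0 = join_sets V r heavy V1"
  define W2 where "W2 = V2 - heavy - Q"
  \<comment> \<open>The sets gained by adding \<open>Q\<close>: one vertex in \<open>Q\<close> and
    all others in \<open>V2\<close> outside \<open>heavy\<close>, hence disjoint from those counted
    in \<open>A0\<close>.\<close>
  define C0 where "C0 = {e \<in> good_sets V r Q. {} \<subseteq> e \<and> e \<subseteq> Q \<union> W2 \<union> {}}"
  have fks: "finite (ksets V r)" by (rule finite_ksets[OF V])
  have fA: "finite A0" "finite C0" unfolding A0_def C0_def join_sets_def good_sets_def using fks by auto
  have disj: "A0 \<inter> C0 = {}"
  proof -
    have "e \<notin> A0" if "e \<in> C0" for e
    proof -
      have "e \<subseteq> V2 - heavy" using that Q(1) unfolding C0_def W2_def by auto
      then have "e \<inter> heavy = {}" "e \<inter> V1 = {}" using fin(6) by auto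
      then show ?thesis unfolding A0_def join_sets_def by simp
    qed
    then show ?thesis by blast
  qed
  have sub: "A0 \<union> C0 \<subseteq> join_sets V r T V1"
  proof (rule Un_least)
    show "A0 \<subseteq> join_sets V r T V1" unfolding A0_def join_sets_def T_def by auto
    show "C0 \<subseteq> join_sets V r T V1"
    proof
      fix e assume "e \<in> C0"
      then have "e \<in> ksets V r" "card (e \<inter> Q) = 1" unfolding C0_def good_sets_def by auto
      moreover then have "e \<inter> Q \<noteq> {}" by auto
      then have "e \<inter> T \<noteq> {}" unfolding T_def by auto
      ultimately show "e \<in> join_sets V r T V1" unfolding join_sets_def by simp
    qed
  qed
  have "card A0 + card C0 = card (A0 \<union> C0)" using card_Un_disjoint[OF fA disj] by simp
  also have "\<dots> \<le> card (join_sets V r T V1)" using sub fks by (intro card_mono) (auto simp: join_sets_def)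
  also have "\<dots> \<le> card E" by (rule mx[OF TV cT])
  finally have c1E: "card A0 + card C0 \<le> card E" .
  have Esub: "E \<subseteq> (A0 \<inter> E) \<union> stray"
    using E unfolding A0_def join_sets_def stray_def by auto
  have fst: "finite stray" unfolding stray_def using fin(4) by simp
  have "card E \<le> card ((A0 \<inter> E) \<union> stray)" using Esub fst fA by (intro card_mono) auto
  also have "\<dots> \<le> card (A0 \<inter> E) + card stray" by (rule card_Un_le)
  finally have c2: "card E \<le> card (A0 \<inter> E) + card stray" .
  have "card A0 = card (A0 \<inter> E) + card (A0 - E)"
    using card_Un_disjoint[of "A0 \<inter> E" "A0 - E"] fA by (simp add: Int_Diff_Un Int_Diff_disjoint)
  then have main: "card (A0 - E) + card C0 \<le> card stray" using c1E c2 by linarith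
  have "Miss \<subseteq> A0 - E" unfolding Miss_def A0_def join_sets_def good_sets_def by auto
  then have mi: "card Miss \<le> card (A0 - E)" using fA by (intro card_mono) auto
  define b where "b = c1 / (2 * real r)"
  have b: "0 < b" "b \<le> 1" using base unfolding b_def by auto
  have "b ^ r * n ^ (r - 1) \<le> b ^ (r - 1) * n ^ (r - 1)"
    using b pos by (intro mult_right_mono power_decreasing) auto
  also have "\<dots> \<le> real (card (ksets W2 (r - 1)))" unfolding b_def
  proof (rule ksets_lower)
    have "real (card V2) - real (card T) \<le> real (card (V2 - T))"
      by (rule card_minus_ge) (use fh Q in \<open>simp add: T_def\<close>)
    moreover have "V2 - T = W2" unfolding T_def W2_def by auto
    ultimately show "c1 / 2 * n \<le> real (card W2)" using bigV2 tn cT c0 by simp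
  qed (use r fin(2) in \<open>auto simp: W2_def\<close>)
  finally have "real k * (b ^ r * n ^ (r - 1)) \<le> real k * real (card (ksets W2 (r - 1)))" by (intro mult_left_mono) auto
  also have "\<dots> = real (card Q * card (ksets W2 (r - 1)))" using Q(2) by simp
  also have "\<dots> \<le> real (card C0)"
    unfolding C0_def by (simp only: of_nat_le_iff, rule good_count[OF V]) (use QV r fin(5) in \<open>auto simp: W2_def\<close>)
  finally have kC: "real k * (b ^ r * n ^ (r - 1)) \<le> real (card C0)" .
  have st: "real (card stray) \<le> real k * real (copy_size r) * (\<eta>1 * n ^ (r - 1)) + real (card Miss) / 2"
    unfolding k_def by (rule few_stray[OF t K e12])
  have "real (card (A0 - E)) + real (card C0) \<le> real (card stray)" using main by linarith
  then have "real (card (A0 - E)) + real k * (b ^ r * n ^ (r - 1)) \<le> real k * real (copy_size r) * (\<eta>1 * n ^ (r - 1)) + real (card Miss) / 2"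
    using kC st by linarith
  then have q: "real (card (A0 - E)) - real (card Miss) / 2 + real k * ((b ^ r - real (copy_size r) * \<eta>1) * n ^ (r - 1)) \<le> 0"
    by (simp add: algebra_simps)
  have pp: "0 < (b ^ r - real (copy_size r) * \<eta>1) * n ^ (r - 1)" using cs pos unfolding b_def by simp
  then have "0 \<le> real k * ((b ^ r - real (copy_size r) * \<eta>1) * n ^ (r - 1))" by simp
  moreover have "real (card Miss) \<le> real (card (A0 - E))" using mi by simp
  ultimately have z: "real (card Miss) = 0" "real (card (A0 - E)) = 0" "real k * ((b ^ r - real (copy_size r) * \<eta>1) * n ^ (r - 1)) = 0"
    using q by linarith+
  have k0: "k = 0"
  proof (rule ccontr)
    assume "k \<noteq> 0"
    then have "0 < real k * ((b ^ r - real (copy_size r) * \<eta>1) * n ^ (r - 1))" by (intro mult_pos_pos[OF _ pp]) auto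
    then show False unfolding z(3) by (rule less_irrefl[THEN notE])
  qed
  have "real (card stray) \<le> 0" using st z(1) unfolding k0 by simp
  then have "stray = {}" using fst by simp
  moreover have "A0 - E = {}" using z(2) fA(1) by simp
  ultimately have "E = A0" using Esub by auto
  moreover have "card heavy = t" using k0 ct unfolding k_def by simp
  ultimately show ?thesis using fh(2) unfolding A0_def by (intro exI[of _ heavy]) simp
qed

end

section \<open>Choice of constants\<close>

lemma binomial_lower:
  assumes "m \<le> k"
  shows "(real k - real m) ^ m \<le> fact m * real (k choose m)"
proof -
  have "fact m * real (k choose m) = fact m * (real k gchoose m)" by (simp add: binomial_gbinomial)
  also have "\<dots> = (\<Prod>i = 0..<m. real k - real i)" by (simp add: gbinomial_prod_rev)
  finally have eq: "fact m * real (k choose m) = (\<Prod>i = 0..<m. real k - real i)" .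
  have "(real k - real m) ^ m = (\<Prod>i = 0..<m. real k - real m)" by simp
  also have "\<dots> \<le> (\<Prod>i = 0..<m. real k - real i)" using assms by (intro prod_mono) auto
  finally show ?thesis unfolding eq .
qed

text \<open>The first part has \<open>n div r\<close> vertices; the normalised count of sets with
  one vertex there is at least \<open>f n\<close>, which tends to the star density.\<close>

lemma semibipartite_density:
  assumes r: "2 \<le> r" and d: "0 < \<delta>"
  shows "\<exists>N. \<forall>V :: 'a set. finite V \<longrightarrow> N \<le> card V \<longrightarrow>
    (\<exists>U\<subseteq>V. (star_density r - \<delta>) * real (card V) ^ r \<le> fact r * real (card (good_sets V r U)))"
proof -
  define m where "m = r - 1"
  have m: "r = Suc m" using r by (simp add: m_def)
  define f where "f n = (1 - real r / real n) * (1 - 1 / real r - real m / real n) ^ m" for n :: nat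
  have "f \<longlonglongrightarrow> (1 - 0) * (1 - 1 / real r - 0) ^ m"
    unfolding f_def by (intro tendsto_intros lim_const_over_n)
  then have "f \<longlonglongrightarrow> star_density r" unfolding star_density_def m_def by simp
  then have "eventually (\<lambda>n. star_density r - \<delta> < f n) sequentially"
    by (rule order_tendstoD) (use d in simp)
  then obtain N0 where N0: "\<And>n. N0 \<le> n \<Longrightarrow> star_density r - \<delta> < f n" unfolding eventually_sequentially by auto
  show ?thesis
  proof (intro exI[of _ "N0 + 2 * r"] allI impI)
    fix V :: "'a set" assume V: "finite V" "N0 + 2 * r \<le> card V"
    define n where "n = card V"
    have n0: "0 < n" "2 * r \<le> n" "N0 \<le> n" using V r unfolding n_def by auto
    define a where "a = n div r"
    have an: "a \<le> n" unfolding a_def by simp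
    then obtain U where U: "U \<subseteq> V" "card U = a" "finite U" unfolding n_def by (rule obtain_subset_with_card_n)
    have ra: "real n / real r - 1 \<le> real a"
    proof -
      have "n < r * (a + 1)" unfolding a_def using r by (metis Suc_eq_plus1 dividend_less_times_div mult.commute mult_Suc_right Suc_le_eq pos2 zero_less_numeral less_le_trans add.commute mult_Suc)
      then have "real n < real (r * (a + 1))" by (simp only: of_nat_less_iff)
      then have "real n < (real a + 1) * real r" by (simp add: algebra_simps)
      then have "real n / real r < real a + 1" using r by (subst pos_divide_less_eq) auto
      then show ?thesis by simp
    qed
    have ua: "real a \<le> real n / real r" unfolding a_def by (rule of_nat_div_le_of_nat)
    have cVU: "card (V - U) = n - a" using U V card_Diff_subset[of U V] unfolding n_def by simp
    have rn: "(1 - 1 / real r) * real n \<le> real (n - a)" using ua an by (simp add: of_nat_diff algebra_simps)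
    have mle: "real m \<le> (1 - 1 / real r) * real n"
    proof -
      have "1 / 2 \<le> 1 - 1 / real r" using r by (simp add: field_simps)
      then have "1 / 2 * real n \<le> (1 - 1 / real r) * real n" by (intro mult_right_mono) auto
      moreover have "real (2 * r) \<le> real n" using n0(2) by (simp only: of_nat_le_iff)
      then have "real r \<le> 1 / 2 * real n" by simp
      moreover have "real m \<le> real r" unfolding m_def by simp
      ultimately show ?thesis by linarith
    qed
    then have mk: "m \<le> n - a" using rn by linarith
    have "(star_density r - \<delta>) * real n ^ r \<le> f n * real n ^ r"
      using N0[OF n0(3)] by (intro mult_right_mono) auto
    also have "\<dots> = (real n * (1 - real r / real n)) * (real n * (1 - 1 / real r - real m / real n)) ^ m"
      unfolding f_def m power_mult_distrib by simp
    also have "real n * (1 - real r / real n) = real n - real r" using n0 by (simp add: right_diff_distrib)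
    also have "real n * (1 - 1 / real r - real m / real n) = (1 - 1 / real r) * real n - real m"
      using n0 by (simp add: right_diff_distrib left_diff_distrib)
    also have "(real n - real r) * ((1 - 1 / real r) * real n - real m) ^ m \<le> (real r * real a) * (fact m * real (n - a choose m))"
    proof (rule mult_mono)
      have "(real n / real r - 1) * real r \<le> real a * real r" using ra by (intro mult_right_mono) auto
      moreover have "(real n / real r - 1) * real r = real n - real r" using r by (simp add: left_diff_distrib)
      ultimately show "real n - real r \<le> real r * real a" by (simp only: mult.commute)
      have "((1 - 1 / real r) * real n - real m) ^ m \<le> (real (n - a) - real m) ^ m"
        using rn mle by (intro power_mono) auto
      also have "\<dots> \<le> fact m * real (n - a choose m)" by (rule binomial_lower[OF mk])
      finally show "((1 - 1 / real r) * real n - real m) ^ m \<le> fact m * real (n - a choose m)" .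
    qed (use mle in auto)
    also have "\<dots> = fact r * real (a * (n - a choose m))" unfolding m by (simp add: algebra_simps)
    also have "\<dots> = fact r * real (card U * card (ksets (V - U) m))"
      using card_ksets[of "V - U" m] V(1) cVU U(2) by simp
    also have "\<dots> \<le> fact r * real (card (good_sets V r U))"
    proof (intro mult_left_mono, simp only: of_nat_le_iff)
      have "card U * card (ksets (V - U) m) \<le> card {e \<in> good_sets V r U. {} \<subseteq> e \<and> e \<subseteq> U \<union> (V - U) \<union> {}}"
        by (rule good_count[OF V(1)]) (use U m in auto)
      also have "\<dots> \<le> card (good_sets V r U)"
        using finite_ksets[OF V(1), of r] by (intro card_mono) (auto simp: good_sets_def)
      finally show "card U * card (ksets (V - U) m) \<le> card (good_sets V r U)" .
    qed simp
    finally show "\<exists>U\<subseteq>V. (star_density r - \<delta>) * real (card V) ^ r \<le> fact r * real (card (good_sets V r U))"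
      using U(1) unfolding n_def by blast
  qed
qed

text \<open>The dependencies allow the order \<open>\<gamma>\<close>, \<open>\<eta>2\<close>,
  \<open>\<eta>1\<close>, \<open>\<theta>\<close>, \<open>\<epsilon>\<close>: each constant is the
  minimum of what its conditions require in terms of the earlier ones, with a factor 2 to spare in
  the strict inequalities.\<close>

lemma extremal_constants:
  fixes c1 cs M :: real
  assumes r: "4 \<le> r" and c1: "0 < c1" "c1 \<le> 1" and cs: "0 < cs" and M: "0 < M"
  obtains \<gamma> \<eta>1 \<eta>2 \<theta> \<epsilon> \<mu> :: real where
    "0 < \<gamma>" "0 < \<eta>1" "0 < \<eta>2" "0 < \<theta>" "0 < \<mu>" "0 < \<epsilon>"
    "\<mu> < \<gamma> / 2" "\<mu> \<le> \<eta>1 / 32" "\<mu> \<le> c1 / 8"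
    "2 * \<gamma> \<le> (c1 / (2 * real r)) ^ r"
    "real r * (real r * \<eta>2 / \<gamma>) \<le> c1 / 8" "\<eta>2 < (c1 / 2 / real (r - 1)) ^ (r - 1)"
    "real r * (real r * \<theta> / \<gamma>) \<le> \<eta>1 / 32"
    "real r * \<epsilon> / \<eta>2 \<le> c1 / 8" "real r * \<epsilon> / \<eta>2 \<le> \<eta>1 / 32" "real r * \<epsilon> / \<theta> \<le> \<eta>1 / 32"
    "\<epsilon> < (\<eta>1 / 4) * ((\<eta>1 / 4) / real (r - 1)) ^ (r - 1)"
    "\<eta>1 \<le> c1" "2 * real r * \<eta>1 \<le> \<eta>2" "cs * \<eta>1 < (c1 / (2 * real r)) ^ r" "\<epsilon> \<le> M"
proof -
  have r0: "0 < real r" "0 < real (r - 1)" using r by auto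
  define b where "b = (c1 / (2 * real r)) ^ r"
  have b: "0 < b" unfolding b_def using c1 r0 by simp
  define \<gamma> where "\<gamma> = b / 2"
  have g: "0 < \<gamma>" unfolding \<gamma>_def using b by simp
  define h where "h = (c1 / 2 / real (r - 1)) ^ (r - 1)"
  have h: "0 < h" unfolding h_def using c1 r0 by simp
  define \<eta>2 where "\<eta>2 = min (c1 * \<gamma> / (8 * real r * real r)) (h / 2)"
  have e2: "0 < \<eta>2" unfolding \<eta>2_def using c1 g r0 h by simp
  have e2': "\<eta>2 \<le> c1 * \<gamma> / (8 * real r * real r)" "\<eta>2 \<le> h / 2" unfolding \<eta>2_def by linarith+
  define \<eta>1 where "\<eta>1 = min (\<eta>2 / (2 * real r)) (min (b / (2 * cs)) c1)"
  have e1: "0 < \<eta>1" unfolding \<eta>1_def using c1 e2 r0 b cs by simp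
  have e1': "\<eta>1 \<le> \<eta>2 / (2 * real r)" "\<eta>1 \<le> b / (2 * cs)" "\<eta>1 \<le> c1" unfolding \<eta>1_def by linarith+
  define \<theta> where "\<theta> = \<eta>1 * \<gamma> / (32 * real r * real r)"
  have t: "0 < \<theta>" unfolding \<theta>_def using e1 g r0 by simp
  define z where "z = (\<eta>1 / 4) * ((\<eta>1 / 4) / real (r - 1)) ^ (r - 1)"
  have z: "0 < z" unfolding z_def using e1 r0 by (intro mult_pos_pos zero_less_power divide_pos_pos) auto
  define \<epsilon> where "\<epsilon> = min (min (\<eta>2 * c1 / (8 * real r)) (\<eta>2 * \<eta>1 / (32 * real r))) (min (\<theta> * \<eta>1 / (32 * real r)) (min (z / 2) M))"
  have e: "0 < \<epsilon>" unfolding \<epsilon>_def using e2 c1 r0 e1 t z M by simp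
  have e': "\<epsilon> \<le> \<eta>2 * c1 / (8 * real r)" "\<epsilon> \<le> \<eta>2 * \<eta>1 / (32 * real r)" "\<epsilon> \<le> \<theta> * \<eta>1 / (32 * real r)" "\<epsilon> \<le> z / 2" "\<epsilon> \<le> M"
    unfolding \<epsilon>_def by linarith+
  define \<mu> where "\<mu> = min (\<gamma> / 4) (min (\<eta>1 / 32) (c1 / 8))"
  have u: "0 < \<mu>" unfolding \<mu>_def using g e1 c1 by simp
  have u': "\<mu> \<le> \<gamma> / 4" "\<mu> \<le> \<eta>1 / 32" "\<mu> \<le> c1 / 8" unfolding \<mu>_def by linarith+
  have q: "x * k \<le> y" if "x \<le> y / k" "0 < k" for x y k :: real using that by (simp add: pos_le_divide_eq)
  show ?thesis
  proof (rule that[OF g e1 e2 t u e _ u'(2,3)])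
    show "\<mu> < \<gamma> / 2" using u'(1) g by linarith
    show "2 * \<gamma> \<le> (c1 / (2 * real r)) ^ r" unfolding \<gamma>_def b_def by simp
    have "\<eta>2 * (8 * real r * real r) \<le> c1 * \<gamma>" by (rule q[OF e2'(1)]) (use r0 in simp)
    then have "real r * (real r * \<eta>2) \<le> c1 / 8 * \<gamma>" by (simp add: mult_ac)
    then have "real r * (real r * \<eta>2) / \<gamma> \<le> c1 / 8" using g by (simp only: pos_divide_le_eq)
    then show "real r * (real r * \<eta>2 / \<gamma>) \<le> c1 / 8" by simp
    show "\<eta>2 < (c1 / 2 / real (r - 1)) ^ (r - 1)" using e2'(2) h unfolding h_def[symmetric] by linarith
    show "real r * (real r * \<theta> / \<gamma>) \<le> \<eta>1 / 32" unfolding \<theta>_def using g r0 by simp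
    have "\<epsilon> * (8 * real r) \<le> \<eta>2 * c1" by (rule q[OF e'(1)]) (use r0 in simp)
    then have "real r * \<epsilon> \<le> c1 / 8 * \<eta>2" by (simp add: mult_ac)
    then show "real r * \<epsilon> / \<eta>2 \<le> c1 / 8" using e2 by (simp only: pos_divide_le_eq)
    have "\<epsilon> * (32 * real r) \<le> \<eta>2 * \<eta>1" by (rule q[OF e'(2)]) (use r0 in simp)
    then have "real r * \<epsilon> \<le> \<eta>1 / 32 * \<eta>2" by (simp add: mult_ac)
    then show "real r * \<epsilon> / \<eta>2 \<le> \<eta>1 / 32" using e2 by (simp only: pos_divide_le_eq)
    have "\<epsilon> * (32 * real r) \<le> \<theta> * \<eta>1" by (rule q[OF e'(3)]) (use r0 in simp)
    then have "real r * \<epsilon> \<le> \<eta>1 / 32 * \<theta>" by (simp add: mult_ac)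
    then show "real r * \<epsilon> / \<theta> \<le> \<eta>1 / 32" using t by (simp only: pos_divide_le_eq)
    show "\<epsilon> < (\<eta>1 / 4) * ((\<eta>1 / 4) / real (r - 1)) ^ (r - 1)" using e'(4) z unfolding z_def[symmetric] by linarith
    show "\<eta>1 \<le> c1" by fact
    have "\<eta>1 * (2 * real r) \<le> \<eta>2" by (rule q[OF e1'(1)]) (use r0 in simp)
    then show "2 * real r * \<eta>1 \<le> \<eta>2" by (simp add: mult_ac)
    have "\<eta>1 * (2 * cs) \<le> b" by (rule q[OF e1'(2)]) (use cs in simp)
    then have "cs * \<eta>1 \<le> b / 2" by (simp add: mult_ac)
    then show "cs * \<eta>1 < (c1 / (2 * real r)) ^ r" using b unfolding b_def by linarith
    show "\<epsilon> \<le> M" by fact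
  qed
qed

lemma card_good_le_hitting:
  assumes V: "finite V" and F: "F \<subseteq> ksets V r" "0 < r" and W: "W \<subseteq> V" "\<And>e. e \<in> F \<Longrightarrow> e \<inter> W \<noteq> {}"
  shows "real (card F) \<le> real (card W) * real (card V) ^ (r - 1)"
proof -
  have "F \<subseteq> ksets V (Suc (r - 1))" using F by simp
  moreover have "{e \<in> F. e \<inter> W \<noteq> {}} = F" using W(2) by blast
  ultimately show ?thesis using card_hitting_le[OF V _ W(1), of F "r - 1"] by simp
qed

text \<open>Maximality against joins makes \<open>E\<close> at least as large as any complete
  semibipartite graph, which gives the density for stability. It also bounds the missing sets by the
  bad edges, and many good edges remain, so that both parts are of linear size.\<close>

theorem extremal_structure:
  assumes r: "4 \<le> r"
  obtains N :: nat and c :: real where "0 < c" "\<And>(V :: 'a set) E t. finite V \<Longrightarrow> N \<le> card V \<Longrightarrow> E \<subseteq> ksets V r \<Longrightarrow>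
    real t \<le> c * real (card V) \<Longrightarrow> (\<And>\<W>. packs r V E \<W> \<Longrightarrow> card \<W> \<le> t) \<Longrightarrow>
    (\<And>T U. T \<subseteq> V \<Longrightarrow> card T = t \<Longrightarrow> U \<subseteq> V \<Longrightarrow> card (join_sets V r T U) \<le> card E) \<Longrightarrow>
    \<exists>T\<subseteq>V. \<exists>U\<subseteq>V. card T = t \<and> E = join_sets V r T U"
proof -
  define M where "M = star_density r"
  have M: "0 < M" "M \<le> 1" unfolding M_def using r star_density_pos[of r] star_density_le_1[of r] by auto
  \<comment> \<open>At least \<open>M / 2 * n ^ r / fact r\<close> good edges survive and each meets
    both parts, while a set of size \<open>w\<close> meets at most \<open>w * n ^ (r - 1)\<close>
    edges.\<close>
  define c1 where "c1 = M / (2 * fact r)"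
  have c1: "0 < c1" unfolding c1_def using M by simp
  have c1': "c1 \<le> 1"
  proof -
    have "M \<le> 2 * fact r" using M(2) fact_ge_1[of r, where 'a = real] by linarith
    then show ?thesis unfolding c1_def by (simp add: pos_divide_le_eq)
  qed
  define cs where "cs = real (copy_size r)"
  have cs: "0 < cs" unfolding cs_def using copy_size_pos[of r] r by simp
  define M' where "M' = M / (4 * fact r)"
  have M': "0 < M'" unfolding M'_def using M by simp
  obtain \<gamma> \<eta>1 \<eta>2 \<theta> \<epsilon> \<mu> :: real where k:
    "0 < \<gamma>" "0 < \<eta>1" "0 < \<eta>2" "0 < \<theta>" "0 < \<mu>" "0 < \<epsilon>"
    "\<mu> < \<gamma> / 2" "\<mu> \<le> \<eta>1 / 32" "\<mu> \<le> c1 / 8"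
    "2 * \<gamma> \<le> (c1 / (2 * real r)) ^ r"
    "real r * (real r * \<eta>2 / \<gamma>) \<le> c1 / 8" "\<eta>2 < (c1 / 2 / real (r - 1)) ^ (r - 1)"
    "real r * (real r * \<theta> / \<gamma>) \<le> \<eta>1 / 32"
    "real r * \<epsilon> / \<eta>2 \<le> c1 / 8" "real r * \<epsilon> / \<eta>2 \<le> \<eta>1 / 32" "real r * \<epsilon> / \<theta> \<le> \<eta>1 / 32"
    "\<epsilon> < (\<eta>1 / 4) * ((\<eta>1 / 4) / real (r - 1)) ^ (r - 1)"
    "\<eta>1 \<le> c1" "2 * real r * \<eta>1 \<le> \<eta>2" "cs * \<eta>1 < (c1 / (2 * real r)) ^ r" "\<epsilon> \<le> M'"
    by (rule extremal_constants[OF r c1 c1' cs M'])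
  show ?thesis
  proof (rule packing_stability[OF r k(6)])
    fix \<delta> cst :: real and N1 :: nat
    assume d: "0 < \<delta>" "0 < cst" and st: "\<And>(V :: 'a set) E t. finite V \<Longrightarrow> N1 \<le> card V \<Longrightarrow> E \<subseteq> ksets V r \<Longrightarrow> real t \<le> cst * real (card V) \<Longrightarrow>
      (\<And>\<W>. packs r V E \<W> \<Longrightarrow> card \<W> \<le> t) \<Longrightarrow>
      (star_density r - \<delta>) * real (card V) ^ r \<le> fact r * real (card E) \<Longrightarrow>
      \<exists>V1\<subseteq>V. real (card {e \<in> E. card (e \<inter> V1) \<noteq> 1}) \<le> \<epsilon> * real (card V) ^ r"
    define \<delta>' where "\<delta>' = min \<delta> (M / 4)"
    have d': "0 < \<delta>'" "\<delta>' \<le> \<delta>" "\<delta>' \<le> M / 4" unfolding \<delta>'_def using d M by auto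
    have r2: "2 \<le> r" using r by simp
    obtain N2 where N2: "\<And>V :: 'a set. finite V \<Longrightarrow> N2 \<le> card V \<Longrightarrow>
      \<exists>U\<subseteq>V. (star_density r - \<delta>') * real (card V) ^ r \<le> fact r * real (card (good_sets V r U))"
      using semibipartite_density[OF r2 d'(1), where 'a = 'a] by auto
    \<comment> \<open>The bounds \<open>cst\<close> and 1 serve stability and
      \<open>t \<le> card V\<close>; the third makes \<open>t * (cs + 1)\<close> at most half of
      \<open>\<mu> * n\<close>, the other half being left for the additional
      \<open>cs + 1\<close>.\<close>
    define c where "c = min (min cst 1) (\<mu> / (2 * (cs + 1)))"
    have c: "0 < c" "c \<le> cst" "c \<le> 1" "c \<le> \<mu> / (2 * (cs + 1))" unfolding c_def using d k cs by auto
    define R where "R = 16 * real r / c1 + 32 * real r / \<eta>1 + 2 * real (emb_const r) / \<gamma> + 16 * real (emb_const r) / \<eta>1 + 2 * (cs + 1) / \<mu> + 1"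
    define N where "N = N1 + N2 + nat \<lceil>R\<rceil>"
    show ?thesis
    proof (rule that[OF c(1)])
      fix V :: "'a set" and E t
      assume V: "finite V" "N \<le> card V" and E: "E \<subseteq> ksets V r" and t: "real t \<le> c * real (card V)"
        and pk: "\<And>\<W>. packs r V E \<W> \<Longrightarrow> card \<W> \<le> t"
        and mx: "\<And>T U. T \<subseteq> V \<Longrightarrow> card T = t \<Longrightarrow> U \<subseteq> V \<Longrightarrow> card (join_sets V r T U) \<le> card E"
      define n where "n = real (card V)"
      have "R \<le> real N" unfolding N_def by linarith
      also have "\<dots> \<le> n" using V unfolding n_def by simp
      finally have nR: "R \<le> n" .
      have p: "0 \<le> 16 * real r / c1" "0 \<le> 32 * real r / \<eta>1" "0 \<le> 2 * real (emb_const r) / \<gamma>"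
        "0 \<le> 16 * real (emb_const r) / \<eta>1" "0 \<le> 2 * (cs + 1) / \<mu>" using c1 k cs by auto
      have n0: "0 < n" using nR p unfolding R_def by linarith
      have big: "16 * real r / c1 \<le> n" "32 * real r / \<eta>1 \<le> n" "2 * real (emb_const r) / \<gamma> \<le> n"
        "16 * real (emb_const r) / \<eta>1 \<le> n" "2 * (cs + 1) / \<mu> \<le> n"
        using nR p unfolding R_def by linarith+
      have q: "x \<le> y * n" if "x / y \<le> n" "0 < y" for x y using that by (simp add: pos_divide_le_eq mult.commute)
      note lrg = q[OF big(1) c1] q[OF big(2) k(2)] q[OF big(3) k(1)] q[OF big(4) k(2)] q[OF big(5) k(5)]
      have "c * n \<le> 1 * n" using c n0 by (intro mult_right_mono) auto
      then have "t \<le> card V" using t unfolding n_def by simp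
      then obtain T0 where T0: "T0 \<subseteq> V" "card T0 = t" "finite T0" by (rule obtain_subset_with_card_n)
      have fks: "finite (ksets V r)" by (rule finite_ksets[OF V(1)])
      have fE: "finite E" by (rule finite_fam[OF V(1) E])
      have gE: "card (good_sets V r U) \<le> card E" if "U \<subseteq> V" for U
      proof -
        have "card (good_sets V r U) \<le> card (join_sets V r T0 U)"
          using fks by (intro card_mono) (auto simp: join_sets_def good_sets_def)
        also have "\<dots> \<le> card E" by (rule mx[OF T0(1,2) that])
        finally show ?thesis .
      qed
      have "N2 \<le> card V" using V(2) unfolding N_def by simp
      from N2[OF V(1) this] obtain U where U: "U \<subseteq> V" "(M - \<delta>') * n ^ r \<le> fact r * real (card (good_sets V r U))"
        unfolding M_def n_def by blast
      have D: "(M - \<delta>') * n ^ r \<le> fact r * real (card E)"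
      proof -
        have "fact r * real (card (good_sets V r U)) \<le> fact r * real (card E)"
          using gE[OF U(1)] by (intro mult_left_mono) auto
        then show ?thesis using U(2) by linarith
      qed
      have D1: "(star_density r - \<delta>) * real (card V) ^ r \<le> fact r * real (card E)"
      proof -
        have "(M - \<delta>) * n ^ r \<le> (M - \<delta>') * n ^ r" using d' n0 by (intro mult_right_mono) auto
        then show ?thesis using D unfolding M_def n_def by linarith
      qed
      have tcst: "real t \<le> cst * real (card V)"
      proof -
        have "c * n \<le> cst * n" using c n0 by (intro mult_right_mono) auto
        then show ?thesis using t unfolding n_def by linarith
      qed
      have "N1 \<le> card V" using V(2) unfolding N_def by simp
      from st[OF V(1) this E tcst pk D1] obtain V0 where V0: "V0 \<subseteq> V" "real (card {e \<in> E. card (e \<inter> V0) \<noteq> 1}) \<le> \<epsilon> * n ^ r"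
        unfolding n_def by blast
      define bad where "bad U = card {e \<in> E. card (e \<inter> U) \<noteq> 1}" for U
      have "Min (bad ` Pow V) \<in> bad ` Pow V" using V(1) by (intro Min_in) auto
      then obtain V1 where V1: "V1 \<subseteq> V" "bad V1 = Min (bad ` Pow V)" by auto
      have best: "bad V1 \<le> bad U" if "U \<subseteq> V" for U unfolding V1(2) using V(1) that by (intro Min_le) auto
      have "real (bad V1) \<le> real (bad V0)" using best[OF V0(1)] by simp
      then have bV1: "real (card (E - good_sets V r V1)) \<le> \<epsilon> * n ^ r"
      proof -
        have "E - good_sets V r V1 = {e \<in> E. card (e \<inter> V1) \<noteq> 1}" using E unfolding good_sets_def by auto
        then show ?thesis using \<open>real (bad V1) \<le> real (bad V0)\<close> V0(2) unfolding bad_def by simp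
      qed
      define G where "G = good_sets V r V1"
      have fG: "finite G" unfolding G_def good_sets_def using fks by simp
      have s1: "card G = card (G \<inter> E) + card (G - E)"
        using card_Un_disjoint[of "G \<inter> E" "G - E"] fG by (simp add: Int_Diff_Un Int_Diff_disjoint)
      have s2: "card E = card (G \<inter> E) + card (E - G)"
        using card_Un_disjoint[of "E \<inter> G" "E - G"] fE by (simp add: Int_Diff_Un Int_Diff_disjoint Int_commute[of G E])
      have miss: "real (card (good_sets V r V1 - E)) \<le> \<epsilon> * n ^ r"
        using s1 s2 gE[OF V1(1)] bV1 unfolding G_def[symmetric] by linarith
      have GE: "c1 * n ^ r \<le> real (card (G \<inter> E))"
      proof -
        have "(M - M / 4) * n ^ r \<le> (M - \<delta>') * n ^ r" using d' n0 by (intro mult_right_mono) auto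
        then have "3 / 4 * M * n ^ r \<le> fact r * real (card E)" using D by simp
        moreover have "\<epsilon> * n ^ r \<le> M' * n ^ r" using k(21) n0 by (intro mult_right_mono) auto
        then have "fact r * (\<epsilon> * n ^ r) \<le> fact r * (M' * n ^ r)" by (intro mult_left_mono) auto
        moreover have "fact r * (M' * n ^ r) = M / 4 * n ^ r" unfolding M'_def by simp
        moreover have "fact r * real (card (E - G)) \<le> fact r * (\<epsilon> * n ^ r)"
          using bV1 unfolding G_def by (intro mult_left_mono) auto
        moreover have "fact r * real (card E) = fact r * real (card (G \<inter> E)) + fact r * real (card (E - G))"
          unfolding s2 by (simp add: distrib_left)
        ultimately have "1 / 2 * M * n ^ r \<le> fact r * real (card (G \<inter> E))" by linarith
        moreover have "fact r * (c1 * n ^ r) = 1 / 2 * M * n ^ r" unfolding c1_def by simp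
        ultimately have "fact r * (c1 * n ^ r) \<le> fact r * real (card (G \<inter> E))" by linarith
        then show ?thesis by (simp only: mult_le_cancel_left_pos fact_gt_zero)
      qed
      have npow: "n ^ r = n * n ^ (r - 1)" using r by (metis Suc_diff_1 less_le_trans power_Suc zero_less_numeral)
      have side: "c1 * n \<le> real (card W)" if W: "W \<subseteq> V" "\<And>e. e \<in> G \<Longrightarrow> e \<inter> W \<noteq> {}" for W
      proof -
        have "real (card (G \<inter> E)) \<le> real (card W) * real (card V) ^ (r - 1)"
        proof (rule card_good_le_hitting[OF V(1) _ _ W(1)])
          show "G \<inter> E \<subseteq> ksets V r" using E by auto
          show "e \<inter> W \<noteq> {}" if "e \<in> G \<inter> E" for e using W(2)[of e] that by simp
        qed (use r in simp)
        then have "c1 * (n * n ^ (r - 1)) \<le> real (card W) * n ^ (r - 1)"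
          using GE unfolding npow n_def[symmetric] by linarith
        then have "n ^ (r - 1) * (c1 * n) \<le> n ^ (r - 1) * real (card W)" by (simp only: mult_ac)
        then show ?thesis using n0 by (simp only: mult_le_cancel_left_pos zero_less_power)
      qed
      have b1: "c1 * n \<le> real (card V1)" by (rule side[OF V1(1)]) (auto simp: G_def good_sets_def)
      have b2: "c1 * n \<le> real (card (V - V1))"
      proof (rule side)
        fix e assume "e \<in> G"
        then have e: "e \<subseteq> V" "card e = r" "card (e \<inter> V1) = 1" unfolding G_def good_sets_def ksets_def by auto
        show "e \<inter> (V - V1) \<noteq> {}"
        proof
          assume "e \<inter> (V - V1) = {}"
          then have "e \<inter> V1 = e" using e(1) by auto
          then show False using e r by simp
        qed
      qed simp
      interpret near_extremal r V E V1 n c1 \<gamma> \<eta>1 \<eta>2 \<theta> \<epsilon> \<mu>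
        by unfold_locales (rule r V(1) E V1(1) n_def b1 b2 miss best[unfolded bad_def] n0 c1 c1' k lrg | assumption)+
      have tK: "real ((t + 1) * copy_size r + (t + 1)) \<le> \<mu> * n"
      proof -
        have "real t * (2 * (cs + 1)) \<le> c * n * (2 * (cs + 1))" using t cs unfolding n_def by (intro mult_right_mono) auto
        also have "\<dots> = c * (2 * (cs + 1)) * n" by simp
        also have "\<dots> \<le> \<mu> * n" using c(4) cs n0 by (intro mult_right_mono) (simp_all add: pos_le_divide_eq)
        finally have "2 * (real t * (cs + 1)) \<le> \<mu> * n" by (simp only: mult_ac)
        moreover have "a + b \<le> d" if "2 * a \<le> d" "2 * b \<le> d" for a b d :: real using that by linarith
        ultimately have "real t * (cs + 1) + (cs + 1) \<le> \<mu> * n" using lrg(5) by blast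
        moreover have "real ((t + 1) * copy_size r + (t + 1)) = real t * (cs + 1) + (cs + 1)"
          unfolding cs_def by (simp add: algebra_simps)
        ultimately show ?thesis by simp
      qed
      have cse: "real (copy_size r) * \<eta>1 < (c1 / (2 * real r)) ^ r" using k(20) unfolding cs_def .
      have "\<exists>T\<subseteq>V. card T = t \<and> E = join_sets V r T V1"
        by (rule exact[OF pk tK k(19) cse mx[OF _ _ V1(1)]])
      then show "\<exists>T\<subseteq>V. \<exists>U\<subseteq>V. card T = t \<and> E = join_sets V r T U" using V1(1) by blast
    qed
  qed
qed

section \<open>Extremal classes\<close>

text \<open>Indexed families and sets of copies agree because a copy has at least one vertex, so
  disjoint copies are distinct.\<close>

lemma has_disjoint_copies_iff:
  assumes r: "2 \<le> r"
  shows "has_disjoint_copies k (expansion r (matching2 r)) G \<longleftrightarrow> (\<exists>\<W>. packs r (verts G) (edges G) \<W> \<and> card \<W> = k)"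
proof
  assume "has_disjoint_copies k (expansion r (matching2 r)) G"
  then obtain C where C: "\<And>i. i < k \<Longrightarrow> subhgraph (C i) G" "\<And>i. i < k \<Longrightarrow> hiso (expansion r (matching2 r)) (C i)"
    "disjoint_family_on (\<lambda>i. verts (C i)) {..<k}" unfolding has_disjoint_copies_def by auto
  have h: "hcopy r (verts G) (edges G) (verts (C i))" if "i < k" for i
    using C(1,2)[OF that] unfolding hcopy_def subhgraph_def by (metis hgraph.collapse)
  have ne: "verts (C i) \<noteq> {}" if "i < k" for i using hcopy_card[OF h[OF that]] copy_size_pos[OF r] by auto
  have inj: "inj_on (\<lambda>i. verts (C i)) {..<k}"
  proof (rule inj_onI, rule ccontr)
    fix i j assume ij: "i \<in> {..<k}" "j \<in> {..<k}" "verts (C i) = verts (C j)" "i \<noteq> j"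
    then have "verts (C i) \<inter> verts (C j) = {}" using C(3) unfolding disjoint_family_on_def by blast
    then show False using ij ne[of i] by simp
  qed
  have "disjoint ((\<lambda>i. verts (C i)) ` {..<k})"
    using C(3) by (rule disjoint_family_on_disjoint_image)
  then have "packs r (verts G) (edges G) ((\<lambda>i. verts (C i)) ` {..<k})"
    unfolding packs_def using h by auto
  moreover have "card ((\<lambda>i. verts (C i)) ` {..<k}) = k" using card_image[OF inj] by simp
  ultimately show "\<exists>\<W>. packs r (verts G) (edges G) \<W> \<and> card \<W> = k" by blast
next
  assume "\<exists>\<W>. packs r (verts G) (edges G) \<W> \<and> card \<W> = k"
  then obtain \<W> where W: "finite \<W>" "\<And>W. W \<in> \<W> \<Longrightarrow> hcopy r (verts G) (edges G) W" "disjoint \<W>" "card \<W> = k"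
    unfolding packs_def by auto
  obtain f where f: "bij_betw f {0..<k} \<W>" using ex_bij_betw_nat_finite[OF W(1)] W(4) by auto
  have "\<forall>W\<in>\<W>. \<exists>F. F \<subseteq> edges G \<and> hiso (expansion r (matching2 r)) (HGraph W F)"
    using W(2) unfolding hcopy_def by blast
  then obtain F where F: "\<forall>W\<in>\<W>. F W \<subseteq> edges G \<and> hiso (expansion r (matching2 r)) (HGraph W (F W))"
    by (rule bchoice[THEN exE])
  define C where "C i = HGraph (f i) (F (f i))" for i
  have fW: "f i \<in> \<W>" if "i < k" for i using bij_betwE[OF f] that by auto
  have "subhgraph (C i) G \<and> hiso (expansion r (matching2 r)) (C i)" if "i < k" for i
    using fW[OF that] F W(2)[OF fW[OF that]] unfolding C_def subhgraph_def hcopy_def by auto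
  moreover have "disjoint_family_on (\<lambda>i. verts (C i)) {..<k}"
    unfolding disjoint_family_on_def
  proof (intro ballI impI)
    fix i j assume ij: "i \<in> {..<k}" "j \<in> {..<k}" "i \<noteq> j"
    then have "f i \<noteq> f j" using bij_betw_imp_inj_on[OF f] by (auto dest: inj_onD)
    then show "verts (C i) \<inter> verts (C j) = {}"
      using W(3) fW ij unfolding C_def disjoint_def by simp
  qed
  ultimately show "has_disjoint_copies k (expansion r (matching2 r)) G"
    unfolding has_disjoint_copies_def by blast
qed

lemma no_disjoint_copies_iff:
  assumes r: "2 \<le> r"
  shows "\<not> has_disjoint_copies (t + 1) (expansion r (matching2 r)) G \<longleftrightarrow>
    (\<forall>\<W>. packs r (verts G) (edges G) \<W> \<longrightarrow> card \<W> \<le> t)"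
  unfolding has_disjoint_copies_iff[OF r]
proof
  assume no: "\<not> (\<exists>\<W>. packs r (verts G) (edges G) \<W> \<and> card \<W> = t + 1)"
  show "\<forall>\<W>. packs r (verts G) (edges G) \<W> \<longrightarrow> card \<W> \<le> t"
  proof (intro allI impI, rule ccontr)
    fix \<W> assume W: "packs r (verts G) (edges G) \<W>" "\<not> card \<W> \<le> t"
    then have "t + 1 \<le> card \<W>" by simp
    then obtain \<W>' where "\<W>' \<subseteq> \<W>" "card \<W>' = t + 1" by (rule obtain_subset_with_card_n)
    then show False using no packs_subset[OF W(1)] by blast
  qed
next
  assume a: "\<forall>\<W>. packs r (verts G) (edges G) \<W> \<longrightarrow> card \<W> \<le> t"
  show "\<not> (\<exists>\<W>. packs r (verts G) (edges G) \<W> \<and> card \<W> = t + 1)"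
  proof
    assume "\<exists>\<W>. packs r (verts G) (edges G) \<W> \<and> card \<W> = t + 1"
    then obtain \<W> where "packs r (verts G) (edges G) \<W>" "card \<W> = t + 1" by blast
    then show False using a[rule_format, of \<W>] by simp
  qed
qed

text \<open>A copy avoiding \<open>T\<close> would live in a semibipartite graph, where the two first-part vertices of
  its two disjoint core edges would lie in a common edge.\<close>

lemma packs_join_sets:
  assumes r: "2 \<le> r" and V: "finite V" and T: "T \<subseteq> V" and p: "packs r V (join_sets V r T U) \<W>"
  shows "card \<W> \<le> card T"
proof -
  have "W \<inter> T \<noteq> {}" if W: "W \<in> \<W>" for W
  proof
    assume d: "W \<inter> T = {}"
    have "hcopy r V (join_sets V r T U) W" using p W unfolding packs_def by simp
    then obtain A B where AB: "A \<in> join_sets V r T U" "B \<in> join_sets V r T U" "A \<subseteq> W" "B \<subseteq> W" "A \<inter> B = {}"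
      and e: "\<And>a b. a \<in> A \<Longrightarrow> b \<in> B \<Longrightarrow> \<exists>e\<in>join_sets V r T U. e \<subseteq> W \<and> a \<in> e \<and> b \<in> e"
      by (rule hcopy_pairs[OF r]) (assumption | rule that)+
    have c: "card (e \<inter> U) = 1" if "e \<in> join_sets V r T U" "e \<subseteq> W" for e
    proof -
      have "e \<inter> T = {}" using that(2) d by blast
      then show ?thesis using that(1) unfolding join_sets_def by simp
    qed
    have "A \<inter> U \<noteq> {}" "B \<inter> U \<noteq> {}" using c[OF AB(1,3)] c[OF AB(2,4)] by auto
    then obtain a b where ab: "a \<in> A" "a \<in> U" "b \<in> B" "b \<in> U" by blast
    obtain f where f: "f \<in> join_sets V r T U" "f \<subseteq> W" "a \<in> f" "b \<in> f" using e[OF ab(1,3)] by blast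
    obtain z where "f \<inter> U = {z}" using c[OF f(1,2)] card_1_singletonE by blast
    then have "a = z" "b = z" using f(3,4) ab by blast+
    then show False using AB(5) ab by blast
  qed
  then have "\<forall>W\<in>\<W>. \<exists>x. x \<in> W \<inter> T" by blast
  then obtain g where g: "\<forall>W\<in>\<W>. g W \<in> W \<inter> T" by (rule bchoice[THEN exE])
  have "inj_on g \<W>"
  proof (rule inj_onI, rule ccontr)
    fix W W' assume w: "W \<in> \<W>" "W' \<in> \<W>" "g W = g W'" "W \<noteq> W'"
    then have "W \<inter> W' = {}" using p unfolding packs_def disjoint_def by blast
    moreover have "g W \<in> W" "g W' \<in> W'" using g w by auto
    ultimately show False using w(3) by auto
  qed
  moreover have "g ` \<W> \<subseteq> T" using g by auto
  ultimately show ?thesis using card_inj_on_le[of g \<W> T] finite_subset[OF T V] by blast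
qed

text \<open>For fixed sizes of \<open>V\<close> and \<open>T\<close> the count varies only with the
  good sets on \<open>V - T\<close>, so extremal joins correspond to maximal semibipartite graphs.
  The additive form avoids truncated subtraction.\<close>

lemma card_join_sets:
  assumes V: "finite V" and T: "T \<subseteq> V"
  shows "card (join_sets V r T U) + (card V - card T choose r) = (card V choose r) + card (good_sets (V - T) r U)"
proof -
  have f: "finite (ksets V r)" by (rule finite_ksets[OF V])
  define H where "H = {e \<in> ksets V r. e \<inter> T \<noteq> {}}"
  have k: "ksets V r = H \<union> ksets (V - T) r" "H \<inter> ksets (V - T) r = {}" unfolding H_def ksets_def using T by auto
  have j: "join_sets V r T U = H \<union> good_sets (V - T) r U" "H \<inter> good_sets (V - T) r U = {}"
    unfolding H_def join_sets_def good_sets_def ksets_def by auto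
  have fin: "finite H" "finite (ksets (V - T) r)" "finite (good_sets (V - T) r U)"
    using f finite_ksets[of "V - T" r] V unfolding H_def good_sets_def by auto
  have "card V choose r = card H + card (ksets (V - T) r)"
    using card_ksets[OF V, of r] card_Un_disjoint[OF fin(1,2) k(2)] unfolding k(1)[symmetric] by simp
  moreover have "card (ksets (V - T) r) = card V - card T choose r"
    using card_ksets[of "V - T" r] V T by (simp add: card_Diff_subset finite_subset)
  moreover have "card (join_sets V r T U) = card H + card (good_sets (V - T) r U)"
    unfolding j(1) by (rule card_Un_disjoint[OF fin(1,3) j(2)])
  ultimately show ?thesis by simp
qed

lemma semibipartite_good_sets:
  assumes "finite W"
  shows "rgraph r (HGraph W (good_sets W r U))" "semibipartite (HGraph W (good_sets W r U))"
proof -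
  show "rgraph r (HGraph W (good_sets W r U))" unfolding rgraph_def good_sets_def ksets_def using assms by auto
  have "card (e \<inter> (U \<inter> W)) = 1" if "e \<in> good_sets W r U" for e
  proof -
    have "e \<inter> (U \<inter> W) = e \<inter> U" using that unfolding good_sets_def ksets_def by auto
    then show ?thesis using that unfolding good_sets_def by simp
  qed
  then show "semibipartite (HGraph W (good_sets W r U))"
    unfolding semibipartite_def by (intro exI[of _ "U \<inter> W"] exI[of _ "W - U"]) auto
qed

text \<open>A bijection of ground sets carries the first part to \<open>U\<close>, and every edge
  then becomes a good set for it.\<close>

lemma semibipartite_transfer:
  assumes S: "rgraph r S" "semibipartite S" and W: "finite W" "card W = card (verts S)"
  obtains U where "U \<subseteq> W" "card (edges S) \<le> card (good_sets W r U)"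
proof -
  obtain V1 V2 where p: "V1 \<union> V2 = verts S" "\<And>e. e \<in> edges S \<Longrightarrow> card (e \<inter> V1) = 1"
    using S(2) unfolding semibipartite_def by blast
  have fS: "finite (verts S)" "\<And>e. e \<in> edges S \<Longrightarrow> e \<subseteq> verts S" "\<And>e. e \<in> edges S \<Longrightarrow> card e = r"
    using S(1) unfolding rgraph_def by auto
  obtain g where g: "bij_betw g (verts S) W" using finite_same_card_bij[OF fS(1) W(1)] W(2) by auto
  have inj: "inj_on g (verts S)" and im: "g ` verts S = W" using g unfolding bij_betw_def by auto
  have V1: "V1 \<subseteq> verts S" using p(1) by auto
  have "inj_on (\<lambda>e. g ` e) (edges S)"
    by (rule inj_on_subset[OF inj_on_image_Pow[OF inj]]) (use fS(2) in auto)
  then have "card (edges S) = card ((\<lambda>e. g ` e) ` edges S)" by (rule card_image[symmetric])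
  also have "\<dots> \<le> card (good_sets W r (g ` V1))"
  proof (rule card_mono)
    show "finite (good_sets W r (g ` V1))" unfolding good_sets_def using finite_ksets[OF W(1)] by simp
    show "(\<lambda>e. g ` e) ` edges S \<subseteq> good_sets W r (g ` V1)"
    proof (rule image_subsetI)
      fix e assume e: "e \<in> edges S"
      have "g ` e \<inter> g ` V1 = g ` (e \<inter> V1)" by (rule inj_on_image_Int[OF inj fS(2)[OF e] V1, symmetric])
      moreover have "card (g ` (e \<inter> V1)) = card (e \<inter> V1)"
        by (rule card_image[OF inj_on_subset[OF inj]]) (use V1 in auto)
      moreover have "card (g ` e) = card e" by (rule card_image[OF inj_on_subset[OF inj fS(2)[OF e]]])
      moreover have "g ` e \<subseteq> W" using fS(2)[OF e] im by auto
      ultimately show "g ` e \<in> good_sets W r (g ` V1)" unfolding good_sets_def ksets_def using p(2)[OF e] fS(3)[OF e] by simp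
    qed
  qed
  finally show ?thesis using that[of "g ` V1"] V1 im by auto
qed

section \<open>Isomorphism types and the join\<close>

lemma hiso_sym:
  assumes "hiso G H" "\<And>e. e \<in> edges G \<Longrightarrow> e \<subseteq> verts G"
  shows "hiso H G"
proof -
  obtain f where f: "bij_betw f (verts G) (verts H)" "edges H = (\<lambda>e. f ` e) ` edges G"
    using assms(1) unfolding hiso_def by (elim exE conjE)
  have inj: "inj_on f (verts G)" using f(1) by (rule bij_betw_imp_inj_on)
  have "inv_into (verts G) f ` f ` e = e" if "e \<in> edges G" for e
    by (rule inv_into_image_cancel[OF inj assms(2)[OF that]])
  then have "edges G = (\<lambda>e. inv_into (verts G) f ` e) ` edges H" unfolding f(2) image_image by simp
  then show ?thesis unfolding hiso_def using bij_betw_inv_into[OF f(1)] by (intro exI[of _ "inv_into (verts G) f"] conjI)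
qed

lemma hiso_trans: "hiso G H \<Longrightarrow> hiso H K \<Longrightarrow> hiso G K"
proof -
  assume GH: "hiso G H" and HK: "hiso H K"
  obtain f where f: "bij_betw f (verts G) (verts H)" "edges H = (\<lambda>e. f ` e) ` edges G"
    using GH unfolding hiso_def by (elim exE conjE)
  obtain g where g: "bij_betw g (verts H) (verts K)" "edges K = (\<lambda>e. g ` e) ` edges H"
    using HK unfolding hiso_def by (elim exE conjE)
  have "bij_betw (g \<circ> f) (verts G) (verts K)" by (rule bij_betw_trans[OF f(1) g(1)])
  moreover have "edges K = (\<lambda>e. (g \<circ> f) ` e) ` edges G" unfolding g(2) f(2) image_image by (simp add: image_comp)
  ultimately show ?thesis unfolding hiso_def by (intro exI[of _ "g \<circ> f"] conjI)
qed

lemma iso_class_eq: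
  assumes "hiso G H" "\<And>e. e \<in> edges G \<Longrightarrow> e \<subseteq> verts G"
  shows "iso_class H = iso_class G"
  unfolding iso_class_def using hiso_trans[OF assms(1)] hiso_trans[OF hiso_sym[OF assms]] by blast

lemma image_ksets_meeting:
  assumes f: "bij_betw f X V" and A: "A \<subseteq> X"
  shows "(\<lambda>e. f ` e) ` {e. e \<subseteq> X \<and> card e = r \<and> e \<inter> A \<noteq> {}} = {e. e \<subseteq> V \<and> card e = r \<and> e \<inter> f ` A \<noteq> {}}"
proof
  have inj: "inj_on f X" and im: "f ` X = V" using f unfolding bij_betw_def by auto
  have ci: "card (f ` e) = card e" if "e \<subseteq> X" for e by (rule card_image[OF inj_on_subset[OF inj that]])
  show "(\<lambda>e. f ` e) ` {e. e \<subseteq> X \<and> card e = r \<and> e \<inter> A \<noteq> {}} \<subseteq> {e. e \<subseteq> V \<and> card e = r \<and> e \<inter> f ` A \<noteq> {}}"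
    using ci im by auto
  show "{e. e \<subseteq> V \<and> card e = r \<and> e \<inter> f ` A \<noteq> {}} \<subseteq> (\<lambda>e. f ` e) ` {e. e \<subseteq> X \<and> card e = r \<and> e \<inter> A \<noteq> {}}"
  proof
    fix e assume "e \<in> {e. e \<subseteq> V \<and> card e = r \<and> e \<inter> f ` A \<noteq> {}}"
    then have e: "e \<subseteq> V" "card e = r" "e \<inter> f ` A \<noteq> {}" by auto
    define d where "d = {x \<in> X. f x \<in> e}"
    have d: "f ` d = e" "d \<subseteq> X" using e(1) im unfolding d_def by auto
    moreover have "card d = r" using ci[OF d(2)] d(1) e(2) by simp
    moreover have "d \<inter> A \<noteq> {}" using e(3) A unfolding d_def by auto
    ultimately show "e \<in> (\<lambda>e. f ` e) ` {e. e \<subseteq> X \<and> card e = r \<and> e \<inter> A \<noteq> {}}"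
      by (intro image_eqI[of _ _ d]) auto
  qed
qed

text \<open>The complete part is mapped onto \<open>T\<close> by an enumeration and the other part
  by the identity. On the left-hand side the edges of the complete part and the mixed sets together
  are all \<open>r\<close>-sets meeting \<open>A\<close>.\<close>

lemma hjoin_complete:
  assumes r: "0 < r" and V: "finite (V :: 'a set)" and T: "T \<subseteq> V" "card T = t"
  shows "hiso (hjoin r (complete_hgraph r t) (HGraph (V - T) (good_sets (V - T) r U))) (HGraph V (join_sets V r T U))"
proof -
  have fT: "finite T" using T V finite_subset by blast
  obtain \<tau> where t: "bij_betw \<tau> {0..<t} T" using ex_bij_betw_nat_finite[OF fT] T(2) by auto
  define f where "f = case_sum \<tau> (\<lambda>v. v)"
  define A :: "(nat + 'a) set" where "A = Inl ` {0..<t}"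
  define B :: "(nat + 'a) set" where "B = Inr ` (V - T)"
  have fA: "f ` A = T" using bij_betw_imp_surj_on[OF t] unfolding f_def A_def by (simp add: image_image)
  have fB: "f ` B = V - T" unfolding f_def B_def by (simp add: image_image)
  have "inj_on f A" using bij_betw_imp_inj_on[OF t] unfolding f_def A_def by (auto simp: inj_on_def)
  moreover have "inj_on f B" unfolding f_def B_def by (auto simp: inj_on_def)
  moreover have "f ` (A - B) \<inter> f ` (B - A) = {}" using fA fB by blast
  ultimately have inj: "inj_on f (A \<union> B)" unfolding inj_on_Un by simp
  have im: "f ` (A \<union> B) = V" using fA fB T(1) by (auto simp: image_Un)
  have bij: "bij_betw f (A \<union> B) V" unfolding bij_betw_def using inj im by simp
  define J where "J = hjoin r (complete_hgraph r t) (HGraph (V - T) (good_sets (V - T) r U))"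
  have vJ: "verts J = A \<union> B" unfolding J_def hjoin_def complete_hgraph_def A_def B_def by (simp add: Let_def)
  have eJ: "edges J = {e. e \<subseteq> A \<union> B \<and> card e = r \<and> e \<inter> A \<noteq> {}} \<union> (\<lambda>e. Inr ` e) ` good_sets (V - T) r U"
  proof -
    have "(\<lambda>e. Inl ` e) ` {e. e \<subseteq> {0..<t} \<and> card e = r} = {e. e \<subseteq> A \<and> card e = r}"
    proof
      show "(\<lambda>e. Inl ` e) ` {e. e \<subseteq> {0..<t} \<and> card e = r} \<subseteq> {e. e \<subseteq> A \<and> card e = r}"
        unfolding A_def by (auto simp: card_image)
      show "{e. e \<subseteq> A \<and> card e = r} \<subseteq> (\<lambda>e. Inl ` e) ` {e. e \<subseteq> {0..<t} \<and> card e = r}"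
      proof
        fix e assume "e \<in> {e. e \<subseteq> A \<and> card e = r}"
        then have e: "e \<subseteq> Inl ` {0..<t}" "card e = r" unfolding A_def by auto
        then obtain d where d: "d \<subseteq> {0..<t}" "e = Inl ` d" by (meson subset_imageE)
        then have "card d = r" using e(2) by (simp add: card_image)
        then show "e \<in> (\<lambda>e. Inl ` e) ` {e. e \<subseteq> {0..<t} \<and> card e = r}" using d by blast
      qed
    qed
    \<comment> \<open>Nonemptiness lets the edges inside \<open>A\<close> be described as sets
      meeting \<open>A\<close>, which merges them with the mixed sets.\<close>
    moreover have "e \<noteq> {}" if "card e = r" for e :: "(nat + 'a) set" using that r by auto
    then have "{e. e \<subseteq> A \<and> card e = r} \<union> {e. e \<subseteq> A \<union> B \<and> card e = r \<and> e \<inter> A \<noteq> {} \<and> e \<inter> B \<noteq> {}}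
       = {e. e \<subseteq> A \<union> B \<and> card e = r \<and> e \<inter> A \<noteq> {}}" by blast
    ultimately show ?thesis
      unfolding J_def hjoin_def complete_hgraph_def A_def[symmetric] B_def[symmetric] Let_def
      by (simp add: A_def[symmetric] B_def[symmetric] Un_ac)
  qed
  have "(\<lambda>e. f ` e) ` edges J = {e. e \<subseteq> V \<and> card e = r \<and> e \<inter> T \<noteq> {}} \<union> good_sets (V - T) r U"
  proof -
    have "(\<lambda>e. f ` e) ` {e. e \<subseteq> A \<union> B \<and> card e = r \<and> e \<inter> A \<noteq> {}} = {e. e \<subseteq> V \<and> card e = r \<and> e \<inter> T \<noteq> {}}"
      using image_ksets_meeting[OF bij, of A r] unfolding fA by simp
    moreover have "(\<lambda>e. f ` e) ` (\<lambda>e. Inr ` e) ` good_sets (V - T) r U = good_sets (V - T) r U"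
      unfolding image_image f_def by simp
    ultimately show ?thesis unfolding eJ image_Un by simp
  qed
  also have "\<dots> = join_sets V r T U" unfolding join_sets_def good_sets_def ksets_def by auto
  finally have "edges (HGraph V (join_sets V r T U)) = (\<lambda>e. f ` e) ` edges J" by simp
  moreover have "bij_betw f (verts J) (verts (HGraph V (join_sets V r T U)))" using bij vJ by simp
  ultimately show ?thesis unfolding hiso_def J_def[symmetric] by (intro exI[of _ f] conjI)
qed

lemma hjoin_edges_subset:
  assumes "\<And>e. e \<in> edges H \<Longrightarrow> e \<subseteq> verts H" "e \<in> edges (hjoin r (complete_hgraph r t) H)"
  shows "e \<subseteq> verts (hjoin r (complete_hgraph r t) H)"
  using assms unfolding hjoin_def complete_hgraph_def Let_def by auto

text \<open>Taking \<open>c\<close> at most 1 ensures \<open>t \<le> n\<close>. Since the size of a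
  join depends only on its semibipartite part, extremality passes between the two sides; the
  inclusion from right to left needs in addition that some extremal hypergraph exists.\<close>

theorem theorem2p9:
  fixes r :: nat
  assumes "r \<ge> 4"
  shows "\<exists>(N0::nat) (c::real). c > 0 \<and>
    (\<forall>n::nat. \<forall>t::nat. n \<ge> N0 \<longrightarrow> real t \<le> c * real n \<longrightarrow>
      extremal_classes r n (t + 1) (expansion r (matching2 r)) =
        {iso_class (hjoin r (complete_hgraph r t) S) | S. max_semibipartite r (n - t) S})"
proof -
  have r2: "2 \<le> r" and r0: "0 < r" using assms by auto
  show ?thesis
  proof (rule extremal_structure[OF assms, where 'a = nat])
  fix N0 :: nat and c0 :: real
  assume c0: "0 < c0" and str: "\<And>(V :: nat set) E t. finite V \<Longrightarrow> N0 \<le> card V \<Longrightarrow> E \<subseteq> ksets V r \<Longrightarrow>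
    real t \<le> c0 * real (card V) \<Longrightarrow> (\<And>\<W>. packs r V E \<W> \<Longrightarrow> card \<W> \<le> t) \<Longrightarrow>
    (\<And>T U. T \<subseteq> V \<Longrightarrow> card T = t \<Longrightarrow> U \<subseteq> V \<Longrightarrow> card (join_sets V r T U) \<le> card E) \<Longrightarrow>
    \<exists>T\<subseteq>V. \<exists>U\<subseteq>V. card T = t \<and> E = join_sets V r T U"
  define c where "c = min c0 1"
  have c: "0 < c" "c \<le> c0" "c \<le> 1" unfolding c_def using c0 by auto
  show ?thesis
  proof (intro exI[of _ N0] exI[of _ c] conjI allI impI)
    show "0 < c" by (rule c(1))
    fix n t :: nat assume n: "N0 \<le> n" and t: "real t \<le> c * real n"
    have tn: "t \<le> n"
    proof -
      have "c * real n \<le> 1 * real n" using c by (intro mult_right_mono) auto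
      then show ?thesis using t by simp
    qed
    have tc0: "real t \<le> c0 * real n"
    proof -
      have "c * real n \<le> c0 * real n" using c by (intro mult_right_mono) auto
      then show ?thesis using t by linarith
    qed
    define P where "P G \<longleftrightarrow> rgraph r G \<and> card (verts G) = n \<and> \<not> has_disjoint_copies (t + 1) (expansion r (matching2 r)) G" for G :: "nat hgraph"
    have PJ: "P (HGraph V (join_sets V r T U))" if "finite V" "card V = n" "T \<subseteq> V" "card T = t" for V T U
      unfolding P_def no_disjoint_copies_iff[OF r2]
      using that packs_join_sets[OF r2 that(1,3), of U] by (auto simp: rgraph_def join_sets_def ksets_def)
    have sizes: "card (join_sets V r T U) + (n - t choose r) = (n choose r) + card (good_sets (V - T) r U)"
      if "finite V" "card V = n" "T \<subseteq> V" "card T = t" for V T U :: "nat set"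
      using card_join_sets[OF that(1,3), of r U] that by simp
    have main: "\<exists>T\<subseteq>verts G. card T = t \<and> (\<exists>U. edges G = join_sets (verts G) r T U)"
      if G: "P G" "\<And>H. P H \<Longrightarrow> card (edges H) \<le> card (edges G)" for G
    proof -
      have g: "finite (verts G)" "card (verts G) = n" "edges G \<subseteq> ksets (verts G) r"
        using G(1) unfolding P_def rgraph_def ksets_def by auto
      have pk: "card \<W> \<le> t" if "packs r (verts G) (edges G) \<W>" for \<W>
        using G(1) that unfolding P_def no_disjoint_copies_iff[OF r2] by blast
      have mx: "card (join_sets (verts G) r T U) \<le> card (edges G)" if "T \<subseteq> verts G" "card T = t" "U \<subseteq> verts G" for T U
        using G(2)[OF PJ[OF g(1,2) that(1,2), of U]] by simp
      have "N0 \<le> card (verts G)" "real t \<le> c0 * real (card (verts G))" using n tc0 g(2) by auto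
      from str[OF g(1) this(1) g(3) this(2) pk mx] show ?thesis by blast
    qed
    show "extremal_classes r n (t + 1) (expansion r (matching2 r)) =
        {iso_class (hjoin r (complete_hgraph r t) S) | S. max_semibipartite r (n - t) S}" (is "?L = ?R")
    proof
      show "?L \<subseteq> ?R"
      proof
        fix I assume "I \<in> ?L"
        then obtain G where G: "I = iso_class G" "P G" "\<And>H. P H \<Longrightarrow> card (edges H) \<le> card (edges G)"
          unfolding extremal_classes_def is_arg_max_def P_def by (auto simp: not_less)
        define V where "V = verts G"
        have V: "finite V" "card V = n" using G(2) unfolding P_def rgraph_def V_def by auto
        obtain T U where T: "T \<subseteq> V" "card T = t" and E: "edges G = join_sets V r T U"
          using main[OF G(2,3)] unfolding V_def by blast
        have fT: "finite T" using T V finite_subset by blast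
        define W where "W = V - T"
        have W: "finite W" "card W = n - t" unfolding W_def using V T fT by (auto simp: card_Diff_subset)
        define S where "S = HGraph W (good_sets W r U)"
        have S: "rgraph r S" "semibipartite S" "card (verts S) = n - t"
          unfolding S_def using semibipartite_good_sets[OF W(1), of r U] W(2) by auto
        have "card (edges S') \<le> card (edges S)" if S': "rgraph r S'" "card (verts S') = n - t" "semibipartite S'" for S' :: "nat hgraph"
        proof -
          obtain U' where U': "U' \<subseteq> W" "card (edges S') \<le> card (good_sets W r U')"
            by (rule semibipartite_transfer[OF S'(1,3) W(1)]) (use W(2) S'(2) in auto)
          have "card (join_sets V r T U') \<le> card (join_sets V r T U)"
            using G(3)[OF PJ[OF V T, of U']] E by simp
          then have "card (good_sets W r U') \<le> card (good_sets W r U)"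
            using sizes[OF V T, of U] sizes[OF V T, of U'] unfolding W_def by linarith
          then show ?thesis using U'(2) unfolding S_def by simp
        qed
        then have mS: "max_semibipartite r (n - t) S"
          unfolding max_semibipartite_def is_arg_max_def using S by (auto simp: not_less)
        have "G = HGraph V (join_sets V r T U)" using E unfolding V_def by (metis hgraph.collapse)
        then have "hiso (hjoin r (complete_hgraph r t) S) G"
          using hjoin_complete[OF r0 V(1) T, of U] unfolding S_def W_def by simp
        moreover have "e \<subseteq> verts S" if "e \<in> edges S" for e using that S(1) unfolding rgraph_def by simp
        then have "e \<subseteq> verts (hjoin r (complete_hgraph r t) S)" if "e \<in> edges (hjoin r (complete_hgraph r t) S)" for e
          by (rule hjoin_edges_subset[OF _ that])
        ultimately have "I = iso_class (hjoin r (complete_hgraph r t) S)" unfolding G(1) by (rule iso_class_eq)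
        then show "I \<in> ?R" using mS by blast
      qed
      show "?R \<subseteq> ?L"
      proof
        fix I assume "I \<in> ?R"
        then obtain S where I: "I = iso_class (hjoin r (complete_hgraph r t) S)" and mS: "max_semibipartite r (n - t) S" by blast
        have S: "rgraph r S" "card (verts S) = n - t" "semibipartite S"
          and Smax: "\<And>S' :: nat hgraph. rgraph r S' \<Longrightarrow> card (verts S') = n - t \<Longrightarrow> semibipartite S' \<Longrightarrow> card (edges S') \<le> card (edges S)"
          using mS unfolding max_semibipartite_def is_arg_max_def by (auto simp: not_less)
        define W where "W = verts S"
        have W: "finite W" "card W = n - t" using S(1,2) unfolding rgraph_def W_def by auto
        obtain U where U: "\<And>e. e \<in> edges S \<Longrightarrow> card (e \<inter> U) = 1" using S(3) unfolding semibipartite_def by blast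
        have sub: "edges S \<subseteq> good_sets W r U"
          using S(1) U unfolding good_sets_def ksets_def rgraph_def W_def by auto
        have fg: "finite (good_sets W r U)" unfolding good_sets_def using finite_ksets[OF W(1)] by simp
        have "card (good_sets W r U) \<le> card (edges S)"
          using Smax[of "HGraph W (good_sets W r U)"] semibipartite_good_sets[OF W(1), of r U] W(2) by simp
        then have Se: "edges S = good_sets W r U" by (intro card_subset_eq[OF fg sub] antisym card_mono[OF fg sub])
        have Sg: "S = HGraph W (good_sets W r U)" using Se unfolding W_def by (metis hgraph.collapse)
        obtain T where T: "finite T" "card T = t" "T \<inter> W = {}"
        proof -
          have "infinite (- W)" using W(1) by (simp add: finite_compl infinite_UNIV_nat)
          then obtain T where "T \<subseteq> - W" "finite T" "card T = t" using infinite_arbitrarily_large by blast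
          then show ?thesis using that[of T] by blast
        qed
        define V where "V = W \<union> T"
        have V: "finite V" "card V = n" "T \<subseteq> V" "V - T = W"
          unfolding V_def using W T tn card_Un_disjoint[of W T] by (auto simp: Int_commute)
        define G where "G = HGraph V (join_sets V r T U)"
        have PG: "P G" unfolding G_def by (rule PJ[OF V(1,2,3) T(2)])
        have bnd: "card (edges H) \<le> n choose r" if "P H" for H
        proof -
          have h: "finite (verts H)" "card (verts H) = n" "edges H \<subseteq> ksets (verts H) r"
            using that unfolding P_def rgraph_def ksets_def by auto
          then show ?thesis using card_mono[OF finite_ksets[OF h(1)] h(3)] card_ksets[OF h(1), of r] by simp
        qed
        \<comment> \<open>A maximiser exists because edge counts are at most
          \<open>n choose r\<close>. Its structure is that of a join, whose semibipartite part
          cannot exceed \<open>S\<close>, so \<open>G\<close> is extremal as well.\<close>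
        have "\<exists>H. P H \<and> (\<forall>K. P K \<longrightarrow> card (edges K) \<le> card (edges H))"
          by (rule ex_has_greatest_nat[of P G _ "Suc (n choose r)"]) (intro PG allI impI le_imp_less_Suc bnd; assumption)+
        then obtain H where H0: "P H" "\<forall>K. P K \<longrightarrow> card (edges K) \<le> card (edges H)" by (elim exE conjE)
        note H = H0(1) H0(2)[rule_format]
        have h: "finite (verts H)" "card (verts H) = n" using H(1) unfolding P_def rgraph_def by auto
        obtain T' U' where T': "T' \<subseteq> verts H" "card T' = t" and E': "edges H = join_sets (verts H) r T' U'"
          using main[OF H] by blast
        have fT': "finite T'" using T' h finite_subset by blast
        have "card (good_sets (verts H - T') r U') \<le> card (edges S)"
          using Smax[of "HGraph (verts H - T') (good_sets (verts H - T') r U')"]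
            semibipartite_good_sets[of "verts H - T'" r U'] h T' fT' by (simp add: card_Diff_subset)
        then have "card (edges H) \<le> card (edges G)"
          using sizes[OF h T', of U'] sizes[OF V(1,2,3) T(2), of U] V(4) unfolding E' G_def Se by simp
        then have "card (edges K) \<le> card (edges G)" if "P K" for K using H(2)[OF that] by simp
        then have "iso_class G \<in> ?L"
          unfolding extremal_classes_def is_arg_max_def using PG unfolding P_def by (auto simp: not_less)
        moreover have "hiso (hjoin r (complete_hgraph r t) S) G"
          using hjoin_complete[OF r0 V(1,3) T(2), of U] unfolding V(4) Sg[symmetric] G_def .
        moreover have "e \<subseteq> verts S" if "e \<in> edges S" for e using that S(1) unfolding rgraph_def by simp
        then have "e \<subseteq> verts (hjoin r (complete_hgraph r t) S)" if "e \<in> edges (hjoin r (complete_hgraph r t) S)" for e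
          by (rule hjoin_edges_subset[OF _ that])
        ultimately show "I \<in> ?L" unfolding I using iso_class_eq by metis
      qed
    qed
  qed
  qed
qed

end
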